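(* Let $H$ and $K$ be groupoids, let $p_{\mathscr B}\colon\mathscr B\to H$ and $p_{\mathscr C}\colon\mathscr C\to K$ be Fell bundles, let $T$ be an $(H,K)$-equivalence with open moment maps $\rho\colon T\to H^{(0)}$ and $\sigma\colon T\to K^{(0)}$, and let $q_{\mathscr E}\colon\mathscr E\to T$ be a Fell-bundle equivalence between $\mathscr B$ and $\mathscr C$. Then there are lattice isomorphisms (for the inclusion orders) among the ideals of $\mathscr B$, the full Banach $\mathscr B$–$\mathscr C$-submodules of $\mathscr E$, and the ideals of $\mathscr C$. The correspondences are given as follows. (a) If $\mathscr J$ is an ideal in $\mathscr C$, then the corresponding full Banach $\mathscr B$–$\mathscr C$-submodule is $$\mathscr E\cdot\mathscr J=\bigcup_{t\in T}E_t\cdot J_{\sigma(t)}.$$ (b) If $\mathscr M$ is a full Banach $\mathscr B$–$\mathscr C$-submodule, then for each $t\in T$, $M_t$ is an $L_{\rho(t)}$–$R_{\sigma(t)}$-imprimitivity bimodule for ideals $L_{\rho(t)}=\overline{{}_{\mathscr B}\langle M_t,E_t\rangle}$ in $B_{\rho(t)}$ and $R_{\sigma(t)}=\overline{\langle E_t,M_t\rangle_{\mathscr C}}$ in $C_{\sigma(t)}$ (depending only on $\rho(t)$ and $\sigma(t)$ respectively). The corresponding ideals $\mathscr J_{\mathscr M}$ in $\mathscr C$ and $\mathscr K^{\mathscr M}$ in $\mathscr B$ are given by $$\mathscr J_{\mathscr M}=\bigcup_{k\in K}R_{r(k)}\cdot C_k\quad\text{and}\quad \mathscr K^{\mathscr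 M}=\bigcup_{h\in H}L_{r(h)}\cdot B_h.$$ (c) If $\mathscr K$ is an ideal in $\mathscr B$, then the corresponding full Banach $\mathscr B$–$\mathscr C$-submodule is $$\mathscr K\cdot\mathscr E=\bigcup_{t\in T}K_{\rho(t)}\cdot E_t.$$
   Context: **Conventions.** Locally compact means locally compact Hausdorff; all groupoids are second countable, locally compact and Hausdorff, with unit space $G^{(0)}$, range map $r$, source map $s$. Ideals in $C^*$-algebras are two-sided and norm closed. Products and inner products of sets denote linear spans: $S\cdot Y=\operatorname{span}\{a\cdot x: a\in S, x\in Y\}$ and $\langle Y_1,Y_2\rangle=\operatorname{span}\{\langle x,y\rangle: x\in Y_1,y\in Y_2\}$. (If $X$ is a right Hilbert $B$-module and $J$ an ideal of $B$, then $X\cdot J=\{x\cdot b:x\in X,b\in J\}$ is already closed; similarly on the left.) Closures of subsets of fibres are in the fibre norm. **Banach bundles.** A Banach bundle over a topological space $X$ is a topological space $\mathscr B$ with a continuous open surjection $p\colon\mathscr B\to X$ and complex Banach space structures on the fibres $B_x=p^{-1}(\{x\})$ such that: (B1) $b\mapsto\|b\|$ is upper semicontinuous; (B2) addition is continuous on $\{(a,b):p(a)=p(b)\}$; (B3) $(\lambda,b)\mapsto\lambda b$ is continuous on $\mathbf C\times\mathscr B$; (B4) if $p(b_i)\to x$ and $\|b_i\|\to0$ then $b_i\to0_x$. A Banach subbundle $\mathscr D\subset\mathscr B$ is a subset whose fibres $D_x=\mathscr D\cap B_x$ are closed subspaces of $B_x$ and such that $p|_{\mathscr D}\colon\mathscr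 D\to X$ is a Banach bundle with the relative topology. **Fell bundles.** A Fell bundle over a groupoid $G$ is a Banach bundle $p\colon\mathscr B\to G$ with a continuous, bilinear, associative multiplication $(a,b)\mapsto ab$ from $\mathscr B^{(2)}=\{(a,b):(p(a),p(b))\in G^{(2)}\}$ to $\mathscr B$ and a continuous involution $b\mapsto b^*$ such that $p(ab)=p(a)p(b)$, $p(a^* )=p(a)^{-1}$, $(ab)^*=b^*a^*$, each $B_u$ ($u\in G^{(0)}$) is a $C^*$-algebra in the inherited operations, and each $B_g$ is a $B_{r(g)}$–$B_{s(g)}$-imprimitivity bimodule with the inherited actions and inner products ${}_{B_{r(g)}}\langle a,b\rangle=ab^*$, $\langle a,b\rangle_{B_{s(g)}}=a^*b$. A Fell subbundle is a Banach subbundle that is a Fell bundle in the inherited operations. An ideal $\mathscr J$ of $\mathscr B$ is a Fell subbundle such that $ab\in\mathscr J$ whenever $(a,b)\in\mathscr B^{(2)}$ and $a\in\mathscr J$ or $b\in\mathscr J$. Its fibres are $J_g=\mathscr J\cap B_g$. **Groupoid equivalences.** An $(H,K)$-equivalence $T$ is a locally compact Hausdorff space that is a free and proper left $H$-space and a free and proper right $K$-space, with commuting actions and open moment maps $\rho\colon T\to H^{(0)}$, $\sigma\colon T\to K^{(0)}$ inducing homeomorphisms $T/K\cong H^{(0)}$ and $H\backslash T\cong K^{(0)}$. There are continuous maps $\tau_H\colon T*_\sigma T\to H$ and $\tau_K\colon T*_\rho T\to K$ with $\tau_H(t,t')\cdot t'=t$ and $t\cdot\tau_K(t,t')=t'$.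 **Actions and Fell-bundle equivalences.** A Fell bundle $p\colon\mathscr B\to H$ acts on the left of a Banach bundle $q\colon\mathscr E\to T$ if there is a continuous map $(b,e)\mapsto b\cdot e$ from $\{(b,e): s(p(b))=\rho(q(e))\}$ to $\mathscr E$ with $q(b\cdot e)=p(b)\cdot q(e)$, $a\cdot(b\cdot e)=(ab)\cdot e$, and $\|b\cdot e\|\le\|b\|\|e\|$; right actions are similar. For Fell bundles $p_{\mathscr B}\colon\mathscr B\to H$, $p_{\mathscr C}\colon\mathscr C\to K$ and an $(H,K)$-equivalence $T$, a Banach bundle $q_{\mathscr E}\colon\mathscr E\to T$ is an equivalence between $\mathscr B$ and $\mathscr C$ if: (E1) there are a left $\mathscr B$-action and a right $\mathscr C$-action on $\mathscr E$ with $b\cdot(e\cdot c)=(b\cdot e)\cdot c$; (E2) there are continuous sesquilinear maps ${}_{\mathscr B}\langle\cdot,\cdot\rangle\colon\mathscr E*_\sigma\mathscr E\to\mathscr B$ and $\langle\cdot,\cdot\rangle_{\mathscr C}\colon\mathscr E*_\rho\mathscr E\to\mathscr C$ (defined on pairs whose base points have equal $\sigma$, resp. $\rho$) with (i) $p_{\mathscr B}({}_{\mathscr B}\langle e,f\rangle)=\tau_H(q(e),q(f))$, $p_{\mathscr C}(\langle e,f\rangle_{\mathscr C})=\tau_K(q(e),q(f))$; (ii) ${}_{\mathscr B}\langle e,f\rangle^*={}_{\mathscr B}\langle f,e\rangle$, $\langle e,f\rangle_{\mathscr C}^*=\langle f,e\rangle_{\mathscr C}$; (iii) ${}_{\mathscr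 B}\langle b\cdot e,f\rangle=b\,{}_{\mathscr B}\langle e,f\rangle$, $\langle e,f\cdot c\rangle_{\mathscr C}=\langle e,f\rangle_{\mathscr C}c$; (iv) ${}_{\mathscr B}\langle e,f\rangle\cdot g=e\cdot\langle f,g\rangle_{\mathscr C}$; (E3) with these actions and inner products each fibre $E_t$ is a $B_{\rho(t)}$–$C_{\sigma(t)}$-imprimitivity bimodule. **Submodules.** A Banach $\mathscr B$–$\mathscr C$-submodule of $\mathscr E$ is a Banach subbundle $\mathscr M$ of $\mathscr E$ with $B_h\cdot M_t\subset M_{h\cdot t}$ whenever $s(h)=\rho(t)$ and $M_t\cdot C_k\subset M_{t\cdot k}$ whenever $\sigma(t)=r(k)$. It is full if $\overline{B_h\cdot M_t}=M_{h\cdot t}$ and $\overline{M_t\cdot C_k}=M_{t\cdot k}$ for all such $h,t,k$. **Products with ideals.** For an ideal $\mathscr J$ of $\mathscr C$, $\mathscr E\cdot\mathscr J:=\bigcup_{\sigma(t)=r(k)}E_t\cdot J_k$; for an ideal $\mathscr K$ of $\mathscr B$, $\mathscr K\cdot\mathscr E:=\bigcup_{s(h)=\rho(t)}K_h\cdot E_t$. *)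

theory Defs
  imports "HOL-Analysis.Analysis" "HOL-Algebra.Lattice"
begin

section \<open>Complex Banach spaces and \<open>C\<^sup>*\<close>-algebras on carrier sets\<close>

record 'a cnspace = "'a partial_object" +
  vadd :: "'a \<Rightarrow> 'a \<Rightarrow> 'a"
  vzero :: 'a
  vscale :: "complex \<Rightarrow> 'a \<Rightarrow> 'a"
  vnorm :: "'a \<Rightarrow> real"

text \<open>The value outside the carrier is set to \<open>0\<close> because \<^locale>\<open>Metric_space\<close> asks for
  nonnegativity and symmetry on the whole type.\<close>

definition vdist :: "('a, 'z) cnspace_scheme \<Rightarrow> 'a \<Rightarrow> 'a \<Rightarrow> real" where
  "vdist V x y = (if x \<in> carrier V \<and> y \<in> carrier V
     then vnorm V (vadd V x (vscale V (-1) y)) else 0)"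

definition nclosure :: "('a, 'z) cnspace_scheme \<Rightarrow> 'a set \<Rightarrow> 'a set" where
  "nclosure V S = Metric_space.mtopology (carrier V) (vdist V) closure_of S"

definition csubspace :: "('a, 'z) cnspace_scheme \<Rightarrow> 'a set \<Rightarrow> bool" where
  "csubspace V W \<longleftrightarrow> W \<subseteq> carrier V \<and> vzero V \<in> W \<and>
     (\<forall>x\<in>W. \<forall>y\<in>W. vadd V x y \<in> W) \<and> (\<forall>c. \<forall>x\<in>W. vscale V c x \<in> W)"

definition cspan :: "('a, 'z) cnspace_scheme \<Rightarrow> 'a set \<Rightarrow> 'a set" where
  "cspan V S = csubspace V hull S"

text \<open>The set products \<open>S \<cdot> Y\<close> and inner products \<open>\<langle>Y\<^sub>1, Y\<^sub>2\<rangle>\<close>: the linear span, inside \<open>V\<close>, of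
  the values of the pairing \<open>m\<close>.\<close>

definition prod_span ::
  "('v, 'z) cnspace_scheme \<Rightarrow> ('a \<Rightarrow> 'b \<Rightarrow> 'v) \<Rightarrow> 'a set \<Rightarrow> 'b set \<Rightarrow> 'v set" where
  "prod_span V m S Y = cspan V {m a x | a x. a \<in> S \<and> x \<in> Y}"

locale complex_banach_space =
  fixes V :: "('a, 'z) cnspace_scheme"
  assumes vadd_closed: "\<lbrakk>x \<in> carrier V; y \<in> carrier V\<rbrakk> \<Longrightarrow> vadd V x y \<in> carrier V"
    and vzero_closed: "vzero V \<in> carrier V"
    and vscale_closed: "x \<in> carrier V \<Longrightarrow> vscale V c x \<in> carrier V"
    and vadd_assoc: "\<lbrakk>x \<in> carrier V; y \<in> carrier V; z \<in> carrier V\<rbrakk>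
      \<Longrightarrow> vadd V (vadd V x y) z = vadd V x (vadd V y z)"
    and vadd_commute: "\<lbrakk>x \<in> carrier V; y \<in> carrier V\<rbrakk> \<Longrightarrow> vadd V x y = vadd V y x"
    and vadd_zero: "x \<in> carrier V \<Longrightarrow> vadd V x (vzero V) = x"
    and vadd_inverse: "x \<in> carrier V \<Longrightarrow> vadd V x (vscale V (-1) x) = vzero V"
    and vscale_one: "x \<in> carrier V \<Longrightarrow> vscale V 1 x = x"
    and vscale_vscale: "x \<in> carrier V \<Longrightarrow> vscale V c (vscale V d x) = vscale V (c * d) x"
    and vscale_add_left: "x \<in> carrier V
      \<Longrightarrow> vscale V (c + d) x = vadd V (vscale V c x) (vscale V d x)"
    and vscale_add_right: "\<lbrakk>x \<in> carrier V; y \<in> carrier V\<rbrakk>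
      \<Longrightarrow> vscale V c (vadd V x y) = vadd V (vscale V c x) (vscale V c y)"
    and vnorm_nonneg: "x \<in> carrier V \<Longrightarrow> 0 \<le> vnorm V x"
    and vnorm_eq_zero: "x \<in> carrier V \<Longrightarrow> vnorm V x = 0 \<longleftrightarrow> x = vzero V"
    and vnorm_triangle: "\<lbrakk>x \<in> carrier V; y \<in> carrier V\<rbrakk>
      \<Longrightarrow> vnorm V (vadd V x y) \<le> vnorm V x + vnorm V y"
    and vnorm_scale: "x \<in> carrier V \<Longrightarrow> vnorm V (vscale V c x) = cmod c * vnorm V x"
    and complete: "Metric_space.mcomplete (carrier V) (vdist V)"

record 'a cstar = "'a cnspace" +
  amul :: "'a \<Rightarrow> 'a \<Rightarrow> 'a"
  astar :: "'a \<Rightarrow> 'a"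

locale cstar_algebra =
  fixes A :: "('a, 'z) cstar_scheme"
  assumes banach: "complex_banach_space A"
    and amul_closed: "\<lbrakk>a \<in> carrier A; b \<in> carrier A\<rbrakk> \<Longrightarrow> amul A a b \<in> carrier A"
    and amul_assoc: "\<lbrakk>a \<in> carrier A; b \<in> carrier A; c \<in> carrier A\<rbrakk>
      \<Longrightarrow> amul A (amul A a b) c = amul A a (amul A b c)"
    and amul_add_left: "\<lbrakk>a \<in> carrier A; b \<in> carrier A; c \<in> carrier A\<rbrakk>
      \<Longrightarrow> amul A (vadd A a b) c = vadd A (amul A a c) (amul A b c)"
    and amul_add_right: "\<lbrakk>a \<in> carrier A; b \<in> carrier A; c \<in> carrier A\<rbrakk>
      \<Longrightarrow> amul A a (vadd A b c) = vadd A (amul A a b) (amul A a c)"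
    and amul_scale_left: "\<lbrakk>a \<in> carrier A; b \<in> carrier A\<rbrakk>
      \<Longrightarrow> amul A (vscale A l a) b = vscale A l (amul A a b)"
    and amul_scale_right: "\<lbrakk>a \<in> carrier A; b \<in> carrier A\<rbrakk>
      \<Longrightarrow> amul A a (vscale A l b) = vscale A l (amul A a b)"
    and norm_amul_le: "\<lbrakk>a \<in> carrier A; b \<in> carrier A\<rbrakk>
      \<Longrightarrow> vnorm A (amul A a b) \<le> vnorm A a * vnorm A b"
    and astar_closed: "a \<in> carrier A \<Longrightarrow> astar A a \<in> carrier A"
    and astar_astar: "a \<in> carrier A \<Longrightarrow> astar A (astar A a) = a"
    and astar_add: "\<lbrakk>a \<in> carrier A; b \<in> carrier A\<rbrakk>
      \<Longrightarrow> astar A (vadd A a b) = vadd A (astar A a) (astar A b)"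
    and astar_scale: "a \<in> carrier A \<Longrightarrow> astar A (vscale A l a) = vscale A (cnj l) (astar A a)"
    and astar_amul: "\<lbrakk>a \<in> carrier A; b \<in> carrier A\<rbrakk>
      \<Longrightarrow> astar A (amul A a b) = amul A (astar A b) (astar A a)"
    and cstar_identity: "a \<in> carrier A \<Longrightarrow> vnorm A (amul A (astar A a) a) = (vnorm A a)\<^sup>2"

text \<open>Positive elements are those of the form \<open>c\<^sup>*c\<close>.\<close>

definition cpositive :: "('a, 'z) cstar_scheme \<Rightarrow> 'a \<Rightarrow> bool" where
  "cpositive A a \<longleftrightarrow> (\<exists>c\<in>carrier A. a = amul A (astar A c) c)"

definition cstar_ideal :: "('a, 'z) cstar_scheme \<Rightarrow> 'a set \<Rightarrow> bool" where
  "cstar_ideal A I \<longleftrightarrow> csubspace A I \<and> nclosure A I = I \<and>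
     (\<forall>a\<in>carrier A. \<forall>x\<in>I. amul A a x \<in> I \<and> amul A x a \<in> I)"

section \<open>Hilbert modules and imprimitivity bimodules\<close>

text \<open>A Hilbert module is a Banach space whose given norm is the one defined by the inner product,
  \<open>\<parallel>x\<parallel>\<^sup>2 = \<parallel>\<langle>x, x\<rangle>\<parallel>\<close>.\<close>

locale right_hilbert_module =
  fixes B :: "('b, 'y) cstar_scheme"
    and X :: "('x, 'z) cnspace_scheme"
    and act :: "'x \<Rightarrow> 'b \<Rightarrow> 'x"
    and ip :: "'x \<Rightarrow> 'x \<Rightarrow> 'b"
  assumes algebra: "cstar_algebra B"
    and banach: "complex_banach_space X"
    and act_closed: "\<lbrakk>x \<in> carrier X; b \<in> carrier B\<rbrakk> \<Longrightarrow> act x b \<in> carrier X"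
    and act_add_left: "\<lbrakk>x \<in> carrier X; y \<in> carrier X; b \<in> carrier B\<rbrakk>
      \<Longrightarrow> act (vadd X x y) b = vadd X (act x b) (act y b)"
    and act_add_right: "\<lbrakk>x \<in> carrier X; b \<in> carrier B; c \<in> carrier B\<rbrakk>
      \<Longrightarrow> act x (vadd B b c) = vadd X (act x b) (act x c)"
    and act_scale_left: "\<lbrakk>x \<in> carrier X; b \<in> carrier B\<rbrakk>
      \<Longrightarrow> act (vscale X l x) b = vscale X l (act x b)"
    and act_scale_right: "\<lbrakk>x \<in> carrier X; b \<in> carrier B\<rbrakk>
      \<Longrightarrow> act x (vscale B l b) = vscale X l (act x b)"
    and act_act: "\<lbrakk>x \<in> carrier X; b \<in> carrier B; c \<in> carrier B\<rbrakk>
      \<Longrightarrow> act (act x b) c = act x (amul B b c)"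
    and ip_closed: "\<lbrakk>x \<in> carrier X; y \<in> carrier X\<rbrakk> \<Longrightarrow> ip x y \<in> carrier B"
    and ip_add_right: "\<lbrakk>x \<in> carrier X; y \<in> carrier X; z \<in> carrier X\<rbrakk>
      \<Longrightarrow> ip x (vadd X y z) = vadd B (ip x y) (ip x z)"
    and ip_scale_right: "\<lbrakk>x \<in> carrier X; y \<in> carrier X\<rbrakk>
      \<Longrightarrow> ip x (vscale X l y) = vscale B l (ip x y)"
    and ip_act: "\<lbrakk>x \<in> carrier X; y \<in> carrier X; b \<in> carrier B\<rbrakk>
      \<Longrightarrow> ip x (act y b) = amul B (ip x y) b"
    and ip_star: "\<lbrakk>x \<in> carrier X; y \<in> carrier X\<rbrakk> \<Longrightarrow> astar B (ip x y) = ip y x"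
    and ip_positive: "x \<in> carrier X \<Longrightarrow> cpositive B (ip x x)"
    and ip_definite: "\<lbrakk>x \<in> carrier X; ip x x = vzero B\<rbrakk> \<Longrightarrow> x = vzero X"
    and ip_norm: "x \<in> carrier X \<Longrightarrow> (vnorm X x)\<^sup>2 = vnorm B (ip x x)"

locale left_hilbert_module =
  fixes A :: "('a, 'y) cstar_scheme"
    and X :: "('x, 'z) cnspace_scheme"
    and act :: "'a \<Rightarrow> 'x \<Rightarrow> 'x"
    and ip :: "'x \<Rightarrow> 'x \<Rightarrow> 'a"
  assumes algebra: "cstar_algebra A"
    and banach: "complex_banach_space X"
    and act_closed: "\<lbrakk>a \<in> carrier A; x \<in> carrier X\<rbrakk> \<Longrightarrow> act a x \<in> carrier X"
    and act_add_left: "\<lbrakk>a \<in> carrier A; b \<in> carrier A; x \<in> carrier X\<rbrakk>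
      \<Longrightarrow> act (vadd A a b) x = vadd X (act a x) (act b x)"
    and act_add_right: "\<lbrakk>a \<in> carrier A; x \<in> carrier X; y \<in> carrier X\<rbrakk>
      \<Longrightarrow> act a (vadd X x y) = vadd X (act a x) (act a y)"
    and act_scale_left: "\<lbrakk>a \<in> carrier A; x \<in> carrier X\<rbrakk>
      \<Longrightarrow> act (vscale A l a) x = vscale X l (act a x)"
    and act_scale_right: "\<lbrakk>a \<in> carrier A; x \<in> carrier X\<rbrakk>
      \<Longrightarrow> act a (vscale X l x) = vscale X l (act a x)"
    and act_act: "\<lbrakk>a \<in> carrier A; b \<in> carrier A; x \<in> carrier X\<rbrakk>
      \<Longrightarrow> act a (act b x) = act (amul A a b) x"
    and ip_closed: "\<lbrakk>x \<in> carrier X; y \<in> carrier X\<rbrakk> \<Longrightarrow> ip x y \<in> carrier A"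
    and ip_add_left: "\<lbrakk>x \<in> carrier X; y \<in> carrier X; z \<in> carrier X\<rbrakk>
      \<Longrightarrow> ip (vadd X x y) z = vadd A (ip x z) (ip y z)"
    and ip_scale_left: "\<lbrakk>x \<in> carrier X; y \<in> carrier X\<rbrakk>
      \<Longrightarrow> ip (vscale X l x) y = vscale A l (ip x y)"
    and ip_act: "\<lbrakk>a \<in> carrier A; x \<in> carrier X; y \<in> carrier X\<rbrakk>
      \<Longrightarrow> ip (act a x) y = amul A a (ip x y)"
    and ip_star: "\<lbrakk>x \<in> carrier X; y \<in> carrier X\<rbrakk> \<Longrightarrow> astar A (ip x y) = ip y x"
    and ip_positive: "x \<in> carrier X \<Longrightarrow> cpositive A (ip x x)"
    and ip_definite: "\<lbrakk>x \<in> carrier X; ip x x = vzero A\<rbrakk> \<Longrightarrow> x = vzero X"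
    and ip_norm: "x \<in> carrier X \<Longrightarrow> (vnorm X x)\<^sup>2 = vnorm A (ip x x)"

locale imprimitivity_bimodule =
  fixes A :: "('a, 'u) cstar_scheme"
    and B :: "('b, 'y) cstar_scheme"
    and X :: "('x, 'z) cnspace_scheme"
    and la :: "'a \<Rightarrow> 'x \<Rightarrow> 'x"
    and ra :: "'x \<Rightarrow> 'b \<Rightarrow> 'x"
    and li :: "'x \<Rightarrow> 'x \<Rightarrow> 'a"
    and ri :: "'x \<Rightarrow> 'x \<Rightarrow> 'b"
  assumes left_module: "left_hilbert_module A X la li"
    and right_module: "right_hilbert_module B X ra ri"
    and left_full: "nclosure A (prod_span A li (carrier X) (carrier X)) = carrier A"
    and right_full: "nclosure B (prod_span B ri (carrier X) (carrier X)) = carrier B"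
    and actions_commute: "\<lbrakk>a \<in> carrier A; x \<in> carrier X; b \<in> carrier B\<rbrakk>
      \<Longrightarrow> ra (la a x) b = la a (ra x b)"
    and left_adjointable: "\<lbrakk>a \<in> carrier A; x \<in> carrier X; y \<in> carrier X\<rbrakk>
      \<Longrightarrow> ri (la a x) y = ri x (la (astar A a) y)"
    and right_adjointable: "\<lbrakk>x \<in> carrier X; y \<in> carrier X; b \<in> carrier B\<rbrakk>
      \<Longrightarrow> li (ra x b) y = li x (ra y (astar B b))"
    and ip_compatible: "\<lbrakk>x \<in> carrier X; y \<in> carrier X; z \<in> carrier X\<rbrakk>
      \<Longrightarrow> la (li x y) z = ra x (ri y z)"

section \<open>Groupoids\<close>

text \<open>The unit space is identified with the set of identity arrows; \<open>gmul g h\<close> is meaningful only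
  when \<open>gsrc g = grng h\<close>.\<close>

record 'g groupoid =
  gtop :: "'g topology"
  gmul :: "'g \<Rightarrow> 'g \<Rightarrow> 'g"
  ginv :: "'g \<Rightarrow> 'g"
  grng :: "'g \<Rightarrow> 'g"
  gsrc :: "'g \<Rightarrow> 'g"

abbreviation arrows :: "('g, 'z) groupoid_scheme \<Rightarrow> 'g set" where
  "arrows G \<equiv> topspace (gtop G)"

definition units :: "('g, 'z) groupoid_scheme \<Rightarrow> 'g set" where
  "units G = gsrc G ` arrows G"

abbreviation unit_top :: "('g, 'z) groupoid_scheme \<Rightarrow> 'g topology" where
  "unit_top G \<equiv> subtopology (gtop G) (units G)"

definition composable :: "('g, 'z) groupoid_scheme \<Rightarrow> ('g \<times> 'g) set" where
  "composable G = {(g, h). g \<in> arrows G \<and> h \<in> arrows G \<and> gsrc G g = grng G h}"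

locale lc_groupoid =
  fixes G :: "('g, 'z) groupoid_scheme"
  assumes src_closed: "g \<in> arrows G \<Longrightarrow> gsrc G g \<in> arrows G"
    and rng_closed: "g \<in> arrows G \<Longrightarrow> grng G g \<in> arrows G"
    and src_src: "g \<in> arrows G \<Longrightarrow> gsrc G (gsrc G g) = gsrc G g"
    and rng_src: "g \<in> arrows G \<Longrightarrow> grng G (gsrc G g) = gsrc G g"
    and src_rng: "g \<in> arrows G \<Longrightarrow> gsrc G (grng G g) = grng G g"
    and rng_rng: "g \<in> arrows G \<Longrightarrow> grng G (grng G g) = grng G g"
    and mul_closed: "(g, h) \<in> composable G \<Longrightarrow> gmul G g h \<in> arrows G"
    and rng_mul: "(g, h) \<in> composable G \<Longrightarrow> grng G (gmul G g h) = grng G g"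
    and src_mul: "(g, h) \<in> composable G \<Longrightarrow> gsrc G (gmul G g h) = gsrc G h"
    and mul_assoc: "\<lbrakk>(g, h) \<in> composable G; (h, k) \<in> composable G\<rbrakk>
      \<Longrightarrow> gmul G (gmul G g h) k = gmul G g (gmul G h k)"
    and rng_unit: "g \<in> arrows G \<Longrightarrow> gmul G (grng G g) g = g"
    and src_unit: "g \<in> arrows G \<Longrightarrow> gmul G g (gsrc G g) = g"
    and inv_closed: "g \<in> arrows G \<Longrightarrow> ginv G g \<in> arrows G"
    and rng_inv: "g \<in> arrows G \<Longrightarrow> grng G (ginv G g) = gsrc G g"
    and src_inv: "g \<in> arrows G \<Longrightarrow> gsrc G (ginv G g) = grng G g"
    and mul_inv: "g \<in> arrows G \<Longrightarrow> gmul G g (ginv G g) = grng G g"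
    and inv_mul: "g \<in> arrows G \<Longrightarrow> gmul G (ginv G g) g = gsrc G g"
    and mul_continuous: "continuous_map
      (subtopology (prod_topology (gtop G) (gtop G)) (composable G)) (gtop G)
      (\<lambda>(g, h). gmul G g h)"
    and inv_continuous: "continuous_map (gtop G) (gtop G) (ginv G)"
    and second_countable: "second_countable (gtop G)"
    and locally_compact: "locally_compact_space (gtop G)"
    and Hausdorff: "Hausdorff_space (gtop G)"

section \<open>Banach bundles\<close>

record ('e, 'x) bbundle =
  btop :: "'e topology"
  bbase :: "'x topology"
  bproj :: "'e \<Rightarrow> 'x"
  badd :: "'e \<Rightarrow> 'e \<Rightarrow> 'e"
  bzero :: "'x \<Rightarrow> 'e"
  bscale :: "complex \<Rightarrow> 'e \<Rightarrow> 'e"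
  bnorm :: "'e \<Rightarrow> real"

definition fibre :: "('e, 'x, 'z) bbundle_scheme \<Rightarrow> 'x \<Rightarrow> 'e cnspace" where
  "fibre E x = \<lparr>carrier = {e \<in> topspace (btop E). bproj E e = x},
     vadd = badd E, vzero = bzero E x, vscale = bscale E, vnorm = bnorm E\<rparr>"

abbreviation fib :: "('e, 'x, 'z) bbundle_scheme \<Rightarrow> 'x \<Rightarrow> 'e set" where
  "fib E x \<equiv> carrier (fibre E x)"

text \<open>In \<open>B4\<close>, nets are encoded by filters: every net in the total space has an image filter with
  the same limits, and every filter is the image filter of a net.\<close>

locale banach_bundle =
  fixes E :: "('e, 'x, 'z) bbundle_scheme"
  assumes proj_continuous: "continuous_map (btop E) (bbase E) (bproj E)"
    and proj_open: "open_map (btop E) (bbase E) (bproj E)"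
    and proj_surj: "bproj E ` topspace (btop E) = topspace (bbase E)"
    and fibre_banach: "x \<in> topspace (bbase E) \<Longrightarrow> complex_banach_space (fibre E x)"
    and B1: "openin (btop E) {e \<in> topspace (btop E). bnorm E e < c}"
    and B2: "continuous_map
      (subtopology (prod_topology (btop E) (btop E)) {(a, b). bproj E a = bproj E b}) (btop E)
      (\<lambda>(a, b). badd E a b)"
    and B3: "continuous_map (prod_topology euclidean (btop E)) (btop E)
      (\<lambda>(l, b). bscale E l b)"
    and B4: "\<lbrakk>x \<in> topspace (bbase E); eventually (\<lambda>b. b \<in> topspace (btop E)) F;
        limitin (bbase E) (bproj E) x F; (bnorm E \<longlongrightarrow> 0) F\<rbrakk>
      \<Longrightarrow> limitin (btop E) (\<lambda>b. b) (bzero E x) F"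

definition restrict_bundle ::
  "('e, 'x, 'z) bbundle_scheme \<Rightarrow> 'e set \<Rightarrow> ('e, 'x, 'z) bbundle_scheme" where
  "restrict_bundle E D = E\<lparr>btop := subtopology (btop E) D\<rparr>"

definition banach_subbundle :: "('e, 'x, 'z) bbundle_scheme \<Rightarrow> 'e set \<Rightarrow> bool" where
  "banach_subbundle E D \<longleftrightarrow> D \<subseteq> topspace (btop E) \<and>
     (\<forall>x\<in>topspace (bbase E). csubspace (fibre E x) (D \<inter> fib E x) \<and>
        nclosure (fibre E x) (D \<inter> fib E x) = D \<inter> fib E x) \<and>
     banach_bundle (restrict_bundle E D)"

section \<open>Fell bundles\<close>

record ('b, 'g) fbundle = "('b, 'g) bbundle" +
  bmul :: "'b \<Rightarrow> 'b \<Rightarrow> 'b"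
  bstar :: "'b \<Rightarrow> 'b"

definition fibre_alg :: "('b, 'g, 'z) fbundle_scheme \<Rightarrow> 'g \<Rightarrow> 'b cstar" where
  "fibre_alg B u = \<lparr>carrier = fib B u, vadd = badd B, vzero = bzero B u, vscale = bscale B,
     vnorm = bnorm B, amul = bmul B, astar = bstar B\<rparr>"

locale fell_bundle =
  fixes G :: "('g, 'y) groupoid_scheme"
    and B :: "('b, 'g, 'z) fbundle_scheme"
  assumes is_banach_bundle: "banach_bundle B"
    and base: "bbase B = gtop G"
    and mul_continuous: "continuous_map
      (subtopology (prod_topology (btop B) (btop B)) {(a, b). (bproj B a, bproj B b) \<in> composable G})
      (btop B) (\<lambda>(a, b). bmul B a b)"
    and proj_mul: "\<lbrakk>(g, h) \<in> composable G; a \<in> fib B g; b \<in> fib B h\<rbrakk>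
      \<Longrightarrow> bproj B (bmul B a b) = gmul G g h"
    and mul_add_left: "\<lbrakk>(g, h) \<in> composable G; a \<in> fib B g; a' \<in> fib B g; b \<in> fib B h\<rbrakk>
      \<Longrightarrow> bmul B (badd B a a') b = badd B (bmul B a b) (bmul B a' b)"
    and mul_add_right: "\<lbrakk>(g, h) \<in> composable G; a \<in> fib B g; b \<in> fib B h; b' \<in> fib B h\<rbrakk>
      \<Longrightarrow> bmul B a (badd B b b') = badd B (bmul B a b) (bmul B a b')"
    and mul_scale_left: "\<lbrakk>(g, h) \<in> composable G; a \<in> fib B g; b \<in> fib B h\<rbrakk>
      \<Longrightarrow> bmul B (bscale B l a) b = bscale B l (bmul B a b)"
    and mul_scale_right: "\<lbrakk>(g, h) \<in> composable G; a \<in> fib B g; b \<in> fib B h\<rbrakk>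
      \<Longrightarrow> bmul B a (bscale B l b) = bscale B l (bmul B a b)"
    and mul_assoc: "\<lbrakk>(g, h) \<in> composable G; (h, k) \<in> composable G;
        a \<in> fib B g; b \<in> fib B h; c \<in> fib B k\<rbrakk>
      \<Longrightarrow> bmul B (bmul B a b) c = bmul B a (bmul B b c)"
    and star_continuous: "continuous_map (btop B) (btop B) (bstar B)"
    and proj_star: "\<lbrakk>g \<in> arrows G; a \<in> fib B g\<rbrakk> \<Longrightarrow> bproj B (bstar B a) = ginv G g"
    and star_star: "\<lbrakk>g \<in> arrows G; a \<in> fib B g\<rbrakk> \<Longrightarrow> bstar B (bstar B a) = a"
    and star_add: "\<lbrakk>g \<in> arrows G; a \<in> fib B g; b \<in> fib B g\<rbrakk>
      \<Longrightarrow> bstar B (badd B a b) = badd B (bstar B a) (bstar B b)"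
    and star_scale: "\<lbrakk>g \<in> arrows G; a \<in> fib B g\<rbrakk>
      \<Longrightarrow> bstar B (bscale B l a) = bscale B (cnj l) (bstar B a)"
    and star_mul: "\<lbrakk>(g, h) \<in> composable G; a \<in> fib B g; b \<in> fib B h\<rbrakk>
      \<Longrightarrow> bstar B (bmul B a b) = bmul B (bstar B b) (bstar B a)"
    and fibre_cstar: "u \<in> units G \<Longrightarrow> cstar_algebra (fibre_alg B u)"
    and fibre_imprimitivity: "g \<in> arrows G \<Longrightarrow>
      imprimitivity_bimodule (fibre_alg B (grng G g)) (fibre_alg B (gsrc G g)) (fibre B g)
        (bmul B) (bmul B) (\<lambda>a b. bmul B a (bstar B b)) (\<lambda>a b. bmul B (bstar B a) b)"

definition fell_subbundle ::
  "('g, 'y) groupoid_scheme \<Rightarrow> ('b, 'g, 'z) fbundle_scheme \<Rightarrow> 'b set \<Rightarrow> bool" where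
  "fell_subbundle G B D \<longleftrightarrow> banach_subbundle B D \<and> fell_bundle G (restrict_bundle B D)"

definition fell_ideal ::
  "('g, 'y) groupoid_scheme \<Rightarrow> ('b, 'g, 'z) fbundle_scheme \<Rightarrow> 'b set \<Rightarrow> bool" where
  "fell_ideal G B J \<longleftrightarrow> fell_subbundle G B J \<and>
     (\<forall>a\<in>topspace (btop B). \<forall>b\<in>topspace (btop B). (bproj B a, bproj B b) \<in> composable G \<longrightarrow>
        a \<in> J \<or> b \<in> J \<longrightarrow> bmul B a b \<in> J)"

section \<open>Groupoid equivalences\<close>

record ('t, 'h, 'k) gspace =
  ttop :: "'t topology"
  lmom :: "'t \<Rightarrow> 'h"
  rmom :: "'t \<Rightarrow> 'k"
  lmul :: "'h \<Rightarrow> 't \<Rightarrow> 't"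
  rmul :: "'t \<Rightarrow> 'k \<Rightarrow> 't"

abbreviation pts :: "('t, 'h, 'k, 'z) gspace_scheme \<Rightarrow> 't set" where
  "pts T \<equiv> topspace (ttop T)"

definition lcomp ::
  "('h, 'y) groupoid_scheme \<Rightarrow> ('t, 'h, 'k, 'z) gspace_scheme \<Rightarrow> ('h \<times> 't) set" where
  "lcomp H T = {(h, t). h \<in> arrows H \<and> t \<in> pts T \<and> gsrc H h = lmom T t}"

definition rcomp ::
  "('k, 'y) groupoid_scheme \<Rightarrow> ('t, 'h, 'k, 'z) gspace_scheme \<Rightarrow> ('t \<times> 'k) set" where
  "rcomp K T = {(t, k). t \<in> pts T \<and> k \<in> arrows K \<and> rmom T t = grng K k}"

locale free_proper_left_space =
  fixes H :: "('h, 'y) groupoid_scheme"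
    and T :: "('t, 'h, 'k, 'z) gspace_scheme"
  assumes mom_continuous: "continuous_map (ttop T) (unit_top H) (lmom T)"
    and act_continuous: "continuous_map
      (subtopology (prod_topology (gtop H) (ttop T)) (lcomp H T)) (ttop T) (\<lambda>(h, t). lmul T h t)"
    and mom_act: "(h, t) \<in> lcomp H T \<Longrightarrow> lmom T (lmul T h t) = grng H h"
    and act_act: "\<lbrakk>(g, h) \<in> composable H; (h, t) \<in> lcomp H T\<rbrakk>
      \<Longrightarrow> lmul T g (lmul T h t) = lmul T (gmul H g h) t"
    and unit_act: "t \<in> pts T \<Longrightarrow> lmul T (lmom T t) t = t"
    and free: "\<lbrakk>(h, t) \<in> lcomp H T; lmul T h t = t\<rbrakk> \<Longrightarrow> h \<in> units H"
    and proper: "proper_map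
      (subtopology (prod_topology (gtop H) (ttop T)) (lcomp H T)) (prod_topology (ttop T) (ttop T))
      (\<lambda>(h, t). (lmul T h t, t))"

locale free_proper_right_space =
  fixes K :: "('k, 'y) groupoid_scheme"
    and T :: "('t, 'h, 'k, 'z) gspace_scheme"
  assumes mom_continuous: "continuous_map (ttop T) (unit_top K) (rmom T)"
    and act_continuous: "continuous_map
      (subtopology (prod_topology (ttop T) (gtop K)) (rcomp K T)) (ttop T) (\<lambda>(t, k). rmul T t k)"
    and mom_act: "(t, k) \<in> rcomp K T \<Longrightarrow> rmom T (rmul T t k) = gsrc K k"
    and act_act: "\<lbrakk>(t, k) \<in> rcomp K T; (k, l) \<in> composable K\<rbrakk>
      \<Longrightarrow> rmul T (rmul T t k) l = rmul T t (gmul K k l)"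
    and unit_act: "t \<in> pts T \<Longrightarrow> rmul T t (rmom T t) = t"
    and free: "\<lbrakk>(t, k) \<in> rcomp K T; rmul T t k = t\<rbrakk> \<Longrightarrow> k \<in> units K"
    and proper: "proper_map
      (subtopology (prod_topology (ttop T) (gtop K)) (rcomp K T)) (prod_topology (ttop T) (ttop T))
      (\<lambda>(t, k). (t, rmul T t k))"

text \<open>The quotient topology on the set of classes \<open>orb x\<close>, for \<open>orb\<close> sending a point to its class.\<close>

definition orbit_space :: "'t topology \<Rightarrow> ('t \<Rightarrow> 't set) \<Rightarrow> 't set topology" where
  "orbit_space X orb = topology (\<lambda>U. U \<subseteq> orb ` topspace X \<and> openin X {x \<in> topspace X. orb x \<in> U})"

lemma openin_orbit_space:
  "openin (orbit_space X orb) U \<longleftrightarrow>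
     U \<subseteq> orb ` topspace X \<and> openin X {x \<in> topspace X. orb x \<in> U}"
proof -
  have "istopology (\<lambda>U. U \<subseteq> orb ` topspace X \<and> openin X {x \<in> topspace X. orb x \<in> U})"
    unfolding istopology_def
  proof (intro conjI allI impI, goal_cases)
    case (1 S T)
    then show ?case by auto
  next
    case (2 S T)
    have "{x \<in> topspace X. orb x \<in> S \<inter> T}
        = {x \<in> topspace X. orb x \<in> S} \<inter> {x \<in> topspace X. orb x \<in> T}" by auto
    then show ?case using 2 by auto
  next
    case (3 \<K>)
    then show ?case by auto
  next
    case (4 \<K>)
    have "{x \<in> topspace X. orb x \<in> \<Union>\<K>} = (\<Union>U\<in>\<K>. {x \<in> topspace X. orb x \<in> U})" by auto
    then show ?case using 4 by auto
  qed
  then show ?thesis by (simp add: orbit_space_def topology_inverse')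
qed

definition induces_homeomorphism ::
  "'t topology \<Rightarrow> ('t \<Rightarrow> 't set) \<Rightarrow> 'u topology \<Rightarrow> ('t \<Rightarrow> 'u) \<Rightarrow> bool" where
  "induces_homeomorphism X orb Y f \<longleftrightarrow>
     (\<exists>F. homeomorphic_map (orbit_space X orb) Y F \<and> (\<forall>x\<in>topspace X. F (orb x) = f x))"

locale groupoid_equivalence =
  fixes H :: "('h, 'x) groupoid_scheme"
    and K :: "('k, 'y) groupoid_scheme"
    and T :: "('t, 'h, 'k, 'z) gspace_scheme"
  assumes locally_compact: "locally_compact_space (ttop T)"
    and Hausdorff: "Hausdorff_space (ttop T)"
    and left_space: "free_proper_left_space H T"
    and right_space: "free_proper_right_space K T"
    and lmom_rmul: "(t, k) \<in> rcomp K T \<Longrightarrow> lmom T (rmul T t k) = lmom T t"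
    and rmom_lmul: "(h, t) \<in> lcomp H T \<Longrightarrow> rmom T (lmul T h t) = rmom T t"
    and actions_commute: "\<lbrakk>(h, t) \<in> lcomp H T; (t, k) \<in> rcomp K T\<rbrakk>
      \<Longrightarrow> rmul T (lmul T h t) k = lmul T h (rmul T t k)"
    and lmom_open: "open_map (ttop T) (unit_top H) (lmom T)"
    and rmom_open: "open_map (ttop T) (unit_top K) (rmom T)"
    and lmom_orbits: "induces_homeomorphism (ttop T)
      (\<lambda>t. {rmul T t k | k. (t, k) \<in> rcomp K T}) (unit_top H) (lmom T)"
    and rmom_orbits: "induces_homeomorphism (ttop T)
      (\<lambda>t. {lmul T h t | h. (h, t) \<in> lcomp H T}) (unit_top K) (rmom T)"

text \<open>In an equivalence these are uniquely determined when \<open>\<sigma>(t) = \<sigma>(t')\<close>, respectively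
  \<open>\<rho>(t) = \<rho>(t')\<close>, because the actions are free and the fibres of the moment maps
  are exactly the orbits; their continuity follows from properness of the actions.\<close>

definition tau_left ::
  "('h, 'y) groupoid_scheme \<Rightarrow> ('t, 'h, 'k, 'z) gspace_scheme \<Rightarrow> 't \<Rightarrow> 't \<Rightarrow> 'h" where
  "tau_left H T t t' = (THE h. (h, t') \<in> lcomp H T \<and> lmul T h t' = t)"

definition tau_right ::
  "('k, 'y) groupoid_scheme \<Rightarrow> ('t, 'h, 'k, 'z) gspace_scheme \<Rightarrow> 't \<Rightarrow> 't \<Rightarrow> 'k" where
  "tau_right K T t t' = (THE k. (t, k) \<in> rcomp K T \<and> rmul T t k = t')"

section \<open>Fell-bundle equivalences\<close>

record ('e, 't, 'b, 'c) ebundle = "('e, 't) bbundle" +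
  lact :: "'b \<Rightarrow> 'e \<Rightarrow> 'e"
  ract :: "'e \<Rightarrow> 'c \<Rightarrow> 'e"
  lip :: "'e \<Rightarrow> 'e \<Rightarrow> 'b"
  rip :: "'e \<Rightarrow> 'e \<Rightarrow> 'c"

locale fell_left_action =
  fixes H :: "'h groupoid"
    and B :: "('b, 'h) fbundle"
    and T :: "('t, 'h, 'k) gspace"
    and E :: "('e, 't, 'b, 'c) ebundle"
  assumes continuous: "continuous_map
      (subtopology (prod_topology (btop B) (btop E)) {(b, e). (bproj B b, bproj E e) \<in> lcomp H T})
      (btop E) (\<lambda>(b, e). lact E b e)"
    and proj_act: "\<lbrakk>(h, t) \<in> lcomp H T; b \<in> fib B h; e \<in> fib E t\<rbrakk>
      \<Longrightarrow> bproj E (lact E b e) = lmul T h t"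
    and act_act: "\<lbrakk>(g, h) \<in> composable H; (h, t) \<in> lcomp H T;
        a \<in> fib B g; b \<in> fib B h; e \<in> fib E t\<rbrakk>
      \<Longrightarrow> lact E a (lact E b e) = lact E (bmul B a b) e"
    and norm_act: "\<lbrakk>(h, t) \<in> lcomp H T; b \<in> fib B h; e \<in> fib E t\<rbrakk>
      \<Longrightarrow> bnorm E (lact E b e) \<le> bnorm B b * bnorm E e"

locale fell_right_action =
  fixes K :: "'k groupoid"
    and C :: "('c, 'k) fbundle"
    and T :: "('t, 'h, 'k) gspace"
    and E :: "('e, 't, 'b, 'c) ebundle"
  assumes continuous: "continuous_map
      (subtopology (prod_topology (btop E) (btop C)) {(e, c). (bproj E e, bproj C c) \<in> rcomp K T})
      (btop E) (\<lambda>(e, c). ract E e c)"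
    and proj_act: "\<lbrakk>(t, k) \<in> rcomp K T; e \<in> fib E t; c \<in> fib C k\<rbrakk>
      \<Longrightarrow> bproj E (ract E e c) = rmul T t k"
    and act_act: "\<lbrakk>(t, k) \<in> rcomp K T; (k, l) \<in> composable K;
        e \<in> fib E t; c \<in> fib C k; d \<in> fib C l\<rbrakk>
      \<Longrightarrow> ract E (ract E e c) d = ract E e (bmul C c d)"
    and norm_act: "\<lbrakk>(t, k) \<in> rcomp K T; e \<in> fib E t; c \<in> fib C k\<rbrakk>
      \<Longrightarrow> bnorm E (ract E e c) \<le> bnorm E e * bnorm C c"

text \<open>Inner products are conjugate-linear in the second variable on the left and in the first
  variable on the right.\<close>

locale fell_equivalence =
  fixes H :: "'h groupoid"
    and K :: "'k groupoid"
    and B :: "('b, 'h) fbundle"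
    and C :: "('c, 'k) fbundle"
    and T :: "('t, 'h, 'k) gspace"
    and E :: "('e, 't, 'b, 'c) ebundle"
  assumes is_banach_bundle: "banach_bundle E"
    and base: "bbase E = ttop T"
    and E1_left: "fell_left_action H B T E"
    and E1_right: "fell_right_action K C T E"
    and E1_commute: "\<lbrakk>(h, t) \<in> lcomp H T; (t, k) \<in> rcomp K T;
        b \<in> fib B h; e \<in> fib E t; c \<in> fib C k\<rbrakk>
      \<Longrightarrow> lact E b (ract E e c) = ract E (lact E b e) c"
    and E2_lip_continuous: "continuous_map
      (subtopology (prod_topology (btop E) (btop E))
        {(e, f). rmom T (bproj E e) = rmom T (bproj E f)})
      (btop B) (\<lambda>(e, f). lip E e f)"
    and E2_rip_continuous: "continuous_map
      (subtopology (prod_topology (btop E) (btop E))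
        {(e, f). lmom T (bproj E e) = lmom T (bproj E f)})
      (btop C) (\<lambda>(e, f). rip E e f)"
    and E2_lip_add_left: "\<lbrakk>t \<in> pts T; t' \<in> pts T; rmom T t = rmom T t';
        e \<in> fib E t; e' \<in> fib E t; f \<in> fib E t'\<rbrakk>
      \<Longrightarrow> lip E (badd E e e') f = badd B (lip E e f) (lip E e' f)"
    and E2_lip_add_right: "\<lbrakk>t \<in> pts T; t' \<in> pts T; rmom T t = rmom T t';
        e \<in> fib E t; f \<in> fib E t'; f' \<in> fib E t'\<rbrakk>
      \<Longrightarrow> lip E e (badd E f f') = badd B (lip E e f) (lip E e f')"
    and E2_lip_scale_left: "\<lbrakk>t \<in> pts T; t' \<in> pts T; rmom T t = rmom T t';
        e \<in> fib E t; f \<in> fib E t'\<rbrakk>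
      \<Longrightarrow> lip E (bscale E l e) f = bscale B l (lip E e f)"
    and E2_lip_scale_right: "\<lbrakk>t \<in> pts T; t' \<in> pts T; rmom T t = rmom T t';
        e \<in> fib E t; f \<in> fib E t'\<rbrakk>
      \<Longrightarrow> lip E e (bscale E l f) = bscale B (cnj l) (lip E e f)"
    and E2_rip_add_left: "\<lbrakk>t \<in> pts T; t' \<in> pts T; lmom T t = lmom T t';
        e \<in> fib E t; e' \<in> fib E t; f \<in> fib E t'\<rbrakk>
      \<Longrightarrow> rip E (badd E e e') f = badd C (rip E e f) (rip E e' f)"
    and E2_rip_add_right: "\<lbrakk>t \<in> pts T; t' \<in> pts T; lmom T t = lmom T t';
        e \<in> fib E t; f \<in> fib E t'; f' \<in> fib E t'\<rbrakk>
      \<Longrightarrow> rip E e (badd E f f') = badd C (rip E e f) (rip E e f')"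
    and E2_rip_scale_left: "\<lbrakk>t \<in> pts T; t' \<in> pts T; lmom T t = lmom T t';
        e \<in> fib E t; f \<in> fib E t'\<rbrakk>
      \<Longrightarrow> rip E (bscale E l e) f = bscale C (cnj l) (rip E e f)"
    and E2_rip_scale_right: "\<lbrakk>t \<in> pts T; t' \<in> pts T; lmom T t = lmom T t';
        e \<in> fib E t; f \<in> fib E t'\<rbrakk>
      \<Longrightarrow> rip E e (bscale E l f) = bscale C l (rip E e f)"
    and E2_i_left: "\<lbrakk>t \<in> pts T; t' \<in> pts T; rmom T t = rmom T t'; e \<in> fib E t; f \<in> fib E t'\<rbrakk>
      \<Longrightarrow> bproj B (lip E e f) = tau_left H T t t'"
    and E2_i_right: "\<lbrakk>t \<in> pts T; t' \<in> pts T; lmom T t = lmom T t'; e \<in> fib E t; f \<in> fib E t'\<rbrakk>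
      \<Longrightarrow> bproj C (rip E e f) = tau_right K T t t'"
    and E2_ii_left: "\<lbrakk>t \<in> pts T; t' \<in> pts T; rmom T t = rmom T t'; e \<in> fib E t; f \<in> fib E t'\<rbrakk>
      \<Longrightarrow> bstar B (lip E e f) = lip E f e"
    and E2_ii_right: "\<lbrakk>t \<in> pts T; t' \<in> pts T; lmom T t = lmom T t'; e \<in> fib E t; f \<in> fib E t'\<rbrakk>
      \<Longrightarrow> bstar C (rip E e f) = rip E f e"
    and E2_iii_left: "\<lbrakk>(h, t) \<in> lcomp H T; t' \<in> pts T; rmom T t = rmom T t';
        b \<in> fib B h; e \<in> fib E t; f \<in> fib E t'\<rbrakk>
      \<Longrightarrow> lip E (lact E b e) f = bmul B b (lip E e f)"
    and E2_iii_right: "\<lbrakk>(t', k) \<in> rcomp K T; t \<in> pts T; lmom T t = lmom T t';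
        e \<in> fib E t; f \<in> fib E t'; c \<in> fib C k\<rbrakk>
      \<Longrightarrow> rip E e (ract E f c) = bmul C (rip E e f) c"
    and E2_iv: "\<lbrakk>t \<in> pts T; t' \<in> pts T; t'' \<in> pts T; rmom T t = rmom T t'; lmom T t' = lmom T t'';
        e \<in> fib E t; f \<in> fib E t'; g \<in> fib E t''\<rbrakk>
      \<Longrightarrow> lact E (lip E e f) g = ract E e (rip E f g)"
    and E3: "t \<in> pts T \<Longrightarrow>
      imprimitivity_bimodule (fibre_alg B (lmom T t)) (fibre_alg C (rmom T t)) (fibre E t)
        (lact E) (ract E) (lip E) (rip E)"

section \<open>Submodules, ideals and the correspondences between them\<close>

definition banach_submodule ::
  "'h groupoid \<Rightarrow> 'k groupoid \<Rightarrow> ('b, 'h) fbundle \<Rightarrow> ('c, 'k) fbundle \<Rightarrow> ('t, 'h, 'k) gspace \<Rightarrow>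
   ('e, 't, 'b, 'c) ebundle \<Rightarrow> 'e set \<Rightarrow> bool" where
  "banach_submodule H K B C T E M \<longleftrightarrow> banach_subbundle E M \<and>
     (\<forall>(h, t) \<in> lcomp H T.
        prod_span (fibre E (lmul T h t)) (lact E) (fib B h) (M \<inter> fib E t)
          \<subseteq> M \<inter> fib E (lmul T h t)) \<and>
     (\<forall>(t, k) \<in> rcomp K T.
        prod_span (fibre E (rmul T t k)) (ract E) (M \<inter> fib E t) (fib C k)
          \<subseteq> M \<inter> fib E (rmul T t k))"

definition full_submodule ::
  "'h groupoid \<Rightarrow> 'k groupoid \<Rightarrow> ('b, 'h) fbundle \<Rightarrow> ('c, 'k) fbundle \<Rightarrow> ('t, 'h, 'k) gspace \<Rightarrow>
   ('e, 't, 'b, 'c) ebundle \<Rightarrow> 'e set \<Rightarrow> bool" where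
  "full_submodule H K B C T E M \<longleftrightarrow> banach_submodule H K B C T E M \<and>
     (\<forall>(h, t) \<in> lcomp H T. nclosure (fibre E (lmul T h t))
        (prod_span (fibre E (lmul T h t)) (lact E) (fib B h) (M \<inter> fib E t))
          = M \<inter> fib E (lmul T h t)) \<and>
     (\<forall>(t, k) \<in> rcomp K T. nclosure (fibre E (rmul T t k))
        (prod_span (fibre E (rmul T t k)) (ract E) (M \<inter> fib E t) (fib C k))
          = M \<inter> fib E (rmul T t k))"

definition right_ideal_prod ::
  "'k groupoid \<Rightarrow> ('c, 'k) fbundle \<Rightarrow> ('t, 'h, 'k) gspace \<Rightarrow> ('e, 't, 'b, 'c) ebundle \<Rightarrow>
   'c set \<Rightarrow> 'e set" where
  "right_ideal_prod K C T E J = (\<Union>(t, k) \<in> rcomp K T.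
     prod_span (fibre E (rmul T t k)) (ract E) (fib E t) (J \<inter> fib C k))"

definition left_ideal_prod ::
  "'h groupoid \<Rightarrow> ('b, 'h) fbundle \<Rightarrow> ('t, 'h, 'k) gspace \<Rightarrow> ('e, 't, 'b, 'c) ebundle \<Rightarrow>
   'b set \<Rightarrow> 'e set" where
  "left_ideal_prod H B T E I = (\<Union>(h, t) \<in> lcomp H T.
     prod_span (fibre E (lmul T h t)) (lact E) (I \<inter> fib B h) (fib E t))"

definition left_coeff_at ::
  "('b, 'h) fbundle \<Rightarrow> ('t, 'h, 'k) gspace \<Rightarrow> ('e, 't, 'b, 'c) ebundle \<Rightarrow> 'e set \<Rightarrow> 't \<Rightarrow> 'b set" where
  "left_coeff_at B T E M t = nclosure (fibre B (lmom T t))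
     (prod_span (fibre B (lmom T t)) (lip E) (M \<inter> fib E t) (fib E t))"

definition right_coeff_at ::
  "('c, 'k) fbundle \<Rightarrow> ('t, 'h, 'k) gspace \<Rightarrow> ('e, 't, 'b, 'c) ebundle \<Rightarrow> 'e set \<Rightarrow> 't \<Rightarrow> 'c set" where
  "right_coeff_at C T E M t = nclosure (fibre C (rmom T t))
     (prod_span (fibre C (rmom T t)) (rip E) (fib E t) (M \<inter> fib E t))"

text \<open>\<open>L\<^sub>u\<close> and \<open>R\<^sub>v\<close>, read off at an arbitrary point over the unit; for full submodules the choice is
  immaterial, but that is a theorem and is not built into the definition.\<close>

definition left_coeff ::
  "('b, 'h) fbundle \<Rightarrow> ('t, 'h, 'k) gspace \<Rightarrow> ('e, 't, 'b, 'c) ebundle \<Rightarrow> 'e set \<Rightarrow> 'h \<Rightarrow> 'b set" where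
  "left_coeff B T E M u = left_coeff_at B T E M (SOME t. t \<in> pts T \<and> lmom T t = u)"

definition right_coeff ::
  "('c, 'k) fbundle \<Rightarrow> ('t, 'h, 'k) gspace \<Rightarrow> ('e, 't, 'b, 'c) ebundle \<Rightarrow> 'e set \<Rightarrow> 'k \<Rightarrow> 'c set" where
  "right_coeff C T E M v = right_coeff_at C T E M (SOME t. t \<in> pts T \<and> rmom T t = v)"

definition left_ideal_of ::
  "'h groupoid \<Rightarrow> ('b, 'h) fbundle \<Rightarrow> ('t, 'h, 'k) gspace \<Rightarrow> ('e, 't, 'b, 'c) ebundle \<Rightarrow>
   'e set \<Rightarrow> 'b set" where
  "left_ideal_of H B T E M = (\<Union>h\<in>arrows H.
     prod_span (fibre B h) (bmul B) (left_coeff B T E M (grng H h)) (fib B h))"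

definition right_ideal_of ::
  "'k groupoid \<Rightarrow> ('c, 'k) fbundle \<Rightarrow> ('t, 'h, 'k) gspace \<Rightarrow> ('e, 't, 'b, 'c) ebundle \<Rightarrow>
   'e set \<Rightarrow> 'c set" where
  "right_ideal_of K C T E M = (\<Union>k\<in>arrows K.
     prod_span (fibre C k) (bmul C) (right_coeff C T E M (grng K k)) (fib C k))"

abbreviation inclusion_order :: "'a set set \<Rightarrow> 'a set gorder" where
  "inclusion_order S \<equiv> \<lparr>carrier = S, eq = (=), le = (\<subseteq>)\<rparr>"

definition lattice_isomorphism ::
  "('a, 'y) gorder_scheme \<Rightarrow> ('b, 'z) gorder_scheme \<Rightarrow> ('a \<Rightarrow> 'b) \<Rightarrow> bool" where
  "lattice_isomorphism X Y f \<longleftrightarrow> lattice X \<and> lattice Y \<and>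
     bij_betw f (carrier X) (carrier Y) \<and> join_pres X Y f \<and> meet_pres X Y f"

end

theory Submission
  imports Defs
begin

text \<open>The ideal of \<open>C\<close> belonging to a submodule \<open>M\<close> is the set of all \<open>c\<close> with
  \<open>E\<^sub>t \<cdot> c \<subseteq> M\<close>, and the fibre of \<open>E \<cdot> J\<close> over \<open>t\<close> is the set of all \<open>e\<close> with
  \<open>\<langle>f, e\<rangle> \<in> J\<close> for \<open>f \<in> E\<^sub>t\<close>. With these descriptions the two maps are easily seen to be
  mutually inverse, by \<open>\<langle>e', e\<rangle> \<cdot> c = \<langle>e', e \<cdot> c\<rangle>\<close> and \<open>e' \<cdot> \<langle>e, m\<rangle> = \<langle>e', e\<rangle> \<cdot> m\<close> and because
  the actions are nondegenerate; the statements about \<open>B\<close> follow by passing to opposite groupoids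
  and bundles.

  Two points need work. The set products are plain linear spans, so for a closed ideal \<open>J\<close>
  one needs that \<open>X \<cdot> J\<close> is closed in a Hilbert module \<open>X\<close>; this is a factorization theorem of
  Cohen's type, for which approximate units are constructed from the norm estimate
  \<open>\<parallel>a\<parallel>\<^sup>2 \<le> \<parallel>a a\<^sup>* + b b\<^sup>*\<parallel>\<close> for \<open>a b\<^sup>* = b a\<^sup>*\<close>, without spectral theory. And a family of closed subspaces of
  the fibres is a subbundle iff each of its points is approximated over a whole
  neighbourhood in the base. The points with this property form closed subspaces of the fibres, so that
  it only has to be checked on generators such as \<open>x \<cdot> a\<close> and \<open>\<langle>e, m\<rangle>\<close>.\<close>

section \<open>Normed spaces on carrier sets\<close>

text \<open>Neither spectra nor an order on positive elements are used. The decisive estimates come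
  from the C*-identity for \<open>a + ib\<close> and \<open>a - ib\<close> together, and the inverse
  needed is that of \<open>1 + ib/4\<close>: the imaginary coefficient makes this inverse a
  contraction, and the factor 1/4 makes the Neumann series converge. The constants 7/8 and 16/17 are
  the exact maxima of the functions involved; 99/100 and the factors 2 and 4 in norm bounds are
  crude.

  A second obstacle is that an intersection of two subbundles may lose the openness of the
  projection. For ideals this is repaired by approximating \<open>c\<close> in the intersection by
  products \<open>c e\<close>, with \<open>c\<close> taken from one ideal and \<open>e\<close> from
  the other. Meets and joins are constructed for ideals of a Fell bundle only and reach the
  submodules through the order isomorphism.

  Multipliers are preferred to the displayed products because membership can be tested at one point
  of \<open>T\<close> over each arrow; that the coefficient ideals depend only on the moment of the
  point is then visible.\<close>

abbreviation vsub :: "('a, 'z) cnspace_scheme \<Rightarrow> 'a \<Rightarrow> 'a \<Rightarrow> 'a" where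
  "vsub V x y \<equiv> vadd V x (vscale V (-1) y)"

definition closed_subspace :: "('a, 'z) cnspace_scheme \<Rightarrow> 'a set \<Rightarrow> bool" where
  "closed_subspace V W \<longleftrightarrow> csubspace V W \<and> nclosure V W = W"

lemma csubspaceD:
  assumes "csubspace V W"
  shows "W \<subseteq> carrier V" "vzero V \<in> W" "\<And>x y. \<lbrakk>x \<in> W; y \<in> W\<rbrakk> \<Longrightarrow> vadd V x y \<in> W"
    "\<And>c x. x \<in> W \<Longrightarrow> vscale V c x \<in> W" "\<And>x. x \<in> W \<Longrightarrow> x \<in> carrier V"
  using assms unfolding csubspace_def by auto

lemma cspan_least: "\<lbrakk>S \<subseteq> W; csubspace V W\<rbrakk> \<Longrightarrow> cspan V S \<subseteq> W"
  unfolding cspan_def by (rule hull_minimal)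

lemma cspan_superset: "S \<subseteq> cspan V S"
  unfolding cspan_def by (rule hull_subset)

lemma prod_span_least:
  "\<lbrakk>\<And>a x. \<lbrakk>a \<in> S; x \<in> Y\<rbrakk> \<Longrightarrow> m a x \<in> W; csubspace V W\<rbrakk> \<Longrightarrow> prod_span V m S Y \<subseteq> W"
  unfolding prod_span_def by (rule cspan_least) (clarify, assumption | assumption)+

lemma prod_span_base: "\<lbrakk>a \<in> S; x \<in> Y\<rbrakk> \<Longrightarrow> m a x \<in> prod_span V m S Y"
  unfolding prod_span_def by (rule subsetD[OF cspan_superset]) auto

text \<open>Vector identities are verified in coordinates: since \<open>L\<close> is opaque, rewriting
  the vectors to values of \<open>L\<close> terminates and reduces an identity to one between coefficients.\<close>

definition coordinates ::
  "('a, 'z) cnspace_scheme \<Rightarrow> 'a \<Rightarrow> 'a \<Rightarrow> 'a \<Rightarrow> 'a \<Rightarrow>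
   (complex \<Rightarrow> complex \<Rightarrow> complex \<Rightarrow> complex \<Rightarrow> 'a) \<Rightarrow> bool" where
  "coordinates V x y z w L \<longleftrightarrow>
    (\<forall>a b c d a' b' c' d'. vadd V (L a b c d) (L a' b' c' d') = L (a + a') (b + b') (c + c') (d + d')) \<and>
    (\<forall>k a b c d. vscale V k (L a b c d) = L (k * a) (k * b) (k * c) (k * d)) \<and>
    vzero V = L 0 0 0 0 \<and> x = L 1 0 0 0 \<and> y = L 0 1 0 0 \<and> z = L 0 0 1 0 \<and> w = L 0 0 0 1"

lemma coordinatesD:
  assumes "coordinates V x y z w L"
  shows "vadd V (L a b c d) (L a' b' c' d') = L (a + a') (b + b') (c + c') (d + d')"
    "vscale V k (L a b c d) = L (k * a) (k * b) (k * c) (k * d)"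
    "vzero V = L 0 0 0 0" "x = L 1 0 0 0" "y = L 0 1 0 0" "z = L 0 0 1 0" "w = L 0 0 0 1"
  using assms unfolding coordinates_def by blast+

section \<open>Coordinates, closed subspaces and convergent iterations in one Banach space\<close>

context complex_banach_space
begin

lemma vector_closed [simp, intro]:
  "\<lbrakk>x \<in> carrier V; y \<in> carrier V\<rbrakk> \<Longrightarrow> vadd V x y \<in> carrier V"
  "vzero V \<in> carrier V"
  "x \<in> carrier V \<Longrightarrow> vscale V c x \<in> carrier V"
  by (simp_all add: vadd_closed vzero_closed vscale_closed)

declare vadd_zero [simp]

lemma vadd_left_commute:
  "\<lbrakk>x \<in> carrier V; y \<in> carrier V; z \<in> carrier V\<rbrakk>
    \<Longrightarrow> vadd V x (vadd V y z) = vadd V y (vadd V x z)"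
  by (metis vadd_assoc vadd_commute)

lemma vscale_zero_left: "x \<in> carrier V \<Longrightarrow> vscale V 0 x = vzero V"
  using vscale_add_left[of x 1 "-1"] by (simp add: vscale_one vadd_inverse)

lemma vscale_zero_right [simp]: "vscale V c (vzero V) = vzero V"
  by (metis vscale_vscale vscale_zero_left mult_zero_right vzero_closed)

lemma vzero_add [simp]: "x \<in> carrier V \<Longrightarrow> vadd V (vzero V) x = x"
  by (simp add: vadd_commute vadd_zero)

text \<open>\<open>L a b c d\<close> is the linear combination with these coefficients. The vectors
  may be dependent or repeated: only the passage from equal coefficients to equal vectors is used,
  and identities in fewer than four vectors fill the remaining slots with copies.\<close>

lemma coordinates_exist:
  assumes "x \<in> carrier V" "y \<in> carrier V" "z \<in> carrier V" "w \<in> carrier V"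
  shows "\<exists>L. coordinates V x y z w L"
proof -
  define L where "L = (\<lambda>a b c d. vadd V (vscale V a x) (vadd V (vscale V b y)
     (vadd V (vscale V c z) (vscale V d w))))"
  have "vadd V (L a b c d) (L a' b' c' d') = L (a + a') (b + b') (c + c') (d + d')" for a b c d a' b' c' d'
    unfolding L_def using assms
    by (simp add: vscale_add_left vadd_assoc vadd_commute vadd_left_commute)
  moreover have "vscale V k (L a b c d) = L (k * a) (k * b) (k * c) (k * d)" for k a b c d
    unfolding L_def using assms by (simp add: vscale_add_right vscale_vscale)
  moreover have "vzero V = L 0 0 0 0" "x = L 1 0 0 0" "y = L 0 1 0 0" "z = L 0 0 1 0" "w = L 0 0 0 1"
    unfolding L_def using assms
    by (simp_all add: vscale_zero_left vscale_one vadd_zero vzero_add)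
  ultimately show ?thesis unfolding coordinates_def by blast
qed

lemma vsub_add_vsub:
  assumes "x \<in> carrier V" "y \<in> carrier V" "z \<in> carrier V"
  shows "vadd V (vsub V x y) (vsub V y z) = vsub V x z"
proof -
  obtain L where "coordinates V x y z z L" using coordinates_exist[OF assms assms(3)] ..
  note L = coordinatesD[OF this]
  show ?thesis unfolding L(4,5,6) by (simp add: L(1,2))
qed

lemma vsub_self [simp]: "x \<in> carrier V \<Longrightarrow> vsub V x x = vzero V"
  by (rule vadd_inverse)

lemma vsub_flip:
  assumes "x \<in> carrier V" "y \<in> carrier V" shows "vscale V (-1) (vsub V x y) = vsub V y x"
  using assms by (simp add: vscale_add_right vscale_vscale vscale_one vadd_commute)

lemma vsub_add_cancel:
  assumes "x \<in> carrier V" "y \<in> carrier V" shows "vadd V (vsub V x y) y = x"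
  using assms by (simp add: vadd_assoc vadd_commute[of "vscale V (-1) y" y] vadd_inverse vadd_zero)

lemma vsub_eq_zero:
  assumes "x \<in> carrier V" "y \<in> carrier V" "vsub V x y = vzero V" shows "x = y"
  using vsub_add_cancel[OF assms(1,2)] assms by (simp add: vzero_add)

lemma vnorm_zero [simp]: "vnorm V (vzero V) = 0"
  by (simp add: vnorm_eq_zero)

lemma vnorm_vsub_flip:
  "\<lbrakk>x \<in> carrier V; y \<in> carrier V\<rbrakk> \<Longrightarrow> vnorm V (vsub V x y) = vnorm V (vsub V y x)"
  using vnorm_scale[of "vsub V x y" "-1"] by (simp add: vsub_flip)

lemma vnorm_vsub_le:
  "\<lbrakk>x \<in> carrier V; y \<in> carrier V\<rbrakk> \<Longrightarrow> vnorm V (vsub V x y) \<le> vnorm V x + vnorm V y"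
  using vnorm_triangle[of x "vscale V (-1) y"] by (simp add: vnorm_scale)

lemma vnorm_vsub_triangle:
  "\<lbrakk>x \<in> carrier V; y \<in> carrier V; z \<in> carrier V\<rbrakk>
    \<Longrightarrow> vnorm V (vsub V x z) \<le> vnorm V (vsub V x y) + vnorm V (vsub V y z)"
  by (metis vsub_add_vsub vnorm_triangle vector_closed(1,3))

sublocale metric: Metric_space "carrier V" "vdist V"
proof
  fix x y z
  show "0 \<le> vdist V x y" by (simp add: vdist_def vnorm_nonneg)
  show "vdist V x y = vdist V y x" by (simp add: vdist_def vnorm_vsub_flip)
  assume "x \<in> carrier V" "y \<in> carrier V"
  then show "vdist V x y = 0 \<longleftrightarrow> x = y"
    by (auto simp: vdist_def vnorm_eq_zero intro: vsub_eq_zero)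
  assume "z \<in> carrier V"
  then show "vdist V x z \<le> vdist V x y + vdist V y z"
    using \<open>x \<in> carrier V\<close> \<open>y \<in> carrier V\<close> by (simp add: vdist_def vnorm_vsub_triangle)
qed

lemma vdist_eq: "\<lbrakk>x \<in> carrier V; y \<in> carrier V\<rbrakk> \<Longrightarrow> vdist V x y = vnorm V (vsub V x y)"
  by (simp add: vdist_def)

lemma in_nclosure:
  assumes "S \<subseteq> carrier V"
  shows "x \<in> nclosure V S \<longleftrightarrow> x \<in> carrier V \<and> (\<forall>\<epsilon>>0. \<exists>y\<in>S. vnorm V (vsub V x y) < \<epsilon>)"
  unfolding nclosure_def metric.metric_closure_of using assms
  by (auto simp: subset_iff vdist_eq) (metis vdist_eq)+

lemma nclosure_superset: "S \<subseteq> carrier V \<Longrightarrow> S \<subseteq> nclosure V S"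
  unfolding nclosure_def by (simp add: closure_of_subset)

lemma nclosure_subset_carrier: "nclosure V S \<subseteq> carrier V"
  unfolding nclosure_def using closure_of_subset_topspace[of metric.mtopology S] by simp

lemma nclosure_mono: "S \<subseteq> S' \<Longrightarrow> nclosure V S \<subseteq> nclosure V S'"
  unfolding nclosure_def by (rule closure_of_mono)

lemma nclosure_nclosure [simp]: "nclosure V (nclosure V S) = nclosure V S"
  unfolding nclosure_def by simp

lemma closed_subspaceD:
  assumes "closed_subspace V W"
  shows "csubspace V W" "nclosure V W = W"
  using assms unfolding closed_subspace_def by auto

lemma closed_subspaceI:
  assumes "csubspace V W"
    "\<And>x. \<lbrakk>x \<in> carrier V; \<And>\<epsilon>. \<epsilon> > 0 \<Longrightarrow> \<exists>y\<in>W. vnorm V (vsub V x y) < \<epsilon>\<rbrakk> \<Longrightarrow> x \<in> W"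
  shows "closed_subspace V W"
  using assms nclosure_superset[of W] csubspaceD(1)[OF assms(1)]
  unfolding closed_subspace_def by (auto simp: in_nclosure)

lemma closed_subspace_limit:
  assumes "closed_subspace V W" "x \<in> carrier V"
    "\<And>\<epsilon>. \<epsilon> > 0 \<Longrightarrow> \<exists>y\<in>W. vnorm V (vsub V x y) < \<epsilon>"
  shows "x \<in> W"
  using assms csubspaceD(1)[of V W] in_nclosure[of W x] closed_subspaceD[of W] by auto

lemma closed_subspace_carrier: "closed_subspace V (carrier V)"
  by (rule closed_subspaceI) (auto simp: csubspace_def)

lemma csubspace_nclosure:
  assumes "csubspace V W" shows "csubspace V (nclosure V W)"
proof -
  note W = csubspaceD[OF assms]
  have "vadd V x y \<in> nclosure V W" if xy_in: "x \<in> nclosure V W" "y \<in> nclosure V W" for x y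
  proof -
    have xy: "x \<in> carrier V" "y \<in> carrier V" using that nclosure_subset_carrier by auto
    have "\<exists>z\<in>W. vnorm V (vsub V (vadd V x y) z) < \<epsilon>" if "\<epsilon> > 0" for \<epsilon>
    proof -
      obtain x' y' where *: "x' \<in> W" "y' \<in> W" "vnorm V (vsub V x x') < \<epsilon>/2" "vnorm V (vsub V y y') < \<epsilon>/2"
        using xy_in[unfolded in_nclosure[OF W(1)]] \<open>\<epsilon> > 0\<close> by (meson half_gt_zero)
      then have c: "x' \<in> carrier V" "y' \<in> carrier V" using W by auto
      have "vsub V (vadd V x y) (vadd V x' y') = vadd V (vsub V x x') (vsub V y y')"
        using xy c by (simp add: vscale_add_right vadd_assoc vadd_left_commute)
      then have "vnorm V (vsub V (vadd V x y) (vadd V x' y')) < \<epsilon>"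
        using vnorm_triangle[of "vsub V x x'" "vsub V y y'"] * xy c by simp
      then show ?thesis using W(3)[OF *(1,2)] by blast
    qed
    then show ?thesis using xy by (simp add: in_nclosure[OF W(1)])
  qed
  moreover have "vscale V k x \<in> nclosure V W" if "x \<in> nclosure V W" for k x
  proof -
    have x: "x \<in> carrier V" using that nclosure_subset_carrier by auto
    have "\<exists>z\<in>W. vnorm V (vsub V (vscale V k x) z) < \<epsilon>" if "\<epsilon> > 0" for \<epsilon>
    proof -
      \<comment> \<open>Adding 1 keeps the divisor positive when \<open>k = 0\<close>.\<close>
      have "\<epsilon> / (cmod k + 1) > 0" using that by (simp add: add_nonneg_pos)
      then obtain x' where *: "x' \<in> W" "vnorm V (vsub V x x') < \<epsilon> / (cmod k + 1)"
        using \<open>x \<in> nclosure V W\<close> in_nclosure[OF W(1)] by metis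
      then have c: "x' \<in> carrier V" using W by auto
      have "vsub V (vscale V k x) (vscale V k x') = vscale V k (vsub V x x')"
        using x c by (simp add: vscale_add_right vscale_vscale)
      then have "vnorm V (vsub V (vscale V k x) (vscale V k x')) = cmod k * vnorm V (vsub V x x')"
        using x c by (simp add: vnorm_scale)
      also have "\<dots> \<le> (cmod k + 1) * vnorm V (vsub V x x')"
        using x c by (simp add: mult_right_mono vnorm_nonneg)
      also have "\<dots> < \<epsilon>"
        using *(2) by (simp add: pos_less_divide_eq add_nonneg_pos mult.commute)
      finally show ?thesis using W(4)[OF *(1)] by blast
    qed
    then show ?thesis using x by (simp add: in_nclosure[OF W(1)])
  qed
  ultimately show ?thesis
    using W(1,2) nclosure_superset[OF W(1)] nclosure_subset_carrier by (auto simp: csubspace_def)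
qed

lemma closed_subspace_nclosure: "csubspace V W \<Longrightarrow> closed_subspace V (nclosure V W)"
  by (simp add: closed_subspace_def csubspace_nclosure)

lemma csubspace_cspan:
  assumes "S \<subseteq> carrier V" shows "csubspace V (cspan V S)"
proof -
  have "csubspace V (carrier V)" by (auto simp: csubspace_def)
  then have "cspan V S \<subseteq> carrier V" using assms by (rule cspan_least[rotated])
  then show ?thesis
    unfolding csubspace_def
    by (auto simp: cspan_def hull_def csubspace_def)
qed

lemma nclosure_least:
  assumes "S \<subseteq> W" "closed_subspace V W" shows "nclosure V S \<subseteq> W"
  using nclosure_mono[OF assms(1)] closed_subspaceD(2)[OF assms(2)] by simp

lemma nclosure_prod_span_least:
  assumes "\<And>a x. \<lbrakk>a \<in> S; x \<in> Y\<rbrakk> \<Longrightarrow> m a x \<in> W" "closed_subspace V W"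
  shows "nclosure V (prod_span V m S Y) \<subseteq> W"
  using nclosure_least[OF prod_span_least[of S Y m W V]] assms closed_subspaceD(1) by blast

lemma csubspace_prod_span:
  "(\<And>a x. \<lbrakk>a \<in> S; x \<in> Y\<rbrakk> \<Longrightarrow> m a x \<in> carrier V) \<Longrightarrow> csubspace V (prod_span V m S Y)"
  unfolding prod_span_def by (rule csubspace_cspan) auto

lemma closed_subspace_nclosure_prod_span:
  "(\<And>a x. \<lbrakk>a \<in> S; x \<in> Y\<rbrakk> \<Longrightarrow> m a x \<in> carrier V) \<Longrightarrow> closed_subspace V (nclosure V (prod_span V m S Y))"
  by (rule closed_subspace_nclosure[OF csubspace_prod_span])

lemma nclosure_prod_span_base:
  assumes "\<And>a x. \<lbrakk>a \<in> S; x \<in> Y\<rbrakk> \<Longrightarrow> m a x \<in> carrier V" "a \<in> S" "x \<in> Y"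
  shows "m a x \<in> nclosure V (prod_span V m S Y)"
proof -
  have "prod_span V m S Y \<subseteq> carrier V"
    using csubspaceD(1)[OF csubspace_prod_span[of S Y m]] assms by blast
  then show ?thesis using nclosure_superset prod_span_base[OF assms(2,3)] by blast
qed

lemma closed_subspace_Int:
  assumes "closed_subspace V W" "closed_subspace V W'" shows "closed_subspace V (W \<inter> W')"
proof (rule closed_subspaceI)
  show "csubspace V (W \<inter> W')" using assms by (auto simp: closed_subspace_def csubspace_def)
  show "x \<in> W \<inter> W'" if "x \<in> carrier V" "\<And>\<epsilon>. \<epsilon> > 0 \<Longrightarrow> \<exists>y\<in>W \<inter> W'. vnorm V (vsub V x y) < \<epsilon>" for x
    using closed_subspace_limit[OF assms(1) that(1)] closed_subspace_limit[OF assms(2) that(1)] that(2)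
    by (meson IntD1 IntD2 IntI)
qed

lemma closed_subspace_INT:
  assumes "\<And>i. i \<in> I \<Longrightarrow> closed_subspace V (W i)" "I \<noteq> {}" shows "closed_subspace V (\<Inter>i\<in>I. W i)"
proof (rule closed_subspaceI)
  have sub: "csubspace V (W i)" if "i \<in> I" for i
    using assms(1)[OF that] by (simp add: closed_subspace_def)
  obtain j where "j \<in> I" using assms(2) by blast
  then show "csubspace V (\<Inter>i\<in>I. W i)"
    unfolding csubspace_def using csubspaceD(1)[OF sub]
    by (auto intro: csubspaceD(2-4)[OF sub])
  show "x \<in> (\<Inter>i\<in>I. W i)"
    if "x \<in> carrier V" "\<And>\<epsilon>. \<epsilon> > 0 \<Longrightarrow> \<exists>y\<in>\<Inter>i\<in>I. W i. vnorm V (vsub V x y) < \<epsilon>" for x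
  proof
    fix i assume "i \<in> I"
    then show "x \<in> W i"
      using closed_subspace_limit[OF assms(1)[OF \<open>i \<in> I\<close>] that(1)] that(2) by (meson INT_D)
  qed
qed

lemma closed_subspace_restrict:
  assumes "closed_subspace V W" shows "complex_banach_space (V\<lparr>carrier := W\<rparr>)"
proof -
  note W = csubspaceD[OF closed_subspaceD(1)[OF assms]]
  interpret S: Submetric "carrier V" "vdist V" W
    by (simp add: Submetric_def Submetric_axioms_def metric.Metric_space_axioms W(1))
  have "closedin metric.mtopology W"
    using closed_subspaceD(2)[OF assms] W(1) unfolding nclosure_def by (metis closure_of_eq)
  then have "Metric_space.mcomplete W (vdist V)"
    using S.closedin_eq_mcomplete complete by blast
  \<comment> \<open>The two distances agree on \<open>W\<close> only, since \<open>vdist\<close> is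
    set to 0 outside its own carrier; completeness therefore has to be carried over by comparing
    Cauchy sequences and limits.\<close>
  then have "Metric_space.mcomplete W (vdist (V\<lparr>carrier := W\<rparr>))"
  proof -
    have eq: "vdist (V\<lparr>carrier := W\<rparr>) x y = vdist V x y" if "x \<in> W" "y \<in> W" for x y
      using that W by (auto simp: vdist_def)
    interpret S': Metric_space W "vdist (V\<lparr>carrier := W\<rparr>)"
      by standard
        (use W(5) in \<open>auto simp: vdist_def vnorm_nonneg vnorm_vsub_flip vnorm_eq_zero vnorm_vsub_triangle intro: vsub_eq_zero\<close>)
    have "S'.MCauchy \<sigma> \<longleftrightarrow> S.sub.MCauchy \<sigma>" for \<sigma>
      unfolding S'.MCauchy_def S.sub.MCauchy_def using eq by (metis UNIV_I image_subset_iff)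
    moreover have "limitin S'.mtopology \<sigma> x sequentially \<longleftrightarrow> limitin S.sub.mtopology \<sigma> x sequentially"
      for \<sigma> x
      unfolding S'.limitin_metric S.sub.limitin_metric
      by (simp add: eq cong: conj_cong)
    ultimately show ?thesis
      using \<open>Metric_space.mcomplete W (vdist V)\<close>
      unfolding S'.mcomplete_def S.sub.mcomplete_def by auto
  qed
  then show ?thesis
    by unfold_locales
      (use W in \<open>auto simp: vadd_assoc vadd_commute vadd_left_commute vadd_zero vadd_inverse vscale_one vscale_vscale
         vscale_add_left vscale_add_right vnorm_nonneg vnorm_eq_zero vnorm_triangle vnorm_scale\<close>)
qed

lemma nclosure_restrict:
  assumes "closed_subspace V W" "S \<subseteq> W" shows "nclosure (V\<lparr>carrier := W\<rparr>) S = nclosure V S"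
proof -
  interpret W: complex_banach_space "V\<lparr>carrier := W\<rparr>" by (rule closed_subspace_restrict[OF assms(1)])
  note sub = csubspaceD(1)[OF closed_subspaceD(1)[OF assms(1)]]
  have "nclosure V S \<subseteq> W" by (rule nclosure_least[OF assms(2,1)])
  then show ?thesis
    using W.in_nclosure[of S] in_nclosure[of S] assms(2) sub by auto
qed

text \<open>Differences dominated by a geometric series make the sequence Cauchy. The limit is
  placed in a closed subspace because the iterations below have to stay inside an ideal or a
  submodule.\<close>

lemma geometric_limit:
  fixes x :: "nat \<Rightarrow> 'a"
  assumes W: "closed_subspace V W" and x: "\<And>n. x n \<in> W"
    and step: "\<And>n. vnorm V (vsub V (x (Suc n)) (x n)) \<le> C * \<rho> ^ n" and \<rho>: "0 \<le> \<rho>" "\<rho> < 1"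
  obtains l where "l \<in> W" "(\<lambda>n. vnorm V (vsub V (x n) l)) \<longlonglongrightarrow> 0"
proof -
  have xV: "x n \<in> carrier V" for n using x csubspaceD(5)[OF closed_subspaceD(1)[OF W]] by blast
  have C: "C \<ge> 0" using order_trans[OF vnorm_nonneg step[of 0]] xV by simp
  have tail: "vnorm V (vsub V (x (n + k)) (x n)) \<le> C * \<rho> ^ n * (\<Sum>j<k. \<rho> ^ j)" for n k
  proof (induction k)
    case (Suc k)
    have "vnorm V (vsub V (x (n + Suc k)) (x n)) \<le>
        vnorm V (vsub V (x (Suc (n + k))) (x (n + k))) + vnorm V (vsub V (x (n + k)) (x n))"
      using vnorm_vsub_triangle[of "x (Suc (n + k))" "x (n + k)" "x n"] xV by simp
    also have "\<dots> \<le> C * \<rho> ^ (n + k) + C * \<rho> ^ n * (\<Sum>j<k. \<rho> ^ j)"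
      using step[of "n + k"] Suc by simp
    finally show ?case by (simp add: power_add algebra_simps)
  qed (simp add: xV)
  \<comment> \<open>The factor 2 comes from comparing both \<open>x m\<close> and \<open>x n\<close>
    with \<open>x N\<close>.\<close>
  have tail': "vdist V (x m) (x n) \<le> C * \<rho> ^ N / (1 - \<rho>) * 2" if "m \<ge> N" "n \<ge> N" for m n N
  proof -
    have geo: "(\<Sum>j<k. \<rho> ^ j) \<le> 1 / (1 - \<rho>)" for k
      using \<rho> by (simp add: sum_gp_strict divide_right_mono)
    have "vnorm V (vsub V (x p) (x N)) \<le> C * \<rho> ^ N / (1 - \<rho>)" if "p \<ge> N" for p
      using order_trans[OF tail[of N "p - N"] mult_left_mono[OF geo]] that C \<rho> by simp
    then show ?thesis
      using vnorm_vsub_triangle[of "x m" "x N" "x n"] vnorm_vsub_flip[of "x n" "x N"] that xV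
      by (smt (verit) vdist_eq)
  qed
  have "metric.MCauchy x"
    unfolding metric.MCauchy_def
  proof (intro conjI allI impI)
    show "range x \<subseteq> carrier V" using xV by auto
    fix \<epsilon> :: real assume "\<epsilon> > 0"
    have "(\<lambda>N. C * \<rho> ^ N / (1 - \<rho>) * 2) \<longlonglongrightarrow> C * 0 / (1 - \<rho>) * 2"
      by (intro tendsto_intros LIMSEQ_power_zero) (use \<rho> in auto)
    then have "\<forall>\<^sub>F N in sequentially. C * \<rho> ^ N / (1 - \<rho>) * 2 < \<epsilon>"
      using \<open>\<epsilon> > 0\<close> by (auto dest: order_tendstoD(2)[of _ _ _ \<epsilon>])
    then obtain N where "C * \<rho> ^ N / (1 - \<rho>) * 2 < \<epsilon>" by (auto simp: eventually_sequentially)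
    then show "\<exists>N. \<forall>n n'. N \<le> n \<longrightarrow> N \<le> n' \<longrightarrow> vdist V (x n) (x n') < \<epsilon>"
      using tail' by (meson order_le_less_trans)
  qed
  then obtain l where l: "limitin metric.mtopology x l sequentially"
    using complete unfolding metric.mcomplete_def by blast
  then have lV: "l \<in> carrier V" and "\<And>\<epsilon>. \<epsilon> > 0 \<Longrightarrow> \<forall>\<^sub>F n in sequentially. vdist V (x n) l < \<epsilon>"
    unfolding metric.limitin_metric by (auto elim: eventually_mono)
  then have ev: "\<forall>\<^sub>F n in sequentially. vnorm V (vsub V (x n) l) < \<epsilon>" if "\<epsilon> > 0" for \<epsilon>
    using that xV by (simp add: vdist_eq)
  have "l \<in> W"
  proof (rule closed_subspace_limit[OF W lV])
    fix \<epsilon> :: real assume "\<epsilon> > 0"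
    then obtain n where "vnorm V (vsub V (x n) l) < \<epsilon>"
      using ev eventually_sequentially by force
    then show "\<exists>y\<in>W. vnorm V (vsub V l y) < \<epsilon>"
      using x vnorm_vsub_flip[OF lV xV] by metis
  qed
  moreover have "(\<lambda>n. vnorm V (vsub V (x n) l)) \<longlonglongrightarrow> 0"
    using ev xV lV by (auto simp: tendsto_iff vnorm_nonneg)
  ultimately show ?thesis by (rule that)
qed

lemma limit_unique:
  fixes x :: "nat \<Rightarrow> 'a"
  assumes "\<And>n. x n \<in> carrier V" "l \<in> carrier V" "l' \<in> carrier V"
    "(\<lambda>n. vnorm V (vsub V (x n) l)) \<longlonglongrightarrow> 0" "(\<lambda>n. vnorm V (vsub V (x n) l')) \<longlonglongrightarrow> 0"
  shows "l = l'"
proof -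
  have "(\<lambda>n. vnorm V (vsub V (x n) l) + vnorm V (vsub V (x n) l')) \<longlonglongrightarrow> 0 + 0"
    by (intro tendsto_add assms)
  moreover have "vnorm V (vsub V l l') \<le> vnorm V (vsub V (x n) l) + vnorm V (vsub V (x n) l')" for n
    using vnorm_vsub_triangle[of l "x n" l'] vnorm_vsub_flip[of l "x n"] assms by simp
  ultimately have "vnorm V (vsub V l l') \<le> 0" by (auto intro: LIMSEQ_le_const)
  then have "vnorm V (vsub V l l') = 0" using assms vnorm_nonneg[of "vsub V l l'"] by simp
  then show ?thesis using assms vnorm_eq_zero vsub_eq_zero by simp
qed

text \<open>The Neumann series, as a fixed point iteration.\<close>

lemma contraction_solve:
  assumes W: "closed_subspace V W" and F: "\<And>x. x \<in> W \<Longrightarrow> F x \<in> W"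
    and diff: "\<And>x y. \<lbrakk>x \<in> W; y \<in> W\<rbrakk> \<Longrightarrow> F (vsub V x y) = vsub V (F x) (F y)"
    and bound: "\<And>x. x \<in> W \<Longrightarrow> vnorm V (F x) \<le> \<rho> * vnorm V x" and \<rho>: "0 \<le> \<rho>" "\<rho> < 1"
    and v: "v \<in> W"
  obtains u where "u \<in> W" "u = vadd V v (F u)" "(1 - \<rho>) * vnorm V u \<le> vnorm V v"
proof -
  note sub = csubspaceD[OF closed_subspaceD(1)[OF W]]
  \<comment> \<open>Starting at zero makes the first difference equal to \<open>v\<close>, whence
    the constant \<open>vnorm V v\<close> in the geometric bound.\<close>
  define x where "x n = ((\<lambda>u. vadd V v (F u)) ^^ n) (vzero V)" for n
  have x_Suc: "x (Suc n) = vadd V v (F (x n))" for n by (simp add: x_def)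
  have xW: "x n \<in> W" for n
  proof (induction n)
    case 0 show ?case by (simp add: x_def sub)
  next
    case (Suc n) then show ?case unfolding x_Suc by (rule sub(3)[OF v F])
  qed
  have subW: "vsub V a b \<in> W" if "a \<in> W" "b \<in> W" for a b using that sub by simp
  have shift: "vsub V (vadd V v a) (vadd V v b) = vsub V a b" if ab: "a \<in> W" "b \<in> W" for a b
  proof -
    obtain L where "coordinates V a b v v L" using coordinates_exist[OF sub(5)[OF ab(1)] sub(5)[OF ab(2)] sub(5)[OF v] sub(5)[OF v]] ..
    note L = coordinatesD[OF this]
    show ?thesis unfolding L(4,5,6) by (simp add: L(1,2))
  qed
  have "vnorm V (vsub V (x (Suc n)) (x n)) \<le> vnorm V v * \<rho> ^ n" for n
  proof (induction n)
    case 0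
    have "F (vsub V (vzero V) (vzero V)) = vzero V"
      unfolding diff[OF sub(2,2)] by (rule vsub_self[OF sub(5)[OF F[OF sub(2)]]])
    then have "F (vzero V) = vzero V" by simp
    then show ?case using sub(5)[OF v] by (simp add: x_def vadd_zero)
  next
    case (Suc n)
    have "vsub V (x (Suc (Suc n))) (x (Suc n)) = F (vsub V (x (Suc n)) (x n))"
      using shift[OF F[OF xW[of "Suc n"]] F[OF xW[of n]]] diff[OF xW[of "Suc n"] xW[of n]]
      by (simp add: x_Suc)
    then have "vnorm V (vsub V (x (Suc (Suc n))) (x (Suc n))) \<le> \<rho> * vnorm V (vsub V (x (Suc n)) (x n))"
      using bound subW[OF xW xW] by simp
    also have "\<dots> \<le> \<rho> * (vnorm V v * \<rho> ^ n)" using Suc \<rho> by (intro mult_left_mono) auto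
    finally show ?case by (simp add: mult.left_commute)
  qed
  from geometric_limit[OF W xW this \<rho>] obtain u
    where u: "u \<in> W" "(\<lambda>n. vnorm V (vsub V (x n) u)) \<longlonglongrightarrow> 0" by blast
  have "u = vadd V v (F u)"
  proof (rule limit_unique)
    show "x (Suc n) \<in> carrier V" for n using xW sub by blast
    show "u \<in> carrier V" "vadd V v (F u) \<in> carrier V" using u F v sub by auto
    show "(\<lambda>n. vnorm V (vsub V (x (Suc n)) u)) \<longlonglongrightarrow> 0" using u(2) by (rule LIMSEQ_Suc)
    show "(\<lambda>n. vnorm V (vsub V (x (Suc n)) (vadd V v (F u)))) \<longlonglongrightarrow> 0"
    proof (rule Lim_null_comparison)
      show "\<forall>\<^sub>F n in sequentially. norm (vnorm V (vsub V (x (Suc n)) (vadd V v (F u)))) \<le> \<rho> * vnorm V (vsub V (x n) u)"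
        using bound[OF subW[OF xW u(1)]] sub(5) subW[OF F F, OF xW u(1)] 
        by (intro always_eventually allI) (simp add: x_Suc shift[OF F F, OF xW u(1)] diff[OF xW u(1)] vnorm_nonneg)
      show "(\<lambda>n. \<rho> * vnorm V (vsub V (x n) u)) \<longlonglongrightarrow> 0"
        using tendsto_mult_left[OF u(2), of \<rho>] by simp
    qed
  qed
  moreover have "(1 - \<rho>) * vnorm V u \<le> vnorm V v"
    using vnorm_triangle[of v "F u"] bound[OF u(1)] \<open>u = vadd V v (F u)\<close> sub(5) v u(1) F[OF u(1)]
    by (simp add: algebra_simps)
  ultimately show ?thesis using u(1) that by blast
qed

end

text \<open>A bounded additive map is continuous. This is how a property tested on generators
  reaches a closed span: the elements that pass the test form such a preimage. The weak form of
  \<open>scale\<close> also admits conjugate-linear maps.\<close>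

lemma closed_subspace_vimage:
  assumes V: "complex_banach_space V" and V': "complex_banach_space V'"
    and f: "\<And>x. x \<in> carrier V \<Longrightarrow> f x \<in> carrier V'"
    and add: "\<And>x y. \<lbrakk>x \<in> carrier V; y \<in> carrier V\<rbrakk> \<Longrightarrow> f (vadd V x y) = vadd V' (f x) (f y)"
    and scale: "\<And>c x. x \<in> carrier V \<Longrightarrow> \<exists>c'. f (vscale V c x) = vscale V' c' (f x)"
    and minus: "\<And>x. x \<in> carrier V \<Longrightarrow> f (vscale V (-1) x) = vscale V' (-1) (f x)"
    and bound: "\<And>x. x \<in> carrier V \<Longrightarrow> vnorm V' (f x) \<le> K * vnorm V x"
    and W: "closed_subspace V' W"
  shows "closed_subspace V {x \<in> carrier V. f x \<in> W}"
proof -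
  interpret V: complex_banach_space V by fact
  interpret V': complex_banach_space V' by fact
  note sub = csubspaceD[OF V'.closed_subspaceD(1)[OF W]]
  show ?thesis
  proof (rule V.closed_subspaceI)
    have "f (vsub V (vzero V) (vzero V)) = vsub V' (f (vzero V)) (f (vzero V))"
      by (simp only: add minus V.vector_closed)
    also have "\<dots> = vzero V'" by (rule V'.vsub_self[OF f[OF V.vzero_closed]])
    finally have "f (vzero V) = vzero V'" by simp
    then show "csubspace V {x \<in> carrier V. f x \<in> W}"
      unfolding csubspace_def using sub add scale by (auto) (metis sub(4) scale)
    fix x assume x: "x \<in> carrier V"
      and lim: "\<And>\<epsilon>. \<epsilon> > 0 \<Longrightarrow> \<exists>y\<in>{x \<in> carrier V. f x \<in> W}. vnorm V (vsub V x y) < \<epsilon>"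
    have "\<exists>y\<in>W. vnorm V' (vsub V' (f x) y) < \<epsilon>" if "\<epsilon> > 0" for \<epsilon>
    proof -
      have "\<epsilon> / (\<bar>K\<bar> + 1) > 0" using that by simp
      then obtain y where y: "y \<in> carrier V" "f y \<in> W" "vnorm V (vsub V x y) < \<epsilon> / (\<bar>K\<bar> + 1)"
        using lim by blast
      have "vsub V' (f x) (f y) = f (vsub V x y)" using x y add minus by simp
      then have "vnorm V' (vsub V' (f x) (f y)) \<le> K * vnorm V (vsub V x y)"
        using bound x y by simp
      also have "\<dots> \<le> (\<bar>K\<bar> + 1) * vnorm V (vsub V x y)"
        using x y by (intro mult_right_mono V.vnorm_nonneg) auto
      also have "\<dots> < \<epsilon>" using y(3) by (simp add: pos_less_divide_eq mult.commute)
      finally show ?thesis using y(2) by blast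
    qed
    then show "x \<in> {x \<in> carrier V. f x \<in> W}"
      using V'.closed_subspace_limit[OF W f[OF x]] x by blast
  qed
qed

section \<open>Ideals of C*-algebras and factorization in Hilbert modules\<close>

context cstar_algebra
begin

sublocale complex_banach_space A by (rule banach)

lemma algebra_closed [simp, intro]:
  "\<lbrakk>a \<in> carrier A; b \<in> carrier A\<rbrakk> \<Longrightarrow> amul A a b \<in> carrier A"
  "a \<in> carrier A \<Longrightarrow> astar A a \<in> carrier A"
  by (simp_all add: amul_closed astar_closed)

lemmas algebra_expand = amul_add_left amul_add_right amul_scale_left amul_scale_right amul_assoc
  astar_add astar_scale astar_amul astar_astar vscale_vscale vscale_add_right

lemma vnorm_astar: assumes "a \<in> carrier A" shows "vnorm A (astar A a) = vnorm A a"
proof -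
  have le: "vnorm A b \<le> vnorm A (astar A b)" if "b \<in> carrier A" for b
  proof -
    have "vnorm A b * vnorm A b \<le> vnorm A (astar A b) * vnorm A b"
      using cstar_identity[OF that] norm_amul_le[of "astar A b" b] that by (simp add: power2_eq_square)
    then show ?thesis
      using vnorm_nonneg[OF that] vnorm_nonneg[of "astar A b"] that by (cases "vnorm A b = 0") auto
  qed
  from le[OF assms] le[of "astar A a"] assms show ?thesis by (simp add: astar_astar)
qed

lemma vnorm_amul_astar: "a \<in> carrier A \<Longrightarrow> vnorm A (amul A a (astar A a)) = (vnorm A a)\<^sup>2"
  using cstar_identity[of "astar A a"] by (simp add: astar_astar vnorm_astar)

text \<open>Because \<open>a b^* = b a^*\<close>, the cross terms cancel when \<open>a + ib\<close>
  is multiplied by its adjoint, and likewise for \<open>a - ib\<close>; both have the same norm, and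
  \<open>a\<close> is their mean. This stands in for monotonicity of the norm on positive
  elements.\<close>

lemma vnorm_plus_i:
  assumes "a \<in> carrier A" "b \<in> carrier A" "amul A a (astar A b) = amul A b (astar A a)"
  shows "(vnorm A (vadd A a (vscale A \<i> b)))\<^sup>2 = vnorm A (vadd A (amul A a (astar A a)) (amul A b (astar A b)))"
    and "vnorm A a \<le> vnorm A (vadd A a (vscale A \<i> b))"
proof -
  let ?P = "amul A a (astar A a)" and ?Q = "amul A a (astar A b)" and ?R = "amul A b (astar A b)"
  let ?u = "vadd A a (vscale A \<i> b)" and ?v = "vadd A a (vscale A (-\<i>) b)"
  obtain L where "coordinates A ?P ?Q ?R ?R L" using coordinates_exist[of ?P ?Q ?R ?R] assms by auto
  note L = coordinatesD[OF this]
  have Q: "amul A b (astar A a) = L 0 1 0 0" using L(5) assms(3) by simp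
  have "amul A ?u (astar A ?u) = vadd A ?P ?R" "amul A ?v (astar A ?v) = vadd A ?P ?R"
    using assms(1,2) by (simp_all add: algebra_expand) (simp_all add: L(1,2,4,5,6) Q)
  then have *: "(vnorm A ?u)\<^sup>2 = vnorm A (vadd A ?P ?R)" "(vnorm A ?v)\<^sup>2 = vnorm A (vadd A ?P ?R)"
    using vnorm_amul_astar[of ?u] vnorm_amul_astar[of ?v] assms(1,2) by simp_all
  then show "(vnorm A ?u)\<^sup>2 = vnorm A (vadd A ?P ?R)" by blast
  have uv: "vnorm A ?u = vnorm A ?v"
    using * assms(1,2) vnorm_nonneg[of ?u] vnorm_nonneg[of ?v] by (metis power2_eq_iff_nonneg vector_closed(1,3))
  obtain M where "coordinates A a b b b M" using coordinates_exist[of a b b b] assms by auto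
  note M = coordinatesD[OF this]
  have "vscale A 2 a = vadd A ?u ?v" unfolding M(4,5) by (simp add: M(1,2))
  then have "2 * vnorm A a \<le> vnorm A ?u + vnorm A ?v"
    using vnorm_scale[of a 2] vnorm_triangle[of ?u ?v] assms(1,2) by simp
  then show "vnorm A a \<le> vnorm A ?u" using uv by simp
qed

text \<open>On the spectrum this is \<open>t\<^sup>2 - t\<^sup>4/8 \<le> 7/8\<close> for \<open>\<bar>t\<bar> \<le> 1\<close>; the certificate is
  \<open>(t\<^sup>2 - t\<^sup>4/8)\<^sup>2 + (t - t\<^sup>3)\<^sup>2/4 = t\<^sup>2/4 + t\<^sup>4/2 + t\<^sup>8/64\<close>.\<close>

lemma vnorm_square_minus:
  assumes b: "b \<in> carrier A" "astar A b = b" "vnorm A b \<le> 1"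
  defines "x \<equiv> amul A b b"
  shows "vnorm A (vsub A x (vscale A (1/8) (amul A x x))) \<le> 7/8"
proof -
  let ?p = "vsub A x (vscale A (1/8) (amul A x x))"
  let ?s = "vscale A (1/2) (vsub A b (amul A b x))"
  \<comment> \<open>\<open>w3\<close> to \<open>w8\<close> are the powers of \<open>b\<close>,
    nested to the right as the associativity rules leave them, so that every word folds to a single
    name.\<close>
  define w3 where "w3 = amul A b x"
  define w4 where "w4 = amul A b w3"
  define w5 where "w5 = amul A b w4"
  define w6 where "w6 = amul A b w5"
  define w7 where "w7 = amul A b w6"
  define w8 where "w8 = amul A b w7"
  have x: "x \<in> carrier A" using b(1) by (simp add: x_def)
  have w: "w3 \<in> carrier A" "w4 \<in> carrier A" "w5 \<in> carrier A" "w6 \<in> carrier A" "w7 \<in> carrier A" "w8 \<in> carrier A"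
    unfolding w3_def w4_def w5_def w6_def w7_def w8_def using b(1) x by simp_all
  note words = x_def[symmetric] w3_def[symmetric] w4_def[symmetric] w5_def[symmetric] w6_def[symmetric]
    w7_def[symmetric] w8_def[symmetric]
  have star: "astar A ?p = ?p" "astar A ?s = ?s"
    using b(1) by (simp_all add: algebra_expand x_def b(2))
  have "amul A ?p ?s = amul A ?s ?p"
  proof -
    obtain L where "coordinates A w3 w5 w7 w7 L" using coordinates_exist[of w3 w5 w7 w7] w by auto
    note L = coordinatesD[OF this]
    show ?thesis unfolding x_def using b(1)
      by (simp add: algebra_expand, simp only: words) (simp add: L(1,2,4,5,6))
  qed
  then have comm: "amul A ?p (astar A ?s) = amul A ?s (astar A ?p)" unfolding star .
  have ps: "?p \<in> carrier A" "?s \<in> carrier A" using x b(1) by simp_all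
  have sum: "vadd A (amul A ?p ?p) (amul A ?s ?s) =
      vadd A (vscale A (1/4) x) (vadd A (vscale A (1/2) w4) (vscale A (1/64) w8))"
  proof -
    obtain L where "coordinates A x w4 w6 w8 L" using coordinates_exist[of x w4 w6 w8] x w by auto
    note L = coordinatesD[OF this]
    have "vadd A (amul A ?p ?p) (amul A ?s ?s) =
      vadd A (vsub A w4 (vadd A (vscale A (1/4) w6) (vscale A (-1/64) w8)))
        (vadd A (vscale A (1/4) x) (vadd A (vscale A (-1/2) w4) (vscale A (1/4) w6)))"
      unfolding x_def using b(1)
      by (simp add: algebra_expand, simp only: words) (simp add: L(1,2,4,5,6,7))
    also have "\<dots> = vadd A (vscale A (1/4) x) (vadd A (vscale A (1/2) w4) (vscale A (1/64) w8))"
      by (simp add: L(1,2,4,5,6,7))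
    finally show ?thesis .
  qed
  have "(vnorm A ?p)\<^sup>2 \<le> (vnorm A (vadd A ?p (vscale A \<i> ?s)))\<^sup>2"
    by (rule power_mono[OF vnorm_plus_i(2)[OF ps comm] vnorm_nonneg[OF ps(1)]])
  also have "\<dots> = vnorm A (vadd A (amul A ?p ?p) (amul A ?s ?s))"
    using vnorm_plus_i(1)[OF ps comm] unfolding star .
  \<comment> \<open>The right-hand side is 49/64, exactly the square of 7/8; so the certificate
    gives the true maximum, attained at \<open>t = 1\<close>.\<close>
  also have "\<dots> \<le> 1/4 + (1/2 + 1/64)"
  proof -
    have mul: "vnorm A (amul A b c) \<le> 1" if "c \<in> carrier A" "vnorm A c \<le> 1" for c
      using norm_amul_le[OF b(1) that(1)] mult_mono[OF b(3) that(2)] vnorm_nonneg that(1) by simp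
    have "vnorm A x \<le> 1" unfolding x_def by (rule mul[OF b(1,3)])
    moreover from mul[OF x this] have "vnorm A w3 \<le> 1" by (simp add: w3_def)
    moreover from mul[OF w(1) this] have "vnorm A w4 \<le> 1" by (simp add: w4_def)
    moreover from mul[OF w(2) this] have "vnorm A w5 \<le> 1" by (simp add: w5_def)
    moreover from mul[OF w(3) this] have "vnorm A w6 \<le> 1" by (simp add: w6_def)
    moreover from mul[OF w(4) this] have "vnorm A w7 \<le> 1" by (simp add: w7_def)
    moreover from mul[OF w(5) this] have "vnorm A w8 \<le> 1" by (simp add: w8_def)
    moreover have "vnorm A (vadd A (vscale A (1/4) x) (vadd A (vscale A (1/2) w4) (vscale A (1/64) w8)))
        \<le> 1/4 * vnorm A x + (1/2 * vnorm A w4 + 1/64 * vnorm A w8)"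
      using vnorm_triangle[of "vscale A (1/4) x" "vadd A (vscale A (1/2) w4) (vscale A (1/64) w8)"]
        vnorm_triangle[of "vscale A (1/2) w4" "vscale A (1/64) w8"] x w
      by (simp add: vnorm_scale)
    ultimately show ?thesis unfolding sum by linarith
  qed
  also have "\<dots> \<le> (7/8)\<^sup>2" by (simp add: power2_eq_square)
  finally show ?thesis by (rule power2_le_imp_le) simp
qed

text \<open>The previous estimate applies to \<open>w\<close> and \<open>w b / 4\<close>, whose
  cross terms agree because \<open>b\<close> is self-adjoint. Read backwards, right multiplication
  by the inverse of \<open>1 + ib/4\<close> is a contraction.\<close>

lemma resolvent_norm:
  assumes b: "b \<in> carrier A" "astar A b = b" and w: "w \<in> carrier A"
  shows "vnorm A w \<le> vnorm A (vadd A w (amul A w (vscale A (\<i>/4) b)))"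
proof -
  have "amul A w (astar A (vscale A (1/4) (amul A w b))) = amul A (vscale A (1/4) (amul A w b)) (astar A w)"
    using b w by (simp add: algebra_expand)
  from vnorm_plus_i(2)[OF w _ this] show ?thesis using b w by (simp add: algebra_expand)
qed

text \<open>Here \<open>h = b (1 + ib/4)^-1\<close>, and on the spectrum
  \<open>|h|^2 = t^2 / (1 + t^2/16)\<close>, which is at most 16/17 for \<open>|t| <= 1\<close>. The
  algebraic substitute: with \<open>x = b^2\<close>, the element \<open>G = h h^*\<close> satisfies
  \<open>G + G x / 16 = x\<close>. Substituting this relation into itself gives
  \<open>G = x - x^2/16 + G x^2/256\<close>, so the norm of \<open>G\<close> is at most 15/16 plus
  1/256 of itself, which is precisely the bound 16/17.\<close>

lemma resolvent_square_norm:
  assumes b: "b \<in> carrier A" "astar A b = b" "vnorm A b \<le> 1" and h: "h \<in> carrier A"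
    and eq: "vadd A h (amul A h (vscale A (\<i>/4) b)) = b"
  shows "(vnorm A h)\<^sup>2 \<le> 16/17"
proof -
  have eq': "vadd A h (vscale A (\<i>/4) (amul A h b)) = b" using eq b h by (simp add: algebra_expand)
  \<comment> \<open>Multiplying the equation for \<open>h\<close> by \<open>b\<close> on either side
    and subtracting gives \<open>f = -(i/4) f b\<close>. Hence the norm of the commutator
    \<open>f\<close> is at most a quarter of itself, and \<open>f\<close> vanishes.\<close>
  define f where "f = vsub A (amul A h b) (amul A b h)"
  have f: "f \<in> carrier A" using b h by (simp add: f_def)
  have comm: "amul A h b = amul A b h"
  proof -
    define bb hb bh where "bb = amul A b b" and "hb = amul A h b" and "bh = amul A b h"
    define hbb bhb where "hbb = amul A h bb" and "bhb = amul A b hb"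
    note words = bb_def[symmetric] hb_def[symmetric] bh_def[symmetric] hbb_def[symmetric] bhb_def[symmetric]
    have cl: "bb \<in> carrier A" "hb \<in> carrier A" "bh \<in> carrier A" "hbb \<in> carrier A" "bhb \<in> carrier A"
      unfolding bb_def hb_def bh_def hbb_def bhb_def using b h by simp_all
    have 1: "vadd A hb (vscale A (\<i>/4) hbb) = bb"
      using arg_cong[OF eq', of "\<lambda>y. amul A y b"] b h by (simp add: algebra_expand, simp only: words)
    have 2: "vadd A bh (vscale A (\<i>/4) bhb) = bb"
      using arg_cong[OF eq', of "\<lambda>y. amul A b y"] b h by (simp add: algebra_expand, simp only: words)
    obtain L where "coordinates A hb bh hbb bhb L" using coordinates_exist[of hb bh hbb bhb] cl by auto
    note L = coordinatesD[OF this]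
    have fb: "amul A f b = vsub A hbb bhb"
      unfolding f_def using b h by (simp add: algebra_expand, simp only: words)
    have "f = vadd A (vsub A (vadd A hb (vscale A (\<i>/4) hbb)) (vadd A bh (vscale A (\<i>/4) bhb)))
        (vscale A (-\<i>/4) (amul A f b))"
      unfolding fb unfolding f_def words by (simp add: L(1,2,4,5,6,7))
    then have "f = vadd A (vsub A bb bb) (vscale A (-\<i>/4) (amul A f b))" unfolding 1 2 .
    then have "f = vscale A (-\<i>/4) (amul A f b)" using b f cl by simp
    then have "vnorm A f = 1/4 * vnorm A (amul A f b)"
      using vnorm_scale[of "amul A f b" "-\<i>/4"] b f by simp
    also have "\<dots> \<le> 1/4 * vnorm A f"
      using norm_amul_le[OF f b(1)] mult_left_mono[OF b(3) vnorm_nonneg[OF f]] by simp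
    finally have "vnorm A f = 0" using vnorm_nonneg[OF f] by linarith
    then have "f = vzero A" using vnorm_eq_zero[OF f] by blast
    then show ?thesis using vsub_eq_zero[of "amul A h b" "amul A b h"] b h unfolding f_def by simp
  qed
  have comm': "amul A b (astar A h) = amul A (astar A h) b"
    using arg_cong[OF comm, of "astar A"] b h by (simp add: astar_amul)
  define x where "x = amul A b b"
  define G where "G = amul A h (astar A h)"
  have x: "x \<in> carrier A" and G: "G \<in> carrier A" using b h by (simp_all add: x_def G_def)
  \<comment> \<open>Replace \<open>b\<close> by \<open>h + (i/4) h b\<close> in
    \<open>b b^*\<close>. The cross terms cancel, and \<open>h b b h^*\<close> equals
    \<open>G x\<close> because \<open>b\<close> commutes with the adjoint of
    \<open>h\<close>.\<close>
  have xG: "x = vadd A G (vscale A (1/16) (amul A G x))"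
  proof -
    have hbbh: "amul A h (amul A b (amul A b (astar A h))) = amul A G x"
    proof -
      have "amul A b (amul A b (astar A h)) = amul A (amul A b (astar A h)) b"
        using amul_assoc[of b "astar A h" b] b h by (simp add: comm')
      also have "\<dots> = amul A (astar A h) x" unfolding comm' x_def using b h by (simp add: amul_assoc)
      finally show ?thesis using b h by (simp add: G_def x_def amul_assoc)
    qed
    have hbh: "amul A h (amul A b (astar A h)) \<in> carrier A" using b h by simp
    have "x = amul A (vadd A h (vscale A (\<i>/4) (amul A h b))) (astar A (vadd A h (vscale A (\<i>/4) (amul A h b))))"
      unfolding eq' x_def b(2) ..
    also have "\<dots> = vadd A G (vscale A (1/16) (amul A G x))"
    proof -
      obtain L where "coordinates A G (amul A h (amul A b (astar A h))) (amul A G x) G L"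
        using coordinates_exist[OF G hbh _ G, of "amul A G x"] G x by auto
      note L = coordinatesD[OF this]
      show ?thesis using b h by (simp add: algebra_expand hbbh G_def[symmetric]) (unfold L(6), unfold L(4,5), simp add: L(1,2))
    qed
    finally show ?thesis .
  qed
  let ?q = "vsub A x (vscale A (1/16) (amul A x x))"
  have "G = vadd A ?q (vscale A (1/256) (amul A G (amul A x x)))"
  proof -
    define Gx Gxx where "Gx = amul A G x" and "Gxx = amul A G (amul A x x)"
    have cl: "Gx \<in> carrier A" "Gxx \<in> carrier A" using x G by (simp_all add: Gx_def Gxx_def)
    have xx: "amul A x x = vadd A Gx (vscale A (1/16) Gxx)"
      using arg_cong[OF xG, of "\<lambda>y. amul A y x"] x G by (simp add: algebra_expand Gx_def Gxx_def)
    obtain L where "coordinates A G Gx Gxx G L" using coordinates_exist[of G Gx Gxx G] cl G by auto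
    note L = coordinatesD[OF this]
    have "?q = vsub A (vadd A G (vscale A (1/16) Gx)) (vscale A (1/16) (vadd A Gx (vscale A (1/16) Gxx)))"
      using xG xx unfolding Gx_def by presburger
    then show ?thesis unfolding Gxx_def[symmetric] unfolding L(4,5,6) by (simp add: L(1,2))
  qed
  then have "vnorm A G \<le> vnorm A ?q + 1/256 * vnorm A (amul A G (amul A x x))"
    using vnorm_triangle[of ?q "vscale A (1/256) (amul A G (amul A x x))"] x G by (simp add: vnorm_scale)
  \<comment> \<open>Since 1/16 is half of 1/8, \<open>?q\<close> is the mean of \<open>x\<close> and
    \<open>x - x^2/8\<close>, which gives 1/2 + 7/16 = 15/16.\<close>
  moreover have "vnorm A ?q \<le> 15/16"
  proof -
    let ?r = "vsub A x (vscale A (1/8) (amul A x x))"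
    obtain L where "coordinates A x (amul A x x) x x L" using coordinates_exist[of x "amul A x x" x x] x by auto
    note L = coordinatesD[OF this]
    have "?q = vadd A (vscale A (1/2) x) (vscale A (1/2) ?r)" unfolding L(5) unfolding L(4) by (simp add: L(1,2))
    then have "vnorm A ?q \<le> 1/2 * vnorm A x + 1/2 * vnorm A ?r"
      using vnorm_triangle[of "vscale A (1/2) x" "vscale A (1/2) ?r"] x by (simp add: vnorm_scale)
    moreover have "vnorm A x \<le> 1" using norm_amul_le[OF b(1) b(1)] mult_mono[OF b(3) b(3)] vnorm_nonneg b(1)
      by (simp add: x_def)
    ultimately show ?thesis using vnorm_square_minus[OF b] by (simp add: x_def)
  qed
  moreover have "vnorm A (amul A G (amul A x x)) \<le> vnorm A G"
  proof -
    have "vnorm A x \<le> 1" using norm_amul_le[OF b(1) b(1)] mult_mono[OF b(3) b(3)] vnorm_nonneg b(1)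
      by (simp add: x_def)
    then have "vnorm A (amul A x x) \<le> 1"
      using norm_amul_le[OF x x] mult_mono[of "vnorm A x" 1 "vnorm A x" 1] vnorm_nonneg x by simp
    then show ?thesis
      using norm_amul_le[of G "amul A x x"] mult_left_mono[of "vnorm A (amul A x x)" 1 "vnorm A G"] vnorm_nonneg x G by simp
  qed
  ultimately have "vnorm A G \<le> 16/17" by linarith
  then show ?thesis using vnorm_amul_astar[OF h] by (simp add: G_def)
qed


end

lemma cstar_idealD:
  assumes "cstar_ideal A J"
  shows "closed_subspace A J" "csubspace A J" "J \<subseteq> carrier A" "\<And>x. x \<in> J \<Longrightarrow> x \<in> carrier A"
    "\<And>a x. \<lbrakk>a \<in> carrier A; x \<in> J\<rbrakk> \<Longrightarrow> amul A a x \<in> J"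
    "\<And>a x. \<lbrakk>a \<in> carrier A; x \<in> J\<rbrakk> \<Longrightarrow> amul A x a \<in> J"
  using assms unfolding cstar_ideal_def closed_subspace_def csubspace_def by auto

lemma cstar_idealI:
  assumes "closed_subspace A J" "\<And>a x. \<lbrakk>a \<in> carrier A; x \<in> J\<rbrakk> \<Longrightarrow> amul A a x \<in> J"
    "\<And>a x. \<lbrakk>a \<in> carrier A; x \<in> J\<rbrakk> \<Longrightarrow> amul A x a \<in> J"
  shows "cstar_ideal A J"
  using assms unfolding cstar_ideal_def closed_subspace_def by auto

text \<open>In the unitization: \<open>\<parallel>1 - e\<parallel> \<le> 1\<close>.\<close>

definition unit_contraction :: "('a, 'z) cstar_scheme \<Rightarrow> 'a \<Rightarrow> bool" where
  "unit_contraction A e \<longleftrightarrow> e \<in> carrier A \<and> (\<forall>a\<in>carrier A. vnorm A (vsub A a (amul A a e)) \<le> vnorm A a)"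

text \<open>Testing the contraction on the adjoint of \<open>e\<close> bounds the norm of
  \<open>e^* e\<close>, the square of that of \<open>e\<close>, by twice the norm of
  \<open>e\<close>. The bound 2 is what makes the sum of the \<open>2^-k e_k\<close> in the
  factorization converge.\<close>

lemma (in cstar_algebra) unit_contraction_norm:
  assumes "unit_contraction A e" shows "vnorm A e \<le> 2"
proof -
  have e: "e \<in> carrier A" using assms by (simp add: unit_contraction_def)
  let ?s = "astar A e"
  have "vnorm A (vsub A ?s (amul A ?s e)) \<le> vnorm A e"
    using assms e unfolding unit_contraction_def by (metis algebra_closed(2) vnorm_astar)
  moreover have "vsub A ?s (vsub A ?s (amul A ?s e)) = amul A ?s e"
  proof -
    obtain L where "coordinates A ?s (amul A ?s e) ?s ?s L"
      using coordinates_exist[of ?s "amul A ?s e" ?s ?s] e by auto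
    note L = coordinatesD[OF this]
    show ?thesis unfolding L(5) unfolding L(4) by (simp add: L(1,2))
  qed
  ultimately have "vnorm A (amul A ?s e) \<le> vnorm A e + vnorm A e"
    using vnorm_vsub_le[of ?s "vsub A ?s (amul A ?s e)"] e by (simp add: vnorm_astar)
  then have "vnorm A e * vnorm A e \<le> 2 * vnorm A e"
    using cstar_identity[OF e] by (simp add: power2_eq_square)
  then show ?thesis using vnorm_nonneg[OF e] by (cases "vnorm A e = 0") auto
qed

section \<open>Approximate units and factorization in Hilbert modules\<close>

context right_hilbert_module
begin

sublocale A: cstar_algebra B by (rule algebra)
sublocale X: complex_banach_space X by (rule banach)

lemma module_closed [simp, intro]:
  "\<lbrakk>x \<in> carrier X; b \<in> carrier B\<rbrakk> \<Longrightarrow> act x b \<in> carrier X"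
  "\<lbrakk>x \<in> carrier X; y \<in> carrier X\<rbrakk> \<Longrightarrow> ip x y \<in> carrier B"
  by (simp_all add: act_closed ip_closed)

lemma ip_add_left:
  "\<lbrakk>x \<in> carrier X; y \<in> carrier X; z \<in> carrier X\<rbrakk> \<Longrightarrow> ip (vadd X x y) z = vadd B (ip x z) (ip y z)"
  using ip_star[of z "vadd X x y"] by (simp add: ip_add_right A.astar_add ip_star)

lemma ip_scale_left:
  "\<lbrakk>x \<in> carrier X; y \<in> carrier X\<rbrakk> \<Longrightarrow> ip (vscale X l x) y = vscale B (cnj l) (ip x y)"
  using ip_star[of y "vscale X l x"] by (simp add: ip_scale_right A.astar_scale ip_star)

lemma ip_act_left:
  "\<lbrakk>x \<in> carrier X; y \<in> carrier X; b \<in> carrier B\<rbrakk> \<Longrightarrow> ip (act x b) y = amul B (astar B b) (ip x y)"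
  using ip_star[of y "act x b"] by (simp add: ip_act A.astar_amul ip_star)

lemmas module_expand = ip_add_left ip_add_right ip_scale_left ip_scale_right ip_act ip_act_left
  act_add_left act_add_right act_scale_left act_scale_right act_act X.vscale_add_right X.vscale_vscale
  A.algebra_expand

lemma norm_act: assumes "x \<in> carrier X" "b \<in> carrier B" shows "vnorm X (act x b) \<le> vnorm X x * vnorm B b"
proof -
  have "(vnorm X (act x b))\<^sup>2 = vnorm B (amul B (astar B b) (amul B (ip x x) b))"
    using assms ip_norm[of "act x b"] by (simp add: ip_act ip_act_left A.amul_assoc)
  also have "\<dots> \<le> vnorm B b * (vnorm B (ip x x) * vnorm B b)"
    using A.norm_amul_le[of "astar B b" "amul B (ip x x) b"] A.norm_amul_le[of "ip x x" b] assms
    by (simp add: A.vnorm_astar) (meson A.vnorm_nonneg mult_left_mono order_trans)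
  also have "\<dots> = (vnorm X x * vnorm B b)\<^sup>2"
    using ip_norm[OF assms(1)] by (simp add: power2_eq_square)
  finally show ?thesis
    by (rule power2_le_imp_le) (use assms in \<open>simp add: X.vnorm_nonneg A.vnorm_nonneg\<close>)
qed

lemma ip_polarization:
  assumes "x \<in> carrier X" "y \<in> carrier X"
  defines "q \<equiv> \<lambda>k. ip (vadd X x (vscale X k y)) (vadd X x (vscale X k y))"
  shows "vscale B 4 (ip x y) = vadd B (vsub B (q 1) (q (-1)))
    (vscale B (-\<i>) (vsub B (q \<i>) (q (-\<i>))))"
proof -
  obtain L where "coordinates B (ip x x) (ip x y) (ip y x) (ip y y) L"
    using A.coordinates_exist[of "ip x x" "ip x y" "ip y x" "ip y y"] assms by auto
  note L = coordinatesD[OF this]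
  show ?thesis using assms(1,2) unfolding q_def by (simp add: module_expand) (simp add: L(1,2,4-7))
qed

text \<open>A crude Cauchy-Schwarz inequality from polarization: for unit vectors each of the four
  vectors \<open>x + k y\<close> has norm at most 2, hence four terms of norm at most 4, divided by
  4. The result serves to make the inner product continuous, so the constant is immaterial.\<close>

lemma norm_ip_le: assumes "x \<in> carrier X" "y \<in> carrier X" shows "vnorm B (ip x y) \<le> 4 * vnorm X x * vnorm X y"
proof -
  have unit: "vnorm B (ip x y) \<le> 4" if xy: "x \<in> carrier X" "y \<in> carrier X" "vnorm X x = 1" "vnorm X y = 1" for x y
  proof -
    define q where "q = (\<lambda>k. ip (vadd X x (vscale X k y)) (vadd X x (vscale X k y)))"
    have q: "q k \<in> carrier B" for k using xy by (simp add: q_def)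
    have q4: "vnorm B (q k) \<le> 4" if "cmod k = 1" for k
    proof -
      have "vnorm X (vadd X x (vscale X k y)) \<le> 2"
        using X.vnorm_triangle[of x "vscale X k y"] xy that by (simp add: X.vnorm_scale)
      then have "(vnorm X (vadd X x (vscale X k y)))\<^sup>2 \<le> 2\<^sup>2"
        by (rule power_mono) (use xy in \<open>simp add: X.vnorm_nonneg\<close>)
      then show ?thesis using ip_norm[of "vadd X x (vscale X k y)"] xy by (simp add: q_def)
    qed
    have "4 * vnorm B (ip x y) = vnorm B (vscale B 4 (ip x y))" using xy by (simp add: A.vnorm_scale)
    also have "\<dots> = vnorm B (vadd B (vsub B (q 1) (q (-1))) (vscale B (-\<i>) (vsub B (q \<i>) (q (-\<i>)))))"
      unfolding ip_polarization[OF xy(1,2)] q_def ..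
    also have "\<dots> \<le> vnorm B (vsub B (q 1) (q (-1))) + vnorm B (vsub B (q \<i>) (q (-\<i>)))"
      using A.vnorm_triangle[of "vsub B (q 1) (q (-1))" "vscale B (-\<i>) (vsub B (q \<i>) (q (-\<i>)))"] q
      by (simp add: A.vnorm_scale)
    also have "\<dots> \<le> (4 + 4) + (4 + 4)"
      by (intro add_mono order_trans[OF A.vnorm_vsub_le] q q4) simp_all
    finally show ?thesis by simp
  qed
  show ?thesis
  proof (cases "vnorm X x = 0 \<or> vnorm X y = 0")
    case True
    have "ip (vscale X 0 x) y = vscale B 0 (ip x y)" "ip x (vscale X 0 y) = vscale B 0 (ip x y)"
      using assms by (simp_all add: module_expand)
    then have "ip x y = vzero B" using True assms X.vnorm_eq_zero
      by (auto simp: X.vscale_zero_left A.vscale_zero_left)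
    then show ?thesis using assms by (simp add: X.vnorm_nonneg)
  next
    case False
    then have pos: "vnorm X x > 0" "vnorm X y > 0" using assms X.vnorm_nonneg by (metis order_le_less)+
    let ?k = "complex_of_real (1 / vnorm X x)" and ?l = "complex_of_real (1 / vnorm X y)"
    have "vnorm B (ip (vscale X ?k x) (vscale X ?l y)) \<le> 4"
      by (rule unit) (use assms pos in \<open>simp_all add: X.vnorm_scale norm_divide\<close>)
    moreover have "vnorm B (ip (vscale X ?k x) (vscale X ?l y)) = 1 / vnorm X x * (1 / vnorm X y) * vnorm B (ip x y)"
      using assms pos by (simp add: module_expand A.vnorm_scale norm_mult norm_divide)
    ultimately have "1 / vnorm X x * (1 / vnorm X y) * vnorm B (ip x y) \<le> 4" by simp
    then show ?thesis using pos by (simp add: field_simps)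
  qed
qed

lemma act_zero [simp]: "x \<in> carrier X \<Longrightarrow> act x (vzero B) = vzero X"
  using act_scale_right[of x "vzero B" 0] by (simp add: X.vscale_zero_left)

text \<open>With \<open>w = x - x e\<close>, the square of the norm of \<open>w\<close> is that of
  \<open><w,x> - <w,x> e\<close>, so at most that of \<open><w,x>\<close>. Passing to the adjoint
  \<open><x,w> = <x,x> - <x,x> e\<close> allows the one-sided contraction to be applied a second
  time.\<close>

lemma unit_contraction_act:
  assumes "unit_contraction B e" "x \<in> carrier X"
  shows "vnorm X (vsub X x (act x e)) \<le> vnorm X x"
proof -
  have e: "e \<in> carrier B" using assms by (simp add: unit_contraction_def)
  let ?w = "vsub X x (act x e)"
  have w: "?w \<in> carrier X" using assms e by simp
  have le: "vnorm B (vsub B q (amul B q e)) \<le> vnorm B q" if "q \<in> carrier B" for q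
    using assms that by (simp add: unit_contraction_def)
  have "(vnorm X ?w)\<^sup>2 = vnorm B (vsub B (ip ?w x) (amul B (ip ?w x) e))"
    using ip_norm[OF w] ip_add_right[OF w assms(2), of "vscale X (-1) (act x e)"] w assms e
    by (simp add: ip_scale_right[OF w] ip_act[OF w])
  also have "\<dots> \<le> vnorm B (ip ?w x)" using w assms by (intro le) simp
  also have "\<dots> = vnorm B (ip x ?w)" using ip_star[OF w assms(2)] A.vnorm_astar[of "ip ?w x"] w assms by simp
  also have "\<dots> = vnorm B (vsub B (ip x x) (amul B (ip x x) e))" using assms e by (simp add: module_expand)
  also have "\<dots> \<le> vnorm B (ip x x)" using assms by (intro le) simp
  also have "\<dots> = (vnorm X x)\<^sup>2" using ip_norm assms by simp
  finally show ?thesis by (rule power2_le_imp_le) (use assms in \<open>simp add: X.vnorm_nonneg\<close>)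
qed

text \<open>Here \<open>1 - d\<close> is the resolvent \<open>(1 + ib/4)\<^sup>-\<^sup>1\<close> with \<open>b = \<langle>z, z\<rangle>\<close>.\<close>

lemma approximate_step_normalized:
  assumes J: "cstar_ideal B J" and z: "z \<in> carrier X" "ip z z \<in> J" "vnorm X z = 1"
  obtains d where "d \<in> J" "unit_contraction B d" "vnorm X (vsub X z (act z d)) \<le> 99/100"
proof -
  note J' = cstar_idealD[OF J]
  define b where "b = ip z z"
  have b: "b \<in> carrier B" "astar B b = b" "vnorm B b \<le> 1" "b \<in> J"
    using z ip_star[of z z] ip_norm[of z] by (simp_all add: b_def)
  define k where "k = vscale B (\<i>/4) b"
  have k: "k \<in> carrier B" "k \<in> J" "vnorm B k \<le> 1/4"
    using b csubspaceD(4)[OF J'(2) b(4)] by (simp_all add: k_def A.vnorm_scale norm_divide)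
  \<comment> \<open>\<open>d = k - d k\<close> is the equation of \<open>d = 1 - (1 + k)^-1\<close>
    without the unit. The iteration stays in \<open>J\<close>, so \<open>d\<close> is found in the
    ideal.\<close>
  have "\<exists>d\<in>J. d = vadd B k (vscale B (-1) (amul B d k))"
  proof (rule A.contraction_solve[OF J'(1), of "\<lambda>d. vscale B (-1) (amul B d k)" "1/4" k])
    show "vscale B (-1) (amul B x k) \<in> J" if "x \<in> J" for x
      using csubspaceD(4)[OF J'(2)] J'(6)[OF k(1) that] .
    show "vscale B (-1) (amul B (vsub B x y) k) = vsub B (vscale B (-1) (amul B x k)) (vscale B (-1) (amul B y k))"
      if "x \<in> J" "y \<in> J" for x y using J'(4)[OF that(1)] J'(4)[OF that(2)] k by (simp add: A.algebra_expand)
    show "vnorm B (vscale B (-1) (amul B x k)) \<le> 1/4 * vnorm B x" if "x \<in> J" for x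
      using A.norm_amul_le[OF J'(4)[OF that] k(1)] mult_left_mono[OF k(3) A.vnorm_nonneg[OF J'(4)[OF that]]]
        J'(4)[OF that] k(1) by (simp add: A.vnorm_scale)
  qed (use k in auto)
  then obtain d where dJ: "d \<in> J" and d: "d = vadd B k (vscale B (-1) (amul B d k))" by blast
  have dc: "d \<in> carrier B" by (rule J'(4)[OF dJ])
  have d': "vadd B d (amul B d k) = k"
    using A.vsub_add_cancel[of k "amul B d k"] d dc k by simp
  \<comment> \<open>In the unitization this is \<open>a (1 - d) (1 + k) = a\<close>.\<close>
  have res: "vadd B (vsub B a (amul B a d)) (amul B (vsub B a (amul B a d)) k) = a" if a: "a \<in> carrier B" for a
  proof -
    have 1: "vadd B (amul B a d) (amul B a (amul B d k)) = amul B a k"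
      using arg_cong[OF d', of "amul B a"] a dc k by (simp add: A.amul_add_right)
    obtain L where "coordinates B a (amul B a d) (amul B a (amul B d k)) a L"
      using A.coordinates_exist[of a "amul B a d" "amul B a (amul B d k)" a] a dc k by auto
    note L = coordinatesD[OF this]
    have "amul B (vsub B a (amul B a d)) k = vsub B (amul B a k) (amul B a (amul B d k))"
      using a dc k by (simp add: A.algebra_expand)
    then show ?thesis unfolding 1[symmetric] unfolding L(6) unfolding L(5) unfolding L(4) by (simp add: L(1,2))
  qed
  have contr: "unit_contraction B d"
    unfolding unit_contraction_def
  proof (intro conjI ballI dc)
    fix a assume a: "a \<in> carrier B"
    show "vnorm B (vsub B a (amul B a d)) \<le> vnorm B a"
      using A.resolvent_norm[OF b(1,2), of "vsub B a (amul B a d)"] res[OF a] a dc by (simp add: k_def)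
  qed
  define w where "w = vsub X z (act z d)"
  have w: "w \<in> carrier X" using z dc by (simp add: w_def)
  \<comment> \<open>\<open>h = b (1 - d)\<close> is the element bounded by
    \<open>resolvent_square_norm\<close>. It dominates \<open>c = <w,w>\<close>, because
    \<open>c (1 + k) = <w,z>\<close> is the adjoint of \<open>h\<close> and multiplication by
    \<open>1 + k\<close> does not decrease norms.\<close>
  define h where "h = ip z w"
  have h: "h \<in> carrier B" using z w by (simp add: h_def)
  have hb: "h = vsub B b (amul B b d)" unfolding h_def w_def b_def using z dc by (simp add: module_expand)
  have h2: "(vnorm B h)\<^sup>2 \<le> 16/17"
    using A.resolvent_square_norm[OF b(1-3) h] res[OF b(1)] by (simp add: hb k_def)
  define c where "c = ip w w"
  have c: "c \<in> carrier B" "astar B c = c" using w ip_star[of w w] by (simp_all add: c_def)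
  have "vadd X w (act w k) = z"
  proof -
    have 1: "vadd X (act z d) (act z (amul B d k)) = act z k"
      using arg_cong[OF d', of "act z"] z dc k by (simp add: act_add_right)
    obtain L where "coordinates X z (act z d) (act z (amul B d k)) z L"
      using X.coordinates_exist[of z "act z d" "act z (amul B d k)" z] z dc k by auto
    note L = coordinatesD[OF this]
    have "act w k = vsub X (act z k) (act z (amul B d k))"
      unfolding w_def using z dc k by (simp add: module_expand)
    then show ?thesis unfolding w_def 1[symmetric] unfolding L(6) unfolding L(5) unfolding L(4) by (simp add: L(1,2))
  qed
  then have "ip w z = vadd B c (amul B c k)"
    using w k by (metis c_def ip_act ip_add_right act_closed)
  then have "vnorm B c \<le> vnorm B (ip w z)"
    using A.resolvent_norm[OF b(1,2) c(1)] by (simp add: k_def)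
  also have "\<dots> = vnorm B h" using ip_star[OF z(1) w] A.vnorm_astar[OF h] by (simp add: h_def)
  finally have "vnorm B c \<le> vnorm B h" .
  \<comment> \<open>The fourth root of 16/17 is about 0.985, so 99/100 leaves room.\<close>
  have "(vnorm X w) ^ 4 = (vnorm B c)\<^sup>2"
    using ip_norm[OF w] power_mult[of "vnorm X w" 2 2] by (simp add: c_def)
  then have "(vnorm X w) ^ 4 \<le> 16/17"
    using h2 power_mono[OF \<open>vnorm B c \<le> vnorm B h\<close> A.vnorm_nonneg[OF c(1)], of 2] by linarith
  have "vnorm X w \<le> 99/100"
  proof (rule ccontr)
    assume "\<not> vnorm X w \<le> 99/100"
    then have "(99/100) ^ 4 \<le> (vnorm X w) ^ 4" by (intro power_mono) auto
    with \<open>(vnorm X w) ^ 4 \<le> 16/17\<close> show False by (simp add: power4_eq_xxxx)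
  qed
  then show ?thesis using that[OF dJ contr] by (simp add: w_def)
qed

text \<open>By homogeneity the step for unit vectors applies to \<open>z\<close> divided by its
  norm; the zero vector takes \<open>d = 0\<close>.\<close>

lemma approximate_step:
  assumes J: "cstar_ideal B J" and z: "z \<in> carrier X" "ip z z \<in> J"
  obtains d where "d \<in> J" "unit_contraction B d" "vnorm X (vsub X z (act z d)) \<le> 99/100 * vnorm X z"
proof (cases "z = vzero X")
  case True
  have "unit_contraction B (vzero B)" unfolding unit_contraction_def
  proof (intro conjI ballI)
    fix a assume "a \<in> carrier B"
    moreover from this have "amul B a (vzero B) = vzero B"
      using A.amul_scale_right[of a "vzero B" 0] by (simp add: A.vscale_zero_left)
    ultimately show "vnorm B (vsub B a (amul B a (vzero B))) \<le> vnorm B a" by simp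
  qed simp
  moreover have "vzero B \<in> J" using csubspaceD(2)[OF cstar_idealD(2)[OF J]] .
  ultimately show ?thesis using that True by simp
next
  case False
  then have pos: "vnorm X z > 0" using z X.vnorm_nonneg X.vnorm_eq_zero by (metis order_le_less)
  let ?k = "complex_of_real (1 / vnorm X z)"
  let ?z = "vscale X ?k z"
  have "ip ?z ?z \<in> J" using z csubspaceD(4)[OF cstar_idealD(2)[OF J]] by (simp add: module_expand)
  moreover have "vnorm X ?z = 1" using pos z by (simp add: X.vnorm_scale norm_divide)
  ultimately obtain d where d: "d \<in> J" "unit_contraction B d" "vnorm X (vsub X ?z (act ?z d)) \<le> 99/100"
    using approximate_step_normalized[OF J, of ?z] z by auto
  have dc: "d \<in> carrier B" using d(2) by (simp add: unit_contraction_def)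
  have "vsub X ?z (act ?z d) = vscale X ?k (vsub X z (act z d))"
    using z dc by (simp add: module_expand mult.commute)
  then have "1 / vnorm X z * vnorm X (vsub X z (act z d)) \<le> 99/100"
    using d(3) z dc pos by (simp add: X.vnorm_scale norm_divide)
  then show ?thesis using that d(1,2) pos by (simp add: field_simps)
qed

text \<open>The step is repeated on the residual \<open>y = z - z e\<close>, which is why
  \<open><y,y>\<close> in \<open>J\<close> is part of the induction. Two steps are combined as
  \<open>1 - f = (1 - e)(1 - d)\<close>, that is, \<open>f = e + d - e d\<close>: products of
  contractions are contractions, and each factor shrinks the residual by 99/100.\<close>

lemma approximate_unit:
  assumes J: "cstar_ideal B J" and z: "z \<in> carrier X" "ip z z \<in> J" and "\<delta> > 0"
  obtains e where "e \<in> J" "unit_contraction B e" "vnorm X (vsub X z (act z e)) < \<delta>"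
proof -
  note J' = cstar_idealD[OF J]
  have "\<exists>e\<in>J. unit_contraction B e \<and> ip (vsub X z (act z e)) (vsub X z (act z e)) \<in> J \<and>
      vnorm X (vsub X z (act z e)) \<le> (99/100) ^ Suc n * vnorm X z" for n
  proof (induction n)
    have inJ: "ip (vsub X y (act y d)) (vsub X y (act y d)) \<in> J"
      if y: "y \<in> carrier X" "ip y y \<in> J" and d: "d \<in> J" for y d
    proof -
      have dc: "d \<in> carrier B" by (rule J'(4)[OF d])
      have "vsub B (ip y y) (amul B (ip y y) d) \<in> J" 
        "vsub B (amul B (astar B d) (ip y y)) (amul B (astar B d) (amul B (ip y y) d)) \<in> J"
        using y dc J'(5,6) csubspaceD(3,4)[OF J'(2)] by simp_all
      then have "vsub B (vsub B (ip y y) (amul B (ip y y) d))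
          (vsub B (amul B (astar B d) (ip y y)) (amul B (astar B d) (amul B (ip y y) d))) \<in> J"
        using csubspaceD(3,4)[OF J'(2)] by simp
      moreover have "ip (vsub X y (act y d)) (vsub X y (act y d)) = vsub B (vsub B (ip y y) (amul B (ip y y) d))
          (vsub B (amul B (astar B d) (ip y y)) (amul B (astar B d) (amul B (ip y y) d)))"
      proof -
        obtain L where "coordinates B (ip y y) (amul B (ip y y) d) (amul B (astar B d) (ip y y))
            (amul B (astar B d) (amul B (ip y y) d)) L"
          using A.coordinates_exist[of "ip y y" "amul B (ip y y) d" "amul B (astar B d) (ip y y)"
            "amul B (astar B d) (amul B (ip y y) d)"] y dc by auto
        note L = coordinatesD[OF this]
        show ?thesis using y dc
          by (simp add: module_expand) (unfold L(7), unfold L(6), unfold L(5), unfold L(4), simp add: L(1,2))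
      qed
      ultimately show ?thesis by simp
    qed
    {
      case 0
      obtain d where d: "d \<in> J" "unit_contraction B d" "vnorm X (vsub X z (act z d)) \<le> 99/100 * vnorm X z"
        using approximate_step[OF J z] by blast
      then show ?case using inJ[OF z d(1)] by auto
    next
      case (Suc n)
      then obtain e where e: "e \<in> J" "unit_contraction B e"
        "ip (vsub X z (act z e)) (vsub X z (act z e)) \<in> J"
        "vnorm X (vsub X z (act z e)) \<le> (99/100) ^ Suc n * vnorm X z" by blast
      have ec: "e \<in> carrier B" by (rule J'(4)[OF e(1)])
      let ?y = "vsub X z (act z e)"
      have y: "?y \<in> carrier X" using z ec by simp
      obtain d where d: "d \<in> J" "unit_contraction B d" "vnorm X (vsub X ?y (act ?y d)) \<le> 99/100 * vnorm X ?y"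
        using approximate_step[OF J y e(3)] by blast
      have dc: "d \<in> carrier B" by (rule J'(4)[OF d(1)])
      define f where "f = vadd B e (vsub B d (amul B e d))"
      have f: "f \<in> J" unfolding f_def using e d csubspaceD(3,4)[OF J'(2)] J'(6)[OF dc] by simp
      have fc: "f \<in> carrier B" by (rule J'(4)[OF f])
      have zf: "vsub X z (act z f) = vsub X ?y (act ?y d)"
      proof -
        obtain L where "coordinates X z (act z e) (act z d) (act z (amul B e d)) L"
          using X.coordinates_exist[of z "act z e" "act z d" "act z (amul B e d)"] z ec dc by auto
        note L = coordinatesD[OF this]
        show ?thesis using z ec dc
          by (simp add: f_def module_expand) (unfold L(7), unfold L(6), unfold L(5), unfold L(4), simp add: L(1,2))
      qed
      have af: "vsub B a (amul B a f) = vsub B (vsub B a (amul B a e)) (amul B (vsub B a (amul B a e)) d)"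
        if a: "a \<in> carrier B" for a
      proof -
        obtain L where "coordinates B a (amul B a e) (amul B a d) (amul B a (amul B e d)) L"
          using A.coordinates_exist[of a "amul B a e" "amul B a d" "amul B a (amul B e d)"] a ec dc by auto
        note L = coordinatesD[OF this]
        show ?thesis using a ec dc
          by (simp add: f_def A.algebra_expand) (unfold L(7), unfold L(6), unfold L(5), unfold L(4), simp add: L(1,2))
      qed
      have "unit_contraction B f" unfolding unit_contraction_def
      proof (intro conjI ballI fc)
        fix a assume a: "a \<in> carrier B"
        have "vnorm B (vsub B a (amul B a f)) \<le> vnorm B (vsub B a (amul B a e))"
          unfolding af[OF a] using d(2) a ec by (simp add: unit_contraction_def)
        also have "\<dots> \<le> vnorm B a" using e(2) a by (simp add: unit_contraction_def)
        finally show "vnorm B (vsub B a (amul B a f)) \<le> vnorm B a" .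
      qed
      moreover have "vnorm X (vsub X z (act z f)) \<le> (99/100) ^ Suc (Suc n) * vnorm X z"
        unfolding zf using d(3) e(4) by simp
      ultimately show ?case using f inJ[OF y e(3) d(1)] zf by (intro bexI[of _ f]) auto
    }
  qed
  moreover have "(\<lambda>n. (99/100) ^ Suc n * vnorm X z) \<longlonglongrightarrow> 0 * vnorm X z"
    by (rule tendsto_mult[OF LIMSEQ_Suc[OF LIMSEQ_power_zero] tendsto_const]) simp
  then have "\<forall>\<^sub>F n in sequentially. (99/100) ^ Suc n * vnorm X z < \<delta>"
    by (rule order_tendstoD(2)) (use \<open>\<delta> > 0\<close> in simp)
  then obtain n where n: "(99/100) ^ Suc n * vnorm X z < \<delta>" by (auto simp: eventually_sequentially)
  moreover from calculation(1)[of n] obtain e where "e \<in> J" "unit_contraction B e"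
    "vnorm X (vsub X z (act z e)) \<le> (99/100) ^ Suc n * vnorm X z" by blast
  ultimately show ?thesis using that[of e] by linarith
qed

text \<open>\<open>z\<close> is a limit of vectors \<open>z e\<close>. Most later uses of
  approximate units have this form: membership in a closed subspace need only be shown for the
  \<open>z e\<close>.\<close>

lemma approximate_unit_mem:
  assumes J: "cstar_ideal B J" and z: "z \<in> carrier X" "ip z z \<in> J" and W: "closed_subspace X W"
    and act: "\<And>e. e \<in> J \<Longrightarrow> act z e \<in> W"
  shows "z \<in> W"
proof (rule X.closed_subspace_limit[OF W z(1)])
  fix \<epsilon> :: real assume "\<epsilon> > 0"
  from approximate_unit[OF J z this] show "\<exists>y\<in>W. vnorm X (vsub X z y) < \<epsilon>" using act by metis
qed

text \<open>This is the submodule \<open>X J\<close>, described so that its closedness is evident;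
  that it equals the plain span of products is the content of the factorization theorem.\<close>

definition ideal_part :: "'b set \<Rightarrow> 'x set" where
  "ideal_part J = {y \<in> carrier X. \<forall>x\<in>carrier X. ip x y \<in> J}"

lemma closed_subspace_ip_vimage:
  assumes x: "x \<in> carrier X" and W: "closed_subspace B W"
  shows "closed_subspace X {y \<in> carrier X. ip x y \<in> W}"
  by (rule closed_subspace_vimage[where K = "4 * vnorm X x", OF X.complex_banach_space_axioms A.complex_banach_space_axioms _ _ _ _ _ W])
    (use x norm_ip_le in \<open>auto simp: ip_add_right ip_scale_right\<close>)

text \<open>If \<open><y,y>\<close> lies in \<open>J\<close>, then \<open>y\<close> is a limit of
  vectors \<open>y e\<close>, and \<open><x, y e> = <x,y> e\<close> lies in
  \<open>J\<close>.\<close>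

lemma ideal_part_iff:
  assumes J: "cstar_ideal B J" shows "y \<in> ideal_part J \<longleftrightarrow> y \<in> carrier X \<and> ip y y \<in> J"
proof (intro iffI conjI)
  note J' = cstar_idealD[OF J]
  assume y: "y \<in> carrier X \<and> ip y y \<in> J"
  have "ip x y \<in> J" if x: "x \<in> carrier X" for x
  proof -
    have "y \<in> {y \<in> carrier X. ip x y \<in> J}"
      by (rule approximate_unit_mem[OF J _ _ closed_subspace_ip_vimage[OF x J'(1)]])
        (use y x J' in \<open>auto simp: ip_act\<close>)
    then show ?thesis by simp
  qed
  then show "y \<in> ideal_part J" using y by (simp add: ideal_part_def)
qed (auto simp: ideal_part_def)

lemma closed_subspace_ideal_part:
  assumes J: "cstar_ideal B J" shows "closed_subspace X (ideal_part J)"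
proof -
  have "ideal_part J = (\<Inter>x\<in>carrier X. {y \<in> carrier X. ip x y \<in> J})"
    by (auto simp: ideal_part_def intro: X.vzero_closed)
  then show ?thesis
    using X.closed_subspace_INT[of "carrier X" "\<lambda>x. {y \<in> carrier X. ip x y \<in> J}"]
      closed_subspace_ip_vimage[OF _ cstar_idealD(1)[OF J]] X.vzero_closed by auto
qed

text \<open>This is Cohen's factorization argument. The elements \<open>2\<^sup>-\<^sup>n + c\<^sub>n\<close> of the unitization with
  \<open>c\<^sub>n = \<Sum>\<^sub>k\<^sub><\<^sub>n 2\<^sup>-\<^sup>k\<^sup>-\<^sup>1 e\<^sub>k\<close> are invertible by the Neumann series, because \<open>\<parallel>1 - e\<^sub>k\<parallel> \<le> 1\<close>; the \<open>e\<^sub>k\<close> are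
  chosen such that \<open>z\<^sub>n = y (2\<^sup>-\<^sup>n + c\<^sub>n)\<^sup>-\<^sup>1\<close> converges.\<close>

theorem factorization:
  assumes J: "cstar_ideal B J" and y: "y \<in> ideal_part J"
  obtains z a where "z \<in> ideal_part J" "a \<in> J" "y = act z a"
proof -
  note J' = cstar_idealD[OF J]
  note Y = closed_subspace_ideal_part[OF J]
  note Y' = csubspaceD[OF X.closed_subspaceD(1)[OF Y]]
  have Yact: "act x b \<in> ideal_part J" if "x \<in> ideal_part J" "b \<in> carrier B" for x b
    using that J'(6) by (auto simp: ideal_part_def ip_act)
  define s :: "nat \<Rightarrow> real" where "s n = (1/2) ^ n" for n
  \<comment> \<open>For \<open>p = (c, z)\<close> at stage \<open>n\<close>, the invariant reads
    \<open>y = z (s + c)\<close> with \<open>s = 2^-n\<close>, together with the bound that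
    \<open>s + c\<close>, acting from the right, is within \<open>1 - s\<close> of the identity.
    \<open>Q\<close> makes both increments at most \<open>2^-n\<close>.\<close>
  define P where "P n p \<longleftrightarrow> fst p \<in> J \<and> snd p \<in> ideal_part J \<and>
    y = vadd X (vscale X (s n) (snd p)) (act (snd p) (fst p)) \<and>
    (\<forall>x\<in>carrier X. vnorm X (vsub X (vscale X (1 - s n) x) (act x (fst p))) \<le> (1 - s n) * vnorm X x)" for n p
  define Q where "Q n p p' \<longleftrightarrow> vnorm B (vsub B (fst p') (fst p)) \<le> s n \<and> vnorm X (vsub X (snd p') (snd p)) \<le> s n"
    for n p p'
  have "\<exists>f. \<forall>n. P n (f n) \<and> Q n (f n) (f (Suc n))"
  proof (rule dependent_nat_choice)
    have "P 0 (vzero B, y)" unfolding P_def s_def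
      using csubspaceD(2)[OF J'(2)] y Y'(5)[OF y] by (simp add: X.vscale_one X.vscale_zero_left)
    then show "\<exists>p. P 0 p" ..
    fix p n assume "P n p"
    then obtain c z where p: "p = (c, z)" and c: "c \<in> J" and z: "z \<in> ideal_part J"
      and yz: "y = vadd X (vscale X (s n) z) (act z c)"
      and bd: "\<And>x. x \<in> carrier X \<Longrightarrow> vnorm X (vsub X (vscale X (1 - s n) x) (act x c)) \<le> (1 - s n) * vnorm X x"
      unfolding P_def by (cases p) auto
    have zc: "z \<in> carrier X" and cc: "c \<in> carrier B" using Y'(5)[OF z] J'(4)[OF c] by auto
    define t where "t = s (Suc n)"
    have st: "s n = 2 * t" and t: "t > 0" "t \<le> 1"
      using power_le_one[of "1/2::real" n] by (simp_all add: s_def t_def)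
    have "ip z z \<in> J" using z ideal_part_iff[OF J] by blast
    then obtain e where e: "e \<in> J" "unit_contraction B e" "vnorm X (vsub X z (act z e)) < s n"
      using approximate_unit[OF J zc, of "s n"] by (auto simp: s_def)
    have ec: "e \<in> carrier B" by (rule J'(4)[OF e(1)])
    define c' where "c' = vadd B c (vscale B t e)"
    have c': "c' \<in> J" using c e csubspaceD(3,4)[OF J'(2)] by (simp add: c'_def)
    have cc': "c' \<in> carrier B" by (rule J'(4)[OF c'])
    \<comment> \<open>As \<open>s = 2 t\<close>, the old bound \<open>1 - s\<close> and
      \<open>t\<close> times the contraction \<open>x - x e\<close> add up exactly to the new bound
      \<open>1 - t\<close>.\<close>
    have bd': "vnorm X (vsub X (vscale X (1 - t) x) (act x c')) \<le> (1 - t) * vnorm X x" if x: "x \<in> carrier X" for x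
    proof -
      have "vsub X (vscale X (1 - t) x) (act x c') =
          vadd X (vsub X (vscale X (1 - s n) x) (act x c)) (vscale X t (vsub X x (act x e)))"
      proof -
        obtain L where "coordinates X x (act x c) (act x e) x L"
          using X.coordinates_exist[of x "act x c" "act x e" x] x cc ec by auto
        note L = coordinatesD[OF this]
        show ?thesis unfolding st c'_def using x cc ec
          by (simp add: module_expand) (unfold L(6), unfold L(5), unfold L(4), simp add: L(1,2))
      qed
      also have "vnorm X \<dots> \<le> (1 - s n) * vnorm X x + t * vnorm X x"
      proof (rule order_trans[OF X.vnorm_triangle add_mono])
        show "vnorm X (vscale X t (vsub X x (act x e))) \<le> t * vnorm X x"
          using unit_contraction_act[OF e(2) x] t x ec by (simp add: X.vnorm_scale)
      qed (use bd[OF x] x cc ec in simp_all)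
      finally show ?thesis by (simp add: st algebra_simps)
    qed
    \<comment> \<open>For \<open>z + u\<close> to satisfy \<open>y = (z + u)(t + c')\<close>, the
      correction must solve \<open>u (t + c') = t (z - z e)\<close>. This is the fixed point
      equation \<open>u = t v + u (1 - t - c')\<close>, contracting with factor
      \<open>1 - t\<close>. Its estimate loses a factor \<open>1/t\<close>, which the
      \<open>t\<close> in front of \<open>v\<close> compensates, so \<open>u\<close> is no larger
      than \<open>v\<close>.\<close>
    let ?v = "vsub X z (act z e)"
    have v: "?v \<in> ideal_part J" using z Yact[OF z ec] Y'(3,4) by simp
    obtain u where u: "u \<in> ideal_part J"
      "u = vadd X (vscale X t ?v) (vsub X (vscale X (1 - t) u) (act u c'))"
      "(1 - (1 - t)) * vnorm X u \<le> vnorm X (vscale X t ?v)"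
    proof (rule X.contraction_solve[OF Y, of "\<lambda>u. vsub X (vscale X (1 - t) u) (act u c')" "1 - t" "vscale X t ?v"])
      show "vsub X (vscale X (1 - t) x) (act x c') \<in> ideal_part J" if "x \<in> ideal_part J" for x
        using that Yact[OF that cc'] Y'(3,4) by simp
      show "vsub X (vscale X (1 - t) (vsub X x x')) (act (vsub X x x') c') =
          vsub X (vsub X (vscale X (1 - t) x) (act x c')) (vsub X (vscale X (1 - t) x') (act x' c'))"
        if "x \<in> ideal_part J" "x' \<in> ideal_part J" for x x'
      proof -
        note xx = Y'(5)[OF that(1)] Y'(5)[OF that(2)]
        obtain L where "coordinates X x x' (act x c') (act x' c') L"
          using X.coordinates_exist[of x x' "act x c'" "act x' c'"] xx cc' by auto
        note L = coordinatesD[OF this]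
        show ?thesis using xx cc'
          by (simp add: module_expand) (unfold L(7), unfold L(6), unfold L(5), unfold L(4), simp add: L(1,2))
      qed
      show "vnorm X (vsub X (vscale X (1 - t) x) (act x c')) \<le> (1 - t) * vnorm X x" if "x \<in> ideal_part J" for x
        by (rule bd'[OF Y'(5)[OF that]])
      show "vscale X t ?v \<in> ideal_part J" using v Y'(4) by simp
    qed (use t in auto)
    have uc: "u \<in> carrier X" by (rule Y'(5)[OF u(1)])
    have "t * vnorm X u \<le> t * vnorm X ?v" using u(3) t Y'(5)[OF v] by (simp add: X.vnorm_scale)
    then have un: "vnorm X u \<le> s n" using t e(3) by simp
    have eq: "vadd X (vscale X t u) (act u c') = vscale X t ?v"
    proof -
      let ?w = "vscale X t ?v"
      have wc: "?w \<in> carrier X" using Y'(5)[OF v] by simp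
      obtain L where "coordinates X u (act u c') ?w u L"
        using X.coordinates_exist[OF uc _ wc uc, of "act u c'"] uc cc' by auto
      note L = coordinatesD[OF this]
      have "?w = vsub X (vadd X u (act u c')) (vscale X (1 - t) u)"
      proof -
        have "vsub X (vadd X ?w (vsub X (vscale X (1 - t) u) (act u c'))) u = vzero X"
          using u(2) uc by simp
        moreover have "?w = vadd X (vsub X (vadd X ?w (vsub X (vscale X (1 - t) u) (act u c'))) u)
           (vsub X (vadd X u (act u c')) (vscale X (1 - t) u))"
          unfolding L(6) unfolding L(5) unfolding L(4) by (simp add: L(1,2))
        ultimately show ?thesis using uc cc' by simp
      qed
      also have "\<dots> = vadd X (vscale X t u) (act u c')"
        unfolding L(5) unfolding L(4) by (simp add: L(1,2))
      finally show ?thesis ..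
    qed
    have "P (Suc n) (c', vadd X z u)"
      unfolding P_def fst_conv snd_conv t_def[symmetric]
    proof (intro conjI ballI c' bd')
      show "vadd X z u \<in> ideal_part J" by (rule Y'(3)[OF z u(1)])
      have "vadd X (vscale X t (vadd X z u)) (act (vadd X z u) c') =
          vadd X (vadd X (vscale X t z) (vadd X (act z c) (vscale X t (act z e)))) (vadd X (vscale X t u) (act u c'))"
      proof -
        have 1: "act z c' = vadd X (act z c) (vscale X t (act z e))" using zc cc ec by (simp add: c'_def module_expand)
        have "vadd X (vscale X t (vadd X z u)) (act (vadd X z u) c') = vadd X (vadd X (vscale X t z) (act z c')) (vadd X (vscale X t u) (act u c'))"
          using zc uc cc' by (simp add: act_add_left X.vscale_add_right X.vadd_assoc X.vadd_left_commute)
        then show ?thesis unfolding 1 .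
      qed
      also have "\<dots> = y" unfolding eq yz st
      proof -
        obtain L where "coordinates X z (act z c) (act z e) z L"
          using X.coordinates_exist[of z "act z c" "act z e" z] zc cc ec by auto
        note L = coordinatesD[OF this]
        show "vadd X (vadd X (vscale X t z) (vadd X (act z c) (vscale X t (act z e)))) (vscale X t ?v) =
            vadd X (vscale X (complex_of_real (2 * t)) z) (act z c)"
          unfolding L(6) unfolding L(5) unfolding L(4) by (simp add: L(1,2))
      qed
      finally show "y = vadd X (vscale X t (vadd X z u)) (act (vadd X z u) c')" ..
    qed
    moreover have "Q n p (c', vadd X z u)"
    proof -
      have "vsub B c' c = vscale B t e"
      proof -
        obtain L where "coordinates B c e c c L" using A.coordinates_exist[of c e c c] cc ec by auto
        note L = coordinatesD[OF this]
        show ?thesis unfolding c'_def unfolding L(5) unfolding L(4) by (simp add: L(1,2))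
      qed
      moreover have "vsub X (vadd X z u) z = u"
      proof -
        obtain L where "coordinates X z u z z L" using X.coordinates_exist[of z u z z] zc uc by auto
        note L = coordinatesD[OF this]
        show ?thesis unfolding L(5) unfolding L(4) by (simp add: L(1,2))
      qed
      ultimately show ?thesis unfolding Q_def p
        using un A.unit_contraction_norm[OF e(2)] t ec by (simp add: A.vnorm_scale st)
    qed
    ultimately show "\<exists>p'. P (Suc n) p' \<and> Q n p p'" by blast
  qed
  then obtain f where f: "\<And>n. P n (f n)" "\<And>n. Q n (f n) (f (Suc n))" by blast
  define c z where "c n = fst (f n)" and "z n = snd (f n)" for n
  have cJ: "c n \<in> J" and zY: "z n \<in> ideal_part J" and yz: "y = vadd X (vscale X (s n) (z n)) (act (z n) (c n))" for n
    using f(1)[of n] by (simp_all add: P_def c_def z_def)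
  have cB: "c n \<in> carrier B" and zX: "z n \<in> carrier X" for n using J'(4)[OF cJ] Y'(5)[OF zY] by auto
  have step: "vnorm B (vsub B (c (Suc n)) (c n)) \<le> 1 * (1/2) ^ n"
    "vnorm X (vsub X (z (Suc n)) (z n)) \<le> 1 * (1/2) ^ n" for n
    using f(2)[of n] by (simp_all add: Q_def c_def z_def s_def)
  obtain l where l: "l \<in> J" "(\<lambda>n. vnorm B (vsub B (c n) l)) \<longlonglongrightarrow> 0"
    by (rule A.geometric_limit[OF J'(1) cJ step(1)]) simp_all
  obtain m where m: "m \<in> ideal_part J" "(\<lambda>n. vnorm X (vsub X (z n) m)) \<longlonglongrightarrow> 0"
    by (rule X.geometric_limit[OF Y zY step(2)]) simp_all
  have lB: "l \<in> carrier B" and mX: "m \<in> carrier X" using J'(4)[OF l(1)] Y'(5)[OF m(1)] by auto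
  \<comment> \<open>Both are the limit of \<open>z_n c_n\<close>: one by continuity of the action,
    the other because \<open>y - z_n c_n = 2^-n z_n\<close> with \<open>z_n\<close> bounded.\<close>
  have "act m l = y"
  proof (rule X.limit_unique[of "\<lambda>n. act (z n) (c n)"])
    show "(\<lambda>n. vnorm X (vsub X (act (z n) (c n)) (act m l))) \<longlonglongrightarrow> 0"
    proof (rule Lim_null_comparison)
      show "\<forall>\<^sub>F n in sequentially. norm (vnorm X (vsub X (act (z n) (c n)) (act m l))) \<le>
          vnorm X (vsub X (z n) m) * (vnorm B (vsub B (c n) l) + vnorm B l) + vnorm X m * vnorm B (vsub B (c n) l)"
      proof (intro always_eventually allI)
        fix n
        have "vsub X (act (z n) (c n)) (act m l) = vadd X (act (vsub X (z n) m) (c n)) (act m (vsub B (c n) l))"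
        proof -
          obtain L where "coordinates X (act (z n) (c n)) (act m l) (act m (c n)) (act m l) L"
            using X.coordinates_exist[of "act (z n) (c n)" "act m l" "act m (c n)" "act m l"] zX mX cB lB by auto
          note L = coordinatesD[OF this]
          show ?thesis using zX[of n] mX cB[of n] lB by (simp add: module_expand L(1,2,4-6))
        qed
        then have "vnorm X (vsub X (act (z n) (c n)) (act m l)) \<le>
            vnorm X (vsub X (z n) m) * vnorm B (c n) + vnorm X m * vnorm B (vsub B (c n) l)"
          using X.vnorm_triangle[of "act (vsub X (z n) m) (c n)" "act m (vsub B (c n) l)"]
            norm_act[of "vsub X (z n) m" "c n"] norm_act[of m "vsub B (c n) l"] zX[of n] mX cB[of n] lB by simp
        moreover have "vnorm B (c n) \<le> vnorm B (vsub B (c n) l) + vnorm B l"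
          using A.vnorm_triangle[of "vsub B (c n) l" l] A.vsub_add_cancel[of "c n" l] cB[of n] lB by simp
        then have "vnorm X (vsub X (z n) m) * vnorm B (c n) \<le> vnorm X (vsub X (z n) m) * (vnorm B (vsub B (c n) l) + vnorm B l)"
          using zX mX by (intro mult_left_mono X.vnorm_nonneg) auto
        ultimately show "norm (vnorm X (vsub X (act (z n) (c n)) (act m l))) \<le>
          vnorm X (vsub X (z n) m) * (vnorm B (vsub B (c n) l) + vnorm B l) + vnorm X m * vnorm B (vsub B (c n) l)"
          using zX cB mX lB by (simp add: X.vnorm_nonneg)
      qed
      show "(\<lambda>n. vnorm X (vsub X (z n) m) * (vnorm B (vsub B (c n) l) + vnorm B l) + vnorm X m * vnorm B (vsub B (c n) l)) \<longlonglongrightarrow> 0"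
        using tendsto_add[OF tendsto_mult[OF m(2) tendsto_add[OF l(2) tendsto_const]] tendsto_mult_left[OF l(2)]] by simp
    qed
    show "(\<lambda>n. vnorm X (vsub X (act (z n) (c n)) y)) \<longlonglongrightarrow> 0"
    proof (rule Lim_null_comparison)
      show "\<forall>\<^sub>F n in sequentially. norm (vnorm X (vsub X (act (z n) (c n)) y)) \<le> s n * (vnorm X (vsub X (z n) m) + vnorm X m)"
      proof (intro always_eventually allI)
        fix n
        have "0 \<le> s n" by (simp add: s_def)
        have "vsub X (act (z n) (c n)) y = vscale X (- s n) (z n)"
        proof -
          obtain L where "coordinates X (z n) (act (z n) (c n)) (z n) (z n) L"
            using X.coordinates_exist[of "z n" "act (z n) (c n)" "z n" "z n"] zX cB by auto
          note L = coordinatesD[OF this]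
          show ?thesis unfolding yz[of n] unfolding L(5) unfolding L(4) by (simp add: L(1,2))
        qed
        then have "vnorm X (vsub X (act (z n) (c n)) y) = s n * vnorm X (z n)"
          using zX \<open>0 \<le> s n\<close> by (simp add: X.vnorm_scale)
        moreover have "vnorm X (z n) \<le> vnorm X (vsub X (z n) m) + vnorm X m"
          using X.vnorm_triangle[of "vsub X (z n) m" m] X.vsub_add_cancel[of "z n" m] zX[of n] mX by simp
        ultimately show "norm (vnorm X (vsub X (act (z n) (c n)) y)) \<le> s n * (vnorm X (vsub X (z n) m) + vnorm X m)"
          using zX by (simp add: X.vnorm_nonneg s_def mult_left_mono)
      qed
      have "s \<longlonglongrightarrow> 0" unfolding s_def by (rule LIMSEQ_power_zero) simp
      from tendsto_mult[OF this tendsto_add[OF m(2) tendsto_const[of "vnorm X m"]]]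
      show "(\<lambda>n. s n * (vnorm X (vsub X (z n) m) + vnorm X m)) \<longlonglongrightarrow> 0" by simp
    qed
    show "act (z n) (c n) \<in> carrier X" for n using zX cB by simp
    show "act m l \<in> carrier X" "y \<in> carrier X" using mX lB Y'(5)[OF y] by simp_all
  qed
  then show ?thesis using that[OF m(1) l(1)] by simp
qed

text \<open>Each element of the closed submodule is a single product, so the linear span needs no
  closure.\<close>

lemma ideal_part_eq_prod_span:
  assumes J: "cstar_ideal B J" shows "prod_span X act (carrier X) J = ideal_part J"
proof
  show "prod_span X act (carrier X) J \<subseteq> ideal_part J"
    by (rule prod_span_least[OF _ X.closed_subspaceD(1)[OF closed_subspace_ideal_part[OF J]]])
      (use cstar_idealD[OF J] in \<open>auto simp: ideal_part_def ip_act\<close>)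
  show "ideal_part J \<subseteq> prod_span X act (carrier X) J"
  proof
    fix y assume "y \<in> ideal_part J"
    then obtain z a where "z \<in> ideal_part J" "a \<in> J" "y = act z a" using factorization[OF J] by blast
    then show "y \<in> prod_span X act (carrier X) J"
      using prod_span_base[of z "carrier X" a J act X] by (auto simp: ideal_part_def)
  qed
qed

end

section \<open>Opposite algebras and sub-bimodules\<close>

lemma nclosure_cong:
  assumes "carrier V = carrier V'" "vadd V = vadd V'" "vscale V = vscale V'" "vnorm V = vnorm V'"
  shows "nclosure V = nclosure V'"
  unfolding nclosure_def vdist_def assms ..

lemma csubspace_cong:
  assumes "carrier V = carrier V'" "vadd V = vadd V'" "vscale V = vscale V'" "vzero V = vzero V'"
  shows "csubspace V = csubspace V'"
  unfolding csubspace_def assms ..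

lemma prod_span_cong:
  assumes "carrier V = carrier V'" "vadd V = vadd V'" "vscale V = vscale V'" "vzero V = vzero V'"
  shows "prod_span V m = prod_span V' m"
  unfolding prod_span_def[abs_def] cspan_def csubspace_cong[OF assms] ..

lemma prod_span_flip: "prod_span V m S Y = prod_span V (\<lambda>x a. m a x) Y S"
  unfolding prod_span_def by (rule arg_cong[where f = "cspan V"]) blast

text \<open>The span inside \<open>W\<close> is a hull over fewer subspaces; intersecting an
  arbitrary one with \<open>W\<close> shows that nothing is lost.\<close>

lemma cspan_restrict:
  assumes "csubspace V W" "S \<subseteq> W" shows "cspan (V\<lparr>carrier := W\<rparr>) S = cspan V S"
proof -
  note W = csubspaceD[OF assms(1)]
  have sub: "csubspace (V\<lparr>carrier := W\<rparr>) U \<longleftrightarrow> U \<subseteq> W \<and> csubspace V U" for U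
    using W(1) by (auto simp: csubspace_def)
  show ?thesis
  proof
    show "cspan V S \<subseteq> cspan (V\<lparr>carrier := W\<rparr>) S"
      unfolding cspan_def hull_def sub by blast
    have "cspan (V\<lparr>carrier := W\<rparr>) S \<subseteq> U" if U: "csubspace V U" "S \<subseteq> U" for U
    proof -
      have "csubspace (V\<lparr>carrier := W\<rparr>) (U \<inter> W)"
        unfolding sub using U(1) assms(1) by (auto simp: csubspace_def)
      with U(2) assms(2) have "cspan (V\<lparr>carrier := W\<rparr>) S \<subseteq> U \<inter> W" by (intro cspan_least) auto
      then show ?thesis by blast
    qed
    then show "cspan (V\<lparr>carrier := W\<rparr>) S \<subseteq> cspan V S" unfolding cspan_def[of V] hull_def by blast
  qed
qed

text \<open>A left module is a right module over the opposite algebra, so approximation,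
  factorization and restriction are proved on one side only.\<close>

definition opp_alg :: "('a, 'z) cstar_scheme \<Rightarrow> ('a, 'z) cstar_scheme" where
  "opp_alg A = A\<lparr>amul := \<lambda>a b. amul A b a\<rparr>"

lemma opp_alg_simps [simp]:
  "carrier (opp_alg A) = carrier A" "vadd (opp_alg A) = vadd A" "vzero (opp_alg A) = vzero A"
  "vscale (opp_alg A) = vscale A" "vnorm (opp_alg A) = vnorm A" "amul (opp_alg A) a b = amul A b a"
  "astar (opp_alg A) = astar A" "opp_alg (opp_alg A) = A"
  "nclosure (opp_alg A) = nclosure A" "csubspace (opp_alg A) = csubspace A"
  "prod_span (opp_alg A) m = prod_span A m" "vdist (opp_alg A) = vdist A"
  "opp_alg (A\<lparr>carrier := J\<rparr>) = (opp_alg A)\<lparr>carrier := J\<rparr>"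
proof -
  have eq: "carrier (opp_alg A) = carrier A" "vadd (opp_alg A) = vadd A" "vzero (opp_alg A) = vzero A"
    "vscale (opp_alg A) = vscale A" "vnorm (opp_alg A) = vnorm A"
    by (simp_all add: opp_alg_def)
  show "nclosure (opp_alg A) = nclosure A" by (rule nclosure_cong[OF eq(1,2,4,5)])
  show "csubspace (opp_alg A) = csubspace A" by (rule csubspace_cong[OF eq(1,2,4,3)])
  show "prod_span (opp_alg A) m = prod_span A m" for m :: "'c \<Rightarrow> 'd \<Rightarrow> 'a"
    by (rule prod_span_cong[OF eq(1,2,4,3)])
  show "vdist (opp_alg A) = vdist A" by (simp add: vdist_def fun_eq_iff eq)
qed (simp_all add: opp_alg_def)

lemma closed_subspace_opp_alg [simp]: "closed_subspace (opp_alg A) = closed_subspace A"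
  by (simp add: closed_subspace_def fun_eq_iff)

lemma cstar_ideal_opp_alg [simp]: "cstar_ideal (opp_alg A) = cstar_ideal A"
  by (auto simp: cstar_ideal_def fun_eq_iff)

lemma complex_banach_space_opp_alg:
  assumes "complex_banach_space A" shows "complex_banach_space (opp_alg A)"
proof -
  interpret complex_banach_space A by fact
  show ?thesis
    by (rule complex_banach_space.intro)
      (auto simp: vadd_assoc vadd_commute vadd_left_commute vadd_inverse vscale_one vscale_vscale
        vscale_add_left vscale_add_right vnorm_nonneg vnorm_eq_zero vnorm_triangle vnorm_scale complete)
qed

lemma cstar_algebra_opp_alg:
  assumes "cstar_algebra A" shows "cstar_algebra (opp_alg A)"
proof -
  interpret cstar_algebra A by fact
  show ?thesis
  proof (rule cstar_algebra.intro)
    show "vnorm (opp_alg A) (amul (opp_alg A) (astar (opp_alg A) a) a) = (vnorm (opp_alg A) a)\<^sup>2"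
      if "a \<in> carrier (opp_alg A)" for a using that by (simp add: vnorm_amul_astar)
    show "vnorm (opp_alg A) (amul (opp_alg A) a b) \<le> vnorm (opp_alg A) a * vnorm (opp_alg A) b"
      if "a \<in> carrier (opp_alg A)" "b \<in> carrier (opp_alg A)" for a b
      using that norm_amul_le[of b a] by (simp add: mult.commute)
  qed (simp_all add: complex_banach_space_opp_alg banach algebra_expand)
qed

lemma cpositive_opp_alg:
  assumes "cstar_algebra A" shows "cpositive (opp_alg A) a \<longleftrightarrow> cpositive A a"
proof -
  interpret cstar_algebra A by fact
  show ?thesis unfolding cpositive_def by (auto simp: astar_astar) (metis algebra_closed(2) astar_astar)+
qed

lemma right_hilbert_module_opp:
  assumes "left_hilbert_module A X act ip"
  shows "right_hilbert_module (opp_alg A) X (\<lambda>x a. act a x) (\<lambda>x y. ip y x)"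
proof -
  interpret left_hilbert_module A X act ip by fact
  show ?thesis
    by (rule right_hilbert_module.intro)
      (simp_all add: algebra cstar_algebra_opp_alg cpositive_opp_alg banach act_closed act_add_left act_add_right
        act_scale_left act_scale_right act_act ip_closed ip_add_left ip_scale_left ip_act ip_star
        ip_positive ip_definite ip_norm)
qed

lemma left_hilbert_module_opp:
  assumes "right_hilbert_module B X act ip"
  shows "left_hilbert_module (opp_alg B) X (\<lambda>b x. act x b) (\<lambda>x y. ip y x)"
proof -
  interpret right_hilbert_module B X act ip by fact
  show ?thesis
    by (rule left_hilbert_module.intro)
      (simp_all add: algebra cstar_algebra_opp_alg cpositive_opp_alg banach act_add_left act_add_right
        act_scale_left act_scale_right act_act ip_add_right ip_scale_right ip_act ip_star
        ip_positive ip_definite ip_norm)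
qed

text \<open>The two inner products trade places with their arguments exchanged, and each
  adjointability condition becomes the other, read for the adjoint of the acting element.\<close>

lemma imprimitivity_bimodule_opp:
  assumes "imprimitivity_bimodule A B X la ra li ri"
  shows "imprimitivity_bimodule (opp_alg B) (opp_alg A) X (\<lambda>b x. ra x b) (\<lambda>x a. la a x)
    (\<lambda>x y. ri y x) (\<lambda>x y. li y x)"
proof -
  interpret imprimitivity_bimodule A B X la ra li ri by fact
  interpret L: left_hilbert_module A X la li by (rule left_module)
  interpret R: right_hilbert_module B X ra ri by (rule right_module)
  show ?thesis
  proof (rule imprimitivity_bimodule.intro)
    show "nclosure (opp_alg B) (prod_span (opp_alg B) (\<lambda>x y. ri y x) (carrier X) (carrier X)) = carrier (opp_alg B)"
      using right_full by (simp add: prod_span_flip[of _ "\<lambda>x y. ri y x"])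
    show "nclosure (opp_alg A) (prod_span (opp_alg A) (\<lambda>x y. li y x) (carrier X) (carrier X)) = carrier (opp_alg A)"
      using left_full by (simp add: prod_span_flip[of _ "\<lambda>x y. li y x"])
    show "li y (ra x a) = li (ra y (astar (opp_alg B) a)) x"
      if "a \<in> carrier (opp_alg B)" "x \<in> carrier X" "y \<in> carrier X" for a x y
      using right_adjointable[of y x "astar B a"] that by (simp add: R.A.astar_astar)
    show "ri y (la b x) = ri (la (astar (opp_alg A) b) y) x"
      if "x \<in> carrier X" "y \<in> carrier X" "b \<in> carrier (opp_alg A)" for x y b
    proof -
      interpret A: cstar_algebra A by (rule L.algebra)
      show ?thesis using left_adjointable[of "astar A b" y x] that by (simp add: A.astar_astar)
    qed
  qed (simp_all add: right_hilbert_module_opp[OF left_module] left_hilbert_module_opp[OF right_module]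
      actions_commute ip_compatible)
qed

lemma (in complex_banach_space) cstar_ideal_carrier:
  "cstar_algebra A \<Longrightarrow> cstar_ideal A (carrier A)"
  by (rule cstar_idealI)
    (auto simp: complex_banach_space.closed_subspace_carrier cstar_algebra.banach cstar_algebra.amul_closed)

section \<open>Closed ideals, and bimodules restricted to them\<close>

context cstar_algebra
begin

text \<open>As a Hilbert module over itself, the algebra inherits approximate units for its ideals
  from the module statements.\<close>

lemma self_module: "right_hilbert_module A A (amul A) (\<lambda>x y. amul A (astar A x) y)"
proof (rule right_hilbert_module.intro)
  show "x = vzero A" if "x \<in> carrier A" "amul A (astar A x) x = vzero A" for x
    using cstar_identity[OF that(1)] that vnorm_eq_zero[of x] by simp
  show "cpositive A (amul A (astar A x) x)" if "x \<in> carrier A" for x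
    using that by (auto simp: cpositive_def)
qed (simp_all add: cstar_algebra_axioms banach algebra_expand cstar_identity)

text \<open>In the module \<open>A\<close> the inner square of \<open>c\<close> is
  \<open>c^* c\<close>, so \<open>c\<close> is a limit of products \<open>c e\<close> with
  \<open>e\<close> in \<open>J\<close>.\<close>

lemma ideal_square_mem:
  assumes J: "cstar_ideal A J" and c: "c \<in> carrier A" "amul A (astar A c) c \<in> J" shows "c \<in> J"
proof -
  interpret self: right_hilbert_module A A "amul A" "\<lambda>x y. amul A (astar A x) y" by (rule self_module)
  show ?thesis
    by (rule self.approximate_unit_mem[OF J c cstar_idealD(1)[OF J]]) (rule cstar_idealD(5)[OF J c(1)])
qed

text \<open>The inner square of the adjoint of \<open>a\<close> is \<open>a a^*\<close>, which lies
  in \<open>J\<close>. Thus closed two-sided ideals are self-adjoint.\<close>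

lemma ideal_astar:
  assumes J: "cstar_ideal A J" and a: "a \<in> J" shows "astar A a \<in> J"
  by (rule ideal_square_mem[OF J])
    (use cstar_idealD[OF J] a in \<open>simp_all add: astar_astar\<close>)

lemma mem_closed_subspace_amul:
  assumes J: "cstar_ideal A J" and a: "a \<in> J" and W: "closed_subspace A W" and "\<And>e. e \<in> J \<Longrightarrow> amul A a e \<in> W"
  shows "a \<in> W"
proof -
  interpret self: right_hilbert_module A A "amul A" "\<lambda>x y. amul A (astar A x) y" by (rule self_module)
  show ?thesis
    by (rule self.approximate_unit_mem[OF J _ _ W assms(4)]) (use a cstar_idealD[OF J] in auto)
qed

lemma closed_subspace_amul_left_vimage:
  assumes "a \<in> carrier A" "closed_subspace A W" shows "closed_subspace A {b \<in> carrier A. amul A a b \<in> W}"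
  by (rule closed_subspace_vimage[where K = "vnorm A a", OF complex_banach_space_axioms complex_banach_space_axioms _ _ _ _ _ assms(2)])
    (use assms(1) norm_amul_le in \<open>auto simp: algebra_expand\<close>)

lemma closed_subspace_amul_right_vimage:
  assumes "a \<in> carrier A" "closed_subspace A W" shows "closed_subspace A {b \<in> carrier A. amul A b a \<in> W}"
  by (rule closed_subspace_vimage[where K = "vnorm A a", OF complex_banach_space_axioms complex_banach_space_axioms _ _ _ _ _ assms(2)])
    (use assms(1) norm_amul_le in \<open>auto simp: algebra_expand mult.commute\<close>)

lemma cstar_algebra_ideal:
  assumes J: "cstar_ideal A J" shows "cstar_algebra (A\<lparr>carrier := J\<rparr>)"
proof -
  note J' = cstar_idealD[OF J]
  show ?thesis
    by (rule cstar_algebra.intro)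
      (use closed_subspace_restrict[OF J'(1)] J'(4,5) ideal_astar[OF J]
        in \<open>simp_all add: algebra_expand norm_amul_le cstar_identity\<close>)
qed

end

context right_hilbert_module
begin

text \<open>This is the case where the ideal is the whole algebra: every \<open>x\<close> is a limit
  of vectors \<open>x b\<close>.\<close>

lemma nondegenerate_mem:
  assumes "x \<in> carrier X" "closed_subspace X W" "\<And>b. b \<in> carrier B \<Longrightarrow> act x b \<in> W" shows "x \<in> W"
  by (rule approximate_unit_mem[OF A.cstar_ideal_carrier[OF algebra] _ _ assms(2)]) (use assms in auto)

lemma restrict_hilbert_module:
  assumes R: "cstar_ideal B R" and Y: "closed_subspace X Y"
    and ip: "\<And>x y. \<lbrakk>x \<in> carrier X; y \<in> Y\<rbrakk> \<Longrightarrow> ip x y \<in> R"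
    and act: "\<And>x b. \<lbrakk>x \<in> carrier X; b \<in> R\<rbrakk> \<Longrightarrow> act x b \<in> Y"
  shows "right_hilbert_module (B\<lparr>carrier := R\<rparr>) (X\<lparr>carrier := Y\<rparr>) act ip"
proof -
  note R' = cstar_idealD[OF R]
  note Y' = csubspaceD(5)[OF X.closed_subspaceD(1)[OF Y]]
  \<comment> \<open>Positivity is relative to the carrier: the root \<open>c\<close> must itself lie
    in \<open>R\<close>, which follows since \<open>c^* c\<close> does.\<close>
  have pos: "cpositive (B\<lparr>carrier := R\<rparr>) (ip x x)" if x: "x \<in> Y" for x
  proof -
    obtain c where c: "c \<in> carrier B" "ip x x = amul B (astar B c) c"
      using ip_positive[OF Y'[OF x]] by (auto simp: cpositive_def)
    then have "c \<in> R" using A.ideal_square_mem[OF R c(1)] ip[OF Y'[OF x] x] by simp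
    then show ?thesis using c by (auto simp: cpositive_def)
  qed
  show ?thesis
    by (rule right_hilbert_module.intro)
      (use Y' R'(4) ip act pos A.cstar_algebra_ideal[OF R] X.closed_subspace_restrict[OF Y]
        in \<open>simp_all add: module_expand ip_star ip_definite ip_norm\<close>)
qed

text \<open>The closed span \<open>I\<close> of \<open><Y,Y>\<close> is an ideal, and
  \<open><y,y>\<close> in \<open>I\<close> forces \<open><y,x>\<close> into \<open>I\<close> for
  every \<open>x\<close> in \<open>X\<close>. For \<open>r\<close> in \<open>R\<close> one has
  \<open>r <x,x'> = <x r^*, x'>\<close> with the first vector in \<open>Y\<close>, so fullness of
  \<open>X\<close> puts \<open>r b\<close> into \<open>I\<close> for all \<open>b\<close>, and an
  approximate unit puts \<open>r\<close> there.\<close>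

lemma restrict_full:
  assumes R: "cstar_ideal B R" and Y: "closed_subspace X Y"
    and ip: "\<And>x y. \<lbrakk>x \<in> carrier X; y \<in> Y\<rbrakk> \<Longrightarrow> ip x y \<in> R"
    and act: "\<And>x b. \<lbrakk>x \<in> carrier X; b \<in> R\<rbrakk> \<Longrightarrow> act x b \<in> Y"
    and full: "nclosure B (prod_span B ip (carrier X) (carrier X)) = carrier B"
  shows "nclosure (B\<lparr>carrier := R\<rparr>) (prod_span (B\<lparr>carrier := R\<rparr>) ip Y Y) = R"
proof -
  note R' = cstar_idealD[OF R]
  note Y' = csubspaceD[OF X.closed_subspaceD(1)[OF Y]]
  \<comment> \<open>Factorization enters here: the hypotheses control only products
    \<open>x b\<close> with \<open>b\<close> in \<open>R\<close>, and these exhaust the ideal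
    part.\<close>
  have YR: "Y = ideal_part R"
  proof
    show "Y \<subseteq> ideal_part R" using Y' ip by (auto simp: ideal_part_def)
    show "ideal_part R \<subseteq> Y"
      unfolding ideal_part_eq_prod_span[OF R, symmetric]
      by (rule prod_span_least[OF act Y[THEN X.closed_subspaceD(1)]])
  qed
  have Yact: "act y b \<in> Y" if "y \<in> Y" "b \<in> carrier B" for y b
    using that R'(6) unfolding YR by (auto simp: ideal_part_def ip_act)
  have ipR: "ip y y' \<in> R" if "y \<in> Y" "y' \<in> Y" for y y' using ip that Y' by blast
  have sub: "{ip y y' | y y'. y \<in> Y \<and> y' \<in> Y} \<subseteq> R" using ipR by blast
  define I where "I = nclosure B (prod_span B ip Y Y)"
  have I: "closed_subspace B I" unfolding I_def
    by (rule A.closed_subspace_nclosure_prod_span) (use ipR R' in blast)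
  have ipI: "ip y y' \<in> I" if "y \<in> Y" "y' \<in> Y" for y y' unfolding I_def
    by (rule A.nclosure_prod_span_base) (use that ipR R' in blast)+
  have "prod_span B ip Y Y \<subseteq> R" by (rule prod_span_least[OF ipR R'(2)])
  then have eq: "nclosure (B\<lparr>carrier := R\<rparr>) (prod_span (B\<lparr>carrier := R\<rparr>) ip Y Y) = I"
    unfolding I_def prod_span_def cspan_restrict[OF R'(2) sub] by (rule A.nclosure_restrict[OF R'(1)])
  have ideal: "cstar_ideal B I"
  proof (rule cstar_idealI[OF I])
    fix a x assume a: "a \<in> carrier B" and x: "x \<in> I"
    have "I \<subseteq> {b \<in> carrier B. amul B a b \<in> I}" unfolding I_def
    proof (rule A.nclosure_prod_span_least[OF _ A.closed_subspace_amul_left_vimage[OF a I[unfolded I_def]]])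
      fix y y' assume yy: "y \<in> Y" "y' \<in> Y"
      have "amul B a (ip y y') = ip (act y (astar B a)) y'"
        using yy Y' a by (simp add: ip_act_left A.astar_astar)
      then show "ip y y' \<in> {b \<in> carrier B. amul B a b \<in> nclosure B (prod_span B ip Y Y)}"
        using ipI[OF Yact[OF yy(1)] yy(2), of "astar B a"] a yy ipR R'(4) by (simp add: I_def)
    qed
    then show "amul B a x \<in> I" using x by blast
    have "I \<subseteq> {b \<in> carrier B. amul B b a \<in> I}" unfolding I_def
    proof (rule A.nclosure_prod_span_least[OF _ A.closed_subspace_amul_right_vimage[OF a I[unfolded I_def]]])
      fix y y' assume yy: "y \<in> Y" "y' \<in> Y"
      have "amul B (ip y y') a = ip y (act y' a)" using yy Y' a by (simp add: ip_act)
      then show "ip y y' \<in> {b \<in> carrier B. amul B b a \<in> nclosure B (prod_span B ip Y Y)}"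
        using ipI[OF yy(1) Yact[OF yy(2) a]] a yy ipR R'(4) by (simp add: I_def)
    qed
    then show "amul B x a \<in> I" using x by blast
  qed
  have ipI': "ip y x \<in> I" if y: "y \<in> Y" and x: "x \<in> carrier X" for y x
  proof -
    have "y \<in> ideal_part I" using ideal_part_iff[OF ideal] y ipI Y' by blast
    then have "ip x y \<in> I" using x by (simp add: ideal_part_def)
    from A.ideal_astar[OF ideal this] show ?thesis using ip_star[of x y] x y Y' by simp
  qed
  have "r \<in> I" if r: "r \<in> R" for r
  proof -
    have rc: "r \<in> carrier B" by (rule R'(4)[OF r])
    have "carrier B \<subseteq> {b \<in> carrier B. amul B r b \<in> I}" unfolding full[symmetric]
    proof (rule A.nclosure_prod_span_least)
      show "closed_subspace B {b \<in> nclosure B (prod_span B ip (carrier X) (carrier X)). amul B r b \<in> I}"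
        unfolding full by (rule A.closed_subspace_amul_left_vimage[OF rc I])
      fix x x' assume x: "x \<in> carrier X" "x' \<in> carrier X"
      have "amul B r (ip x x') = ip (act x (astar B r)) x'" using x rc by (simp add: ip_act_left A.astar_astar)
      then show "ip x x' \<in> {b \<in> nclosure B (prod_span B ip (carrier X) (carrier X)). amul B r b \<in> I}"
        unfolding full using ipI'[OF act[OF x(1) A.ideal_astar[OF R r]] x(2)] x by simp
    qed
    then show ?thesis using A.mem_closed_subspace_amul[OF R r I] R'(4) by blast
  qed
  moreover have "I \<subseteq> R" unfolding I_def by (rule A.nclosure_prod_span_least[OF ipR R'(1)])
  ultimately show ?thesis unfolding eq by blast
qed

end

context imprimitivity_bimodule
begin

sublocale L: right_hilbert_module "opp_alg A" X "\<lambda>x a. la a x" "\<lambda>x y. li y x"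
  by (rule right_hilbert_module_opp[OF left_module])

sublocale R: right_hilbert_module B X ra ri
  by (rule right_module)

lemma restrict_imprimitivity:
  assumes L: "cstar_ideal A L" and R: "cstar_ideal B R" and Y: "closed_subspace X Y"
    and li: "\<And>x y. \<lbrakk>y \<in> Y; x \<in> carrier X\<rbrakk> \<Longrightarrow> li y x \<in> L"
    and ri: "\<And>x y. \<lbrakk>x \<in> carrier X; y \<in> Y\<rbrakk> \<Longrightarrow> ri x y \<in> R"
    and la: "\<And>a x. \<lbrakk>a \<in> L; x \<in> carrier X\<rbrakk> \<Longrightarrow> la a x \<in> Y"
    and ra: "\<And>x b. \<lbrakk>x \<in> carrier X; b \<in> R\<rbrakk> \<Longrightarrow> ra x b \<in> Y"
  shows "imprimitivity_bimodule (A\<lparr>carrier := L\<rparr>) (B\<lparr>carrier := R\<rparr>) (X\<lparr>carrier := Y\<rparr>) la ra li ri"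
proof -
  note Y' = csubspaceD(5)[OF L.X.closed_subspaceD(1)[OF Y]]
  have L': "cstar_ideal (opp_alg A) L" using L by simp
  have lmod: "left_hilbert_module (A\<lparr>carrier := L\<rparr>) (X\<lparr>carrier := Y\<rparr>) la li"
    using left_hilbert_module_opp[OF L.restrict_hilbert_module[OF L' Y li la]]
    by (simp add: opp_alg_simps(13)[symmetric] del: opp_alg_simps(13))
  have lfull: "nclosure (A\<lparr>carrier := L\<rparr>) (prod_span (A\<lparr>carrier := L\<rparr>) li Y Y) = L"
    using L.restrict_full[OF L' Y li la] left_full
    by (simp add: prod_span_flip[of _ "\<lambda>x y. li y x"] opp_alg_simps(13)[symmetric] del: opp_alg_simps(13))
  show ?thesis
    using lmod R.restrict_hilbert_module[OF R Y ri ra] lfull R.restrict_full[OF R Y ri ra right_full]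
      cstar_idealD(4)[OF L] cstar_idealD(4)[OF R] Y'
    by (intro imprimitivity_bimodule.intro)
      (simp_all add: actions_commute left_adjointable right_adjointable ip_compatible)
qed

end

section \<open>Subbundles\<close>

lemma in_fib: "e \<in> fib E x \<longleftrightarrow> e \<in> topspace (btop E) \<and> bproj E e = x"
  by (auto simp: fibre_def)

lemma fibre_simps [simp]:
  "vadd (fibre E x) = badd E" "vzero (fibre E x) = bzero E x" "vscale (fibre E x) = bscale E"
  "vnorm (fibre E x) = bnorm E"
  by (simp_all add: fibre_def)

lemma fibre_restrict_bundle: "fibre (restrict_bundle E D) x = (fibre E x)\<lparr>carrier := D \<inter> fib E x\<rparr>"
  by (auto simp: fibre_def restrict_bundle_def)

lemma continuous_map_prodE:
  assumes "continuous_map (subtopology (prod_topology X Y) S) Z f" "openin Z V" "(a, b) \<in> S"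
    "a \<in> topspace X" "b \<in> topspace Y" "f (a, b) \<in> V"
  obtains U1 U2 where "openin X U1" "a \<in> U1" "openin Y U2" "b \<in> U2"
    "\<And>a' b'. \<lbrakk>a' \<in> U1; b' \<in> U2; (a', b') \<in> S\<rbrakk> \<Longrightarrow> f (a', b') \<in> V"
proof -
  obtain O' where O': "openin (prod_topology X Y) O'"
    "{p \<in> topspace (subtopology (prod_topology X Y) S). f p \<in> V} = O' \<inter> S"
    using openin_continuous_map_preimage[OF assms(1,2)] by (auto simp: openin_subtopology)
  then have "(a, b) \<in> O'" using assms(3-6) by auto
  from O'(1)[unfolded openin_prod_topology_alt, rule_format, OF this]
  obtain U1 U2 where "openin X U1" "openin Y U2" "a \<in> U1" "b \<in> U2" "U1 \<times> U2 \<subseteq> O'"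
    by (elim exE conjE)
  moreover have "f p \<in> V" if "p \<in> O'" "p \<in> S" for p using O'(2) that by blast
  ultimately show ?thesis by (intro that[of U1 U2]) auto
qed

lemma continuous_map_restrict_prod:
  assumes "continuous_map (subtopology (prod_topology X Y) S) Z f"
    "\<And>a b. \<lbrakk>a \<in> topspace X; b \<in> topspace Y; a \<in> D; b \<in> D'; (a, b) \<in> S\<rbrakk> \<Longrightarrow> f (a, b) \<in> D''"
  shows "continuous_map (subtopology (prod_topology (subtopology X D) (subtopology Y D')) S) (subtopology Z D'') f"
proof -
  have eq: "subtopology (prod_topology (subtopology X D) (subtopology Y D')) S
      = subtopology (subtopology (prod_topology X Y) S) (D \<times> D')"
    by (simp add: subtopology_Times[symmetric] subtopology_subtopology Int_commute)
  show ?thesis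
    unfolding eq continuous_map_in_subtopology
    using continuous_map_from_subtopology[OF assms(1)] assms(2) by auto
qed

text \<open>\<open>D \<subseteq> lsc_points E D\<close> says that the projection of \<open>D\<close> onto the base is open.\<close>

definition lsc_points :: "('e, 'x, 'z) bbundle_scheme \<Rightarrow> 'e set \<Rightarrow> 'e set" where
  "lsc_points E D = {e \<in> topspace (btop E). \<forall>V. openin (btop E) V \<longrightarrow> e \<in> V \<longrightarrow>
     (\<exists>W. openin (bbase E) W \<and> bproj E e \<in> W \<and> W \<subseteq> bproj E ` (V \<inter> D))}"

lemma lsc_pointsE:
  assumes "e \<in> lsc_points E D" "openin (btop E) V" "e \<in> V"
  obtains W where "openin (bbase E) W" "bproj E e \<in> W"
    "\<And>x. x \<in> W \<Longrightarrow> \<exists>d. d \<in> V \<and> d \<in> D \<and> bproj E d = x"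
proof -
  from assms obtain W where "openin (bbase E) W" "bproj E e \<in> W" "W \<subseteq> bproj E ` (V \<inter> D)"
    unfolding lsc_points_def by blast
  then show ?thesis using that[of W] by blast
qed

lemma lsc_pointsI:
  assumes "e \<in> topspace (btop E)"
    "\<And>V. \<lbrakk>openin (btop E) V; e \<in> V\<rbrakk> \<Longrightarrow> \<exists>W. openin (bbase E) W \<and> bproj E e \<in> W \<and>
       (\<forall>x\<in>W. \<exists>d. d \<in> V \<and> d \<in> D \<and> bproj E d = x)"
  shows "e \<in> lsc_points E D"
  unfolding lsc_points_def
proof (intro CollectI conjI allI impI)
  fix V assume "openin (btop E) V" "e \<in> V"
  from assms(2)[OF this] obtain W where "openin (bbase E) W" "bproj E e \<in> W"
    and W: "\<forall>x\<in>W. \<exists>d. d \<in> V \<and> d \<in> D \<and> bproj E d = x" by (elim exE conjE)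
  moreover have "W \<subseteq> bproj E ` (V \<inter> D)"
  proof
    fix x assume "x \<in> W"
    with W obtain d where "d \<in> V" "d \<in> D" "bproj E d = x" by blast
    then show "x \<in> bproj E ` (V \<inter> D)" by blast
  qed
  ultimately show "\<exists>W. openin (bbase E) W \<and> bproj E e \<in> W \<and> W \<subseteq> bproj E ` (V \<inter> D)" by blast
qed (rule assms(1))

lemma lsc_points_mono:
  assumes "D \<subseteq> D'" shows "lsc_points E D \<subseteq> lsc_points E D'"
proof
  fix e assume e: "e \<in> lsc_points E D"
  show "e \<in> lsc_points E D'"
  proof (rule lsc_pointsI)
    show "e \<in> topspace (btop E)" using e by (simp add: lsc_points_def)
    fix V assume "openin (btop E) V" "e \<in> V"
    from lsc_pointsE[OF e this] obtain W where "openin (bbase E) W" "bproj E e \<in> W"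
      "\<And>x. x \<in> W \<Longrightarrow> \<exists>d. d \<in> V \<and> d \<in> D \<and> bproj E d = x" by blast
    then show "\<exists>W. openin (bbase E) W \<and> bproj E e \<in> W \<and> (\<forall>x\<in>W. \<exists>d. d \<in> V \<and> d \<in> D' \<and> bproj E d = x)"
      using assms by (meson subsetD)
  qed
qed

context banach_bundle
begin

lemma fib_base: "e \<in> fib E x \<Longrightarrow> x \<in> topspace (bbase E)"
  using proj_surj by (auto simp: in_fib)

lemma fib_vector_closed:
  "\<lbrakk>e \<in> fib E x; f \<in> fib E x\<rbrakk> \<Longrightarrow> badd E e f \<in> fib E x"
  "x \<in> topspace (bbase E) \<Longrightarrow> bzero E x \<in> fib E x"
  "e \<in> fib E x \<Longrightarrow> bscale E c e \<in> fib E x"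
  using complex_banach_space.vector_closed[OF fibre_banach[of x]] fib_base[of _ x] by force+

lemma bnorm_nonneg: "e \<in> topspace (btop E) \<Longrightarrow> 0 \<le> bnorm E e"
  using complex_banach_space.vnorm_nonneg[OF fibre_banach, of "bproj E e" e] proj_surj by (auto simp: in_fib)

text \<open>The topology induced on a fibre is no finer than the norm topology. Otherwise some
  \<open>f_n\<close> outside \<open>V\<close> would tend to \<open>e\<close> in norm; then
  \<open>f_n - e\<close> tends to the zero vector by \<open>B4\<close>, and continuity of addition
  brings \<open>f_n\<close> into \<open>V\<close>.\<close>

lemma norm_ball_subset_open:
  assumes V: "openin (btop E) V" "e \<in> V" and e: "e \<in> fib E x"
  obtains \<epsilon> where "\<epsilon> > 0" "\<And>f. \<lbrakk>f \<in> fib E x; bnorm E (badd E e (bscale E (-1) f)) < \<epsilon>\<rbrakk> \<Longrightarrow> f \<in> V"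
proof (rule ccontr)
  note x = fib_base[OF e]
  interpret X: complex_banach_space "fibre E x" by (rule fibre_banach[OF x])
  note concl = that
  assume no: "\<not> thesis"
  have "\<exists>f. f \<in> fib E x \<and> bnorm E (badd E e (bscale E (-1) f)) < \<epsilon> \<and> f \<notin> V" if pos: "\<epsilon> > 0" for \<epsilon>
    using concl[OF pos] no by blast
  then have "\<exists>f. f \<in> fib E x \<and> bnorm E (badd E e (bscale E (-1) f)) < inverse (real (Suc n)) \<and> f \<notin> V" for n
    by (simp add: inverse_positive_iff_positive)
  then obtain f where f: "\<And>n. f n \<in> fib E x" "\<And>n. bnorm E (badd E e (bscale E (-1) (f n))) < inverse (real (Suc n))"
    "\<And>n. f n \<notin> V" by metis
  define d where "d n = badd E (f n) (bscale E (-1) e)" for n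
  have d: "d n \<in> fib E x" for n using f(1) e by (simp add: d_def fib_vector_closed)
  have "bnorm E (d n) \<le> inverse (real (Suc n))" for n
    using f(2)[of n] X.vnorm_vsub_flip[OF e f(1)[of n]] by (simp add: d_def)
  then have "((\<lambda>n. bnorm E (d n)) \<longlongrightarrow> 0) sequentially"
    using LIMSEQ_inverse_real_of_nat d bnorm_nonneg
    by (intro Lim_null_comparison[OF _ LIMSEQ_inverse_real_of_nat]) (auto simp: in_fib)
  then have lim: "limitin (btop E) (\<lambda>b. b) (bzero E x) (filtermap d sequentially)"
    using d x by (intro B4) (auto simp: in_fib eventually_filtermap limitin_def filterlim_filtermap)
  have ze: "bzero E x \<in> fib E x" by (rule fib_vector_closed(2)[OF x])
  obtain U1 U2 where U: "openin (btop E) U1" "bzero E x \<in> U1" "openin (btop E) U2" "e \<in> U2"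
    "\<And>a b. \<lbrakk>a \<in> U1; b \<in> U2; (a, b) \<in> {(a, b). bproj E a = bproj E b}\<rbrakk> \<Longrightarrow> (\<lambda>(a, b). badd E a b) (a, b) \<in> V"
  proof (rule continuous_map_prodE[OF B2 V(1), of "bzero E x" e])
    show "(\<lambda>(a, b). badd E a b) (bzero E x, e) \<in> V" using X.vzero_add[OF e] V(2) by simp
  qed (use ze e in \<open>auto simp: in_fib\<close>)
  have "\<forall>\<^sub>F n in sequentially. d n \<in> U1"
    using lim U(1,2) by (auto simp: limitin_def eventually_filtermap)
  then obtain n where "d n \<in> U1" by (auto simp: eventually_sequentially)
  then have "badd E (d n) e \<in> V" using U(4) U(5)[of "d n" e] d[of n] e by (auto simp: in_fib)
  moreover have "badd E (d n) e = f n" using X.vsub_add_cancel[OF f(1) e] by (simp add: d_def)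
  ultimately show False using f(3) by simp
qed

text \<open>Continuity of the zero section: \<open>B4\<close> is applied to the image under
  \<open>bzero E\<close> of the neighbourhood filter of \<open>x\<close>.\<close>

lemma zero_section_nbhd:
  assumes x: "x \<in> topspace (bbase E)" and V: "openin (btop E) V" "bzero E x \<in> V"
  obtains W where "openin (bbase E) W" "x \<in> W" "\<And>y. y \<in> W \<Longrightarrow> bzero E y \<in> V"
proof -
  let ?F = "filtermap (bzero E) (nhdsin (bbase E) x)"
  have zero: "bzero E y \<in> topspace (btop E)" "bproj E (bzero E y) = y" "bnorm E (bzero E y) = 0"
    if "y \<in> topspace (bbase E)" for y
    using fib_vector_closed(2)[OF that] complex_banach_space.vnorm_zero[OF fibre_banach[OF that]]
    by (simp_all add: in_fib)
  have ev: "\<forall>\<^sub>F y in nhdsin (bbase E) x. y \<in> topspace (bbase E)"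
    using x by (auto simp: eventually_nhdsin)
  have "limitin (btop E) (\<lambda>b. b) (bzero E x) ?F"
  proof (rule B4[OF x])
    show "\<forall>\<^sub>F b in ?F. b \<in> topspace (btop E)"
      unfolding eventually_filtermap by (rule eventually_mono[OF ev]) (simp add: zero)
    show "limitin (bbase E) (bproj E) x ?F"
      unfolding limitin_def eventually_filtermap
    proof (intro conjI allI impI x)
      fix U assume "openin (bbase E) U \<and> x \<in> U"
      then show "\<forall>\<^sub>F y in nhdsin (bbase E) x. bproj E (bzero E y) \<in> U"
        using zero(2) openin_subset unfolding eventually_nhdsin by (metis subsetD)
    qed
    have "\<forall>\<^sub>F b in ?F. bnorm E b = 0"
      unfolding eventually_filtermap by (rule eventually_mono[OF ev]) (simp add: zero)
    then show "(bnorm E \<longlongrightarrow> 0) ?F" by (rule tendsto_eventually)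
  qed
  then have "\<forall>\<^sub>F y in nhdsin (bbase E) x. bzero E y \<in> V"
    using V by (auto simp: limitin_def eventually_filtermap)
  then show ?thesis using that x by (auto simp: eventually_nhdsin)
qed

text \<open>Sums and multiples follow from continuity of the operations, with base neighbourhoods
  intersected. For a norm limit \<open>e\<close>, an open set around \<open>e\<close> already
  contains an approximating \<open>f\<close> over the same base point, and the neighbourhood found
  for \<open>f\<close> serves \<open>e\<close>.\<close>

lemma closed_subspace_lsc_points:
  assumes D: "\<And>x. x \<in> topspace (bbase E) \<Longrightarrow> csubspace (fibre E x) (D \<inter> fib E x)"
    and x: "x \<in> topspace (bbase E)"
  shows "closed_subspace (fibre E x) (lsc_points E D \<inter> fib E x)"
proof -
  interpret X: complex_banach_space "fibre E x" by (rule fibre_banach[OF x])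
  note D' = csubspaceD[OF D]
  have base_open: "y \<in> topspace (bbase E)" if "openin (bbase E) W" "y \<in> W" for y W
    using that openin_subset by blast
  have Dadd: "badd E d d' \<in> D \<and> bproj E (badd E d d') = y"
    if "d \<in> D" "d' \<in> D" "d \<in> topspace (btop E)" "d' \<in> topspace (btop E)" "bproj E d = y" "bproj E d' = y" for d d' y
    using D'(3)[of y d d'] that proj_surj by (auto simp: in_fib)
  have Dscale: "bscale E c d \<in> D \<and> bproj E (bscale E c d) = y"
    if "d \<in> D" "d \<in> topspace (btop E)" "bproj E d = y" for d y c
    using D'(4)[of y d c] that proj_surj by (auto simp: in_fib)
  have open_top: "d \<in> topspace (btop E)" if "openin (btop E) V" "d \<in> V" for d V
    using that openin_subset by blast
  show ?thesis
  proof (rule X.closed_subspaceI)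
    have "bzero E x \<in> lsc_points E D"
    proof (rule lsc_pointsI)
      show "bzero E x \<in> topspace (btop E)" using fib_vector_closed(2)[OF x] by (simp add: in_fib)
      fix V assume V: "openin (btop E) V" "bzero E x \<in> V"
      obtain W where W: "openin (bbase E) W" "x \<in> W" "\<And>y. y \<in> W \<Longrightarrow> bzero E y \<in> V"
        using zero_section_nbhd[OF x V] by blast
      have "bzero E y \<in> D \<and> bproj E (bzero E y) = y" if "y \<in> W" for y
        using D'(2)[OF base_open[OF W(1) that]] fib_vector_closed(2)[OF base_open[OF W(1) that]] by (auto simp: in_fib)
      then show "\<exists>W. openin (bbase E) W \<and> bproj E (bzero E x) \<in> W \<and> (\<forall>x\<in>W. \<exists>d. d \<in> V \<and> d \<in> D \<and> bproj E d = x)"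
        using W fib_vector_closed(2)[OF x] by (intro exI[of _ W]) (auto simp: in_fib)
    qed
    moreover have "badd E e f \<in> lsc_points E D"
      if e: "e \<in> lsc_points E D" "e \<in> fib E x" and f: "f \<in> lsc_points E D" "f \<in> fib E x" for e f
    proof (rule lsc_pointsI)
      have ef: "badd E e f \<in> fib E x" using e f by (simp add: fib_vector_closed)
      then show "badd E e f \<in> topspace (btop E)" by (simp add: in_fib)
      fix V assume V: "openin (btop E) V" "badd E e f \<in> V"
      obtain U1 U2 where U: "openin (btop E) U1" "e \<in> U1" "openin (btop E) U2" "f \<in> U2"
        "\<And>a b. \<lbrakk>a \<in> U1; b \<in> U2; (a, b) \<in> {(a, b). bproj E a = bproj E b}\<rbrakk> \<Longrightarrow> (\<lambda>(a, b). badd E a b) (a, b) \<in> V"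
        by (rule continuous_map_prodE[OF B2 V(1), of e f]) (use e f V in \<open>auto simp: in_fib\<close>)
      obtain W1 where W1: "openin (bbase E) W1" "x \<in> W1" "\<And>y. y \<in> W1 \<Longrightarrow> \<exists>d. d \<in> U1 \<and> d \<in> D \<and> bproj E d = y"
        using lsc_pointsE[OF e(1) U(1,2)] e(2) by (auto simp: in_fib)
      obtain W2 where W2: "openin (bbase E) W2" "x \<in> W2" "\<And>y. y \<in> W2 \<Longrightarrow> \<exists>d. d \<in> U2 \<and> d \<in> D \<and> bproj E d = y"
        using lsc_pointsE[OF f(1) U(3,4)] f(2) by (auto simp: in_fib)
      have "\<exists>d. d \<in> V \<and> d \<in> D \<and> bproj E d = y" if y: "y \<in> W1 \<inter> W2" for y
      proof -
        obtain d d' where d: "d \<in> U1" "d \<in> D" "bproj E d = y" "d' \<in> U2" "d' \<in> D" "bproj E d' = y"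
          using y W1(3)[of y] W2(3)[of y] by blast
        then show ?thesis
          using U(5)[of d d'] Dadd[of d d' y] open_top[OF U(1)] open_top[OF U(3)] by auto
      qed
      then show "\<exists>W. openin (bbase E) W \<and> bproj E (badd E e f) \<in> W \<and> (\<forall>x\<in>W. \<exists>d. d \<in> V \<and> d \<in> D \<and> bproj E d = x)"
        using W1 W2 ef by (intro exI[of _ "W1 \<inter> W2"]) (auto simp: in_fib)
    qed
    moreover have "bscale E c e \<in> lsc_points E D" if e: "e \<in> lsc_points E D" "e \<in> fib E x" for c e
    proof (rule lsc_pointsI)
      have ce: "bscale E c e \<in> fib E x" using e by (simp add: fib_vector_closed)
      then show "bscale E c e \<in> topspace (btop E)" by (simp add: in_fib)
      fix V assume V: "openin (btop E) V" "bscale E c e \<in> V"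
      have "continuous_map (btop E) (btop E) ((\<lambda>(l, b). bscale E l b) \<circ> (\<lambda>b. (c, b)))"
        by (rule continuous_map_compose[OF _ B3]) (intro continuous_map_pairedI; simp)
      then have U: "openin (btop E) {b \<in> topspace (btop E). bscale E c b \<in> V}"
        using openin_continuous_map_preimage[OF _ V(1)] by fastforce
      obtain W where W: "openin (bbase E) W" "x \<in> W"
        "\<And>y. y \<in> W \<Longrightarrow> \<exists>d. d \<in> {b \<in> topspace (btop E). bscale E c b \<in> V} \<and> d \<in> D \<and> bproj E d = y"
        using lsc_pointsE[OF e(1) U] V e(2) by (auto simp: in_fib)
      then have "\<exists>d. d \<in> V \<and> d \<in> D \<and> bproj E d = y" if "y \<in> W" for y
        using Dscale[of _ y c] W(3)[OF that] by blast
      then show "\<exists>W. openin (bbase E) W \<and> bproj E (bscale E c e) \<in> W \<and> (\<forall>x\<in>W. \<exists>d. d \<in> V \<and> d \<in> D \<and> bproj E d = x)"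
        using W(1,2) ce by (intro exI[of _ W]) (auto simp: in_fib)
    qed
    ultimately show "csubspace (fibre E x) (lsc_points E D \<inter> fib E x)"
      unfolding csubspace_def by (simp add: fib_vector_closed x)
    fix e assume e: "e \<in> fib E x"
      and lim: "\<And>\<epsilon>. \<epsilon> > 0 \<Longrightarrow> \<exists>f\<in>lsc_points E D \<inter> fib E x. vnorm (fibre E x) (vsub (fibre E x) e f) < \<epsilon>"
    have "e \<in> lsc_points E D"
    proof (rule lsc_pointsI)
      show "e \<in> topspace (btop E)" using e by (simp add: in_fib)
      fix V assume V: "openin (btop E) V" "e \<in> V"
      obtain \<epsilon> where \<epsilon>: "\<epsilon> > 0" "\<And>f. \<lbrakk>f \<in> fib E x; bnorm E (badd E e (bscale E (-1) f)) < \<epsilon>\<rbrakk> \<Longrightarrow> f \<in> V"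
        using norm_ball_subset_open[OF V e] by blast
      obtain f where f: "f \<in> lsc_points E D" "f \<in> fib E x" "f \<in> V" using lim[OF \<epsilon>(1)] \<epsilon>(2) by auto
      obtain W where "openin (bbase E) W" "bproj E f \<in> W" "\<And>y. y \<in> W \<Longrightarrow> \<exists>d. d \<in> V \<and> d \<in> D \<and> bproj E d = y"
        using lsc_pointsE[OF f(1) V(1) f(3)] by blast
      then show "\<exists>W. openin (bbase E) W \<and> bproj E e \<in> W \<and> (\<forall>x\<in>W. \<exists>d. d \<in> V \<and> d \<in> D \<and> bproj E d = x)"
        using f(2) e by (intro exI[of _ W]) (auto simp: in_fib)
    qed
    then show "e \<in> lsc_points E D \<inter> fib E x" using e by simp
  qed
qed

text \<open>Openness of the projection is the one bundle axiom that closed subspaces of the fibres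
  do not inherit; surjectivity comes from the zero vectors, and all other axioms restrict.\<close>

lemma banach_subbundle_iff:
  "banach_subbundle E D \<longleftrightarrow> D \<subseteq> lsc_points E D \<and>
     (\<forall>x\<in>topspace (bbase E). closed_subspace (fibre E x) (D \<inter> fib E x))"
proof
  assume sub: "banach_subbundle E D"
  then have D: "D \<subseteq> topspace (btop E)" and B: "banach_bundle (restrict_bundle E D)"
    by (auto simp: banach_subbundle_def)
  have "e \<in> lsc_points E D" if e: "e \<in> D" for e
  proof (rule lsc_pointsI)
    show "e \<in> topspace (btop E)" using D e by blast
    fix V assume V: "openin (btop E) V" "e \<in> V"
    have "openin (subtopology (btop E) D) (V \<inter> D)" using V(1) by (auto simp: openin_subtopology)
    then have "openin (bbase E) (bproj E ` (V \<inter> D))"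
      using banach_bundle.proj_open[OF B] by (auto simp: open_map_def restrict_bundle_def)
    then show "\<exists>W. openin (bbase E) W \<and> bproj E e \<in> W \<and> (\<forall>x\<in>W. \<exists>d. d \<in> V \<and> d \<in> D \<and> bproj E d = x)"
      using e V by (intro exI[of _ "bproj E ` (V \<inter> D)"]) auto
  qed
  then show "D \<subseteq> lsc_points E D \<and> (\<forall>x\<in>topspace (bbase E). closed_subspace (fibre E x) (D \<inter> fib E x))"
    using sub by (auto simp: banach_subbundle_def closed_subspace_def)
next
  assume *: "D \<subseteq> lsc_points E D \<and> (\<forall>x\<in>topspace (bbase E). closed_subspace (fibre E x) (D \<inter> fib E x))"
  then have Dlsc: "D \<subseteq> lsc_points E D" and D: "\<And>x. x \<in> topspace (bbase E) \<Longrightarrow> closed_subspace (fibre E x) (D \<inter> fib E x)"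
    by auto
  have sub: "csubspace (fibre E x) (D \<inter> fib E x)" if "x \<in> topspace (bbase E)" for x
    using D[OF that] by (simp add: closed_subspace_def)
  note D' = csubspaceD[OF sub]
  have Dtop: "D \<subseteq> topspace (btop E)" using Dlsc by (auto simp: lsc_points_def)
  have base: "bproj E d \<in> topspace (bbase E)" if "d \<in> topspace (btop E)" for d using proj_surj that by blast
  let ?R = "restrict_bundle E D"
  have sel: "btop ?R = subtopology (btop E) D" "bbase ?R = bbase E" "bproj ?R = bproj E" "badd ?R = badd E"
    "bzero ?R = bzero E" "bscale ?R = bscale E" "bnorm ?R = bnorm E"
    by (simp_all add: restrict_bundle_def)
  have "banach_bundle ?R"
  proof (rule banach_bundle.intro, unfold sel)
    show "continuous_map (subtopology (btop E) D) (bbase E) (bproj E)"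
      by (rule continuous_map_from_subtopology[OF proj_continuous])
    show "open_map (subtopology (btop E) D) (bbase E) (bproj E)"
      unfolding open_map_def
    proof (intro allI impI)
      fix U assume "openin (subtopology (btop E) D) U"
      then obtain V where V: "openin (btop E) V" "U = V \<inter> D" by (auto simp: openin_subtopology)
      have "\<exists>W. openin (bbase E) W \<and> bproj E e \<in> W \<and> W \<subseteq> bproj E ` U" if "e \<in> U" for e
        using that Dlsc V unfolding lsc_points_def by blast
      then show "openin (bbase E) (bproj E ` U)" by (subst openin_subopen) blast
    qed
    show "bproj E ` topspace (subtopology (btop E) D) = topspace (bbase E)"
    proof
      show "topspace (bbase E) \<subseteq> bproj E ` topspace (subtopology (btop E) D)"
        using D'(2) by (auto simp: in_fib intro!: image_eqI[of _ _ "bzero E _"])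
    qed (use base in auto)
    show "complex_banach_space (fibre ?R x)" if "x \<in> topspace (bbase E)" for x
      unfolding fibre_restrict_bundle
      by (rule complex_banach_space.closed_subspace_restrict[OF fibre_banach[OF that] D[OF that]])
    show "openin (subtopology (btop E) D) {e \<in> topspace (subtopology (btop E) D). bnorm E e < c}" for c
      using B1[of c] by (auto simp: openin_subtopology intro!: exI[of _ "{e \<in> topspace (btop E). bnorm E e < c}"])
    show "continuous_map (subtopology (prod_topology (subtopology (btop E) D) (subtopology (btop E) D))
       {(a, b). bproj E a = bproj E b}) (subtopology (btop E) D) (\<lambda>(a, b). badd E a b)"
      by (rule continuous_map_restrict_prod[OF B2]) (use D'(3) base in \<open>auto simp: in_fib\<close>)
    have "continuous_map (subtopology (prod_topology (subtopology euclidean UNIV) (subtopology (btop E) D)) UNIV)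
        (subtopology (btop E) D) (\<lambda>(l, b). bscale E l b)"
      by (rule continuous_map_restrict_prod) (use B3 D'(4) base in \<open>auto simp: in_fib\<close>)
    then show "continuous_map (prod_topology euclidean (subtopology (btop E) D)) (subtopology (btop E) D)
        (\<lambda>(l, b). bscale E l b)" by simp
    show "limitin (subtopology (btop E) D) (\<lambda>b. b) (bzero E x) F"
      if "x \<in> topspace (bbase E)" "\<forall>\<^sub>F b in F. b \<in> topspace (subtopology (btop E) D)"
        "limitin (bbase E) (bproj E) x F" "(bnorm E \<longlongrightarrow> 0) F" for x F
      unfolding limitin_subtopology
    proof (intro conjI)
      show "bzero E x \<in> D" using D'(2)[OF that(1)] by (simp add: in_fib)
      show "\<forall>\<^sub>F b in F. b \<in> D" using that(2) by (rule eventually_mono) simp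
      show "limitin (btop E) (\<lambda>b. b) (bzero E x) F"
        by (rule B4[OF that(1) _ that(3,4)]) (use that(2) in \<open>auto elim: eventually_mono\<close>)
    qed
  qed
  then show "banach_subbundle E D"
    using Dtop D by (auto simp: banach_subbundle_def closed_subspace_def)
qed

end

section \<open>Ideals of Fell bundles\<close>

lemma fibre_alg_simps [simp]:
  "carrier (fibre_alg B u) = fib B u" "vadd (fibre_alg B u) = badd B" "vzero (fibre_alg B u) = bzero B u"
  "vscale (fibre_alg B u) = bscale B" "vnorm (fibre_alg B u) = bnorm B" "amul (fibre_alg B u) = bmul B"
  "astar (fibre_alg B u) = bstar B"
  by (simp_all add: fibre_alg_def)

lemma fibre_alg_topology [simp]:
  "nclosure (fibre_alg B u) = nclosure (fibre B u)" "csubspace (fibre_alg B u) = csubspace (fibre B u)"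
  "closed_subspace (fibre_alg B u) = closed_subspace (fibre B u)"
  by (simp_all add: closed_subspace_def fun_eq_iff nclosure_cong[of "fibre_alg B u" "fibre B u"]
      csubspace_cong[of "fibre_alg B u" "fibre B u"])

lemma fibre_alg_prod_span [simp]: "prod_span (fibre_alg B u) m = prod_span (fibre B u) m"
  by (rule prod_span_cong) simp_all

lemma fibre_alg_restrict_bundle:
  "fibre_alg (restrict_bundle B D) u = (fibre_alg B u)\<lparr>carrier := D \<inter> fib B u\<rparr>"
  by (auto simp: fibre_alg_def fibre_def restrict_bundle_def)

lemma restrict_bundle_simps [simp]:
  "btop (restrict_bundle E D) = subtopology (btop E) D" "bbase (restrict_bundle E D) = bbase E"
  "bproj (restrict_bundle E D) = bproj E" "badd (restrict_bundle E D) = badd E"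
  "bzero (restrict_bundle E D) = bzero E" "bscale (restrict_bundle E D) = bscale E"
  "bnorm (restrict_bundle E D) = bnorm E"
  by (simp_all add: restrict_bundle_def)

lemma restrict_fbundle_simps [simp]:
  "bmul (restrict_bundle B D) = bmul B" "bstar (restrict_bundle B D) = bstar B"
  by (simp_all add: restrict_bundle_def)

context lc_groupoid
begin

lemma units_arrows: "u \<in> units G \<Longrightarrow> u \<in> arrows G"
  by (auto simp: units_def src_closed)

lemma unit_src: "u \<in> units G \<Longrightarrow> gsrc G u = u"
  by (auto simp: units_def src_src)

lemma unit_rng: "u \<in> units G \<Longrightarrow> grng G u = u"
  by (auto simp: units_def rng_src)

lemma src_units: "g \<in> arrows G \<Longrightarrow> gsrc G g \<in> units G"
  by (auto simp: units_def)

lemma rng_units: "g \<in> arrows G \<Longrightarrow> grng G g \<in> units G"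
  using src_units[OF rng_closed] by (simp add: src_rng)

text \<open>The source is the product of \<open>g^-1\<close> and \<open>g\<close>, so its continuity
  follows from that of multiplication and inversion.\<close>

lemma src_continuous: "continuous_map (gtop G) (gtop G) (gsrc G)"
proof -
  have "continuous_map (gtop G) (subtopology (prod_topology (gtop G) (gtop G)) (composable G)) (\<lambda>g. (ginv G g, g))"
    by (intro continuous_map_into_subtopology continuous_map_pairedI inv_continuous)
      (auto simp: composable_def inv_closed src_inv)
  from continuous_map_compose[OF this mul_continuous] show ?thesis
    by (rule continuous_map_eq) (simp add: inv_mul)
qed

end

section \<open>Fibrewise structure of a Fell bundle and the lattice of its ideals\<close>

locale groupoid_fell_bundle =
  fixes G :: "'g groupoid" and B :: "('b, 'g) fbundle"
  assumes groupoid: "lc_groupoid G" and fell: "fell_bundle G B"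
begin

sublocale G: lc_groupoid G by (rule groupoid)
sublocale F: fell_bundle G B by (rule fell)
sublocale banach_bundle B by (rule F.is_banach_bundle)

lemma fib_arrow: "b \<in> fib B g \<Longrightarrow> g \<in> arrows G"
  using fib_base by (simp add: F.base)

lemma mul_fib:
  assumes "(g, h) \<in> composable G" "a \<in> fib B g" "b \<in> fib B h" shows "bmul B a b \<in> fib B (gmul G g h)"
proof -
  have "(\<lambda>(a, b). bmul B a b) (a, b) \<in> topspace (btop B)"
    using assms continuous_map_image_subset_topspace[OF F.mul_continuous] by (auto simp: in_fib)
  then show ?thesis using F.proj_mul[OF assms] by (simp add: in_fib)
qed

lemma star_fib:
  assumes "b \<in> fib B g" shows "bstar B b \<in> fib B (ginv G g)"
  using F.proj_star[OF fib_arrow[OF assms] assms] continuous_map_image_subset_topspace[OF F.star_continuous] assms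
  by (auto simp: in_fib)

lemma composable_simps:
  assumes "g \<in> arrows G"
  shows "(g, gsrc G g) \<in> composable G" "(grng G g, g) \<in> composable G"
    "(ginv G g, g) \<in> composable G" "(g, ginv G g) \<in> composable G"
  using assms
  by (simp_all add: composable_def G.src_closed G.rng_closed G.inv_closed G.rng_src G.src_rng G.src_inv G.rng_inv)

lemma mul_fib_src: "\<lbrakk>a \<in> fib B g; b \<in> fib B (gsrc G g)\<rbrakk> \<Longrightarrow> bmul B a b \<in> fib B g"
  using mul_fib[OF composable_simps(1)[OF fib_arrow]] G.src_unit[OF fib_arrow] by metis

lemma mul_fib_rng: "\<lbrakk>a \<in> fib B (grng G g); b \<in> fib B g\<rbrakk> \<Longrightarrow> bmul B a b \<in> fib B g"
  using mul_fib[OF composable_simps(2)[OF fib_arrow]] G.rng_unit[OF fib_arrow] by metis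

lemma star_mul_fib: "\<lbrakk>a \<in> fib B g; b \<in> fib B g\<rbrakk> \<Longrightarrow> bmul B (bstar B a) b \<in> fib B (gsrc G g)"
  using mul_fib[OF composable_simps(3)[OF fib_arrow] star_fib] G.inv_mul[OF fib_arrow] by metis

lemma mul_star_fib: "\<lbrakk>a \<in> fib B g; b \<in> fib B g\<rbrakk> \<Longrightarrow> bmul B a (bstar B b) \<in> fib B (grng G g)"
  using mul_fib[OF composable_simps(4)[OF fib_arrow] _ star_fib] G.mul_inv[OF fib_arrow] by metis

text \<open>The bound is derived from the bimodule structure: the inner square of \<open>a b\<close>
  is \<open><b, (a^* a) b>\<close>, computed in the module over \<open>h\<close>. The crude
  Cauchy-Schwarz constant 4 leaves the factor 2 after taking roots.\<close>

lemma norm_mul_le: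
  assumes gh: "(g, h) \<in> composable G" and a: "a \<in> fib B g" and b: "b \<in> fib B h"
  shows "bnorm B (bmul B a b) \<le> 2 * bnorm B a * bnorm B b"
proof -
  have g: "g \<in> arrows G" and h: "h \<in> arrows G" and sr: "gsrc G g = grng G h" using gh by (auto simp: composable_def)
  have gh': "gmul G g h \<in> arrows G" "gsrc G (gmul G g h) = gsrc G h" using gh G.mul_closed G.src_mul by auto
  interpret I: imprimitivity_bimodule "fibre_alg B (grng G h)" "fibre_alg B (gsrc G h)" "fibre B h"
    "bmul B" "bmul B" "\<lambda>a b. bmul B a (bstar B b)" "\<lambda>a b. bmul B (bstar B a) b" by (rule F.fibre_imprimitivity[OF h])
  interpret J: imprimitivity_bimodule "fibre_alg B (grng G g)" "fibre_alg B (gsrc G g)" "fibre B g"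
    "bmul B" "bmul B" "\<lambda>a b. bmul B a (bstar B b)" "\<lambda>a b. bmul B (bstar B a) b" by (rule F.fibre_imprimitivity[OF g])
  interpret K: imprimitivity_bimodule "fibre_alg B (grng G (gmul G g h))" "fibre_alg B (gsrc G (gmul G g h))" "fibre B (gmul G g h)"
    "bmul B" "bmul B" "\<lambda>a b. bmul B a (bstar B b)" "\<lambda>a b. bmul B (bstar B a) b" by (rule F.fibre_imprimitivity[OF gh'(1)])
  have aa: "bmul B (bstar B a) a \<in> fib B (grng G h)" using star_mul_fib[OF a a] by (simp add: sr)
  have ab: "bmul B a b \<in> fib B (gmul G g h)" by (rule mul_fib[OF gh a b])
  have aab: "bmul B (bmul B (bstar B a) a) b \<in> fib B h" by (rule mul_fib_rng[OF aa b])
  have inv: "(ginv G g, g) \<in> composable G" "(ginv G h, ginv G g) \<in> composable G" "(ginv G g, gmul G g h) \<in> composable G"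
    using g h sr gh' G.rng_mul[OF gh] by (auto simp: composable_def G.inv_closed G.src_inv G.rng_inv)
  have "bmul B (bstar B (bmul B a b)) (bmul B a b) = bmul B (bmul B (bstar B b) (bstar B a)) (bmul B a b)"
    by (simp add: F.star_mul[OF gh a b])
  also have "\<dots> = bmul B (bstar B b) (bmul B (bstar B a) (bmul B a b))"
    by (rule F.mul_assoc[OF inv(2,3) star_fib[OF b] star_fib[OF a] ab])
  also have "bmul B (bstar B a) (bmul B a b) = bmul B (bmul B (bstar B a) a) b"
    by (rule F.mul_assoc[OF inv(1) gh star_fib[OF a] a b, symmetric])
  finally have "(bnorm B (bmul B a b))\<^sup>2 = bnorm B (bmul B (bstar B b) (bmul B (bmul B (bstar B a) a) b))"
    using K.R.ip_norm[of "bmul B a b"] ab by simp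
  also have "\<dots> \<le> 4 * bnorm B b * bnorm B (bmul B (bmul B (bstar B a) a) b)"
    using I.R.norm_ip_le[of b "bmul B (bmul B (bstar B a) a) b"] b aab by simp
  also have "\<dots> \<le> 4 * bnorm B b * (bnorm B b * bnorm B (bmul B (bstar B a) a))"
    using I.L.norm_act[of b "bmul B (bstar B a) a"] b aa bnorm_nonneg[of b]
    by (intro mult_left_mono) (auto simp: in_fib)
  also have "\<dots> = (2 * bnorm B a * bnorm B b)\<^sup>2"
    using J.R.ip_norm[of a] a by (simp add: power2_eq_square)
  finally show ?thesis
    by (rule power2_le_imp_le) (use a b bnorm_nonneg in \<open>simp add: in_fib\<close>)
qed

lemma closed_subspace_mul_left_vimage:
  assumes gh: "(g, h) \<in> composable G" and a: "a \<in> fib B g" and W: "closed_subspace (fibre B (gmul G g h)) W"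
  shows "closed_subspace (fibre B h) {b \<in> fib B h. bmul B a b \<in> W}"
proof (rule closed_subspace_vimage[where K = "2 * bnorm B a", OF _ _ _ _ _ _ _ W])
  have "h \<in> arrows G" "gmul G g h \<in> arrows G" using gh G.mul_closed by (auto simp: composable_def)
  then show "complex_banach_space (fibre B h)" "complex_banach_space (fibre B (gmul G g h))"
    by (simp_all add: fibre_banach F.base)
qed (use gh a in \<open>auto simp: mul_fib F.mul_add_right F.mul_scale_right norm_mul_le\<close>)

lemma closed_subspace_mul_right_vimage:
  assumes gh: "(g, h) \<in> composable G" and b: "b \<in> fib B h" and W: "closed_subspace (fibre B (gmul G g h)) W"
  shows "closed_subspace (fibre B g) {a \<in> fib B g. bmul B a b \<in> W}"
proof (rule closed_subspace_vimage[where K = "2 * bnorm B b", OF _ _ _ _ _ _ _ W])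
  have "g \<in> arrows G" "gmul G g h \<in> arrows G" using gh G.mul_closed by (auto simp: composable_def)
  then show "complex_banach_space (fibre B g)" "complex_banach_space (fibre B (gmul G g h))"
    by (simp_all add: fibre_banach F.base)
  show "vnorm (fibre B (gmul G g h)) (bmul B x b) \<le> 2 * bnorm B b * vnorm (fibre B g) x" if "x \<in> fib B g" for x
    using norm_mul_le[OF gh that b] by (simp add: mult.commute mult.left_commute)
qed (use gh b in \<open>auto simp: mul_fib F.mul_add_left F.mul_scale_left\<close>)

text \<open>The algebraic half of \<open>fell_ideal\<close>, fibre by fibre; the topological half is
  \<open>J \<subseteq> lsc_points B J\<close>.\<close>

definition fibrewise_ideal :: "'b set \<Rightarrow> bool" where
  "fibrewise_ideal J \<longleftrightarrow> J \<subseteq> topspace (btop B) \<and>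
     (\<forall>g\<in>arrows G. closed_subspace (fibre B g) (J \<inter> fib B g)) \<and>
     (\<forall>g h a b. (g, h) \<in> composable G \<longrightarrow> a \<in> fib B g \<longrightarrow> b \<in> fib B h \<longrightarrow> a \<in> J \<or> b \<in> J \<longrightarrow> bmul B a b \<in> J)"

lemma fibrewise_idealD:
  assumes "fibrewise_ideal J"
  shows "J \<subseteq> topspace (btop B)" "\<And>g. g \<in> arrows G \<Longrightarrow> closed_subspace (fibre B g) (J \<inter> fib B g)"
    "\<And>g h a b. \<lbrakk>(g, h) \<in> composable G; a \<in> fib B g; b \<in> fib B h; a \<in> J\<rbrakk> \<Longrightarrow> bmul B a b \<in> J"
    "\<And>g h a b. \<lbrakk>(g, h) \<in> composable G; a \<in> fib B g; b \<in> fib B h; b \<in> J\<rbrakk> \<Longrightarrow> bmul B a b \<in> J"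
  using assms unfolding fibrewise_ideal_def by blast+

lemma fibrewise_ideal_unit:
  assumes J: "fibrewise_ideal J" and u: "u \<in> units G"
  shows "cstar_ideal (fibre_alg B u) (J \<inter> fib B u)"
proof (rule cstar_idealI)
  note J' = fibrewise_idealD[OF J]
  have uu: "(u, u) \<in> composable G" "gmul G u u = u"
    using u composable_simps(1)[of u] G.src_unit[of u] by (auto simp: G.unit_src G.units_arrows)
  show "closed_subspace (fibre_alg B u) (J \<inter> fib B u)" using J'(2)[of u] u by (simp add: G.units_arrows)
  fix a x assume "a \<in> carrier (fibre_alg B u)" "x \<in> J \<inter> fib B u"
  then show "amul (fibre_alg B u) a x \<in> J \<inter> fib B u" "amul (fibre_alg B u) x a \<in> J \<inter> fib B u"
    using J'(3)[OF uu(1), of x a] J'(4)[OF uu(1), of a x] mul_fib[OF uu(1)] uu(2) by auto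
qed

text \<open>The fibre over \<open>g\<close> is the ideal part of the Hilbert module
  \<open>B_g\<close> for the ideal in the unit fibre at the source: if \<open>c\<close> lies in
  \<open>J\<close>, so does \<open>c^* c\<close>, and conversely factorization writes
  \<open>c\<close> as a product ending in that unit fibre. The range side is the same in the
  opposite module.\<close>

lemma fibrewise_ideal_decompositions:
  assumes J: "fibrewise_ideal J" and g: "g \<in> arrows G"
  shows "prod_span (fibre B g) (bmul B) (fib B g) (J \<inter> fib B (gsrc G g)) = J \<inter> fib B g"
    and "prod_span (fibre B g) (bmul B) (J \<inter> fib B (grng G g)) (fib B g) = J \<inter> fib B g"
    and "\<And>c. c \<in> J \<inter> fib B g \<Longrightarrow> \<exists>z\<in>fib B g. \<exists>a\<in>J \<inter> fib B (gsrc G g). c = bmul B z a"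
proof -
  note J' = fibrewise_idealD[OF J]
  interpret I: imprimitivity_bimodule "fibre_alg B (grng G g)" "fibre_alg B (gsrc G g)" "fibre B g"
    "bmul B" "bmul B" "\<lambda>a b. bmul B a (bstar B b)" "\<lambda>a b. bmul B (bstar B a) b" by (rule F.fibre_imprimitivity[OF g])
  have s: "cstar_ideal (fibre_alg B (gsrc G g)) (J \<inter> fib B (gsrc G g))"
    by (rule fibrewise_ideal_unit[OF J G.src_units[OF g]])
  have r: "cstar_ideal (opp_alg (fibre_alg B (grng G g))) (J \<inter> fib B (grng G g))"
    using fibrewise_ideal_unit[OF J G.rng_units[OF g]] by simp
  have right: "I.R.ideal_part (J \<inter> fib B (gsrc G g)) = J \<inter> fib B g"
  proof (intro equalityI subsetI)
    fix c assume c: "c \<in> J \<inter> fib B g"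
    then show "c \<in> I.R.ideal_part (J \<inter> fib B (gsrc G g))"
      using J'(4)[OF composable_simps(3)[OF g] star_fib[of c g], of c] star_mul_fib[of c g c]
      by (simp add: I.R.ideal_part_iff[OF s])
  next
    fix c assume "c \<in> I.R.ideal_part (J \<inter> fib B (gsrc G g))"
    from I.R.factorization[OF s this] obtain z a
      where "z \<in> I.R.ideal_part (J \<inter> fib B (gsrc G g))" "a \<in> J \<inter> fib B (gsrc G g)" "c = bmul B z a" .
    then show "c \<in> J \<inter> fib B g"
      using J'(4)[OF composable_simps(1)[OF g], of z a] mul_fib_src[of z g a] by (auto simp: I.R.ideal_part_def)
  qed
  show "prod_span (fibre B g) (bmul B) (fib B g) (J \<inter> fib B (gsrc G g)) = J \<inter> fib B g"
    using I.R.ideal_part_eq_prod_span[OF s] right by simp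
  have left: "I.L.ideal_part (J \<inter> fib B (grng G g)) = J \<inter> fib B g"
  proof (intro equalityI subsetI)
    fix c assume c: "c \<in> J \<inter> fib B g"
    then show "c \<in> I.L.ideal_part (J \<inter> fib B (grng G g))"
      using J'(3)[OF composable_simps(4)[OF g] _ star_fib[of c g], of c] mul_star_fib[of c g c]
      by (simp add: I.L.ideal_part_iff[OF r])
  next
    fix c assume "c \<in> I.L.ideal_part (J \<inter> fib B (grng G g))"
    from I.L.factorization[OF r this] obtain z a
      where "z \<in> I.L.ideal_part (J \<inter> fib B (grng G g))" "a \<in> J \<inter> fib B (grng G g)" "c = bmul B a z" .
    then show "c \<in> J \<inter> fib B g"
      using J'(3)[OF composable_simps(2)[OF g], of a z] mul_fib_rng[of a g z] by (auto simp: I.L.ideal_part_def)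
  qed
  show "prod_span (fibre B g) (bmul B) (J \<inter> fib B (grng G g)) (fib B g) = J \<inter> fib B g"
    using I.L.ideal_part_eq_prod_span[OF r] left by (simp add: prod_span_flip[of _ "\<lambda>x a. bmul B a x"])
  fix c assume "c \<in> J \<inter> fib B g"
  then have "c \<in> I.R.ideal_part (J \<inter> fib B (gsrc G g))" by (simp add: right)
  from I.R.factorization[OF s this] obtain z a
    where "z \<in> I.R.ideal_part (J \<inter> fib B (gsrc G g))" "a \<in> J \<inter> fib B (gsrc G g)" "c = bmul B z a" .
  then show "\<exists>z\<in>fib B g. \<exists>a\<in>J \<inter> fib B (gsrc G g). c = bmul B z a"
    by (auto simp: I.R.ideal_part_def)
qed

text \<open>Writing \<open>c = z a\<close> with \<open>a\<close> in a unit fibre reduces the claim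
  to self-adjointness of closed ideals in a C*-algebra: the adjoint of \<open>c\<close> begins with
  the adjoint of \<open>a\<close>.\<close>

lemma fibrewise_ideal_star:
  assumes J: "fibrewise_ideal J" and c: "c \<in> J" shows "bstar B c \<in> J"
proof -
  define g where "g = bproj B c"
  have cg: "c \<in> fib B g" using c fibrewise_idealD(1)[OF J] by (auto simp: g_def in_fib)
  note g = fib_arrow[OF cg]
  obtain z a where za: "z \<in> fib B g" "a \<in> J" "a \<in> fib B (gsrc G g)" "c = bmul B z a"
    using fibrewise_ideal_decompositions(3)[OF J g, of c] c cg by blast
  interpret S: cstar_algebra "fibre_alg B (gsrc G g)" by (rule F.fibre_cstar[OF G.src_units[OF g]])
  have "bstar B a \<in> J \<inter> fib B (gsrc G g)"
    using S.ideal_astar[OF fibrewise_ideal_unit[OF J G.src_units[OF g]], of a] za by simp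
  moreover have "bstar B c = bmul B (bstar B a) (bstar B z)"
    unfolding za(4) by (rule F.star_mul[OF composable_simps(1)[OF g] za(1,3)])
  moreover have "(gsrc G g, ginv G g) \<in> composable G"
    using g by (simp add: composable_def G.src_closed G.inv_closed G.src_src G.rng_inv)
  ultimately show ?thesis using fibrewise_idealD(3)[OF J _ _ star_fib[OF za(1)]] by auto
qed

text \<open>A closed fibrewise ideal is automatically stable under the involution, and its fibres
  are imprimitivity bimodules by restriction; what remains of the Fell subbundle conditions is
  openness of the projection.\<close>

lemma fell_ideal_iff: "fell_ideal G B J \<longleftrightarrow> fibrewise_ideal J \<and> J \<subseteq> lsc_points B J"
proof
  assume fi: "fell_ideal G B J"
  then have sub: "banach_subbundle B J" by (simp add: fell_ideal_def fell_subbundle_def)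
  have "J \<subseteq> topspace (btop B)" using sub by (simp add: banach_subbundle_def)
  moreover have "bmul B a b \<in> J"
    if "(g, h) \<in> composable G" "a \<in> fib B g" "b \<in> fib B h" "a \<in> J \<or> b \<in> J" for g h a b
    using fi that unfolding fell_ideal_def by (auto simp: in_fib)
  ultimately show "fibrewise_ideal J \<and> J \<subseteq> lsc_points B J"
    using sub unfolding banach_subbundle_iff fibrewise_ideal_def F.base by blast
next
  assume *: "fibrewise_ideal J \<and> J \<subseteq> lsc_points B J"
  then have J: "fibrewise_ideal J" and lsc: "J \<subseteq> lsc_points B J" by auto
  note J' = fibrewise_idealD[OF J]
  have sub: "banach_subbundle B J" unfolding banach_subbundle_iff F.base using lsc J'(2) by blast
  have "fell_bundle G (restrict_bundle B J)"
  proof (rule fell_bundle.intro, unfold restrict_bundle_simps restrict_fbundle_simps fibre_restrict_bundle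
      fibre_alg_restrict_bundle)
    show "banach_bundle (restrict_bundle B J)" using sub by (simp add: banach_subbundle_def)
    show "bbase B = gtop G" by (rule F.base)
    show "continuous_map (subtopology (prod_topology (subtopology (btop B) J) (subtopology (btop B) J))
        {(a, b). (bproj B a, bproj B b) \<in> composable G}) (subtopology (btop B) J) (\<lambda>(a, b). bmul B a b)"
      by (rule continuous_map_restrict_prod[OF F.mul_continuous]) (use J'(3) in \<open>auto simp: in_fib\<close>)
    show "continuous_map (subtopology (btop B) J) (subtopology (btop B) J) (bstar B)"
      by (intro continuous_map_into_subtopology continuous_map_from_subtopology F.star_continuous)
        (use fibrewise_ideal_star[OF J] in auto)
    show "cstar_algebra ((fibre_alg B u)\<lparr>carrier := J \<inter> fib B u\<rparr>)" if u: "u \<in> units G" for u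
      by (rule cstar_algebra.cstar_algebra_ideal[OF F.fibre_cstar[OF u] fibrewise_ideal_unit[OF J u]])
    show "imprimitivity_bimodule ((fibre_alg B (grng G g))\<lparr>carrier := J \<inter> fib B (grng G g)\<rparr>)
        ((fibre_alg B (gsrc G g))\<lparr>carrier := J \<inter> fib B (gsrc G g)\<rparr>) ((fibre B g)\<lparr>carrier := J \<inter> fib B g\<rparr>)
        (bmul B) (bmul B) (\<lambda>a b. bmul B a (bstar B b)) (\<lambda>a b. bmul B (bstar B a) b)" if g: "g \<in> arrows G" for g
    proof (rule imprimitivity_bimodule.restrict_imprimitivity[OF F.fibre_imprimitivity[OF g]
          fibrewise_ideal_unit[OF J G.rng_units[OF g]] fibrewise_ideal_unit[OF J G.src_units[OF g]] J'(2)[OF g]])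
      show "bmul B y (bstar B x) \<in> J \<inter> fib B (grng G g)" if "y \<in> J \<inter> fib B g" "x \<in> fib B g" for x y
        using J'(3)[OF composable_simps(4)[OF g] _ star_fib[OF that(2)]] mul_star_fib[of y g x] that by auto
      show "bmul B (bstar B x) y \<in> J \<inter> fib B (gsrc G g)" if "x \<in> fib B g" "y \<in> J \<inter> fib B g" for x y
        using J'(4)[OF composable_simps(3)[OF g] star_fib[OF that(1)]] star_mul_fib[of x g y] that by auto
      show "bmul B a x \<in> J \<inter> fib B g" if "a \<in> J \<inter> fib B (grng G g)" "x \<in> fib B g" for a x
        using J'(3)[OF composable_simps(2)[OF g] _ that(2)] mul_fib_rng[of a g x] that by auto
      show "bmul B x b \<in> J \<inter> fib B g" if "x \<in> fib B g" "b \<in> J \<inter> fib B (gsrc G g)" for x b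
        using J'(4)[OF composable_simps(1)[OF g] that(1)] mul_fib_src[of x g b] that by auto
    qed
  qed (simp_all add: F.proj_mul F.mul_add_left F.mul_add_right F.mul_scale_left F.mul_scale_right F.proj_star
      F.star_star F.star_add F.star_scale F.star_mul F.mul_assoc)
  then show "fell_ideal G B J"
    using sub J'(3,4) by (auto simp: fell_ideal_def fell_subbundle_def in_fib)
qed

text \<open>For \<open>k\<close> near \<open>g\<close>, approximate \<open>c\<close> over
  \<open>k\<close> and \<open>a\<close> over the source of \<open>k\<close>; the product again lies
  over \<open>k\<close>. Continuity of the source map makes both choices possible on one
  neighbourhood.\<close>

lemma lsc_points_mul:
  assumes gh: "(g, gsrc G g) \<in> composable G" and c: "c \<in> fib B g" "c \<in> lsc_points B J"
    and a: "a \<in> fib B (gsrc G g)" "a \<in> lsc_points B I"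
    and ideal: "\<And>k c a. \<lbrakk>c \<in> fib B k; a \<in> fib B (gsrc G k); c \<in> J; a \<in> I\<rbrakk> \<Longrightarrow> bmul B c a \<in> D"
  shows "bmul B c a \<in> lsc_points B D"
proof (rule lsc_pointsI)
  have ca: "bmul B c a \<in> fib B g" by (rule mul_fib_src[OF c(1) a(1)])
  then show "bmul B c a \<in> topspace (btop B)" by (simp add: in_fib)
  fix V assume V: "openin (btop B) V" "bmul B c a \<in> V"
  obtain U1 U2 where U: "openin (btop B) U1" "c \<in> U1" "openin (btop B) U2" "a \<in> U2"
    "\<And>x y. \<lbrakk>x \<in> U1; y \<in> U2; (x, y) \<in> {(a, b). (bproj B a, bproj B b) \<in> composable G}\<rbrakk>
       \<Longrightarrow> (\<lambda>(a, b). bmul B a b) (x, y) \<in> V"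
    by (rule continuous_map_prodE[OF F.mul_continuous V(1), of c a]) (use c a V gh in \<open>auto simp: in_fib\<close>)
  obtain W1 where W1: "openin (gtop G) W1" "g \<in> W1" "\<And>y. y \<in> W1 \<Longrightarrow> \<exists>d. d \<in> U1 \<and> d \<in> J \<and> bproj B d = y"
    using lsc_pointsE[OF c(2) U(1,2)] c(1) by (auto simp: in_fib F.base)
  obtain W2 where W2: "openin (gtop G) W2" "gsrc G g \<in> W2" "\<And>y. y \<in> W2 \<Longrightarrow> \<exists>d. d \<in> U2 \<and> d \<in> I \<and> bproj B d = y"
    using lsc_pointsE[OF a(2) U(3,4)] a(1) by (auto simp: in_fib F.base)
  define W where "W = {k \<in> W1. gsrc G k \<in> W2}"
  have "openin (gtop G) W" unfolding W_def
    by (rule openin_continuous_map_preimage_gen[OF G.src_continuous W1(1) W2(1)])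
  moreover have "\<exists>d. d \<in> V \<and> d \<in> D \<and> bproj B d = k" if k: "k \<in> W" for k
  proof -
    obtain d d' where d: "d \<in> U1" "d \<in> J" "bproj B d = k" "d' \<in> U2" "d' \<in> I" "bproj B d' = gsrc G k"
      using k W1(3)[of k] W2(3)[of "gsrc G k"] unfolding W_def by blast
    have f: "d \<in> fib B k" "d' \<in> fib B (gsrc G k)"
      using d openin_subset[OF U(1)] openin_subset[OF U(3)] by (auto simp: in_fib)
    have "bmul B d d' \<in> V" using U(5)[OF d(1,4)] d composable_simps(1)[OF fib_arrow[OF f(1)]] by simp
    moreover have "bmul B d d' \<in> D" by (rule ideal[OF f d(2,5)])
    moreover have "bproj B (bmul B d d') = k" using mul_fib_src[OF f] by (simp add: in_fib)
    ultimately show ?thesis by blast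
  qed
  ultimately show "\<exists>W. openin (bbase B) W \<and> bproj B (bmul B c a) \<in> W \<and> (\<forall>x\<in>W. \<exists>d. d \<in> V \<and> d \<in> D \<and> bproj B d = x)"
    using W1 W2 ca by (intro exI[of _ W]) (auto simp: F.base in_fib W_def)
qed

text \<open>Points of \<open>I\<close> near \<open>c\<close> need not lie in \<open>J\<close>. But
  \<open>c\<close> is a limit of products \<open>c e\<close> with \<open>e\<close> in a unit fibre
  of \<open>J\<close>; nearby one multiplies elements of \<open>I\<close> by elements of
  \<open>J\<close>, and these products lie in both ideals.\<close>

lemma fell_ideal_Int:
  assumes I: "fell_ideal G B I" and J: "fell_ideal G B J" shows "fell_ideal G B (I \<inter> J)"
proof -
  have I': "fibrewise_ideal I" "I \<subseteq> lsc_points B I" and J': "fibrewise_ideal J" "J \<subseteq> lsc_points B J"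
    using I J by (auto simp: fell_ideal_iff)
  note I'' = fibrewise_idealD[OF I'(1)] and J'' = fibrewise_idealD[OF J'(1)]
  have cl: "closed_subspace (fibre B g) (I \<inter> J \<inter> fib B g)" if "g \<in> arrows G" for g
  proof -
    have "I \<inter> J \<inter> fib B g = (I \<inter> fib B g) \<inter> (J \<inter> fib B g)" by blast
    then show ?thesis
      using complex_banach_space.closed_subspace_Int[OF fibre_banach I''(2)[OF that] J''(2)[OF that]] that
      by (simp add: F.base)
  qed
  have "fibrewise_ideal (I \<inter> J)"
    unfolding fibrewise_ideal_def using cl I'' J'' by auto
  moreover have "c \<in> lsc_points B (I \<inter> J)" if c: "c \<in> I" "c \<in> J" for c
  proof -
    define g where "g = bproj B c"
    have cg: "c \<in> fib B g" using c I''(1) by (auto simp: g_def in_fib)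
    note g = fib_arrow[OF cg]
    interpret M: imprimitivity_bimodule "fibre_alg B (grng G g)" "fibre_alg B (gsrc G g)" "fibre B g"
      "bmul B" "bmul B" "\<lambda>a b. bmul B a (bstar B b)" "\<lambda>a b. bmul B (bstar B a) b" by (rule F.fibre_imprimitivity[OF g])
    have sub: "csubspace (fibre B x) (I \<inter> J \<inter> fib B x)" if "x \<in> topspace (bbase B)" for x
      using cl[of x] that by (simp add: F.base closed_subspace_def)
    have W: "closed_subspace (fibre B g) (lsc_points B (I \<inter> J) \<inter> fib B g)"
      by (rule closed_subspace_lsc_points[OF sub]) (use g in \<open>simp_all add: F.base\<close>)
    have "c \<in> lsc_points B (I \<inter> J) \<inter> fib B g"
    proof (rule M.R.approximate_unit_mem[OF fibrewise_ideal_unit[OF J'(1) G.src_units[OF g]] cg _ W])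
      show "bmul B (bstar B c) c \<in> J \<inter> fib B (gsrc G g)"
        using J''(4)[OF composable_simps(3)[OF g] star_fib[OF cg] cg c(2)] star_mul_fib[OF cg cg] by simp
      fix e assume e: "e \<in> J \<inter> fib B (gsrc G g)"
      have "bmul B c e \<in> lsc_points B (I \<inter> J)"
      proof (rule lsc_points_mul[OF composable_simps(1)[OF g] cg, of I e J])
        fix k x y assume xy: "x \<in> fib B k" "y \<in> fib B (gsrc G k)" "x \<in> I" "y \<in> J"
        note comp = composable_simps(1)[OF fib_arrow[OF xy(1)]]
        show "bmul B x y \<in> I \<inter> J" using I''(3)[OF comp xy(1,2,3)] J''(4)[OF comp xy(1,2,4)] by simp
      qed (use c e I'(2) J'(2) in auto)
      then show "bmul B c e \<in> lsc_points B (I \<inter> J) \<inter> fib B g" using mul_fib_src[OF cg] e by simp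
    qed
    then show ?thesis by simp
  qed
  ultimately show ?thesis by (auto simp: fell_ideal_iff)
qed

text \<open>The supremum is the fibrewise closed span of the union. Stability under products and
  openness of the projection hold on \<open>I\<close> and \<open>J\<close> and are conditions
  defining closed subspaces, so they extend to the span.\<close>

lemma fell_ideal_sup:
  assumes I: "fell_ideal G B I" and J: "fell_ideal G B J"
  obtains D where "fell_ideal G B D" "I \<subseteq> D" "J \<subseteq> D"
    "\<And>D'. \<lbrakk>fell_ideal G B D'; I \<subseteq> D'; J \<subseteq> D'\<rbrakk> \<Longrightarrow> D \<subseteq> D'"
proof -
  have I': "fibrewise_ideal I" "I \<subseteq> lsc_points B I" and J': "fibrewise_ideal J" "J \<subseteq> lsc_points B J"
    using I J by (auto simp: fell_ideal_iff)
  note I'' = fibrewise_idealD[OF I'(1)] and J'' = fibrewise_idealD[OF J'(1)]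
  define Dg where "Dg g = nclosure (fibre B g) (cspan (fibre B g) ((I \<union> J) \<inter> fib B g))" for g
  define D where "D = {c \<in> topspace (btop B). c \<in> Dg (bproj B c)}"
  have banach: "complex_banach_space (fibre B g)" if "g \<in> arrows G" for g
    using that by (simp add: fibre_banach F.base)
  have span: "csubspace (fibre B g) (cspan (fibre B g) ((I \<union> J) \<inter> fib B g))" if "g \<in> arrows G" for g
    by (rule complex_banach_space.csubspace_cspan[OF banach[OF that]]) simp
  have Dfib: "D \<inter> fib B g = Dg g" if "g \<in> arrows G" for g
    using subsetD[OF complex_banach_space.nclosure_subset_carrier[OF banach[OF that]]]
    by (auto simp: D_def Dg_def in_fib)
  have cl: "closed_subspace (fibre B g) (D \<inter> fib B g)" if "g \<in> arrows G" for g
    unfolding Dfib[OF that] Dg_def by (rule complex_banach_space.closed_subspace_nclosure[OF banach[OF that] span[OF that]])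
  have sup: "(I \<union> J) \<inter> fib B g \<subseteq> Dg g" if "g \<in> arrows G" for g
    unfolding Dg_def
    by (rule order_trans[OF cspan_superset complex_banach_space.nclosure_superset[OF banach[OF that] csubspaceD(1)[OF span[OF that]]]])
  have least: "Dg g \<subseteq> W" if "g \<in> arrows G" "(I \<union> J) \<inter> fib B g \<subseteq> W" "closed_subspace (fibre B g) W" for g W
    unfolding Dg_def
    by (rule complex_banach_space.nclosure_least[OF banach[OF that(1)] cspan_least[OF that(2)] that(3)])
      (use that(3) in \<open>simp add: closed_subspace_def\<close>)
  have IJ: "I \<subseteq> D" "J \<subseteq> D"
  proof -
    have "x \<in> D" if "x \<in> topspace (btop B)" "x \<in> I \<union> J" for x
      using sup[of "bproj B x"] that fib_arrow[of x "bproj B x"] by (auto simp: D_def in_fib)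
    then show "I \<subseteq> D" "J \<subseteq> D" using I''(1) J''(1) by blast+
  qed
  have "fibrewise_ideal D"
    unfolding fibrewise_ideal_def
  proof (intro conjI allI impI ballI cl)
    show "D \<subseteq> topspace (btop B)" by (auto simp: D_def)
    fix g h a b assume gh: "(g, h) \<in> composable G" and a: "a \<in> fib B g" and b: "b \<in> fib B h" and "a \<in> D \<or> b \<in> D"
    have g: "g \<in> arrows G" "h \<in> arrows G" "gmul G g h \<in> arrows G" using gh G.mul_closed by (auto simp: composable_def)
    from \<open>a \<in> D \<or> b \<in> D\<close> show "bmul B a b \<in> D"
    proof
      assume "a \<in> D"
      have "Dg g \<subseteq> {a \<in> fib B g. bmul B a b \<in> D \<inter> fib B (gmul G g h)}"
        by (rule least[OF g(1) _ closed_subspace_mul_right_vimage[OF gh b cl[OF g(3)]]])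
          (use I''(3)[OF gh _ b] J''(3)[OF gh _ b] IJ mul_fib[OF gh _ b] in blast)
      then show ?thesis using \<open>a \<in> D\<close> a Dfib[OF g(1)] by blast
    next
      assume "b \<in> D"
      have "Dg h \<subseteq> {b \<in> fib B h. bmul B a b \<in> D \<inter> fib B (gmul G g h)}"
        by (rule least[OF g(2) _ closed_subspace_mul_left_vimage[OF gh a cl[OF g(3)]]])
          (use I''(4)[OF gh a] J''(4)[OF gh a] IJ mul_fib[OF gh a] in blast)
      then show ?thesis using \<open>b \<in> D\<close> b Dfib[OF g(2)] by blast
    qed
  qed
  moreover have "D \<subseteq> lsc_points B D"
  proof
    fix c assume c: "c \<in> D"
    define g where "g = bproj B c"
    have cg: "c \<in> fib B g" using c by (auto simp: g_def in_fib D_def)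
    note g = fib_arrow[OF cg]
    have "closed_subspace (fibre B g) (lsc_points B D \<inter> fib B g)"
      by (rule closed_subspace_lsc_points) (use cl g in \<open>auto simp: F.base closed_subspace_def\<close>)
    moreover have "(I \<union> J) \<inter> fib B g \<subseteq> lsc_points B D \<inter> fib B g"
      using I'(2) J'(2) lsc_points_mono[OF IJ(1)] lsc_points_mono[OF IJ(2)] by blast
    ultimately have "Dg g \<subseteq> lsc_points B D \<inter> fib B g" by (intro least[OF g])
    then show "c \<in> lsc_points B D" using c cg Dfib[OF g] by blast
  qed
  ultimately have "fell_ideal G B D" by (simp add: fell_ideal_iff)
  moreover have "D \<subseteq> D'" if D': "fell_ideal G B D'" "I \<subseteq> D'" "J \<subseteq> D'" for D'
  proof
    fix c assume c: "c \<in> D"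
    then have cg: "c \<in> fib B (bproj B c)" by (auto simp: in_fib D_def)
    note g = fib_arrow[OF cg]
    have "Dg (bproj B c) \<subseteq> D' \<inter> fib B (bproj B c)"
      by (rule least[OF g]) (use D' fibrewise_idealD(2) g in \<open>auto simp: fell_ideal_iff\<close>)
    then show "c \<in> D'" using c by (auto simp: D_def)
  qed
  ultimately show ?thesis using that IJ by blast
qed

end

section \<open>Lattices of sets ordered by inclusion\<close>

lemma least_inclusion_order:
  assumes "x \<in> S" "y \<in> S"
  shows "least (inclusion_order S) z (Upper (inclusion_order S) {x, y}) \<longleftrightarrow>
    z \<in> S \<and> x \<subseteq> z \<and> y \<subseteq> z \<and> (\<forall>w\<in>S. x \<subseteq> w \<longrightarrow> y \<subseteq> w \<longrightarrow> z \<subseteq> w)"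
proof -
  have "u \<in> Upper (inclusion_order S) {x, y} \<longleftrightarrow> u \<in> S \<and> x \<subseteq> u \<and> y \<subseteq> u" for u
    unfolding Upper_def using assms by simp metis
  moreover have "Upper (inclusion_order S) {x, y} \<subseteq> S" unfolding Upper_def by simp
  ultimately show ?thesis unfolding least_def by (simp add: Ball_def) metis
qed

lemma greatest_inclusion_order:
  assumes "x \<in> S" "y \<in> S"
  shows "greatest (inclusion_order S) z (Lower (inclusion_order S) {x, y}) \<longleftrightarrow>
    z \<in> S \<and> z \<subseteq> x \<and> z \<subseteq> y \<and> (\<forall>w\<in>S. w \<subseteq> x \<longrightarrow> w \<subseteq> y \<longrightarrow> w \<subseteq> z)"
proof -
  have "u \<in> Lower (inclusion_order S) {x, y} \<longleftrightarrow> u \<in> S \<and> u \<subseteq> x \<and> u \<subseteq> y" for u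
    unfolding Lower_def using assms by simp metis
  moreover have "Lower (inclusion_order S) {x, y} \<subseteq> S" unfolding Lower_def by simp
  ultimately show ?thesis unfolding greatest_def by (simp add: Ball_def) metis
qed

lemma lattice_inclusion_order:
  assumes inf: "\<And>x y. \<lbrakk>x \<in> S; y \<in> S\<rbrakk> \<Longrightarrow> \<exists>z\<in>S. z \<subseteq> x \<and> z \<subseteq> y \<and> (\<forall>w\<in>S. w \<subseteq> x \<longrightarrow> w \<subseteq> y \<longrightarrow> w \<subseteq> z)"
    and sup: "\<And>x y. \<lbrakk>x \<in> S; y \<in> S\<rbrakk> \<Longrightarrow> \<exists>z\<in>S. x \<subseteq> z \<and> y \<subseteq> z \<and> (\<forall>w\<in>S. x \<subseteq> w \<longrightarrow> y \<subseteq> w \<longrightarrow> z \<subseteq> w)"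
  shows "lattice (inclusion_order S)"
proof (intro lattice.intro upper_semilattice.intro lower_semilattice.intro
    upper_semilattice_axioms.intro lower_semilattice_axioms.intro)
  show "partial_order (inclusion_order S)" by unfold_locales auto
  then show "partial_order (inclusion_order S)" .
  fix x y assume "x \<in> carrier (inclusion_order S)" "y \<in> carrier (inclusion_order S)"
  then have xy: "x \<in> S" "y \<in> S" by simp_all
  show "\<exists>s. least (inclusion_order S) s (Upper (inclusion_order S) {x, y})"
    unfolding least_inclusion_order[OF xy] using sup[OF xy] by (simp only: Bex_def)
  show "\<exists>s. greatest (inclusion_order S) s (Lower (inclusion_order S) {x, y})"
    unfolding greatest_inclusion_order[OF xy] using inf[OF xy] by (simp only: Bex_def)
qed

text \<open>\<open>join\<close> chooses some least upper bound; antisymmetry of inclusion leaves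
  only one.\<close>

lemma join_inclusion_order:
  assumes "x \<in> S" "y \<in> S" "z \<in> S" "x \<subseteq> z" "y \<subseteq> z"
    "\<forall>w\<in>S. x \<subseteq> w \<longrightarrow> y \<subseteq> w \<longrightarrow> z \<subseteq> w"
  shows "join (inclusion_order S) x y = z"
  unfolding join_def sup_def least_inclusion_order[OF assms(1,2)]
  by (rule some_equality) (use assms in \<open>metis subset_antisym\<close>)+

lemma meet_inclusion_order:
  assumes "x \<in> S" "y \<in> S" "z \<in> S" "z \<subseteq> x" "z \<subseteq> y"
    "\<forall>w\<in>S. w \<subseteq> x \<longrightarrow> w \<subseteq> y \<longrightarrow> w \<subseteq> z"
  shows "meet (inclusion_order S) x y = z"
  unfolding meet_def inf_def greatest_inclusion_order[OF assms(1,2)]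
  by (rule some_equality) (use assms in \<open>metis subset_antisym\<close>)+

text \<open>Meets and joins are assumed in \<open>S\<close> alone. Mutually inverse monotone maps
  satisfy the two adjunction laws \<open>le_f\<close> and \<open>f_le\<close>, which transport
  bounds to \<open>S'\<close> and show that both maps preserve them.\<close>

lemma lattice_isomorphism_inclusion:
  assumes inf: "\<And>x y. \<lbrakk>x \<in> S; y \<in> S\<rbrakk> \<Longrightarrow> \<exists>z\<in>S. z \<subseteq> x \<and> z \<subseteq> y \<and> (\<forall>w\<in>S. w \<subseteq> x \<longrightarrow> w \<subseteq> y \<longrightarrow> w \<subseteq> z)"
    and sup: "\<And>x y. \<lbrakk>x \<in> S; y \<in> S\<rbrakk> \<Longrightarrow> \<exists>z\<in>S. x \<subseteq> z \<and> y \<subseteq> z \<and> (\<forall>w\<in>S. x \<subseteq> w \<longrightarrow> y \<subseteq> w \<longrightarrow> z \<subseteq> w)"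
    and f: "\<And>x. x \<in> S \<Longrightarrow> f x \<in> S'" and g: "\<And>y. y \<in> S' \<Longrightarrow> g y \<in> S"
    and gf: "\<And>x. x \<in> S \<Longrightarrow> g (f x) = x" and fg: "\<And>y. y \<in> S' \<Longrightarrow> f (g y) = y"
    and f_mono: "\<And>x y. \<lbrakk>x \<in> S; y \<in> S; x \<subseteq> y\<rbrakk> \<Longrightarrow> f x \<subseteq> f y"
    and g_mono: "\<And>x y. \<lbrakk>x \<in> S'; y \<in> S'; x \<subseteq> y\<rbrakk> \<Longrightarrow> g x \<subseteq> g y"
  shows "lattice_isomorphism (inclusion_order S) (inclusion_order S') f"
    and "lattice_isomorphism (inclusion_order S') (inclusion_order S) g"
proof -
  have le_f: "f x \<subseteq> y \<longleftrightarrow> x \<subseteq> g y" if "x \<in> S" "y \<in> S'" for x y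
    using f_mono[OF that(1) g[OF that(2)]] g_mono[OF f[OF that(1)] that(2)] gf[OF that(1)] fg[OF that(2)]
    by auto
  have f_le: "y \<subseteq> f x \<longleftrightarrow> g y \<subseteq> x" if "x \<in> S" "y \<in> S'" for x y
    using f_mono[OF g[OF that(2)] that(1)] g_mono[OF that(2) f[OF that(1)]] gf[OF that(1)] fg[OF that(2)]
    by auto
  have L: "lattice (inclusion_order S)" by (rule lattice_inclusion_order[OF inf sup])
  have Sf: "\<And>x. x \<in> S' \<Longrightarrow> \<exists>y\<in>S. x = f y" using g fg by metis
  have inf': "\<exists>z\<in>S. f z \<subseteq> f x \<and> f z \<subseteq> f y \<and> z \<subseteq> x \<and> z \<subseteq> y \<and>
      (\<forall>w\<in>S. w \<subseteq> x \<longrightarrow> w \<subseteq> y \<longrightarrow> w \<subseteq> z) \<and> (\<forall>w\<in>S'. w \<subseteq> f x \<longrightarrow> w \<subseteq> f y \<longrightarrow> w \<subseteq> f z)"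
    if xy: "x \<in> S" "y \<in> S" for x y
  proof -
    from inf[OF xy] obtain z where z: "z \<in> S" "z \<subseteq> x" "z \<subseteq> y" "\<forall>w\<in>S. w \<subseteq> x \<longrightarrow> w \<subseteq> y \<longrightarrow> w \<subseteq> z" by blast
    have "w \<subseteq> f z" if "w \<in> S'" "w \<subseteq> f x" "w \<subseteq> f y" for w
      using that z(1,4) f_le[OF xy(1) that(1)] f_le[OF xy(2) that(1)] f_le[OF z(1) that(1)] g[OF that(1)] by blast
    then show ?thesis using z f_mono[OF z(1) xy(1) z(2)] f_mono[OF z(1) xy(2) z(3)] by (intro bexI[OF _ z(1)]) simp
  qed
  have sup': "\<exists>z\<in>S. f x \<subseteq> f z \<and> f y \<subseteq> f z \<and> x \<subseteq> z \<and> y \<subseteq> z \<and>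
      (\<forall>w\<in>S. x \<subseteq> w \<longrightarrow> y \<subseteq> w \<longrightarrow> z \<subseteq> w) \<and> (\<forall>w\<in>S'. f x \<subseteq> w \<longrightarrow> f y \<subseteq> w \<longrightarrow> f z \<subseteq> w)"
    if xy: "x \<in> S" "y \<in> S" for x y
  proof -
    from sup[OF xy] obtain z where z: "z \<in> S" "x \<subseteq> z" "y \<subseteq> z" "\<forall>w\<in>S. x \<subseteq> w \<longrightarrow> y \<subseteq> w \<longrightarrow> z \<subseteq> w" by blast
    have "f z \<subseteq> w" if "w \<in> S'" "f x \<subseteq> w" "f y \<subseteq> w" for w
      using that z(1,4) le_f[OF xy(1) that(1)] le_f[OF xy(2) that(1)] le_f[OF z(1) that(1)] g[OF that(1)] by blast
    then show ?thesis using z f_mono[OF xy(1) z(1) z(2)] f_mono[OF xy(2) z(1) z(3)] by (intro bexI[OF _ z(1)]) simp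
  qed
  have L': "lattice (inclusion_order S')"
  proof (rule lattice_inclusion_order)
    fix x' y' assume "x' \<in> S'" "y' \<in> S'"
    then obtain x y where xy: "x \<in> S" "y \<in> S" "x' = f x" "y' = f y" using Sf by blast
    from inf'[OF xy(1,2)] obtain z where "z \<in> S" "f z \<subseteq> f x" "f z \<subseteq> f y" "\<forall>w\<in>S'. w \<subseteq> f x \<longrightarrow> w \<subseteq> f y \<longrightarrow> w \<subseteq> f z"
      by (elim bexE conjE)
    then show "\<exists>z\<in>S'. z \<subseteq> x' \<and> z \<subseteq> y' \<and> (\<forall>w\<in>S'. w \<subseteq> x' \<longrightarrow> w \<subseteq> y' \<longrightarrow> w \<subseteq> z)"
      unfolding xy by (intro bexI[of _ "f z"] conjI f)
    from sup'[OF xy(1,2)] obtain z where "z \<in> S" "f x \<subseteq> f z" "f y \<subseteq> f z" "\<forall>w\<in>S'. f x \<subseteq> w \<longrightarrow> f y \<subseteq> w \<longrightarrow> f z \<subseteq> w"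
      by (elim bexE conjE)
    then show "\<exists>z\<in>S'. x' \<subseteq> z \<and> y' \<subseteq> z \<and> (\<forall>w\<in>S'. x' \<subseteq> w \<longrightarrow> y' \<subseteq> w \<longrightarrow> z \<subseteq> w)"
      unfolding xy by (intro bexI[of _ "f z"] conjI f)
  qed
  have meet: "f (meet (inclusion_order S) x y) = meet (inclusion_order S') (f x) (f y)"
    if xy: "x \<in> S" "y \<in> S" for x y
  proof -
    from inf'[OF xy] obtain z where z: "z \<in> S" "f z \<subseteq> f x" "f z \<subseteq> f y" "z \<subseteq> x" "z \<subseteq> y"
      "\<forall>w\<in>S. w \<subseteq> x \<longrightarrow> w \<subseteq> y \<longrightarrow> w \<subseteq> z" "\<forall>w\<in>S'. w \<subseteq> f x \<longrightarrow> w \<subseteq> f y \<longrightarrow> w \<subseteq> f z" by (elim bexE conjE)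
    have "meet (inclusion_order S) x y = z" by (rule meet_inclusion_order[OF xy z(1,4,5,6)])
    moreover have "meet (inclusion_order S') (f x) (f y) = f z"
      by (rule meet_inclusion_order[OF f[OF xy(1)] f[OF xy(2)] f[OF z(1)] z(2,3,7)])
    ultimately show ?thesis by simp
  qed
  have join: "f (join (inclusion_order S) x y) = join (inclusion_order S') (f x) (f y)"
    if xy: "x \<in> S" "y \<in> S" for x y
  proof -
    from sup'[OF xy] obtain z where z: "z \<in> S" "f x \<subseteq> f z" "f y \<subseteq> f z" "x \<subseteq> z" "y \<subseteq> z"
      "\<forall>w\<in>S. x \<subseteq> w \<longrightarrow> y \<subseteq> w \<longrightarrow> z \<subseteq> w" "\<forall>w\<in>S'. f x \<subseteq> w \<longrightarrow> f y \<subseteq> w \<longrightarrow> f z \<subseteq> w" by (elim bexE conjE)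
    have "join (inclusion_order S) x y = z" by (rule join_inclusion_order[OF xy z(1,4,5,6)])
    moreover have "join (inclusion_order S') (f x) (f y) = f z"
      by (rule join_inclusion_order[OF f[OF xy(1)] f[OF xy(2)] f[OF z(1)] z(2,3,7)])
    ultimately show ?thesis by simp
  qed
  have bij: "bij_betw f S S'" "bij_betw g S' S"
    by (rule bij_betwI[of _ _ _ g], use f g gf fg in auto) (rule bij_betwI[of _ _ _ f], use f g gf fg in auto)
  show "lattice_isomorphism (inclusion_order S) (inclusion_order S') f"
    unfolding lattice_isomorphism_def join_pres_def meet_pres_def using L L' bij(1) meet join by simp
  have closed: "join (inclusion_order S) x y \<in> S" "meet (inclusion_order S) x y \<in> S" if xy: "x \<in> S" "y \<in> S" for x y
  proof -
    from sup[OF xy] obtain z where z: "z \<in> S" "x \<subseteq> z" "y \<subseteq> z" "\<forall>w\<in>S. x \<subseteq> w \<longrightarrow> y \<subseteq> w \<longrightarrow> z \<subseteq> w"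
      by (elim bexE conjE)
    then show "join (inclusion_order S) x y \<in> S" using join_inclusion_order[OF xy z] by simp
    from inf[OF xy] obtain z where z: "z \<in> S" "z \<subseteq> x" "z \<subseteq> y" "\<forall>w\<in>S. w \<subseteq> x \<longrightarrow> w \<subseteq> y \<longrightarrow> w \<subseteq> z"
      by (elim bexE conjE)
    then show "meet (inclusion_order S) x y \<in> S" using meet_inclusion_order[OF xy z] by simp
  qed
  have "g (join (inclusion_order S') x y) = join (inclusion_order S) (g x) (g y)"
    "g (meet (inclusion_order S') x y) = meet (inclusion_order S) (g x) (g y)" if "x \<in> S'" "y \<in> S'" for x y
    using that join[of "g x" "g y"] meet[of "g x" "g y"] g fg gf closed by metis+
  then show "lattice_isomorphism (inclusion_order S') (inclusion_order S) g"
    unfolding lattice_isomorphism_def join_pres_def meet_pres_def using L L' bij(2) by simp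
qed

section \<open>Opposite groupoids, bundles and equivalences\<close>

definition opp_groupoid :: "'g groupoid \<Rightarrow> 'g groupoid" where
  "opp_groupoid G = G\<lparr>gmul := \<lambda>g h. gmul G h g, grng := gsrc G, gsrc := grng G\<rparr>"

definition opp_fbundle :: "('b, 'g) fbundle \<Rightarrow> ('b, 'g) fbundle" where
  "opp_fbundle B = B\<lparr>bmul := \<lambda>a b. bmul B b a\<rparr>"

definition opp_space :: "('t, 'h, 'k) gspace \<Rightarrow> ('t, 'k, 'h) gspace" where
  "opp_space T = \<lparr>ttop = ttop T, lmom = rmom T, rmom = lmom T, lmul = \<lambda>k t. rmul T t k, rmul = \<lambda>t h. lmul T h t\<rparr>"

text \<open>Exchanging the arguments of the inner products keeps each of them linear in the variable
  in which the equivalence axioms require it.\<close>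

definition opp_ebundle :: "('e, 't, 'b, 'c) ebundle \<Rightarrow> ('e, 't, 'c, 'b) ebundle" where
  "opp_ebundle E = \<lparr>btop = btop E, bbase = bbase E, bproj = bproj E, badd = badd E, bzero = bzero E,
     bscale = bscale E, bnorm = bnorm E, lact = \<lambda>c e. ract E e c, ract = \<lambda>e b. lact E b e,
     lip = \<lambda>e f. rip E f e, rip = \<lambda>e f. lip E f e\<rparr>"

lemma opp_groupoid_simps [simp]:
  "gtop (opp_groupoid G) = gtop G" "gmul (opp_groupoid G) g h = gmul G h g" "ginv (opp_groupoid G) = ginv G"
  "grng (opp_groupoid G) = gsrc G" "gsrc (opp_groupoid G) = grng G"
  by (simp_all add: opp_groupoid_def)

lemma opp_fbundle_simps [simp]:
  "btop (opp_fbundle B) = btop B" "bbase (opp_fbundle B) = bbase B" "bproj (opp_fbundle B) = bproj B"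
  "badd (opp_fbundle B) = badd B" "bzero (opp_fbundle B) = bzero B" "bscale (opp_fbundle B) = bscale B"
  "bnorm (opp_fbundle B) = bnorm B" "bmul (opp_fbundle B) a b = bmul B b a" "bstar (opp_fbundle B) = bstar B"
  by (simp_all add: opp_fbundle_def)

lemma opp_space_simps [simp]:
  "ttop (opp_space T) = ttop T" "lmom (opp_space T) = rmom T" "rmom (opp_space T) = lmom T"
  "lmul (opp_space T) k t = rmul T t k" "rmul (opp_space T) t h = lmul T h t"
  by (simp_all add: opp_space_def)

lemma opp_ebundle_simps [simp]:
  "btop (opp_ebundle E) = btop E" "bbase (opp_ebundle E) = bbase E" "bproj (opp_ebundle E) = bproj E"
  "badd (opp_ebundle E) = badd E" "bzero (opp_ebundle E) = bzero E" "bscale (opp_ebundle E) = bscale E"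
  "bnorm (opp_ebundle E) = bnorm E" "lact (opp_ebundle E) c e = ract E e c" "ract (opp_ebundle E) e b = lact E b e"
  "lip (opp_ebundle E) e f = rip E f e" "rip (opp_ebundle E) e f = lip E f e"
  by (simp_all add: opp_ebundle_def)

lemma fibre_cong:
  assumes "btop E = btop E'" "bproj E = bproj E'" "badd E = badd E'" "bzero E = bzero E'"
    "bscale E = bscale E'" "bnorm E = bnorm E'"
  shows "fibre E = fibre E'"
  unfolding fibre_def assms ..

lemma fibre_opp [simp]: "fibre (opp_fbundle B) = fibre B" "fibre (opp_ebundle E) = fibre E"
  by (rule fibre_cong; simp)+

lemma fibre_alg_opp [simp]: "fibre_alg (opp_fbundle B) u = opp_alg (fibre_alg B u)"
  by (simp add: fibre_alg_def opp_alg_def fun_eq_iff)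

lemma banach_bundle_cong:
  assumes "btop E = btop E'" "bbase E = bbase E'" "bproj E = bproj E'" "badd E = badd E'" "bzero E = bzero E'"
    "bscale E = bscale E'" "bnorm E = bnorm E'"
  shows "banach_bundle E \<longleftrightarrow> banach_bundle E'"
  unfolding banach_bundle_def assms fibre_cong[OF assms(1,3-7)] ..

lemma banach_bundle_opp [simp]:
  "banach_bundle (opp_fbundle B) = banach_bundle B" "banach_bundle (opp_ebundle E) = banach_bundle E"
  by (rule banach_bundle_cong; simp)+

lemma lsc_points_opp [simp]:
  "lsc_points (opp_fbundle B) D = lsc_points B D" "lsc_points (opp_ebundle E) D' = lsc_points E D'"
  by (simp_all add: lsc_points_def)

lemma composable_opp [simp]: "(g, h) \<in> composable (opp_groupoid G) \<longleftrightarrow> (h, g) \<in> composable G"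
  by (auto simp: composable_def)

lemma lcomp_opp [simp]: "(k, t) \<in> lcomp (opp_groupoid K) (opp_space T) \<longleftrightarrow> (t, k) \<in> rcomp K T"
  by (auto simp: lcomp_def rcomp_def)

lemma rcomp_opp [simp]: "(t, h) \<in> rcomp (opp_groupoid H) (opp_space T) \<longleftrightarrow> (h, t) \<in> lcomp H T"
  by (auto simp: lcomp_def rcomp_def)

lemma continuous_map_swap:
  assumes "continuous_map (subtopology (prod_topology X Y) S) Z f"
    "\<And>a b. (b, a) \<in> S' \<Longrightarrow> (a, b) \<in> S" "\<And>a b. f' (b, a) = f (a, b)"
  shows "continuous_map (subtopology (prod_topology Y X) S') Z f'"
proof -
  have "continuous_map (subtopology (prod_topology Y X) S') (subtopology (prod_topology X Y) S) (\<lambda>p. (snd p, fst p))"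
    by (intro continuous_map_into_subtopology continuous_map_pairedI continuous_map_from_subtopology
        continuous_map_fst continuous_map_snd) (use assms(2) in auto)
  from continuous_map_compose[OF this assms(1)] show ?thesis
    by (rule continuous_map_eq) (auto simp: assms(3))
qed

lemma (in lc_groupoid) rng_continuous: "continuous_map (gtop G) (gtop G) (grng G)"
proof -
  have "continuous_map (gtop G) (gtop G) (gsrc G \<circ> ginv G)"
    by (rule continuous_map_compose[OF inv_continuous src_continuous])
  then show ?thesis by (rule continuous_map_eq) (simp add: src_inv)
qed

lemma units_opp:
  assumes "lc_groupoid G" shows "units (opp_groupoid G) = units G"
proof -
  interpret lc_groupoid G by fact
  show ?thesis
  proof
    show "units (opp_groupoid G) \<subseteq> units G" using rng_units by (auto simp: units_def[of "opp_groupoid G"])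
    show "units G \<subseteq> units (opp_groupoid G)"
      using unit_rng units_arrows by (force simp: units_def[of "opp_groupoid G"])
  qed
qed

lemma lc_groupoid_opp:
  assumes "lc_groupoid G" shows "lc_groupoid (opp_groupoid G)"
proof -
  interpret lc_groupoid G by fact
  show ?thesis
  proof (rule lc_groupoid.intro)
    show "continuous_map (subtopology (prod_topology (gtop (opp_groupoid G)) (gtop (opp_groupoid G)))
        (composable (opp_groupoid G))) (gtop (opp_groupoid G)) (\<lambda>(g, h). gmul (opp_groupoid G) g h)"
      unfolding opp_groupoid_simps by (rule continuous_map_swap[OF mul_continuous]) auto
  qed (simp_all add: src_closed rng_closed src_src rng_src src_rng rng_rng mul_closed rng_mul src_mul mul_assoc
      rng_unit src_unit inv_closed rng_inv src_inv mul_inv inv_mul inv_continuous second_countable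
      locally_compact Hausdorff)
qed

lemma fell_bundle_opp:
  assumes "lc_groupoid G" "fell_bundle G B" shows "fell_bundle (opp_groupoid G) (opp_fbundle B)"
proof -
  interpret G: lc_groupoid G by fact
  interpret fell_bundle G B by fact
  show ?thesis
  proof (rule fell_bundle.intro)
    show "continuous_map (subtopology (prod_topology (btop (opp_fbundle B)) (btop (opp_fbundle B)))
        {(a, b). (bproj (opp_fbundle B) a, bproj (opp_fbundle B) b) \<in> composable (opp_groupoid G)})
        (btop (opp_fbundle B)) (\<lambda>(a, b). bmul (opp_fbundle B) a b)"
      unfolding opp_fbundle_simps by (rule continuous_map_swap[OF mul_continuous]) auto
    show "cstar_algebra (fibre_alg (opp_fbundle B) u)" if "u \<in> units (opp_groupoid G)" for u
      using fibre_cstar[of u] that by (simp add: cstar_algebra_opp_alg units_opp[OF assms(1)])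
    show "imprimitivity_bimodule (fibre_alg (opp_fbundle B) (grng (opp_groupoid G) g))
        (fibre_alg (opp_fbundle B) (gsrc (opp_groupoid G) g)) (fibre (opp_fbundle B) g)
        (bmul (opp_fbundle B)) (bmul (opp_fbundle B)) (\<lambda>a b. bmul (opp_fbundle B) a (bstar (opp_fbundle B) b))
        (\<lambda>a b. bmul (opp_fbundle B) (bstar (opp_fbundle B) a) b)" if "g \<in> arrows (opp_groupoid G)" for g
    proof -
      have "bmul (opp_fbundle B) = (\<lambda>a b. bmul B b a)" by (simp add: fun_eq_iff)
      then show ?thesis using imprimitivity_bimodule_opp[OF fibre_imprimitivity[of g]] that by simp
    qed
  qed (use is_banach_bundle star_continuous in \<open>simp_all add: base proj_mul mul_add_left mul_add_right
      mul_scale_left mul_scale_right mul_assoc proj_star star_star star_add star_scale star_mul\<close>)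
qed

lemma fell_left_action_opp:
  assumes "fell_right_action K C T E"
  shows "fell_left_action (opp_groupoid K) (opp_fbundle C) (opp_space T) (opp_ebundle E)"
proof -
  interpret fell_right_action K C T E by fact
  show ?thesis
  proof (rule fell_left_action.intro)
    show "continuous_map (subtopology (prod_topology (btop (opp_fbundle C)) (btop (opp_ebundle E)))
        {(b, e). (bproj (opp_fbundle C) b, bproj (opp_ebundle E) e) \<in> lcomp (opp_groupoid K) (opp_space T)})
        (btop (opp_ebundle E)) (\<lambda>(b, e). lact (opp_ebundle E) b e)"
      unfolding opp_fbundle_simps opp_ebundle_simps by (rule continuous_map_swap[OF continuous]) auto
    show "bnorm (opp_ebundle E) (lact (opp_ebundle E) b e) \<le> bnorm (opp_fbundle C) b * bnorm (opp_ebundle E) e"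
      if "(h, t) \<in> lcomp (opp_groupoid K) (opp_space T)" "b \<in> fib (opp_fbundle C) h" "e \<in> fib (opp_ebundle E) t"
      for h t b e using norm_act[of t h e b] that by (simp add: mult.commute)
  qed (simp_all add: proj_act act_act)
qed

lemma fell_right_action_opp:
  assumes "fell_left_action H B T E"
  shows "fell_right_action (opp_groupoid H) (opp_fbundle B) (opp_space T) (opp_ebundle E)"
proof -
  interpret fell_left_action H B T E by fact
  show ?thesis
  proof (rule fell_right_action.intro)
    show "continuous_map (subtopology (prod_topology (btop (opp_ebundle E)) (btop (opp_fbundle B)))
        {(e, c). (bproj (opp_ebundle E) e, bproj (opp_fbundle B) c) \<in> rcomp (opp_groupoid H) (opp_space T)})
        (btop (opp_ebundle E)) (\<lambda>(e, c). ract (opp_ebundle E) e c)"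
      unfolding opp_fbundle_simps opp_ebundle_simps by (rule continuous_map_swap[OF continuous]) auto
    show "bnorm (opp_ebundle E) (ract (opp_ebundle E) e c) \<le> bnorm (opp_ebundle E) e * bnorm (opp_fbundle B) c"
      if "(t, k) \<in> rcomp (opp_groupoid H) (opp_space T)" "e \<in> fib (opp_ebundle E) t" "c \<in> fib (opp_fbundle B) k"
      for t k e c using norm_act[of k t c e] that by (simp add: mult.commute)
  qed (simp_all add: proj_act act_act)
qed

lemma tau_opp [simp]:
  "tau_left (opp_groupoid K) (opp_space T) t t' = tau_right K T t' t"
  "tau_right (opp_groupoid H) (opp_space T) t t' = tau_left H T t' t"
  by (simp_all add: tau_left_def tau_right_def)

lemma fell_equivalence_opp:
  assumes "fell_equivalence H K B C T E"
  shows "fell_equivalence (opp_groupoid K) (opp_groupoid H) (opp_fbundle C) (opp_fbundle B) (opp_space T) (opp_ebundle E)"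
proof -
  interpret fell_equivalence H K B C T E by fact
  show ?thesis
  proof (rule fell_equivalence.intro)
    show "continuous_map (subtopology (prod_topology (btop (opp_ebundle E)) (btop (opp_ebundle E)))
        {(e, f). rmom (opp_space T) (bproj (opp_ebundle E) e) = rmom (opp_space T) (bproj (opp_ebundle E) f)})
        (btop (opp_fbundle C)) (\<lambda>(e, f). lip (opp_ebundle E) e f)"
      unfolding opp_fbundle_simps opp_ebundle_simps opp_space_simps
      by (rule continuous_map_swap[OF E2_rip_continuous]) auto
    show "continuous_map (subtopology (prod_topology (btop (opp_ebundle E)) (btop (opp_ebundle E)))
        {(e, f). lmom (opp_space T) (bproj (opp_ebundle E) e) = lmom (opp_space T) (bproj (opp_ebundle E) f)})
        (btop (opp_fbundle B)) (\<lambda>(e, f). rip (opp_ebundle E) e f)"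
      unfolding opp_fbundle_simps opp_ebundle_simps opp_space_simps
      by (rule continuous_map_swap[OF E2_lip_continuous]) auto
    show "imprimitivity_bimodule (fibre_alg (opp_fbundle C) (lmom (opp_space T) t))
        (fibre_alg (opp_fbundle B) (rmom (opp_space T) t)) (fibre (opp_ebundle E) t)
        (lact (opp_ebundle E)) (ract (opp_ebundle E)) (lip (opp_ebundle E)) (rip (opp_ebundle E))"
      if "t \<in> pts (opp_space T)" for t
    proof -
      have "lact (opp_ebundle E) = (\<lambda>c e. ract E e c)" "ract (opp_ebundle E) = (\<lambda>e b. lact E b e)"
        "lip (opp_ebundle E) = (\<lambda>e f. rip E f e)" "rip (opp_ebundle E) = (\<lambda>e f. lip E f e)"
        by (simp_all add: fun_eq_iff)
      then show ?thesis using imprimitivity_bimodule_opp[OF E3[of t]] that by simp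
    qed
    show "lact (opp_ebundle E) (lip (opp_ebundle E) e f) g = ract (opp_ebundle E) e (rip (opp_ebundle E) f g)"
      if "t \<in> pts (opp_space T)" "t' \<in> pts (opp_space T)" "t'' \<in> pts (opp_space T)"
        "rmom (opp_space T) t = rmom (opp_space T) t'" "lmom (opp_space T) t' = lmom (opp_space T) t''"
        "e \<in> fib (opp_ebundle E) t" "f \<in> fib (opp_ebundle E) t'" "g \<in> fib (opp_ebundle E) t''" for t t' t'' e f g
      using that E2_iv[of t'' t' t g f e] by simp
    show "lact (opp_ebundle E) b (ract (opp_ebundle E) e c) = ract (opp_ebundle E) (lact (opp_ebundle E) b e) c"
      if "(h, t) \<in> lcomp (opp_groupoid K) (opp_space T)" "(t, k) \<in> rcomp (opp_groupoid H) (opp_space T)"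
        "b \<in> fib (opp_fbundle C) h" "e \<in> fib (opp_ebundle E) t" "c \<in> fib (opp_fbundle B) k" for h t k b e c
      using that E1_commute[of k t h c e b] by simp
    show "lip (opp_ebundle E) (lact (opp_ebundle E) b e) f = bmul (opp_fbundle C) b (lip (opp_ebundle E) e f)"
      if "(h, t) \<in> lcomp (opp_groupoid K) (opp_space T)" "t' \<in> pts (opp_space T)"
        "rmom (opp_space T) t = rmom (opp_space T) t'"
        "b \<in> fib (opp_fbundle C) h" "e \<in> fib (opp_ebundle E) t" "f \<in> fib (opp_ebundle E) t'" for h t t' b e f
      using that E2_iii_right[of t h t' f e b] by simp
    show "rip (opp_ebundle E) e (ract (opp_ebundle E) f c) = bmul (opp_fbundle B) (rip (opp_ebundle E) e f) c"
      if "(t', k) \<in> rcomp (opp_groupoid H) (opp_space T)" "t \<in> pts (opp_space T)"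
        "lmom (opp_space T) t = lmom (opp_space T) t'"
        "e \<in> fib (opp_ebundle E) t" "f \<in> fib (opp_ebundle E) t'" "c \<in> fib (opp_fbundle B) k" for t t' k e f c
      using that E2_iii_left[of k t' t c f e] by simp
  qed (use is_banach_bundle base fell_left_action_opp[OF E1_right] fell_right_action_opp[OF E1_left] in
      \<open>simp_all add: E2_lip_add_left E2_lip_add_right E2_lip_scale_left E2_lip_scale_right
        E2_rip_add_left E2_rip_add_right E2_rip_scale_left E2_rip_scale_right E2_i_left E2_i_right
        E2_ii_left E2_ii_right\<close>)
qed

text \<open>These consequences of an equivalence of groupoids are all that is needed below. Unlike the
  definition, they are visibly invariant under passing to opposites.\<close>

locale equivalence_space =
  fixes H :: "'h groupoid" and K :: "'k groupoid" and T :: "('t, 'h, 'k) gspace"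
  assumes left_groupoid: "lc_groupoid H" and right_groupoid: "lc_groupoid K"
    and lmom_continuous: "continuous_map (ttop T) (unit_top H) (lmom T)"
    and rmom_continuous: "continuous_map (ttop T) (unit_top K) (rmom T)"
    and lmom_open: "open_map (ttop T) (unit_top H) (lmom T)"
    and rmom_open: "open_map (ttop T) (unit_top K) (rmom T)"
    and lmom_onto: "lmom T ` pts T = units H"
    and rmom_onto: "rmom T ` pts T = units K"
    and lmul_continuous: "continuous_map (subtopology (prod_topology (gtop H) (ttop T)) (lcomp H T)) (ttop T)
      (\<lambda>(h, t). lmul T h t)"
    and rmul_continuous: "continuous_map (subtopology (prod_topology (ttop T) (gtop K)) (rcomp K T)) (ttop T)
      (\<lambda>(t, k). rmul T t k)"
    and lmom_lmul: "(h, t) \<in> lcomp H T \<Longrightarrow> lmom T (lmul T h t) = grng H h"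
    and rmom_rmul: "(t, k) \<in> rcomp K T \<Longrightarrow> rmom T (rmul T t k) = gsrc K k"
    and lmom_rmul: "(t, k) \<in> rcomp K T \<Longrightarrow> lmom T (rmul T t k) = lmom T t"
    and rmom_lmul: "(h, t) \<in> lcomp H T \<Longrightarrow> rmom T (lmul T h t) = rmom T t"
    and lmul_lmul: "\<lbrakk>(g, h) \<in> composable H; (h, t) \<in> lcomp H T\<rbrakk> \<Longrightarrow> lmul T g (lmul T h t) = lmul T (gmul H g h) t"
    and rmul_rmul: "\<lbrakk>(t, k) \<in> rcomp K T; (k, l) \<in> composable K\<rbrakk> \<Longrightarrow> rmul T (rmul T t k) l = rmul T t (gmul K k l)"
    and lmul_unit: "t \<in> pts T \<Longrightarrow> lmul T (lmom T t) t = t"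
    and rmul_unit: "t \<in> pts T \<Longrightarrow> rmul T t (rmom T t) = t"
    and actions_commute: "\<lbrakk>(h, t) \<in> lcomp H T; (t, k) \<in> rcomp K T\<rbrakk>
      \<Longrightarrow> rmul T (lmul T h t) k = lmul T h (rmul T t k)"
    and left_transitive: "\<lbrakk>t \<in> pts T; t' \<in> pts T; rmom T t = rmom T t'\<rbrakk>
      \<Longrightarrow> \<exists>h. (h, t') \<in> lcomp H T \<and> lmul T h t' = t"
    and right_transitive: "\<lbrakk>t \<in> pts T; t' \<in> pts T; lmom T t = lmom T t'\<rbrakk>
      \<Longrightarrow> \<exists>k. (t', k) \<in> rcomp K T \<and> rmul T t' k = t"
    and tau_left: "(h, t) \<in> lcomp H T \<Longrightarrow> tau_left H T (lmul T h t) t = h"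
    and tau_right: "(t, k) \<in> rcomp K T \<Longrightarrow> tau_right K T t (rmul T t k) = k"

lemma equivalence_space_opp:
  assumes "equivalence_space H K T"
  shows "equivalence_space (opp_groupoid K) (opp_groupoid H) (opp_space T)"
proof -
  interpret equivalence_space H K T by fact
  interpret H: lc_groupoid H by (rule left_groupoid)
  interpret K: lc_groupoid K by (rule right_groupoid)
  show ?thesis
  proof (rule equivalence_space.intro)
    show "continuous_map (subtopology (prod_topology (gtop (opp_groupoid K)) (ttop (opp_space T)))
        (lcomp (opp_groupoid K) (opp_space T))) (ttop (opp_space T)) (\<lambda>(h, t). lmul (opp_space T) h t)"
      unfolding opp_groupoid_simps opp_space_simps by (rule continuous_map_swap[OF rmul_continuous]) auto
    show "continuous_map (subtopology (prod_topology (ttop (opp_space T)) (gtop (opp_groupoid H)))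
        (rcomp (opp_groupoid H) (opp_space T))) (ttop (opp_space T)) (\<lambda>(t, k). rmul (opp_space T) t k)"
      unfolding opp_groupoid_simps opp_space_simps by (rule continuous_map_swap[OF lmul_continuous]) auto
  qed (use left_transitive right_transitive lmom_continuous rmom_continuous lmom_open rmom_open in
      \<open>simp_all add: units_opp lc_groupoid_opp left_groupoid right_groupoid lmom_onto rmom_onto lmom_lmul rmom_rmul
      lmom_rmul rmom_lmul lmul_lmul rmul_rmul lmul_unit rmul_unit actions_commute tau_left tau_right\<close>)
qed

text \<open>Freeness only says that an arrow fixing a point is a unit. Applied to the quotient of
  two arrows with the same effect, this lemma turns it into uniqueness of the translating arrow,
  hence into the values of \<open>tau_left\<close> and \<open>tau_right\<close>.\<close>

lemma (in lc_groupoid) eq_if_quotient_unit: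
  assumes gh: "(ginv G g, h) \<in> composable G" and g: "g \<in> arrows G" and u: "gmul G (ginv G g) h \<in> units G"
  shows "g = h"
proof -
  have h: "h \<in> arrows G" and r: "grng G h = grng G g" using gh g by (auto simp: composable_def src_inv)
  have "gmul G g (gmul G (ginv G g) h) = gmul G (gmul G g (ginv G g)) h"
    by (rule mul_assoc[symmetric]) (use gh g in \<open>auto simp: composable_def inv_closed rng_inv\<close>)
  also have "\<dots> = h" using mul_inv[OF g] rng_unit[OF h] r by simp
  finally have "gmul G g (gmul G (ginv G g) h) = h" .
  moreover have "gmul G (ginv G g) h = gsrc G g"
    using unit_rng[OF u] rng_mul[OF gh] rng_inv[OF g] by simp
  ultimately show ?thesis using src_unit[OF g] by simp
qed

lemma topspace_orbit_space: "topspace (orbit_space X orb) = orb ` topspace X"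
proof
  show "topspace (orbit_space X orb) \<subseteq> orb ` topspace X"
    using openin_topspace[of "orbit_space X orb"] unfolding openin_orbit_space by blast
  have "{x \<in> topspace X. orb x \<in> orb ` topspace X} = topspace X" by auto
  then have "openin (orbit_space X orb) (orb ` topspace X)" by (simp add: openin_orbit_space)
  then show "orb ` topspace X \<subseteq> topspace (orbit_space X orb)" by (rule openin_subset)
qed

lemma induces_homeomorphismD:
  assumes "induces_homeomorphism X orb Y f"
  shows "f ` topspace X = topspace Y"
    and "\<And>x y. \<lbrakk>x \<in> topspace X; y \<in> topspace X; f x = f y\<rbrakk> \<Longrightarrow> orb x = orb y"
proof -
  obtain F where F: "homeomorphic_map (orbit_space X orb) Y F" "\<And>x. x \<in> topspace X \<Longrightarrow> F (orb x) = f x"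
    using assms unfolding induces_homeomorphism_def by blast
  have "F ` (orb ` topspace X) = topspace Y"
    using homeomorphic_imp_surjective_map[OF F(1)] by (simp add: topspace_orbit_space)
  then show "f ` topspace X = topspace Y" using F(2) by (auto simp: image_image)
  have "inj_on F (orb ` topspace X)"
    using homeomorphic_imp_injective_map[OF F(1)] by (simp add: topspace_orbit_space)
  then show "orb x = orb y" if "x \<in> topspace X" "y \<in> topspace X" "f x = f y" for x y
    using that F(2) by (metis image_eqI inj_onD)
qed

text \<open>Equal moments give equal orbits by injectivity of the induced homeomorphism. A point
  lies in its own orbit through the unit at its moment, hence in the orbit of the other point, and
  this yields the translating arrow; freeness makes it unique.\<close>

lemma equivalence_space_groupoid_equivalence:
  fixes H :: "'h groupoid" and K :: "'k groupoid" and T :: "('t, 'h, 'k) gspace"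
  assumes H: "lc_groupoid H" and K: "lc_groupoid K" and equiv: "groupoid_equivalence H K T"
  shows "equivalence_space H K T"
proof -
  interpret H: lc_groupoid H by fact
  interpret K: lc_groupoid K by fact
  interpret groupoid_equivalence H K T by fact
  interpret L: free_proper_left_space H T by (rule left_space)
  interpret R: free_proper_right_space K T by (rule right_space)
  have topU: "topspace (unit_top H) = units H" "topspace (unit_top K) = units K"
    using H.units_arrows K.units_arrows by auto
  have lmom_arrows: "lmom T t \<in> units H" "rmom T t \<in> units K" if "t \<in> pts T" for t
    using continuous_map_image_subset_topspace[OF L.mom_continuous]
      continuous_map_image_subset_topspace[OF R.mom_continuous] topU that by blast+
  have unit_comp: "(lmom T t, t) \<in> lcomp H T" "(t, rmom T t) \<in> rcomp K T" if "t \<in> pts T" for t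
    using lmom_arrows[OF that] that
    by (simp_all add: lcomp_def rcomp_def H.units_arrows K.units_arrows H.unit_src K.unit_rng)
  show ?thesis
  proof (rule equivalence_space.intro)
    show "lmom T ` pts T = units H" "rmom T ` pts T = units K"
      using induces_homeomorphismD(1)[OF lmom_orbits] induces_homeomorphismD(1)[OF rmom_orbits] topU by simp_all
    show "\<exists>h. (h, t') \<in> lcomp H T \<and> lmul T h t' = t" if "t \<in> pts T" "t' \<in> pts T" "rmom T t = rmom T t'" for t t'
    proof -
      have "t \<in> {lmul T h t | h. (h, t) \<in> lcomp H T}"
        using unit_comp(1)[OF that(1)] L.unit_act[OF that(1)] by (intro CollectI exI[of _ "lmom T t"]) simp
      then show ?thesis using induces_homeomorphismD(2)[OF rmom_orbits that] by auto
    qed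
    show "\<exists>k. (t', k) \<in> rcomp K T \<and> rmul T t' k = t" if "t \<in> pts T" "t' \<in> pts T" "lmom T t = lmom T t'" for t t'
    proof -
      have "t \<in> {rmul T t k | k. (t, k) \<in> rcomp K T}"
        using unit_comp(2)[OF that(1)] R.unit_act[OF that(1)] by (intro CollectI exI[of _ "rmom T t"]) simp
      then show ?thesis using induces_homeomorphismD(2)[OF lmom_orbits that] by auto
    qed
    show "tau_left H T (lmul T h t) t = h" if ht: "(h, t) \<in> lcomp H T" for h t
      unfolding tau_left_def
    proof (rule the_equality)
      fix g assume g: "(g, t) \<in> lcomp H T \<and> lmul T g t = lmul T h t"
      have ar: "g \<in> arrows H" "h \<in> arrows H" "t \<in> pts T" "gsrc H g = lmom T t" "gsrc H h = lmom T t"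
        using ht g by (auto simp: lcomp_def)
      have r: "grng H g = grng H h" using L.mom_act[OF ht] L.mom_act[of g t] g by simp
      have comp: "(ginv H g, h) \<in> composable H" "(ginv H g, g) \<in> composable H"
        using ar r by (auto simp: composable_def H.inv_closed H.src_inv)
      have "lmul T (gmul H (ginv H g) h) t = lmul T (ginv H g) (lmul T h t)"
        by (rule L.act_act[OF comp(1) ht, symmetric])
      also have "\<dots> = lmul T (ginv H g) (lmul T g t)" using g by simp
      also have "\<dots> = t" using L.act_act[OF comp(2) g[THEN conjunct1]] H.inv_mul[OF ar(1)] ar(3,4) L.unit_act by simp
      finally have "lmul T (gmul H (ginv H g) h) t = t" .
      moreover have "(gmul H (ginv H g) h, t) \<in> lcomp H T"
        using ar H.mul_closed[OF comp(1)] H.src_mul[OF comp(1)] by (simp add: lcomp_def)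
      ultimately have "gmul H (ginv H g) h \<in> units H" by (rule L.free[rotated])
      then show "g = h" by (rule H.eq_if_quotient_unit[OF comp(1) ar(1)])
    qed (use ht in simp)
    show "tau_right K T t (rmul T t k) = k" if tk: "(t, k) \<in> rcomp K T" for t k
      unfolding tau_right_def
    proof (rule the_equality)
      \<comment> \<open>On the right the quotient is \<open>k g^-1\<close>, which has the shape
        required by \<open>eq_if_quotient_unit\<close> in the opposite groupoid.\<close>
      interpret K': lc_groupoid "opp_groupoid K" by (rule lc_groupoid_opp[OF K])
      fix g assume g: "(t, g) \<in> rcomp K T \<and> rmul T t g = rmul T t k"
      have ar: "g \<in> arrows K" "k \<in> arrows K" "t \<in> pts T" "grng K g = rmom T t" "grng K k = rmom T t"
        using tk g by (auto simp: rcomp_def)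
      have r: "gsrc K g = gsrc K k" using R.mom_act[OF tk] R.mom_act[of t g] g by simp
      have comp: "(k, ginv K g) \<in> composable K" "(g, ginv K g) \<in> composable K"
        using ar r by (auto simp: composable_def K.inv_closed K.rng_inv)
      have "rmul T t (gmul K k (ginv K g)) = rmul T (rmul T t k) (ginv K g)"
        by (rule R.act_act[OF tk comp(1), symmetric])
      also have "\<dots> = rmul T (rmul T t g) (ginv K g)" using g by simp
      also have "\<dots> = t" using R.act_act[OF g[THEN conjunct1] comp(2)] K.mul_inv[OF ar(1)] ar(3,4) R.unit_act by simp
      finally have "rmul T t (gmul K k (ginv K g)) = t" .
      moreover have "(t, gmul K k (ginv K g)) \<in> rcomp K T"
        using ar K.mul_closed[OF comp(1)] K.rng_mul[OF comp(1)] by (simp add: rcomp_def)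
      ultimately have "gmul K k (ginv K g) \<in> units K" by (rule R.free[rotated])
      then show "g = k" using K'.eq_if_quotient_unit[of g k] comp(1) ar(1) by (simp add: units_opp[OF K])
    qed (use tk in simp)
  qed (use H K in \<open>simp_all add: L.mom_continuous R.mom_continuous lmom_open rmom_open L.act_continuous
      R.act_continuous L.mom_act R.mom_act lmom_rmul rmom_lmul L.act_act R.act_act L.unit_act R.unit_act
      actions_commute\<close>)
qed

section \<open>Submodules and ideals\<close>

lemma (in right_hilbert_module) ip_ext:
  assumes "x \<in> carrier X" "y \<in> carrier X" "\<And>z. z \<in> carrier X \<Longrightarrow> ip z x = ip z y" shows "x = y"
proof -
  let ?z = "vsub X x y"
  have z: "?z \<in> carrier X" using assms(1,2) by simp
  have "ip ?z ?z = vsub B (ip ?z x) (ip ?z y)" using ip_add_right[OF z assms(1)] ip_scale_right[OF z assms(2)] assms(2) by simp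
  also have "\<dots> = vzero B" using assms z by simp
  finally have "?z = vzero X" by (rule ip_definite[OF z])
  then show ?thesis by (rule X.vsub_eq_zero[OF assms(1,2)])
qed

locale bundle_equivalence = equivalence_space H K T
  for H :: "'h groupoid" and K :: "'k groupoid" and T :: "('t, 'h, 'k) gspace" +
  fixes B :: "('b, 'h) fbundle" and C :: "('c, 'k) fbundle" and E :: "('e, 't, 'b, 'c) ebundle"
  assumes left_bundle: "fell_bundle H B" and right_bundle: "fell_bundle K C"
    and equivalence: "fell_equivalence H K B C T E"

lemma bundle_equivalence_opp:
  assumes "bundle_equivalence H K T B C E"
  shows "bundle_equivalence (opp_groupoid K) (opp_groupoid H) (opp_space T) (opp_fbundle C) (opp_fbundle B) (opp_ebundle E)"
proof -
  interpret bundle_equivalence H K T B C E by fact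
  show ?thesis
    by (intro bundle_equivalence.intro bundle_equivalence_axioms.intro equivalence_space_opp[OF equivalence_space_axioms]
        fell_bundle_opp left_groupoid right_groupoid left_bundle right_bundle fell_equivalence_opp[OF equivalence])
qed

section \<open>Actions and inner products between different fibres\<close>

context bundle_equivalence
begin

sublocale HB: groupoid_fell_bundle H B
  by (intro groupoid_fell_bundle.intro left_groupoid left_bundle)

sublocale KC: groupoid_fell_bundle K C
  by (intro groupoid_fell_bundle.intro right_groupoid right_bundle)

sublocale XE: fell_equivalence H K B C T E by (rule equivalence)

sublocale EB: banach_bundle E by (rule XE.is_banach_bundle)

lemma bimodule:
  "t \<in> pts T \<Longrightarrow> imprimitivity_bimodule (fibre_alg B (lmom T t)) (fibre_alg C (rmom T t)) (fibre E t)
    (lact E) (ract E) (lip E) (rip E)"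
  by (rule XE.E3)

lemma fib_pts: "e \<in> fib E t \<Longrightarrow> t \<in> pts T"
  using EB.fib_base by (simp add: XE.base)

lemma mom_units: "t \<in> pts T \<Longrightarrow> lmom T t \<in> units H" "t \<in> pts T \<Longrightarrow> rmom T t \<in> units K"
  using lmom_onto rmom_onto by auto

lemma unit_comp:
  assumes "t \<in> pts T" shows "(lmom T t, t) \<in> lcomp H T" "(t, rmom T t) \<in> rcomp K T"
  using mom_units[OF assms] assms
  by (simp_all add: lcomp_def rcomp_def HB.G.units_arrows KC.G.units_arrows HB.G.unit_src KC.G.unit_rng)

lemma rcompD:
  assumes "(t, k) \<in> rcomp K T"
  shows "t \<in> pts T" "k \<in> arrows K" "rmom T t = grng K k" "rmul T t k \<in> pts T"
proof -
  show "t \<in> pts T" "k \<in> arrows K" "rmom T t = grng K k" using assms by (auto simp: rcomp_def)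
  have "(\<lambda>(t, k). rmul T t k) (t, k) \<in> pts T"
    using continuous_map_image_subset_topspace[OF rmul_continuous] assms by (force simp: rcomp_def)
  then show "rmul T t k \<in> pts T" by simp
qed

lemma lcompD:
  assumes "(h, t) \<in> lcomp H T"
  shows "t \<in> pts T" "h \<in> arrows H" "gsrc H h = lmom T t" "lmul T h t \<in> pts T"
proof -
  show "t \<in> pts T" "h \<in> arrows H" "gsrc H h = lmom T t" using assms by (auto simp: lcomp_def)
  have "(\<lambda>(h, t). lmul T h t) (h, t) \<in> pts T"
    using continuous_map_image_subset_topspace[OF lmul_continuous] assms by (force simp: lcomp_def)
  then show "lmul T h t \<in> pts T" by simp
qed

lemma rmul_inv:
  assumes tk: "(t, k) \<in> rcomp K T"
  shows "(rmul T t k, ginv K k) \<in> rcomp K T" "rmul T (rmul T t k) (ginv K k) = t"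
proof -
  note D = rcompD[OF tk]
  show "(rmul T t k, ginv K k) \<in> rcomp K T"
    using D rmom_rmul[OF tk] by (simp add: rcomp_def KC.G.inv_closed KC.G.rng_inv)
  show "rmul T (rmul T t k) (ginv K k) = t"
    using rmul_rmul[OF tk, of "ginv K k"] KC.composable_simps(4)[OF D(2)] KC.G.mul_inv[OF D(2)] rmul_unit[OF D(1)] D(3)
    by simp
qed

lemma rcomp_mul:
  assumes "(t, k) \<in> rcomp K T" "(k, l) \<in> composable K"
  shows "(rmul T t k, l) \<in> rcomp K T" "(t, gmul K k l) \<in> rcomp K T"
  using rcompD[OF assms(1)] rmom_rmul[OF assms(1)] assms(2) KC.G.mul_closed KC.G.rng_mul
  by (auto simp: rcomp_def composable_def)

lemma ract_fib:
  assumes tk: "(t, k) \<in> rcomp K T" and e: "e \<in> fib E t" and c: "c \<in> fib C k"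
  shows "ract E e c \<in> fib E (rmul T t k)"
proof -
  interpret A: fell_right_action K C T E by (rule XE.E1_right)
  have "(\<lambda>(e, c). ract E e c) (e, c) \<in> topspace (btop E)"
    using continuous_map_image_subset_topspace[OF A.continuous] tk e c by (force simp: in_fib)
  then show ?thesis using A.proj_act[OF tk e c] by (simp add: in_fib)
qed

lemma lact_fib:
  assumes ht: "(h, t) \<in> lcomp H T" and b: "b \<in> fib B h" and e: "e \<in> fib E t"
  shows "lact E b e \<in> fib E (lmul T h t)"
proof -
  interpret A: fell_left_action H B T E by (rule XE.E1_left)
  have "(\<lambda>(b, e). lact E b e) (b, e) \<in> topspace (btop E)"
    using continuous_map_image_subset_topspace[OF A.continuous] ht e b by (force simp: in_fib)
  then show ?thesis using A.proj_act[OF ht b e] by (simp add: in_fib)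
qed

lemma rip_fib:
  assumes tk: "(t, k) \<in> rcomp K T" and e: "e \<in> fib E t" and f: "f \<in> fib E (rmul T t k)"
  shows "rip E e f \<in> fib C k"
proof -
  have "(\<lambda>(e, f). rip E e f) (e, f) \<in> topspace (btop C)"
    using continuous_map_image_subset_topspace[OF XE.E2_rip_continuous] e f lmom_rmul[OF tk] by (force simp: in_fib)
  then show ?thesis
    using XE.E2_i_right[OF rcompD(1,4)[OF tk] _ e f] lmom_rmul[OF tk] tau_right[OF tk] by (simp add: in_fib)
qed

lemma rip_fib':
  assumes tk: "(t, k) \<in> rcomp K T" and e: "e \<in> fib E (rmul T t k)" and f: "f \<in> fib E t"
  shows "rip E e f \<in> fib C (ginv K k)"
  by (rule rip_fib[OF rmul_inv(1)[OF tk] e]) (simp add: rmul_inv(2)[OF tk] f)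

lemma ract_ract:
  "\<lbrakk>(t, k) \<in> rcomp K T; (k, l) \<in> composable K; e \<in> fib E t; c \<in> fib C k; d \<in> fib C l\<rbrakk>
    \<Longrightarrow> ract E (ract E e c) d = ract E e (bmul C c d)"
  using fell_right_action.act_act[OF XE.E1_right] .

lemma rip_ract:
  "\<lbrakk>(t, k) \<in> rcomp K T; g \<in> fib E (rmul T t k); e \<in> fib E t; c \<in> fib C k\<rbrakk>
    \<Longrightarrow> rip E g (ract E e c) = bmul C (rip E g e) c"
  using XE.E2_iii_right[of t k "rmul T t k" g e c] rcompD[of t k] lmom_rmul[of t k] by simp

text \<open>The bimodule axioms give bilinearity for the unit fibres acting on a single
  \<open>E_t\<close>. For a general arrow both sides are paired with vectors of the target fibre:
  this moves the claim into the multiplication of \<open>C\<close>, and inner products separate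
  vectors.\<close>

lemma ract_linear:
  assumes tk: "(t, k) \<in> rcomp K T"
  shows "\<And>e e' c. \<lbrakk>e \<in> fib E t; e' \<in> fib E t; c \<in> fib C k\<rbrakk>
      \<Longrightarrow> ract E (badd E e e') c = badd E (ract E e c) (ract E e' c)"
    and "\<And>e c c'. \<lbrakk>e \<in> fib E t; c \<in> fib C k; c' \<in> fib C k\<rbrakk>
      \<Longrightarrow> ract E e (badd C c c') = badd E (ract E e c) (ract E e c')"
    and "\<And>e c l. \<lbrakk>e \<in> fib E t; c \<in> fib C k\<rbrakk> \<Longrightarrow> ract E (bscale E l e) c = bscale E l (ract E e c)"
    and "\<And>e c l. \<lbrakk>e \<in> fib E t; c \<in> fib C k\<rbrakk> \<Longrightarrow> ract E e (bscale C l c) = bscale E l (ract E e c)"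
proof -
  note D = rcompD[OF tk]
  interpret M: imprimitivity_bimodule "fibre_alg B (lmom T (rmul T t k))" "fibre_alg C (rmom T (rmul T t k))"
    "fibre E (rmul T t k)" "lact E" "ract E" "lip E" "rip E" by (rule bimodule[OF D(4)])
  have comp: "(ginv K k, k) \<in> composable K" by (rule KC.composable_simps(3)[OF D(2)])
  have cl: "ract E e c \<in> fib E (rmul T t k)" if "e \<in> fib E t" "c \<in> fib C k" for e c by (rule ract_fib[OF tk that])
  have ip_add: "rip E g (badd E x y) = badd C (rip E g x) (rip E g y)"
    "rip E g (bscale E l x) = bscale C l (rip E g x)"
    if "g \<in> fib E (rmul T t k)" "x \<in> fib E (rmul T t k)" "y \<in> fib E (rmul T t k)" for g x y l
    using M.R.ip_add_right[of g x y] M.R.ip_scale_right[of g x l] that by simp_all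
  note ext = M.R.ip_ext[simplified]
  show "ract E (badd E e e') c = badd E (ract E e c) (ract E e' c)"
    if "e \<in> fib E t" "e' \<in> fib E t" "c \<in> fib C k" for e e' c
  proof (rule ext)
    fix g assume g: "g \<in> fib E (rmul T t k)"
    have "rip E g (badd E e e') = badd C (rip E g e) (rip E g e')"
      using XE.E2_rip_add_right[OF D(4,1) lmom_rmul[OF tk] g] that by simp
    then show "rip E g (ract E (badd E e e') c) = rip E g (badd E (ract E e c) (ract E e' c))"
      using rip_ract[OF tk g] that g ip_add(1)[OF g cl cl] EB.fib_vector_closed
        KC.F.mul_add_left[OF comp rip_fib'[OF tk g] rip_fib'[OF tk g]] by simp
  qed (use that cl EB.fib_vector_closed in auto)
  show "ract E e (badd C c c') = badd E (ract E e c) (ract E e c')"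
    if "e \<in> fib E t" "c \<in> fib C k" "c' \<in> fib C k" for e c c'
  proof (rule ext)
    fix g assume g: "g \<in> fib E (rmul T t k)"
    show "rip E g (ract E e (badd C c c')) = rip E g (badd E (ract E e c) (ract E e c'))"
      using rip_ract[OF tk g] that g ip_add(1)[OF g cl cl] KC.fib_vector_closed
        KC.F.mul_add_right[OF comp rip_fib'[OF tk g]] by simp
  qed (use that cl EB.fib_vector_closed KC.fib_vector_closed in auto)
  show "ract E (bscale E l e) c = bscale E l (ract E e c)" if "e \<in> fib E t" "c \<in> fib C k" for e c l
  proof (rule ext)
    fix g assume g: "g \<in> fib E (rmul T t k)"
    have "rip E g (bscale E l e) = bscale C l (rip E g e)"
      using XE.E2_rip_scale_right[OF D(4,1) lmom_rmul[OF tk] g] that by simp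
    then show "rip E g (ract E (bscale E l e) c) = rip E g (bscale E l (ract E e c))"
      using rip_ract[OF tk g] that g ip_add(2)[OF g cl cl] EB.fib_vector_closed
        KC.F.mul_scale_left[OF comp rip_fib'[OF tk g]] by simp
  qed (use that cl EB.fib_vector_closed in auto)
  show "ract E e (bscale C l c) = bscale E l (ract E e c)" if "e \<in> fib E t" "c \<in> fib C k" for e c l
  proof (rule ext)
    fix g assume g: "g \<in> fib E (rmul T t k)"
    show "rip E g (ract E e (bscale C l c)) = rip E g (bscale E l (ract E e c))"
      using rip_ract[OF tk g] that g ip_add(2)[OF g cl cl] KC.fib_vector_closed
        KC.F.mul_scale_right[OF comp rip_fib'[OF tk g]] by simp
  qed (use that cl EB.fib_vector_closed KC.fib_vector_closed in auto)
qed

lemma banach_fibres: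
  "t \<in> pts T \<Longrightarrow> complex_banach_space (fibre E t)" "k \<in> arrows K \<Longrightarrow> complex_banach_space (fibre C k)"
  using EB.fibre_banach KC.fibre_banach by (simp_all add: XE.base KC.F.base)

lemma closed_subspace_ract_vimage:
  assumes tk: "(t, k) \<in> rcomp K T" and W: "closed_subspace (fibre E (rmul T t k)) W"
  shows "e \<in> fib E t \<Longrightarrow> closed_subspace (fibre C k) {c \<in> fib C k. ract E e c \<in> W}"
    and "c \<in> fib C k \<Longrightarrow> closed_subspace (fibre E t) {e \<in> fib E t. ract E e c \<in> W}"
proof -
  note D = rcompD[OF tk]
  note norm = fell_right_action.norm_act[OF XE.E1_right tk]
  show "closed_subspace (fibre C k) {c \<in> fib C k. ract E e c \<in> W}" if e: "e \<in> fib E t"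
    by (rule closed_subspace_vimage[where K = "bnorm E e", OF banach_fibres(2)[OF D(2)] banach_fibres(1)[OF D(4)] _ _ _ _ _ W])
      (use e norm ract_fib[OF tk] ract_linear[OF tk] in auto)
  show "closed_subspace (fibre E t) {e \<in> fib E t. ract E e c \<in> W}" if c: "c \<in> fib C k"
    by (rule closed_subspace_vimage[where K = "bnorm C c", OF banach_fibres(1)[OF D(1)] banach_fibres(1)[OF D(4)] _ _ _ _ _ W])
      (use c norm ract_fib[OF tk] ract_linear[OF tk] in \<open>auto simp: mult.commute\<close>)
qed

definition submodule :: "'e set \<Rightarrow> bool" where
  "submodule M \<longleftrightarrow> M \<subseteq> lsc_points E M \<and> (\<forall>t\<in>pts T. closed_subspace (fibre E t) (M \<inter> fib E t)) \<and>
     (\<forall>h t b m. (h, t) \<in> lcomp H T \<longrightarrow> b \<in> fib B h \<longrightarrow> m \<in> fib E t \<longrightarrow> m \<in> M \<longrightarrow> lact E b m \<in> M) \<and>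
     (\<forall>t k m c. (t, k) \<in> rcomp K T \<longrightarrow> m \<in> fib E t \<longrightarrow> m \<in> M \<longrightarrow> c \<in> fib C k \<longrightarrow> ract E m c \<in> M)"

lemma submoduleD:
  assumes "submodule M"
  shows "M \<subseteq> lsc_points E M" "M \<subseteq> topspace (btop E)" "\<And>t. t \<in> pts T \<Longrightarrow> closed_subspace (fibre E t) (M \<inter> fib E t)"
    "\<And>h t b m. \<lbrakk>(h, t) \<in> lcomp H T; b \<in> fib B h; m \<in> fib E t; m \<in> M\<rbrakk> \<Longrightarrow> lact E b m \<in> M"
    "\<And>t k m c. \<lbrakk>(t, k) \<in> rcomp K T; m \<in> fib E t; m \<in> M; c \<in> fib C k\<rbrakk> \<Longrightarrow> ract E m c \<in> M"
proof -
  show "M \<subseteq> lsc_points E M" using assms unfolding submodule_def by (elim conjE)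
  then show "M \<subseteq> topspace (btop E)" by (auto simp: lsc_points_def)
qed (use assms in \<open>simp_all add: submodule_def\<close>)

text \<open>Applied to all of \<open>E\<close>, the fullness lemmas below become density of the
  products \<open>B_h E_t\<close> in the fibre over \<open>h t\<close>.\<close>

lemma submodule_total: "submodule (topspace (btop E))"
  unfolding submodule_def
proof (intro conjI allI impI ballI)
  show "topspace (btop E) \<subseteq> lsc_points E (topspace (btop E))"
  proof
    fix e assume e: "e \<in> topspace (btop E)"
    show "e \<in> lsc_points E (topspace (btop E))"
    proof (rule lsc_pointsI[OF e])
      fix V assume V: "openin (btop E) V" "e \<in> V"
      have "openin (bbase E) (bproj E ` V)" using EB.proj_open V(1) by (simp add: open_map_def)
      then show "\<exists>W. openin (bbase E) W \<and> bproj E e \<in> W \<and> (\<forall>x\<in>W. \<exists>d. d \<in> V \<and> d \<in> topspace (btop E) \<and> bproj E d = x)"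
        using V openin_subset[OF V(1)] by (intro exI[of _ "bproj E ` V"]) auto
    qed
  qed
  show "closed_subspace (fibre E t) (topspace (btop E) \<inter> fib E t)" if "t \<in> pts T" for t
  proof -
    have "topspace (btop E) \<inter> fib E t = fib E t" by (auto simp: in_fib)
    then show ?thesis using complex_banach_space.closed_subspace_carrier[OF banach_fibres(1)[OF that]] by simp
  qed
qed (use lact_fib ract_fib in \<open>simp_all add: in_fib\<close>)

text \<open>Fullness is automatic: \<open>C\<^sub>k\<^sup>* C\<^sub>k\<close> spans a dense subspace of \<open>C\<^bsub>s(k)\<^esub>\<close>, which acts nondegenerately.\<close>

lemma submodule_right_full:
  assumes M: "submodule M" and tk: "(t, k) \<in> rcomp K T"
  shows "nclosure (fibre E (rmul T t k)) (prod_span (fibre E (rmul T t k)) (ract E) (M \<inter> fib E t) (fib C k))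
    = M \<inter> fib E (rmul T t k)" (is "?W = _")
proof
  note D = rcompD[OF tk]
  note M' = submoduleD[OF M]
  let ?s = "rmul T t k"
  interpret M: imprimitivity_bimodule "fibre_alg B (lmom T ?s)" "fibre_alg C (rmom T ?s)"
    "fibre E ?s" "lact E" "ract E" "lip E" "rip E" by (rule bimodule[OF D(4)])
  interpret I: imprimitivity_bimodule "fibre_alg C (grng K k)" "fibre_alg C (gsrc K k)" "fibre C k"
    "bmul C" "bmul C" "\<lambda>a b. bmul C a (bstar C b)" "\<lambda>a b. bmul C (bstar C a) b" by (rule KC.F.fibre_imprimitivity[OF D(2)])
  have act: "ract E m c \<in> M \<inter> fib E ?s" if "m \<in> M \<inter> fib E t" "c \<in> fib C k" for m c
    using M'(5)[OF tk] ract_fib[OF tk] that by blast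
  show "?W \<subseteq> M \<inter> fib E ?s" by (rule M.L.X.nclosure_prod_span_least[OF act M'(3)[OF D(4)]])
  have act': "ract E m c \<in> fib E ?s" if "m \<in> M \<inter> fib E t" "c \<in> fib C k" for m c using act that by blast
  have W: "closed_subspace (fibre E ?s) ?W" by (rule M.L.X.closed_subspace_nclosure_prod_span[OF act'])
  show "M \<inter> fib E ?s \<subseteq> ?W"
  proof
    fix m assume m: "m \<in> M \<inter> fib E ?s"
    have su: "rmom T ?s = gsrc K k" by (rule rmom_rmul[OF tk])
    have sc: "(?s, gsrc K k) \<in> rcomp K T" "rmul T ?s (gsrc K k) = ?s"
      using unit_comp(2)[OF D(4)] rmul_unit[OF D(4)] by (simp_all add: su)
    have "fib C (gsrc K k) \<subseteq> {b \<in> fib C (gsrc K k). ract E m b \<in> ?W}"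
    proof -
      have "nclosure (fibre C (gsrc K k)) (prod_span (fibre C (gsrc K k)) (\<lambda>a b. bmul C (bstar C a) b) (fib C k) (fib C k))
          \<subseteq> {b \<in> fib C (gsrc K k). ract E m b \<in> ?W}"
      proof (rule complex_banach_space.nclosure_prod_span_least[OF banach_fibres(2)[OF KC.G.src_closed[OF D(2)]]])
        show "closed_subspace (fibre C (gsrc K k)) {b \<in> fib C (gsrc K k). ract E m b \<in> ?W}"
          by (rule closed_subspace_ract_vimage(1)[OF sc(1)]) (use W m sc(2) in simp_all)
        fix a c assume ac: "a \<in> fib C k" "c \<in> fib C k"
        have as: "bstar C a \<in> fib C (ginv K k)" by (rule KC.star_fib[OF ac(1)])
        have ms: "ract E m (bstar C a) \<in> M \<inter> fib E t"
          using M'(5)[OF rmul_inv(1)[OF tk] _ _ as] ract_fib[OF rmul_inv(1)[OF tk] _ as] m rmul_inv(2)[OF tk] by auto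
        have "ract E m (bmul C (bstar C a) c) = ract E (ract E m (bstar C a)) c"
          using ract_ract[OF rmul_inv(1)[OF tk] KC.composable_simps(3)[OF D(2)] _ as ac(2)] m by simp
        also have "\<dots> \<in> ?W" by (rule M.L.X.nclosure_prod_span_base[OF act' ms ac(2)])
        finally show "bmul C (bstar C a) c \<in> {b \<in> fib C (gsrc K k). ract E m b \<in> ?W}"
          using KC.star_mul_fib[OF ac] by simp
      qed
      then show ?thesis using I.right_full by simp
    qed
    note act_W = this
    show "m \<in> ?W"
    proof (rule M.R.nondegenerate_mem[OF _ W])
      show "m \<in> fib E ?s" using m by simp
      fix b assume "b \<in> carrier (fibre_alg C (rmom T ?s))"
      then have "b \<in> fib C (gsrc K k)" unfolding su fibre_alg_simps .
      then show "ract E m b \<in> ?W" using act_W by blast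
    qed
  qed
qed

end

lemma ball_prodI: "(\<And>x y. (x, y) \<in> S \<Longrightarrow> P x y) \<Longrightarrow> \<forall>(x, y)\<in>S. P x y"
  by auto

lemma opp_acts:
  "lact (opp_ebundle E) = (\<lambda>c e. ract E e c)" "ract (opp_ebundle E) = (\<lambda>e b. lact E b e)"
  "lip (opp_ebundle E) = (\<lambda>e f. rip E f e)" "rip (opp_ebundle E) = (\<lambda>e f. lip E f e)"
  "bmul (opp_fbundle B) = (\<lambda>a b. bmul B b a)"
  by (simp_all add: fun_eq_iff)

context bundle_equivalence
begin

lemma submodule_opp:
  "bundle_equivalence.submodule (opp_groupoid K) (opp_groupoid H) (opp_space T) (opp_fbundle C) (opp_fbundle B)
     (opp_ebundle E) M \<longleftrightarrow> submodule M"
proof -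
  interpret op: bundle_equivalence "opp_groupoid K" "opp_groupoid H" "opp_space T" "opp_fbundle C" "opp_fbundle B" "opp_ebundle E"
    by (rule bundle_equivalence_opp[OF bundle_equivalence_axioms])
  show ?thesis unfolding op.submodule_def submodule_def by (simp, blast)
qed

lemma submodule_left_full:
  assumes M: "submodule M" and ht: "(h, t) \<in> lcomp H T"
  shows "nclosure (fibre E (lmul T h t)) (prod_span (fibre E (lmul T h t)) (lact E) (fib B h) (M \<inter> fib E t))
    = M \<inter> fib E (lmul T h t)"
proof -
  interpret op: bundle_equivalence "opp_groupoid K" "opp_groupoid H" "opp_space T" "opp_fbundle C" "opp_fbundle B" "opp_ebundle E"
    by (rule bundle_equivalence_opp[OF bundle_equivalence_axioms])
  show ?thesis
    using op.submodule_right_full[of M t h] M ht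
    by (simp add: submodule_opp opp_acts prod_span_flip[of _ "lact E"])
qed

text \<open>The fibres of \<open>M\<close> are subspaces, so the span conditions amount to stability
  of single products; the two density equations are the fullness lemmas.\<close>

lemma full_submodule_iff: "full_submodule H K B C T E M \<longleftrightarrow> submodule M"
proof
  assume full: "full_submodule H K B C T E M"
  then have sub: "banach_submodule H K B C T E M" by (simp add: full_submodule_def)
  then have "M \<subseteq> lsc_points E M" "\<forall>t\<in>pts T. closed_subspace (fibre E t) (M \<inter> fib E t)"
    by (simp_all add: banach_submodule_def EB.banach_subbundle_iff XE.base)
  moreover have "lact E b m \<in> M" if "(h, t) \<in> lcomp H T" "b \<in> fib B h" "m \<in> fib E t" "m \<in> M" for h t b m
  proof -
    have "prod_span (fibre E (lmul T h t)) (lact E) (fib B h) (M \<inter> fib E t) \<subseteq> M \<inter> fib E (lmul T h t)"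
      using sub that(1) unfolding banach_submodule_def by blast
    then show ?thesis using prod_span_base[of b "fib B h" m "M \<inter> fib E t" "lact E"] that by blast
  qed
  moreover have "ract E m c \<in> M" if "(t, k) \<in> rcomp K T" "m \<in> fib E t" "m \<in> M" "c \<in> fib C k" for t k m c
  proof -
    have "prod_span (fibre E (rmul T t k)) (ract E) (M \<inter> fib E t) (fib C k) \<subseteq> M \<inter> fib E (rmul T t k)"
      using sub that(1) unfolding banach_submodule_def by blast
    then show ?thesis using prod_span_base[of m "M \<inter> fib E t" c "fib C k" "ract E"] that by blast
  qed
  ultimately show "submodule M" unfolding submodule_def by blast
next
  assume M: "submodule M"
  note M' = submoduleD[OF M]
  have "banach_subbundle E M" using M'(1,3) by (simp add: EB.banach_subbundle_iff XE.base)
  moreover have "prod_span (fibre E (lmul T h t)) (lact E) (fib B h) (M \<inter> fib E t) \<subseteq> M \<inter> fib E (lmul T h t)"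
    if "(h, t) \<in> lcomp H T" for h t
    by (rule prod_span_least) (use M'(4)[OF that] lact_fib[OF that] M'(3)[OF lcompD(4)[OF that]] in \<open>auto simp: closed_subspace_def\<close>)
  moreover have "prod_span (fibre E (rmul T t k)) (ract E) (M \<inter> fib E t) (fib C k) \<subseteq> M \<inter> fib E (rmul T t k)"
    if "(t, k) \<in> rcomp K T" for t k
    by (rule prod_span_least) (use M'(5)[OF that] ract_fib[OF that] M'(3)[OF rcompD(4)[OF that]] in \<open>auto simp: closed_subspace_def\<close>)
  ultimately show "full_submodule H K B C T E M"
    unfolding full_submodule_def banach_submodule_def
    by (intro conjI ball_prodI submodule_left_full[OF M] submodule_right_full[OF M])
qed

end

section \<open>Multipliers and ideal points: the correspondence on the right\<close>

context bundle_equivalence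
begin

definition right_multiplier :: "'e set \<Rightarrow> 'c set" where
  "right_multiplier M = {c \<in> topspace (btop C). \<forall>t\<in>pts T. rmom T t = grng K (bproj C c) \<longrightarrow>
     (\<forall>e\<in>fib E t. ract E e c \<in> M)}"

lemma right_multiplierD:
  "\<lbrakk>c \<in> right_multiplier M; c \<in> fib C k; (t, k) \<in> rcomp K T; e \<in> fib E t\<rbrakk> \<Longrightarrow> ract E e c \<in> M"
  by (auto simp: right_multiplier_def in_fib rcomp_def)

lemma right_multiplierI:
  assumes "c \<in> fib C k" "\<And>t e. \<lbrakk>(t, k) \<in> rcomp K T; e \<in> fib E t\<rbrakk> \<Longrightarrow> ract E e c \<in> M"
  shows "c \<in> right_multiplier M"
  using assms KC.fib_arrow[OF assms(1)] by (auto simp: right_multiplier_def in_fib rcomp_def)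

lemma rcomp_onto:
  assumes "k \<in> arrows K" obtains t where "(t, k) \<in> rcomp K T"
proof -
  have "grng K k \<in> rmom T ` pts T" using KC.G.rng_units[OF assms] rmom_onto by simp
  then obtain t where "t \<in> pts T" "rmom T t = grng K k" by (metis imageE)
  then show ?thesis using that[of t] assms by (simp add: rcomp_def)
qed

text \<open>It suffices to test a single \<open>t\<close>: any other one is \<open>h \<cdot> t\<close>, and \<open>B\<^sub>h \<cdot> E\<^sub>t\<close> spans a dense subspace of \<open>E\<^bsub>ht\<^esub>\<close>.\<close>

lemma right_multiplierI_at:
  assumes M: "submodule M" and tk: "(t, k) \<in> rcomp K T" and c: "c \<in> fib C k"
    and ec: "\<And>e. e \<in> fib E t \<Longrightarrow> ract E e c \<in> M"
  shows "c \<in> right_multiplier M"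
proof (rule right_multiplierI[OF c])
  note M' = submoduleD[OF M]
  fix t' e assume t'k: "(t', k) \<in> rcomp K T" and e: "e \<in> fib E t'"
  note D = rcompD[OF tk] and D' = rcompD[OF t'k]
  obtain h where h: "(h, t) \<in> lcomp H T" "lmul T h t = t'"
    using left_transitive[OF D'(1) D(1)] D(3) D'(3) by auto
  let ?W = "{e \<in> fib E t'. ract E e c \<in> M \<inter> fib E (rmul T t' k)}"
  have tot: "topspace (btop E) \<inter> fib E s = fib E s" for s by (auto simp: in_fib)
  have hk: "(h, rmul T t k) \<in> lcomp H T"
    using lcompD[OF h(1)] D lmom_rmul[OF tk] by (simp add: lcomp_def)
  have "nclosure (fibre E t') (prod_span (fibre E t') (lact E) (fib B h) (fib E t)) \<subseteq> ?W"
  proof (rule complex_banach_space.nclosure_prod_span_least[OF banach_fibres(1)[OF D'(1)]])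
    show "closed_subspace (fibre E t') ?W"
      by (rule closed_subspace_ract_vimage(2)[OF t'k M'(3)[OF D'(4)] c])
    fix b x assume b: "b \<in> fib B h" and x: "x \<in> fib E t"
    have "ract E (lact E b x) c = lact E b (ract E x c)"
      using XE.E1_commute[OF h(1) tk b x c] by simp
    also have "\<dots> \<in> M" by (rule M'(4)[OF hk b ract_fib[OF tk x c] ec[OF x]])
    finally show "lact E b x \<in> ?W"
      using lact_fib[OF h(1) b x] ract_fib[OF t'k _ c, of "lact E b x"] h(2) by simp
  qed
  moreover have "nclosure (fibre E t') (prod_span (fibre E t') (lact E) (fib B h) (fib E t)) = fib E t'"
    using submodule_left_full[OF submodule_total h(1)] by (simp add: tot h(2))
  ultimately show "ract E e c \<in> M" using e by blast
qed

text \<open>Tested over the point \<open>t\<close> of \<open>e\<close> itself,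
  \<open>e' <e,m>\<close> equals \<open><e',e> m\<close>, where \<open><e',e>\<close> lies in a unit
  fibre of \<open>B\<close> and so preserves the fibre of \<open>M\<close> containing
  \<open>m\<close>.\<close>

lemma rip_right_multiplier:
  assumes M: "submodule M" and tk: "(t, k) \<in> rcomp K T" and e: "e \<in> fib E t"
    and m: "m \<in> M" "m \<in> fib E (rmul T t k)"
  shows "rip E e m \<in> right_multiplier M"
proof (rule right_multiplierI_at[OF M tk rip_fib[OF tk e m(2)]])
  note M' = submoduleD[OF M] and D = rcompD[OF tk]
  interpret N: imprimitivity_bimodule "fibre_alg B (lmom T t)" "fibre_alg C (rmom T t)" "fibre E t"
    "lact E" "ract E" "lip E" "rip E" by (rule bimodule[OF D(1)])
  fix e' assume e': "e' \<in> fib E t"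
  have "ract E e' (rip E e m) = lact E (lip E e' e) m"
    using XE.E2_iv[OF D(1,1,4) refl _ e' e m(2)] lmom_rmul[OF tk] by simp
  moreover have "lip E e' e \<in> fib B (lmom T t)" using N.L.ip_closed[of e e'] e e' by simp
  moreover have "(lmom T t, rmul T t k) \<in> lcomp H T" using unit_comp(1)[OF D(4)] lmom_rmul[OF tk] by simp
  ultimately show "ract E e' (rip E e m) \<in> M" using M'(4) m by metis
qed

text \<open>The inner products \<open><e,f>\<close> of \<open>E_t\<close> span a dense subspace of
  the unit fibre at the range of \<open>k\<close>, which acts nondegenerately on \<open>C_k\<close>;
  and \<open><e,f> c = <e, f c>\<close> with \<open>f c\<close> in \<open>M\<close>. So multipliers
  are limits of sums of inner products \<open><e,m>\<close>. This drives the openness of the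
  projection, the formula for the coefficient ideals and the injectivity of
  \<open>ideal_points\<close>.\<close>

lemma right_multiplier_mem:
  assumes tk: "(t, k) \<in> rcomp K T" and c: "c \<in> fib C k" and ec: "\<And>e. e \<in> fib E t \<Longrightarrow> ract E e c \<in> M"
    and W: "closed_subspace (fibre C k) W"
    and rip: "\<And>e m. \<lbrakk>e \<in> fib E t; m \<in> M; m \<in> fib E (rmul T t k)\<rbrakk> \<Longrightarrow> rip E e m \<in> W"
  shows "c \<in> W"
proof -
  note D = rcompD[OF tk]
  interpret N: imprimitivity_bimodule "fibre_alg B (lmom T t)" "fibre_alg C (rmom T t)" "fibre E t"
    "lact E" "ract E" "lip E" "rip E" by (rule bimodule[OF D(1)])
  interpret I: imprimitivity_bimodule "fibre_alg C (grng K k)" "fibre_alg C (gsrc K k)" "fibre C k"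
    "bmul C" "bmul C" "\<lambda>a b. bmul C a (bstar C b)" "\<lambda>a b. bmul C (bstar C a) b" by (rule KC.F.fibre_imprimitivity[OF D(2)])
  have comp: "(grng K k, k) \<in> composable K" "gmul K (grng K k) k = k"
    using KC.composable_simps(2)[OF D(2)] KC.G.rng_unit[OF D(2)] by auto
  have "nclosure (fibre C (grng K k)) (prod_span (fibre C (grng K k)) (rip E) (fib E t) (fib E t))
      \<subseteq> {b \<in> fib C (grng K k). bmul C b c \<in> W}"
  proof (rule complex_banach_space.nclosure_prod_span_least[OF banach_fibres(2)[OF KC.G.rng_closed[OF D(2)]]])
    show "closed_subspace (fibre C (grng K k)) {b \<in> fib C (grng K k). bmul C b c \<in> W}"
      by (rule KC.closed_subspace_mul_right_vimage[OF comp(1) c]) (simp add: comp(2) W)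
    fix e f assume ef: "e \<in> fib E t" "f \<in> fib E t"
    have "bmul C (rip E e f) c = rip E e (ract E f c)"
      using XE.E2_iii_right[OF tk D(1) refl ef(1,2) c] by simp
    also have "\<dots> \<in> W" by (rule rip[OF ef(1) ec[OF ef(2)] ract_fib[OF tk ef(2) c]])
    finally show "rip E e f \<in> {b \<in> fib C (grng K k). bmul C b c \<in> W}"
      using N.R.ip_closed[of e f] ef D(3) by simp
  qed
  moreover have "nclosure (fibre C (grng K k)) (prod_span (fibre C (grng K k)) (rip E) (fib E t) (fib E t)) = fib C (grng K k)"
    using N.right_full D(3) by simp
  ultimately show ?thesis
    using I.L.nondegenerate_mem[OF _ W, of c] c by auto
qed

lemma right_multiplier_ideal:
  assumes M: "submodule M" shows "KC.fibrewise_ideal (right_multiplier M)"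
  unfolding KC.fibrewise_ideal_def
proof (intro conjI ballI allI impI)
  note M' = submoduleD[OF M]
  show "right_multiplier M \<subseteq> topspace (btop C)" by (auto simp: right_multiplier_def)
  show "closed_subspace (fibre C k) (right_multiplier M \<inter> fib C k)" if k: "k \<in> arrows K" for k
  proof -
    obtain t where tk: "(t, k) \<in> rcomp K T" by (rule rcomp_onto[OF k])
    note D = rcompD[OF tk]
    \<comment> \<open>With the test point \<open>t\<close> fixed, the fibre is an intersection of
      preimages of one closed subspace under the maps \<open>c \<mapsto> e c\<close>.\<close>
    have "right_multiplier M \<inter> fib C k = (\<Inter>e\<in>fib E t. {c \<in> fib C k. ract E e c \<in> M \<inter> fib E (rmul T t k)})" (is "_ = ?R")
    proof (intro equalityI subsetI)
      fix c assume "c \<in> right_multiplier M \<inter> fib C k"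
      then show "c \<in> ?R" using right_multiplierD[OF _ _ tk] ract_fib[OF tk] by auto
    next
      fix c assume c: "c \<in> ?R"
      then have "c \<in> fib C k"
        using complex_banach_space.vzero_closed[OF banach_fibres(1)[OF D(1)]] by auto
      then show "c \<in> right_multiplier M \<inter> fib C k" using right_multiplierI_at[OF M tk, of c] c by auto
    qed
    moreover have "fib E t \<noteq> {}" using complex_banach_space.vzero_closed[OF banach_fibres(1)[OF D(1)]] by blast
    then have "closed_subspace (fibre C k) (\<Inter>e\<in>fib E t. {c \<in> fib C k. ract E e c \<in> M \<inter> fib E (rmul T t k)})"
      by (intro complex_banach_space.closed_subspace_INT[OF banach_fibres(2)[OF k]]
          closed_subspace_ract_vimage(1)[OF tk M'(3)[OF D(4)]])
    ultimately show ?thesis by (simp only:)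
  qed
  fix k l c d assume kl: "(k, l) \<in> composable K" and c: "c \<in> fib C k" and d: "d \<in> fib C l"
    and "c \<in> right_multiplier M \<or> d \<in> right_multiplier M"
  have k: "k \<in> arrows K" using kl by (simp add: composable_def)
  show "bmul C c d \<in> right_multiplier M"
  proof (rule right_multiplierI[OF KC.mul_fib[OF kl c d]])
    fix t e assume t: "(t, gmul K k l) \<in> rcomp K T" and e: "e \<in> fib E t"
    have tk: "(t, k) \<in> rcomp K T" using t k KC.G.rng_mul[OF kl] by (simp add: rcomp_def)
    note comp = rcomp_mul(1)[OF tk kl]
    have eq: "ract E e (bmul C c d) = ract E (ract E e c) d" by (rule ract_ract[OF tk kl e c d, symmetric])
    from \<open>c \<in> right_multiplier M \<or> d \<in> right_multiplier M\<close> show "ract E e (bmul C c d) \<in> M"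
      unfolding eq
    proof
      assume "c \<in> right_multiplier M"
      then have "ract E e c \<in> M" by (rule right_multiplierD[OF _ c tk e])
      then show "ract E (ract E e c) d \<in> M" by (rule M'(5)[OF comp ract_fib[OF tk e c] _ d])
    next
      assume "d \<in> right_multiplier M"
      then show "ract E (ract E e c) d \<in> M" by (rule right_multiplierD[OF _ d comp ract_fib[OF tk e c]])
    qed
  qed
qed

text \<open>For \<open>l\<close> near \<open>k\<close> one needs a base point \<open>s\<close> near
  \<open>t\<close> whose right moment is the range of \<open>l\<close>, a vector near
  \<open>e\<close> over \<open>s\<close>, and an element of \<open>M\<close> near \<open>m\<close>
  over \<open>s l\<close>. Their inner product then lies over \<open>l\<close>.\<close>

lemma rip_lsc_points:
  assumes M: "submodule M" and tk: "(t, k) \<in> rcomp K T" and e: "e \<in> fib E t"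
    and m: "m \<in> M" "m \<in> fib E (rmul T t k)"
  shows "rip E e m \<in> lsc_points C (right_multiplier M)"
proof (rule lsc_pointsI)
  note M' = submoduleD[OF M] and D = rcompD[OF tk]
  have em: "rip E e m \<in> fib C k" by (rule rip_fib[OF tk e m(2)])
  then show "rip E e m \<in> topspace (btop C)" by (simp add: in_fib)
  fix V assume V: "openin (btop C) V" "rip E e m \<in> V"
  obtain U1 U2 where U: "openin (btop E) U1" "e \<in> U1" "openin (btop E) U2" "m \<in> U2"
    "\<And>x y. \<lbrakk>x \<in> U1; y \<in> U2; (x, y) \<in> {(e, f). lmom T (bproj E e) = lmom T (bproj E f)}\<rbrakk>
       \<Longrightarrow> (\<lambda>(e, f). rip E e f) (x, y) \<in> V"
    by (rule continuous_map_prodE[OF XE.E2_rip_continuous V(1), of e m])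
      (use e m V lmom_rmul[OF tk] in \<open>auto simp: in_fib\<close>)
  have O1: "openin (ttop T) (bproj E ` U1)" using EB.proj_open U(1) by (simp add: open_map_def XE.base)
  obtain W2 where W2: "openin (ttop T) W2" "rmul T t k \<in> W2"
    "\<And>s. s \<in> W2 \<Longrightarrow> \<exists>d. d \<in> U2 \<and> d \<in> M \<and> bproj E d = s"
    using lsc_pointsE[OF subsetD[OF M'(1) m(1)] U(3,4)] m(2) by (auto simp: in_fib XE.base)
  obtain N1 N2 where N: "openin (ttop T) N1" "t \<in> N1" "openin (gtop K) N2" "k \<in> N2"
    "\<And>s l. \<lbrakk>s \<in> N1; l \<in> N2; (s, l) \<in> rcomp K T\<rbrakk> \<Longrightarrow> (\<lambda>(t, k). rmul T t k) (s, l) \<in> W2"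
    by (rule continuous_map_prodE[OF rmul_continuous W2(1) tk D(1,2)]) (simp_all only: prod.case W2(2))
  \<comment> \<open>Openness of the moment map supplies \<open>s\<close>; intersecting with the
    image of \<open>U1\<close> ensures that a vector near \<open>e\<close> exists over it.\<close>
  have "openin (unit_top K) (rmom T ` (N1 \<inter> bproj E ` U1))"
    using rmom_open N(1) O1 by (simp add: open_map_def openin_Int)
  then obtain W0 where W0: "openin (gtop K) W0" "rmom T ` (N1 \<inter> bproj E ` U1) = W0 \<inter> units K"
    by (auto simp: openin_subtopology)
  define W where "W = {l \<in> N2. grng K l \<in> W0}"
  have "openin (gtop K) W" unfolding W_def
    by (rule openin_continuous_map_preimage_gen[OF KC.G.rng_continuous N(3) W0(1)])
  moreover have "k \<in> W"
  proof -
    have "t \<in> N1 \<inter> bproj E ` U1" using N(2) U(2) e by (auto simp: in_fib)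
    then have "rmom T t \<in> W0 \<inter> units K" unfolding W0(2)[symmetric] by (rule imageI)
    then have "grng K k \<in> W0" by (simp add: D(3))
    then show ?thesis using N(4) by (simp add: W_def)
  qed
  moreover have "\<exists>d. d \<in> V \<and> d \<in> right_multiplier M \<and> bproj C d = l" if l: "l \<in> W" for l
  proof -
    have la: "l \<in> arrows K" using l openin_subset[OF N(3)] by (auto simp: W_def)
    have "grng K l \<in> rmom T ` (N1 \<inter> bproj E ` U1)"
      unfolding W0(2) using l KC.G.rng_units[OF la] by (simp add: W_def)
    then obtain x where x: "bproj E x \<in> N1" "x \<in> U1" "rmom T (bproj E x) = grng K l" by auto
    let ?s = "bproj E x"
    have xs: "x \<in> fib E ?s" using x(2) openin_subset[OF U(1)] by (auto simp: in_fib)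
    have sl: "(?s, l) \<in> rcomp K T" using fib_pts[OF xs] la x(3) by (simp add: rcomp_def)
    have "rmul T ?s l \<in> W2" using N(5)[OF x(1) _ sl] l by (simp add: W_def)
    then obtain y where y: "y \<in> U2" "y \<in> M" "bproj E y = rmul T ?s l" using W2(3) by blast
    have ys: "y \<in> fib E (rmul T ?s l)" using y(2,3) M'(2) by (auto simp: in_fib)
    have "rip E x y \<in> V" using U(5)[OF x(2) y(1)] y(3) lmom_rmul[OF sl] by simp
    moreover have "rip E x y \<in> right_multiplier M" by (rule rip_right_multiplier[OF M sl xs y(2) ys])
    moreover have "bproj C (rip E x y) = l" using rip_fib[OF sl xs ys] by (simp add: in_fib)
    ultimately show ?thesis by blast
  qed
  ultimately show "\<exists>W. openin (bbase C) W \<and> bproj C (rip E e m) \<in> W \<and>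
      (\<forall>l\<in>W. \<exists>d. d \<in> V \<and> d \<in> right_multiplier M \<and> bproj C d = l)"
    using em by (intro exI[of _ W]) (simp add: KC.F.base in_fib)
qed

text \<open>The points where the projection is locally open form closed subspaces of the fibres and
  contain all \<open><e,m>\<close>; by \<open>right_multiplier_mem\<close> they contain every
  multiplier.\<close>

lemma right_multiplier_fell_ideal:
  assumes M: "submodule M" shows "fell_ideal K C (right_multiplier M)"
  unfolding KC.fell_ideal_iff
proof (intro conjI right_multiplier_ideal[OF M] subsetI)
  fix c assume c: "c \<in> right_multiplier M"
  define k where "k = bproj C c"
  have ck: "c \<in> fib C k" using c by (auto simp: k_def in_fib right_multiplier_def)
  note k = KC.fib_arrow[OF ck]
  obtain t where tk: "(t, k) \<in> rcomp K T" by (rule rcomp_onto[OF k])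
  have sub: "csubspace (fibre C l) (right_multiplier M \<inter> fib C l)" if "l \<in> topspace (bbase C)" for l
    using KC.fibrewise_idealD(2)[OF right_multiplier_ideal[OF M], of l] that
    by (simp add: closed_subspace_def KC.F.base)
  have W: "closed_subspace (fibre C k) (lsc_points C (right_multiplier M) \<inter> fib C k)"
    by (rule KC.closed_subspace_lsc_points[OF sub]) (use k in \<open>simp_all add: KC.F.base\<close>)
  have "c \<in> lsc_points C (right_multiplier M) \<inter> fib C k"
    by (rule right_multiplier_mem[OF tk ck right_multiplierD[OF c ck tk] W])
      (use rip_lsc_points[OF M tk] rip_fib[OF tk] in auto)
  then show "c \<in> lsc_points C (right_multiplier M)" by simp
qed

text \<open>The right-hand side sees \<open>t\<close> only through \<open>rmom T t\<close>; this is
  the independence of the coefficient ideal from the chosen point.\<close>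

lemma right_coeff_at_eq:
  assumes M: "submodule M" and t: "t \<in> pts T"
  shows "right_coeff_at C T E M t = right_multiplier M \<inter> fib C (rmom T t)"
proof
  note tu = unit_comp(2)[OF t]
  note D = rcompD[OF tu]
  have tt: "rmul T t (rmom T t) = t" by (rule rmul_unit[OF t])
  note ideal = right_multiplier_ideal[OF M]
  have rip: "rip E e m \<in> right_multiplier M \<inter> fib C (rmom T t)" if "e \<in> fib E t" "m \<in> M \<inter> fib E t" for e m
    using rip_right_multiplier[OF M tu that(1), of m] rip_fib[OF tu that(1), of m] that(2) by (simp add: tt)
  show "right_coeff_at C T E M t \<subseteq> right_multiplier M \<inter> fib C (rmom T t)"
    unfolding right_coeff_at_def
    by (rule complex_banach_space.nclosure_prod_span_least[OF banach_fibres(2)[OF D(2)] rip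
          KC.fibrewise_idealD(2)[OF ideal D(2)]])
  show "right_multiplier M \<inter> fib C (rmom T t) \<subseteq> right_coeff_at C T E M t"
  proof
    fix c assume c: "c \<in> right_multiplier M \<inter> fib C (rmom T t)"
    have rip': "rip E e m \<in> fib C (rmom T t)" if "e \<in> fib E t" "m \<in> M \<inter> fib E t" for e m using rip that by blast
    show "c \<in> right_coeff_at C T E M t"
      unfolding right_coeff_at_def
    proof (rule right_multiplier_mem[OF tu])
      show "closed_subspace (fibre C (rmom T t)) (nclosure (fibre C (rmom T t))
          (prod_span (fibre C (rmom T t)) (rip E) (fib E t) (M \<inter> fib E t)))"
        by (rule complex_banach_space.closed_subspace_nclosure_prod_span[OF banach_fibres(2)[OF D(2)] rip'])
      show "rip E e m \<in> nclosure (fibre C (rmom T t)) (prod_span (fibre C (rmom T t)) (rip E) (fib E t) (M \<inter> fib E t))"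
        if "e \<in> fib E t" "m \<in> M" "m \<in> fib E (rmul T t (rmom T t))" for e m
        by (rule complex_banach_space.nclosure_prod_span_base[OF banach_fibres(2)[OF D(2)] rip'])
          (use that in \<open>simp_all add: tt\<close>)
      show "c \<in> fib C (rmom T t)" using c by simp
      show "ract E e c \<in> M" if "e \<in> fib E t" for e by (rule right_multiplierD[OF _ _ tu that]) (use c in auto)
    qed
  qed
qed

lemma right_coeff_eq:
  assumes M: "submodule M" and u: "u \<in> units K"
  shows "right_coeff C T E M u = right_multiplier M \<inter> fib C u"
proof -
  have "u \<in> rmom T ` pts T" using u rmom_onto by simp
  then have "\<exists>t. t \<in> pts T \<and> rmom T t = u" by blast
  from someI_ex[OF this] show ?thesis
    unfolding right_coeff_def using right_coeff_at_eq[OF M] by auto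
qed

text \<open>The second form, with the coefficient ideal at the source and on the right, is what the
  formula \<open>L_{r(h)} B_h\<close> for the other side becomes under passage to opposites.\<close>

lemma right_ideal_of_eq:
  assumes M: "submodule M"
  shows "right_ideal_of K C T E M = right_multiplier M"
    and "(\<Union>k\<in>arrows K. prod_span (fibre C k) (bmul C) (fib C k) (right_coeff C T E M (gsrc K k))) = right_multiplier M"
proof -
  note ideal = right_multiplier_ideal[OF M]
  have Un: "(\<Union>k\<in>arrows K. right_multiplier M \<inter> fib C k) = right_multiplier M"
    using KC.fib_arrow by (auto simp: right_multiplier_def in_fib)
  show "right_ideal_of K C T E M = right_multiplier M"
    unfolding right_ideal_of_def
    using KC.fibrewise_ideal_decompositions(2)[OF ideal] right_coeff_eq[OF M KC.G.rng_units] Un by simp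
  show "(\<Union>k\<in>arrows K. prod_span (fibre C k) (bmul C) (fib C k) (right_coeff C T E M (gsrc K k))) = right_multiplier M"
    using KC.fibrewise_ideal_decompositions(1)[OF ideal] right_coeff_eq[OF M KC.G.src_units] Un by simp
qed

definition ideal_points :: "'c set \<Rightarrow> 'e set" where
  "ideal_points J = {e \<in> topspace (btop E). \<forall>f\<in>fib E (bproj E e). rip E f e \<in> J}"

lemma ideal_points_fib:
  assumes J: "KC.fibrewise_ideal J" and t: "t \<in> pts T"
  shows "ideal_points J \<inter> fib E t = prod_span (fibre E t) (ract E) (fib E t) (J \<inter> fib C (rmom T t))"
    and "closed_subspace (fibre E t) (ideal_points J \<inter> fib E t)"
    and "\<And>e. \<lbrakk>e \<in> ideal_points J; e \<in> fib E t\<rbrakk> \<Longrightarrow> \<exists>z\<in>fib E t. \<exists>a\<in>J \<inter> fib C (rmom T t). e = ract E z a"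
proof -
  interpret N: imprimitivity_bimodule "fibre_alg B (lmom T t)" "fibre_alg C (rmom T t)" "fibre E t"
    "lact E" "ract E" "lip E" "rip E" by (rule bimodule[OF t])
  have u: "cstar_ideal (fibre_alg C (rmom T t)) (J \<inter> fib C (rmom T t))"
    by (rule KC.fibrewise_ideal_unit[OF J mom_units(2)[OF t]])
  have eq: "ideal_points J \<inter> fib E t = N.R.ideal_part (J \<inter> fib C (rmom T t))"
    using N.R.ip_closed by (auto simp: ideal_points_def N.R.ideal_part_def in_fib)
  show "ideal_points J \<inter> fib E t = prod_span (fibre E t) (ract E) (fib E t) (J \<inter> fib C (rmom T t))"
    unfolding eq N.R.ideal_part_eq_prod_span[OF u, symmetric] ..
  show "closed_subspace (fibre E t) (ideal_points J \<inter> fib E t)"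
    unfolding eq by (rule N.R.closed_subspace_ideal_part[OF u])
  fix e assume "e \<in> ideal_points J" "e \<in> fib E t"
  then have "e \<in> N.R.ideal_part (J \<inter> fib C (rmom T t))" using eq by blast
  from N.R.factorization[OF u this] obtain z a
    where "z \<in> N.R.ideal_part (J \<inter> fib C (rmom T t))" "a \<in> J \<inter> fib C (rmom T t)" "e = ract E z a" .
  then show "\<exists>z\<in>fib E t. \<exists>a\<in>J \<inter> fib C (rmom T t). e = ract E z a"
    by (auto simp: N.R.ideal_part_def)
qed

lemma ract_ideal_points:
  assumes J: "KC.fibrewise_ideal J" and tk: "(t, k) \<in> rcomp K T" and x: "x \<in> fib E t" and j: "j \<in> J" "j \<in> fib C k"
  shows "ract E x j \<in> ideal_points J"
proof -
  note D = rcompD[OF tk]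
  have xj: "ract E x j \<in> fib E (rmul T t k)" by (rule ract_fib[OF tk x j(2)])
  have "rip E f (ract E x j) \<in> J" if f: "f \<in> fib E (rmul T t k)" for f
    unfolding rip_ract[OF tk f x j(2)]
    by (rule KC.fibrewise_idealD(4)[OF J KC.composable_simps(3)[OF D(2)] rip_fib'[OF tk f x] j(2,1)])
  then show ?thesis using xj by (simp add: ideal_points_def in_fib)
qed

text \<open>All products \<open>E_t J_k\<close> land in the ideal points over \<open>t k\<close>,
  and by factorization the unit arrows alone already produce all of them.\<close>

lemma right_ideal_prod_eq:
  assumes J: "KC.fibrewise_ideal J"
  shows "right_ideal_prod K C T E J = ideal_points J"
    and "(\<Union>t\<in>pts T. prod_span (fibre E t) (ract E) (fib E t) (J \<inter> fib C (rmom T t))) = ideal_points J"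
proof -
  have Un: "ideal_points J \<subseteq> (\<Union>t\<in>pts T. ideal_points J \<inter> fib E t)"
    using fib_pts by (auto simp: ideal_points_def in_fib)
  then show "(\<Union>t\<in>pts T. prod_span (fibre E t) (ract E) (fib E t) (J \<inter> fib C (rmom T t))) = ideal_points J"
    using ideal_points_fib(1)[OF J] by auto
  show "right_ideal_prod K C T E J = ideal_points J"
  proof
    have "prod_span (fibre E (rmul T t k)) (ract E) (fib E t) (J \<inter> fib C k) \<subseteq> ideal_points J \<inter> fib E (rmul T t k)"
      if tk: "(t, k) \<in> rcomp K T" for t k
    proof (rule prod_span_least)
      show "csubspace (fibre E (rmul T t k)) (ideal_points J \<inter> fib E (rmul T t k))"
        using ideal_points_fib(2)[OF J rcompD(4)[OF tk]] by (simp add: closed_subspace_def)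
    qed (use ract_ideal_points[OF J tk] ract_fib[OF tk] in auto)
    then show "right_ideal_prod K C T E J \<subseteq> ideal_points J" unfolding right_ideal_prod_def by blast
    show "ideal_points J \<subseteq> right_ideal_prod K C T E J"
    proof
      fix e assume "e \<in> ideal_points J"
      then obtain t where t: "t \<in> pts T" "e \<in> ideal_points J \<inter> fib E t" using Un by blast
      then have "e \<in> prod_span (fibre E (rmul T t (rmom T t))) (ract E) (fib E t) (J \<inter> fib C (rmom T t))"
        using ideal_points_fib(1)[OF J t(1)] rmul_unit[OF t(1)] by simp
      then show "e \<in> right_ideal_prod K C T E J"
        unfolding right_ideal_prod_def using unit_comp(2)[OF t(1)] by blast
    qed
  qed
qed

text \<open>Factorization makes \<open>e\<close> a single product \<open>z a\<close>. Over
  \<open>s\<close> near \<open>t\<close>, openness of the projection of \<open>E\<close> gives a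
  vector near \<open>z\<close>, and the same property of \<open>J\<close> gives an element near
  \<open>a\<close> over the moment of \<open>s\<close>.\<close>

lemma ideal_points_lsc:
  assumes J: "KC.fibrewise_ideal J" "J \<subseteq> lsc_points C J" shows "ideal_points J \<subseteq> lsc_points E (ideal_points J)"
proof
  fix e assume e: "e \<in> ideal_points J"
  define t where "t = bproj E e"
  have et: "e \<in> fib E t" using e by (simp add: t_def ideal_points_def in_fib)
  note t = fib_pts[OF et]
  obtain z a where z: "z \<in> fib E t" and a: "a \<in> J" "a \<in> fib C (rmom T t)" and eza: "e = ract E z a"
    using ideal_points_fib(3)[OF J(1) t e et] by blast
  interpret A: fell_right_action K C T E by (rule XE.E1_right)
  show "e \<in> lsc_points E (ideal_points J)"
  proof (rule lsc_pointsI)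
    show "e \<in> topspace (btop E)" using et by (simp add: in_fib)
    fix V assume V: "openin (btop E) V" "e \<in> V"
    obtain U1 U2 where U: "openin (btop E) U1" "z \<in> U1" "openin (btop C) U2" "a \<in> U2"
      "\<And>x y. \<lbrakk>x \<in> U1; y \<in> U2; (x, y) \<in> {(e, c). (bproj E e, bproj C c) \<in> rcomp K T}\<rbrakk>
         \<Longrightarrow> (\<lambda>(e, c). ract E e c) (x, y) \<in> V"
      by (rule continuous_map_prodE[OF A.continuous V(1), of z a])
        (use z a V eza unit_comp(2)[OF t] in \<open>auto simp: in_fib\<close>)
    have O1: "openin (ttop T) (bproj E ` U1)" using EB.proj_open U(1) by (simp add: open_map_def XE.base)
    obtain W2 where W2: "openin (gtop K) W2" "rmom T t \<in> W2"
      "\<And>l. l \<in> W2 \<Longrightarrow> \<exists>d. d \<in> U2 \<and> d \<in> J \<and> bproj C d = l"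
      using lsc_pointsE[OF subsetD[OF J(2) a(1)] U(3,4)] a(2) by (auto simp: in_fib KC.F.base)
    have "continuous_map (ttop T) (gtop K) (rmom T)"
      using rmom_continuous continuous_map_into_fulltopology by blast
    then have W: "openin (ttop T) {s \<in> bproj E ` U1. rmom T s \<in> W2}"
      by (rule openin_continuous_map_preimage_gen[OF _ O1 W2(1)])
    have "\<exists>d. d \<in> V \<and> d \<in> ideal_points J \<and> bproj E d = s" if s: "s \<in> {s \<in> bproj E ` U1. rmom T s \<in> W2}" for s
    proof -
      obtain x where x: "x \<in> U1" "bproj E x = s" using s by auto
      obtain y where y: "y \<in> U2" "y \<in> J" "bproj C y = rmom T s" using s W2(3)[of "rmom T s"] by blast
      have xs: "x \<in> fib E s" and ys: "y \<in> fib C (rmom T s)"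
        using x y openin_subset[OF U(1)] openin_subset[OF U(3)] by (auto simp: in_fib)
      note su = unit_comp(2)[OF fib_pts[OF xs]]
      have "ract E x y \<in> V" using U(5)[OF x(1) y(1)] x(2) y(3) su by simp
      moreover have "ract E x y \<in> ideal_points J" by (rule ract_ideal_points[OF J(1) su xs y(2) ys])
      moreover have "bproj E (ract E x y) = s"
        using ract_fib[OF su xs ys] rmul_unit[OF fib_pts[OF xs]] by (simp add: in_fib)
      ultimately show ?thesis by blast
    qed
    then show "\<exists>W. openin (bbase E) W \<and> bproj E e \<in> W \<and> (\<forall>s\<in>W. \<exists>d. d \<in> V \<and> d \<in> ideal_points J \<and> bproj E d = s)"
      using W W2(2) U(2) z unfolding XE.base t_def[symmetric]
      by (intro exI[of _ "{s \<in> bproj E ` U1. rmom T s \<in> W2}"]) (auto simp: in_fib)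
  qed
qed

text \<open>Both actions pass through a factorization: \<open>b (z a) = (b z) a\<close> and
  \<open>(z a) c = z (a c)\<close>.\<close>

lemma ideal_points_submodule:
  assumes J: "KC.fibrewise_ideal J" "J \<subseteq> lsc_points C J" shows "submodule (ideal_points J)"
  unfolding submodule_def
proof (intro conjI allI impI ballI ideal_points_lsc[OF J] ideal_points_fib(2)[OF J(1)])
  fix h t b m assume ht: "(h, t) \<in> lcomp H T" and b: "b \<in> fib B h" and m: "m \<in> fib E t" "m \<in> ideal_points J"
  note D = lcompD[OF ht]
  obtain z a where z: "z \<in> fib E t" "a \<in> J" "a \<in> fib C (rmom T t)" "m = ract E z a"
    using ideal_points_fib(3)[OF J(1) D(1) m(2,1)] by blast
  have "lact E b m = ract E (lact E b z) a"
    unfolding z(4) by (rule XE.E1_commute[OF ht unit_comp(2)[OF D(1)] b z(1,3)])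
  moreover have "(lmul T h t, rmom T t) \<in> rcomp K T" using unit_comp(2)[OF D(4)] rmom_lmul[OF ht] by simp
  ultimately show "lact E b m \<in> ideal_points J"
    using ract_ideal_points[OF J(1) _ lact_fib[OF ht b z(1)] z(2,3)] by simp
next
  fix t k m c assume tk: "(t, k) \<in> rcomp K T" and m: "m \<in> fib E t" "m \<in> ideal_points J" and c: "c \<in> fib C k"
  note D = rcompD[OF tk]
  obtain z a where z: "z \<in> fib E t" "a \<in> J" "a \<in> fib C (rmom T t)" "m = ract E z a"
    using ideal_points_fib(3)[OF J(1) D(1) m(2,1)] by blast
  have comp: "(rmom T t, k) \<in> composable K" "gmul K (rmom T t) k = k"
    using KC.composable_simps(2)[OF D(2)] KC.G.rng_unit[OF D(2)] D(3) by auto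
  have "ract E m c = ract E z (bmul C a c)"
    unfolding z(4) by (rule ract_ract[OF unit_comp(2)[OF D(1)] comp(1) z(1,3) c])
  moreover have "bmul C a c \<in> J" by (rule KC.fibrewise_idealD(3)[OF J(1) comp(1) z(3) c z(2)])
  moreover have "bmul C a c \<in> fib C k" using KC.mul_fib[OF comp(1) z(3) c] comp(2) by simp
  ultimately show "ract E m c \<in> ideal_points J" using ract_ideal_points[OF J(1) tk z(1)] by simp
qed

text \<open>For the nontrivial inclusion a multiplier is a limit of sums of \<open><e,m>\<close>
  with \<open>m = z a\<close> and \<open>a\<close> in \<open>J\<close>, and
  \<open><e, z a> = <e,z> a\<close>.\<close>

lemma right_multiplier_ideal_points:
  assumes J: "KC.fibrewise_ideal J" shows "right_multiplier (ideal_points J) = J"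
proof
  show "J \<subseteq> right_multiplier (ideal_points J)"
  proof
    fix c assume c: "c \<in> J"
    then have "c \<in> fib C (bproj C c)" using KC.fibrewise_idealD(1)[OF J] by (auto simp: in_fib)
    then show "c \<in> right_multiplier (ideal_points J)"
      by (rule right_multiplierI) (use c ract_ideal_points[OF J] \<open>c \<in> fib C (bproj C c)\<close> in blast)
  qed
  show "right_multiplier (ideal_points J) \<subseteq> J"
  proof
    fix c assume c: "c \<in> right_multiplier (ideal_points J)"
    define k where "k = bproj C c"
    have ck: "c \<in> fib C k" using c by (auto simp: k_def in_fib right_multiplier_def)
    note k = KC.fib_arrow[OF ck]
    obtain t where tk: "(t, k) \<in> rcomp K T" by (rule rcomp_onto[OF k])
    note D = rcompD[OF tk]
    have "c \<in> J \<inter> fib C k"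
    proof (rule right_multiplier_mem[OF tk ck right_multiplierD[OF c ck tk] KC.fibrewise_idealD(2)[OF J k]])
      fix e m assume e: "e \<in> fib E t" and m: "m \<in> ideal_points J" "m \<in> fib E (rmul T t k)"
      obtain z a where z: "z \<in> fib E (rmul T t k)" "a \<in> J" "a \<in> fib C (rmom T (rmul T t k))" "m = ract E z a"
        using ideal_points_fib(3)[OF J D(4) m] by blast
      note su = unit_comp(2)[OF D(4)]
      have "rip E e m = bmul C (rip E e z) a"
        unfolding z(4) using XE.E2_iii_right[OF su D(1) _ e z(1,3)] lmom_rmul[OF tk] by simp
      moreover have "(k, rmom T (rmul T t k)) \<in> composable K"
        using KC.composable_simps(1)[OF D(2)] rmom_rmul[OF tk] by simp
      ultimately show "rip E e m \<in> J \<inter> fib C k"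
        using KC.fibrewise_idealD(4)[OF J _ rip_fib[OF tk e z(1)] z(3,2)] rip_fib[OF tk e m(2)] by simp
    qed
    then show "c \<in> J" by simp
  qed
qed

lemma ideal_points_right_multiplier:
  assumes M: "submodule M" shows "ideal_points (right_multiplier M) = M"
proof
  note J = right_multiplier_ideal[OF M] and M' = submoduleD[OF M]
  show "ideal_points (right_multiplier M) \<subseteq> M"
  proof
    fix e assume e: "e \<in> ideal_points (right_multiplier M)"
    define t where "t = bproj E e"
    have et: "e \<in> fib E t" using e by (simp add: t_def ideal_points_def in_fib)
    note t = fib_pts[OF et]
    obtain z a where z: "z \<in> fib E t" "a \<in> right_multiplier M" "a \<in> fib C (rmom T t)" "e = ract E z a"
      using ideal_points_fib(3)[OF J t e et] by blast
    show "e \<in> M" unfolding z(4) by (rule right_multiplierD[OF z(2,3) unit_comp(2)[OF t] z(1)])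
  qed
  show "M \<subseteq> ideal_points (right_multiplier M)"
  proof
    fix m assume m: "m \<in> M"
    define t where "t = bproj E m"
    have mt: "m \<in> fib E t" using m M'(2) by (auto simp: t_def in_fib)
    note t = fib_pts[OF mt]
    have "rip E f m \<in> right_multiplier M" if "f \<in> fib E t" for f
      by (rule rip_right_multiplier[OF M unit_comp(2)[OF t] that m]) (simp add: rmul_unit[OF t] mt)
    then show "m \<in> ideal_points (right_multiplier M)" using mt by (simp add: ideal_points_def in_fib)
  qed
qed

lemma ideal_points_mono: "I \<subseteq> J \<Longrightarrow> ideal_points I \<subseteq> ideal_points J"
  by (auto simp: ideal_points_def)

lemma right_multiplier_mono: "M \<subseteq> N \<Longrightarrow> right_multiplier M \<subseteq> right_multiplier N"
  by (auto simp: right_multiplier_def)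

text \<open>\<open>f\<close> and \<open>g\<close> need only agree with the two maps on ideals and on
  submodules, so the lemma can be instantiated with the explicit product formulas, also in the
  opposite equivalence.\<close>

lemma right_correspondence:
  assumes f: "\<And>J. fell_ideal K C J \<Longrightarrow> f J = ideal_points J"
    and g: "\<And>M. submodule M \<Longrightarrow> g M = right_multiplier M"
  shows "lattice_isomorphism (inclusion_order {J. fell_ideal K C J}) (inclusion_order {M. submodule M}) f"
    and "lattice_isomorphism (inclusion_order {M. submodule M}) (inclusion_order {J. fell_ideal K C J}) g"
proof -
  have inf: "\<exists>z\<in>{J. fell_ideal K C J}. z \<subseteq> x \<and> z \<subseteq> y \<and> (\<forall>w\<in>{J. fell_ideal K C J}. w \<subseteq> x \<longrightarrow> w \<subseteq> y \<longrightarrow> w \<subseteq> z)"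
    if "x \<in> {J. fell_ideal K C J}" "y \<in> {J. fell_ideal K C J}" for x y
    using that KC.fell_ideal_Int[of x y] by (intro bexI[of _ "x \<inter> y"]) auto
  have sup: "\<exists>z\<in>{J. fell_ideal K C J}. x \<subseteq> z \<and> y \<subseteq> z \<and> (\<forall>w\<in>{J. fell_ideal K C J}. x \<subseteq> w \<longrightarrow> y \<subseteq> w \<longrightarrow> z \<subseteq> w)"
    if "x \<in> {J. fell_ideal K C J}" "y \<in> {J. fell_ideal K C J}" for x y
  proof -
    from that obtain D where "fell_ideal K C D" "x \<subseteq> D" "y \<subseteq> D"
      "\<And>D'. \<lbrakk>fell_ideal K C D'; x \<subseteq> D'; y \<subseteq> D'\<rbrakk> \<Longrightarrow> D \<subseteq> D'"
      using KC.fell_ideal_sup[of x y] by (metis mem_Collect_eq)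
    then show ?thesis by (intro bexI[of _ D]) auto
  qed
  have a: "f J \<in> {M. submodule M}" "g (f J) = J" if "J \<in> {J. fell_ideal K C J}" for J
    using that ideal_points_submodule right_multiplier_ideal_points f g by (auto simp: KC.fell_ideal_iff)
  have b: "g M \<in> {J. fell_ideal K C J}" "f (g M) = M" if "M \<in> {M. submodule M}" for M
    using that right_multiplier_fell_ideal ideal_points_right_multiplier f g by auto
  have f_mono: "f I \<subseteq> f J" if "I \<in> {J. fell_ideal K C J}" "J \<in> {J. fell_ideal K C J}" "I \<subseteq> J" for I J
    using that ideal_points_mono f by simp
  have g_mono: "g M \<subseteq> g N" if "M \<in> {M. submodule M}" "N \<in> {M. submodule M}" "M \<subseteq> N" for M N
    using that right_multiplier_mono g by simp
  show "lattice_isomorphism (inclusion_order {J. fell_ideal K C J}) (inclusion_order {M. submodule M}) f"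
    by (rule lattice_isomorphism_inclusion(1)[OF inf sup a(1) b(1) a(2) b(2) f_mono g_mono])
  show "lattice_isomorphism (inclusion_order {M. submodule M}) (inclusion_order {J. fell_ideal K C J}) g"
    by (rule lattice_isomorphism_inclusion(2)[OF inf sup a(1) b(1) a(2) b(2) f_mono g_mono])
qed

end

section \<open>The correspondence on the left, and restriction of the bimodules\<close>

lemma left_coeff_opp:
  "right_coeff_at (opp_fbundle B) (opp_space T) (opp_ebundle E) M = left_coeff_at B T E M"
  "right_coeff (opp_fbundle B) (opp_space T) (opp_ebundle E) M = left_coeff B T E M"
  by (simp_all add: fun_eq_iff right_coeff_at_def left_coeff_at_def right_coeff_def left_coeff_def opp_acts
      prod_span_flip[of _ "lip E"])

lemma left_ideal_prod_opp:
  "right_ideal_prod (opp_groupoid H) (opp_fbundle B) (opp_space T) (opp_ebundle E) I = left_ideal_prod H B T E I"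
proof -
  have "rcomp (opp_groupoid H) (opp_space T) = (\<lambda>(h, t). (t, h)) ` lcomp H T"
    by (auto simp: image_iff)
  then show ?thesis
    by (simp add: right_ideal_prod_def left_ideal_prod_def opp_acts prod_span_flip[of _ "lact E"] split_beta image_image)
qed

context bundle_equivalence
begin

text \<open>Ideals of \<open>B\<close> are ideals of its opposite, and submodules are unchanged, so
  everything is read off from the opposite equivalence. The last five facts describe the left
  multipliers \<open>L M\<close> and feed the bimodule statement.\<close>

lemma left_correspondence:
  defines "L \<equiv> bundle_equivalence.right_multiplier (opp_groupoid H) (opp_space T) (opp_fbundle B) (opp_ebundle E)"
  shows "lattice_isomorphism (inclusion_order {I. fell_ideal H B I}) (inclusion_order {M. submodule M})
      (left_ideal_prod H B T E)"
    and "lattice_isomorphism (inclusion_order {M. submodule M}) (inclusion_order {I. fell_ideal H B I})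
      (left_ideal_of H B T E)"
    and "\<And>I. fell_ideal H B I \<Longrightarrow> left_ideal_of H B T E (left_ideal_prod H B T E I) = I"
    and "\<And>M. submodule M \<Longrightarrow> left_ideal_prod H B T E (left_ideal_of H B T E M) = M"
    and "\<And>I. fell_ideal H B I \<Longrightarrow> left_ideal_prod H B T E I =
      (\<Union>t\<in>pts T. prod_span (fibre E t) (lact E) (I \<inter> fib B (lmom T t)) (fib E t))"
    and "\<And>M t. \<lbrakk>submodule M; t \<in> pts T\<rbrakk> \<Longrightarrow> left_coeff_at B T E M t = L M \<inter> fib B (lmom T t)"
    and "\<And>M u. \<lbrakk>submodule M; u \<in> units H\<rbrakk> \<Longrightarrow> left_coeff B T E M u = L M \<inter> fib B u"
    and "\<And>M. submodule M \<Longrightarrow> HB.fibrewise_ideal (L M)"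
    and "\<And>M t b e. \<lbrakk>b \<in> L M; t \<in> pts T; b \<in> fib B (lmom T t); e \<in> fib E t\<rbrakk> \<Longrightarrow> lact E b e \<in> M"
    and "\<And>M t e m. \<lbrakk>submodule M; t \<in> pts T; e \<in> fib E t; m \<in> M; m \<in> fib E t\<rbrakk> \<Longrightarrow> lip E m e \<in> L M"
proof -
  interpret op: bundle_equivalence "opp_groupoid K" "opp_groupoid H" "opp_space T" "opp_fbundle C" "opp_fbundle B" "opp_ebundle E"
    by (rule bundle_equivalence_opp[OF bundle_equivalence_axioms])
  have fib_ideal: "op.KC.fibrewise_ideal I \<longleftrightarrow> HB.fibrewise_ideal I" for I
    unfolding op.KC.fibrewise_ideal_def HB.fibrewise_ideal_def by (simp, blast)
  have fell: "fell_ideal (opp_groupoid H) (opp_fbundle B) I \<longleftrightarrow> fell_ideal H B I" for I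
    by (simp add: op.KC.fell_ideal_iff HB.fell_ideal_iff fib_ideal)
  have sub: "op.submodule M \<longleftrightarrow> submodule M" for M by (rule submodule_opp)
  have prod: "left_ideal_prod H B T E I = op.ideal_points I" if "HB.fibrewise_ideal I" for I
    using op.right_ideal_prod_eq(1)[of I] that by (simp add: left_ideal_prod_opp fib_ideal)
  \<comment> \<open>Range and source trade places, so the second form in
    \<open>right_ideal_of_eq\<close> is the one that matches.\<close>
  have of: "left_ideal_of H B T E M = op.right_multiplier M" if "submodule M" for M
    using op.right_ideal_of_eq(2)[of M] that
    by (simp add: sub left_ideal_of_def left_coeff_opp opp_acts prod_span_flip[of _ "bmul B"])
  have prod': "left_ideal_prod H B T E I = op.ideal_points I" if "fell_ideal H B I" for I
    using prod that by (simp add: HB.fell_ideal_iff)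
  show "lattice_isomorphism (inclusion_order {I. fell_ideal H B I}) (inclusion_order {M. submodule M})
      (left_ideal_prod H B T E)"
    "lattice_isomorphism (inclusion_order {M. submodule M}) (inclusion_order {I. fell_ideal H B I})
      (left_ideal_of H B T E)"
    using op.right_correspondence[of "left_ideal_prod H B T E" "left_ideal_of H B T E"] prod' of
    by (simp_all add: fell sub)
  show "left_ideal_of H B T E (left_ideal_prod H B T E I) = I" if "fell_ideal H B I" for I
    using that prod'[OF that] of op.ideal_points_submodule[of I] op.right_multiplier_ideal_points[of I]
    by (simp add: HB.fell_ideal_iff fib_ideal sub)
  show "left_ideal_prod H B T E (left_ideal_of H B T E M) = M" if "submodule M" for M
    using that of[OF that] prod[of "op.right_multiplier M"] op.right_multiplier_ideal[of M]
      op.ideal_points_right_multiplier[of M] by (simp add: fib_ideal sub)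
  show "left_ideal_prod H B T E I = (\<Union>t\<in>pts T. prod_span (fibre E t) (lact E) (I \<inter> fib B (lmom T t)) (fib E t))"
    if "fell_ideal H B I" for I
    using op.right_ideal_prod_eq(2)[of I] prod'[OF that] that
    by (simp add: HB.fell_ideal_iff fib_ideal opp_acts prod_span_flip[of _ "lact E"])
  show "left_coeff_at B T E M t = L M \<inter> fib B (lmom T t)" if "submodule M" "t \<in> pts T" for M t
    using op.right_coeff_at_eq[of M t] that by (simp add: L_def sub left_coeff_opp)
  show "left_coeff B T E M u = L M \<inter> fib B u" if "submodule M" "u \<in> units H" for M u
    using op.right_coeff_eq[of M u] that by (simp add: L_def sub left_coeff_opp units_opp[OF left_groupoid])
  show "HB.fibrewise_ideal (L M)" if "submodule M" for M
    using op.right_multiplier_ideal[of M] that by (simp add: L_def sub fib_ideal)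
  show "lact E b e \<in> M" if "b \<in> L M" "t \<in> pts T" "b \<in> fib B (lmom T t)" "e \<in> fib E t" for M t b e
    using op.right_multiplierD[of b M "lmom T t" t e] that unit_comp(1)[of t] by (simp add: L_def)
  show "lip E m e \<in> L M" if "submodule M" "t \<in> pts T" "e \<in> fib E t" "m \<in> M" "m \<in> fib E t" for M t e m
    using op.rip_right_multiplier[of M t "lmom T t" e m] that unit_comp(1)[of t] lmul_unit[of t]
    by (simp add: L_def sub)
qed

text \<open>The four inclusions that \<open>restrict_imprimitivity\<close> asks for say, on either
  side, that inner products with \<open>M\<close> are multipliers and that multipliers carry
  \<open>E\<close> into \<open>M\<close>.\<close>

lemma submodule_imprimitivity:
  assumes M: "submodule M" and t: "t \<in> pts T"
  shows "left_coeff B T E M (lmom T t) = left_coeff_at B T E M t"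
    and "right_coeff C T E M (rmom T t) = right_coeff_at C T E M t"
    and "cstar_ideal (fibre_alg B (lmom T t)) (left_coeff B T E M (lmom T t))"
    and "cstar_ideal (fibre_alg C (rmom T t)) (right_coeff C T E M (rmom T t))"
    and "imprimitivity_bimodule
         ((fibre_alg B (lmom T t))\<lparr>carrier := left_coeff B T E M (lmom T t)\<rparr>)
         ((fibre_alg C (rmom T t))\<lparr>carrier := right_coeff C T E M (rmom T t)\<rparr>)
         ((fibre E t)\<lparr>carrier := M \<inter> fib E t\<rparr>) (lact E) (ract E) (lip E) (rip E)"
proof -
  note L = left_correspondence(6-10)
  note u = mom_units[OF t]
  note tu = unit_comp[OF t]
  show "left_coeff B T E M (lmom T t) = left_coeff_at B T E M t"
    by (simp add: L(1)[OF M t] L(2)[OF M u(1)])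
  show "right_coeff C T E M (rmom T t) = right_coeff_at C T E M t"
    by (simp add: right_coeff_eq[OF M u(2)] right_coeff_at_eq[OF M t])
  show Lid: "cstar_ideal (fibre_alg B (lmom T t)) (left_coeff B T E M (lmom T t))"
    unfolding L(2)[OF M u(1)] by (rule HB.fibrewise_ideal_unit[OF L(3)[OF M] u(1)])
  show Rid: "cstar_ideal (fibre_alg C (rmom T t)) (right_coeff C T E M (rmom T t))"
    unfolding right_coeff_eq[OF M u(2)] by (rule KC.fibrewise_ideal_unit[OF right_multiplier_ideal[OF M] u(2)])
  interpret N: imprimitivity_bimodule "fibre_alg B (lmom T t)" "fibre_alg C (rmom T t)" "fibre E t"
    "lact E" "ract E" "lip E" "rip E" by (rule bimodule[OF t])
  show "imprimitivity_bimodule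
         ((fibre_alg B (lmom T t))\<lparr>carrier := left_coeff B T E M (lmom T t)\<rparr>)
         ((fibre_alg C (rmom T t))\<lparr>carrier := right_coeff C T E M (rmom T t)\<rparr>)
         ((fibre E t)\<lparr>carrier := M \<inter> fib E t\<rparr>) (lact E) (ract E) (lip E) (rip E)"
  proof (rule N.restrict_imprimitivity[OF Lid Rid submoduleD(3)[OF M t]])
    show "lip E y x \<in> left_coeff B T E M (lmom T t)" if "y \<in> M \<inter> fib E t" "x \<in> fib E t" for x y
      unfolding L(2)[OF M u(1)] using L(5)[OF M t that(2), of y] N.L.ip_closed[of x y] that by simp
    show "rip E x y \<in> right_coeff C T E M (rmom T t)" if "x \<in> fib E t" "y \<in> M \<inter> fib E t" for x y
      unfolding right_coeff_eq[OF M u(2)]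
      using rip_right_multiplier[OF M tu(2) that(1), of y] N.R.ip_closed[of x y] that rmul_unit[OF t] by simp
    show "lact E a x \<in> M \<inter> fib E t" if "a \<in> left_coeff B T E M (lmom T t)" "x \<in> fib E t" for a x
      using that L(4)[OF _ t _ that(2), of a M] lact_fib[OF tu(1) _ that(2), of a] lmul_unit[OF t]
      unfolding L(2)[OF M u(1)] by simp
    show "ract E x b \<in> M \<inter> fib E t" if "x \<in> fib E t" "b \<in> right_coeff C T E M (rmom T t)" for x b
      using that right_multiplierD[OF _ _ tu(2) that(1), of b M] ract_fib[OF tu(2) that(1), of b] rmul_unit[OF t]
      unfolding right_coeff_eq[OF M u(2)] by simp
  qed
qed

end

theorem theorem3p10:
  fixes H :: "'h groupoid" and K :: "'k groupoid"
    and B :: "('b, 'h) fbundle" and C :: "('c, 'k) fbundle"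
    and T :: "('t, 'h, 'k) gspace" and E :: "('e, 't, 'b, 'c) ebundle"
  assumes "lc_groupoid H" and "lc_groupoid K"
    and "fell_bundle H B" and "fell_bundle K C"
    and "groupoid_equivalence H K T"
    and "fell_equivalence H K B C T E"
  shows "(
    \<comment> \<open>the lattice isomorphisms, and that the maps in opposite directions are mutually inverse\<close>
    lattice_isomorphism (inclusion_order {J. fell_ideal K C J})
       (inclusion_order {M. full_submodule H K B C T E M}) (right_ideal_prod K C T E) \<and>
    lattice_isomorphism (inclusion_order {M. full_submodule H K B C T E M})
       (inclusion_order {J. fell_ideal K C J}) (right_ideal_of K C T E) \<and>
    lattice_isomorphism (inclusion_order {I. fell_ideal H B I})
       (inclusion_order {M. full_submodule H K B C T E M}) (left_ideal_prod H B T E) \<and>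
    lattice_isomorphism (inclusion_order {M. full_submodule H K B C T E M})
       (inclusion_order {I. fell_ideal H B I}) (left_ideal_of H B T E) \<and>
    (\<forall>J. fell_ideal K C J \<longrightarrow> right_ideal_of K C T E (right_ideal_prod K C T E J) = J) \<and>
    (\<forall>I. fell_ideal H B I \<longrightarrow> left_ideal_of H B T E (left_ideal_prod H B T E I) = I) \<and>
    (\<forall>M. full_submodule H K B C T E M \<longrightarrow>
       right_ideal_prod K C T E (right_ideal_of K C T E M) = M \<and>
       left_ideal_prod H B T E (left_ideal_of H B T E M) = M)) \<and>
    \<comment> \<open>(a)\<close>
    (\<forall>J. fell_ideal K C J \<longrightarrow> right_ideal_prod K C T E J =
       (\<Union>t\<in>pts T. prod_span (fibre E t) (ract E) (fib E t) (J \<inter> fib C (rmom T t)))) \<and>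
    \<comment> \<open>(b)\<close>
    (\<forall>M. full_submodule H K B C T E M \<longrightarrow> (\<forall>t\<in>pts T.
       left_coeff B T E M (lmom T t) = left_coeff_at B T E M t \<and>
       right_coeff C T E M (rmom T t) = right_coeff_at C T E M t \<and>
       cstar_ideal (fibre_alg B (lmom T t)) (left_coeff B T E M (lmom T t)) \<and>
       cstar_ideal (fibre_alg C (rmom T t)) (right_coeff C T E M (rmom T t)) \<and>
       imprimitivity_bimodule
         ((fibre_alg B (lmom T t))\<lparr>carrier := left_coeff B T E M (lmom T t)\<rparr>)
         ((fibre_alg C (rmom T t))\<lparr>carrier := right_coeff C T E M (rmom T t)\<rparr>)
         ((fibre E t)\<lparr>carrier := M \<inter> fib E t\<rparr>)
         (lact E) (ract E) (lip E) (rip E))) \<and>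
    \<comment> \<open>(c)\<close>
    (\<forall>I. fell_ideal H B I \<longrightarrow> left_ideal_prod H B T E I =
       (\<Union>t\<in>pts T. prod_span (fibre E t) (lact E) (I \<inter> fib B (lmom T t)) (fib E t)))"
proof -
  interpret bundle_equivalence H K T B C E
    by (intro bundle_equivalence.intro bundle_equivalence_axioms.intro
        equivalence_space_groupoid_equivalence assms)
  have prod: "right_ideal_prod K C T E J = ideal_points J" if "fell_ideal K C J" for J
    using right_ideal_prod_eq(1) that by (simp add: KC.fell_ideal_iff)
  have inverse: "right_ideal_of K C T E (right_ideal_prod K C T E J) = J" if "fell_ideal K C J" for J
    using that prod[OF that] right_ideal_of_eq(1)[OF ideal_points_submodule] right_multiplier_ideal_points
    by (simp add: KC.fell_ideal_iff)
  have inverse': "right_ideal_prod K C T E (right_ideal_of K C T E M) = M" if "submodule M" for M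
    using right_ideal_of_eq(1)[OF that] right_ideal_prod_eq(1)[OF right_multiplier_ideal[OF that]]
      ideal_points_right_multiplier[OF that] by simp
  have formula: "right_ideal_prod K C T E J =
      (\<Union>t\<in>pts T. prod_span (fibre E t) (ract E) (fib E t) (J \<inter> fib C (rmom T t)))" if "fell_ideal K C J" for J
    using prod[OF that] right_ideal_prod_eq(2) that by (simp add: KC.fell_ideal_iff)
  show ?thesis
    unfolding full_submodule_iff
    by (intro conjI allI impI ballI right_correspondence[OF prod right_ideal_of_eq(1)]
        left_correspondence(1-5) submodule_imprimitivity inverse inverse' formula)
qed

end
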